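(* Let $(\nu^N)_{N\ge1}$ be a sequence of probability measures on $\mathcal Q$ and let $\psi_0\in X_R$ be such that for every $\delta>0$ and every $f\in C_0(\mathbb R_+^\circ)$, $$\lim_{N\to\infty}\nu^N\Big[\Big|\int_0^\infty f(u)\tilde\psi^N_q(u)\,du-\int_0^\infty f(u)\psi_0(u)\,du\Big|>\delta\Big]=0 .$$ Then the problem $$\partial_t\psi=\partial_u^2\psi+\beta\,\partial_u\psi\,(1+\partial_u\psi),\qquad \psi(0,\cdot)=\psi_0,\qquad \psi(t,\cdot)\in X_R\ (t\ge0),$$ with $\beta=\pi/\sqrt{12}$, has a unique classical solution $\psi(t,u)$, and for every $t>0$, $\delta>0$ and $f\in C_0(\mathbb R_+^\circ)$, $$\lim_{N\to\infty}\mathbb Q^N_{\nu^N}\Big[\Big|\int_0^\infty f(u)\tilde\psi^N_{q_t}(u)\,du-\int_0^\infty f(u)\psi(t,u)\,du\Big|>\delta\Big]=0 .$$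
   Context: Notation: $\mathbb N=\{1,2,\dots\}$, $\mathbb Z_+=\{0,1,2,\dots\}$, $\mathbb R_+=[0,\infty)$, $\mathbb R_+^\circ=(0,\infty)$; $C_0(\mathbb R_+^\circ)$ is the set of continuous functions with compact support in $(0,\infty)$. $\mathcal Q$ is the set of sequences $q=(q_i)_{i\in\mathbb N}$ with $q_i\in\mathbb Z_+$, $q_1\ge q_2\ge\cdots$, $n(q):=\sum_iq_i<\infty$, and $q_i>q_{i+1}$ whenever $q_i>0$ (partitions into distinct parts). The height function is $\psi_q(u)=\sum_{i\in\mathbb N}1_{\{u<q_i\}}$, $u\ge0$, and $\tilde\psi^N_q(u)=\frac1N\psi_q(Nu)$. For $0<\varepsilon<1$, $\mu^\varepsilon_R(q)=\varepsilon^{n(q)}/Z_R(\varepsilon)$ with $Z_R(\varepsilon)=\prod_{k\ge1}(1+\varepsilon^k)$. For $N\ge1$, $\varepsilon(N)\in(0,1)$ is the unique number with $E_{\mu_R^{\varepsilon(N)}}[n(q)]=N^2$. For $f:\mathcal Q\to\mathbb R$, $L_{\varepsilon,R}f(q)=\sum_{i\in\mathbb N}\big[\varepsilon1_{\{q_{i-1}>q_i+1\}}(f(q^{i,+})-f(q))+1_{\{q_i>q_{i+1}+1\text{ or }q_i=1\}}(f(q^{i,-})-f(q))\big]$, where $q_0:=\infty$ and $q^{i,\pm}$ is obtained from $q$ by replacing $q_i$ with $q_i\pm1$. For a probability measure $\nu$ on $\mathcal Q$, $\mathbb Q^N_\nu$ is the law on $D(\mathbb R_+,\mathcal Q)$ of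 the Markov process $q_t=q^N_t$ with generator $N^2L_{\varepsilon(N),R}$ and initial law $\nu$. $X_R$ is the set of $C^1$ functions $\psi:[0,\infty)\to[0,\infty)$ with $-1\le\psi'\le0$, $\psi'(0)=-1/2$, $\lim_{u\uparrow\infty}\psi(u)=0$. *)

theory Defs
  imports "HOL-Analysis.Analysis" "HOL-Probability.Probability"
begin

type_synonym config = "nat \<Rightarrow> nat"

text \<open>Partitions into distinct parts. A configuration q is indexed by nat; the
  entries q 1, q 2, ... are the parts q_1, q_2, ...; the coordinate q 0 is a dummy
  fixed to 0 (the convention q_0 = infinity of the generator is built into up_ok).\<close>
definition Qset :: "config set" where
  "Qset = {q. q 0 = 0 \<and> (\<forall>i\<ge>1. q (Suc i) \<le> q i) \<and> finite {i. q i \<noteq> 0}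
              \<and> (\<forall>i\<ge>1. q i > 0 \<longrightarrow> q i > q (Suc i))}"

definition npart :: "config \<Rightarrow> nat" where
  "npart q = (\<Sum>i\<in>{i. 1 \<le> i \<and> q i \<noteq> 0}. q i)"

definition height :: "config \<Rightarrow> real \<Rightarrow> real" where
  "height q u = real (card {i. 1 \<le> i \<and> u < real (q i)})"

definition height_resc :: "nat \<Rightarrow> config \<Rightarrow> real \<Rightarrow> real" where
  "height_resc N q u = height q (real N * u) / real N"

definition ZR :: "real \<Rightarrow> real" where
  "ZR \<epsilon> = (\<Prod>k. 1 + \<epsilon> ^ Suc k)"

definition muR :: "real \<Rightarrow> config \<Rightarrow> real" where
  "muR \<epsilon> q = \<epsilon> ^ npart q / ZR \<epsilon>"

definition mean_n :: "real \<Rightarrow> real" where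
  "mean_n \<epsilon> = infsum (\<lambda>q. real (npart q) * muR \<epsilon> q) Qset"

definition epsN :: "nat \<Rightarrow> real" where
  "epsN N = (THE \<epsilon>. 0 < \<epsilon> \<and> \<epsilon> < 1 \<and> mean_n \<epsilon> = real N ^ 2)"

definition up_ok :: "config \<Rightarrow> nat \<Rightarrow> bool" where
  "up_ok q i \<longleftrightarrow> 1 \<le> i \<and> (i = 1 \<or> q (i - 1) > q i + 1)"

definition down_ok :: "config \<Rightarrow> nat \<Rightarrow> bool" where
  "down_ok q i \<longleftrightarrow> 1 \<le> i \<and> (q i > q (Suc i) + 1 \<or> q i = 1)"

definition rateR :: "real \<Rightarrow> config \<Rightarrow> config \<Rightarrow> real" where
  "rateR \<epsilon> q q' = infsum (\<lambda>i.
       (if up_ok q i \<and> q' = q(i := q i + 1) then \<epsilon> else 0)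
     + (if down_ok q i \<and> q' = q(i := q i - 1) then 1 else 0)) {1..}"

text \<open>Generic continuous-time Markov chain given by off-diagonal jump rates r:
  the (minimal) transition function P_t(x,y), built from the backward
  integral recursion (P^(n) = probability of being at y at time t after at most
  n jumps).\<close>
definition exit_rate :: "('a \<Rightarrow> 'a \<Rightarrow> real) \<Rightarrow> 'a \<Rightarrow> real" where
  "exit_rate r x = infsum (r x) UNIV"

fun mc_approx :: "('a \<Rightarrow> 'a \<Rightarrow> real) \<Rightarrow> nat \<Rightarrow> real \<Rightarrow> 'a \<Rightarrow> 'a \<Rightarrow> real" where
  "mc_approx r 0 t x y = (if x = y then exp (- exit_rate r x * t) else 0)"
| "mc_approx r (Suc n) t x y =
     (if x = y then exp (- exit_rate r x * t) else 0)
     + integral {0..t} (\<lambda>s. exp (- exit_rate r x * s) *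
                          infsum (\<lambda>z. r x z * mc_approx r n (t - s) z y) UNIV)"

definition mc_trans :: "('a \<Rightarrow> 'a \<Rightarrow> real) \<Rightarrow> real \<Rightarrow> 'a \<Rightarrow> 'a \<Rightarrow> real" where
  "mc_trans r t x y = (SUP n. mc_approx r n t x y)"

definition mc_prob :: "('a \<Rightarrow> 'a \<Rightarrow> real) \<Rightarrow> 'a pmf \<Rightarrow> real \<Rightarrow> 'a set \<Rightarrow> real" where
  "mc_prob r \<nu> t A = infsum (\<lambda>x. pmf \<nu> x * infsum (\<lambda>y. mc_trans r t x y) A) (set_pmf \<nu>)"

definition QN_prob :: "nat \<Rightarrow> config pmf \<Rightarrow> real \<Rightarrow> config set \<Rightarrow> real" where
  "QN_prob N \<nu> t A = mc_prob (\<lambda>q q'. real N ^ 2 * rateR (epsN N) q q') \<nu> t A"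

definition XR :: "(real \<Rightarrow> real) set" where
  "XR = {\<psi>. \<exists>\<psi>'. continuous_on {0..} \<psi>'
            \<and> (\<forall>u\<ge>0. (\<psi> has_real_derivative \<psi>' u) (at u within {0..}))
            \<and> (\<forall>u\<ge>0. \<psi> u \<ge> 0 \<and> -1 \<le> \<psi>' u \<and> \<psi>' u \<le> 0)
            \<and> \<psi>' 0 = -1/2
            \<and> (\<psi> \<longlongrightarrow> 0) at_top}"

definition C0pos :: "(real \<Rightarrow> real) \<Rightarrow> bool" where
  "C0pos f \<longleftrightarrow> continuous_on UNIV f \<and>
     (\<exists>a b. 0 < a \<and> a \<le> b \<and> (\<forall>u. u \<notin> {a..b} \<longrightarrow> f u = 0))"

definition d_t :: "(real \<Rightarrow> real \<Rightarrow> real) \<Rightarrow> real \<Rightarrow> real \<Rightarrow> real" where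
  "d_t \<psi> t u = deriv (\<lambda>s. \<psi> s u) t"
definition d_u :: "(real \<Rightarrow> real \<Rightarrow> real) \<Rightarrow> real \<Rightarrow> real \<Rightarrow> real" where
  "d_u \<psi> t u = deriv (\<lambda>v. \<psi> t v) u"
definition d_uu :: "(real \<Rightarrow> real \<Rightarrow> real) \<Rightarrow> real \<Rightarrow> real \<Rightarrow> real" where
  "d_uu \<psi> t u = deriv (\<lambda>v. d_u \<psi> t v) u"

definition classical_sol :: "real \<Rightarrow> (real \<Rightarrow> real) \<Rightarrow> (real \<Rightarrow> real \<Rightarrow> real) \<Rightarrow> bool" where
  "classical_sol \<beta> \<psi>0 \<psi> \<longleftrightarrow>
     continuous_on ({0..} \<times> {0..}) (\<lambda>(t, u). \<psi> t u)
   \<and> (\<forall>u\<ge>0. \<psi> 0 u = \<psi>0 u)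
   \<and> (\<forall>t\<ge>0. \<psi> t \<in> XR)
   \<and> (\<forall>t>0. \<forall>u>0. (\<lambda>s. \<psi> s u) differentiable (at t)
                 \<and> (\<lambda>v. \<psi> t v) differentiable (at u)
                 \<and> (\<lambda>v. d_u \<psi> t v) differentiable (at u))
   \<and> continuous_on ({0<..} \<times> {0<..}) (\<lambda>(t, u). d_t \<psi> t u)
   \<and> continuous_on ({0<..} \<times> {0<..}) (\<lambda>(t, u). d_u \<psi> t u)
   \<and> continuous_on ({0<..} \<times> {0<..}) (\<lambda>(t, u). d_uu \<psi> t u)
   \<and> (\<forall>t>0. \<forall>u>0. d_t \<psi> t u = d_uu \<psi> t u + \<beta> * d_u \<psi> t u * (1 + d_u \<psi> t u))"

end

theory Submission
  imports Defs
begin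

text \<open>Both the equation and the dynamics become linear under an exponential transform. If \<open>\<psi>\<close> solves the
  equation, then \<open>exp (\<beta> (u / 2 + \<psi>) + \<beta>\<^sup>2 t / 4)\<close> solves the heat equation with Neumann condition at
  the origin, so a solution is obtained from the Gaussian convolution of the even extension of the
  initial value; uniqueness follows from a maximum principle.

  For the dynamics with \<open>\<epsilon> = 1 / a\<^sup>2\<close>, the variable \<open>a ^ (x + 2 h(x))\<close>, where \<open>h(x)\<close> is the number of
  parts larger than \<open>x\<close>, is mapped by the generator to a discrete heat operator with even reflection.
  Averaged against a heat kernel whose time runs backwards, it solves the backward equation up to an
  error of order \<open>1 / N\<close>, and so does its squared distance to the limit after adding a small multiple of
  a quadratic energy that makes it a supersolution. The transition function is the minimal solution of
  the backward equation and hence lies below every nonnegative supersolution; with Chebyshev's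
  inequality this bounds the probability that the height at a given point deviates from the limit, and
  no non-explosion argument is needed. Since heights are monotone with slope between \<open>-1\<close> and 0,
  convergence against test functions, at finitely many points, and uniformly are equivalent.

  The constant \<open>\<beta> = pi / sqrt 12\<close> comes from the mean size
  \<open>\<Sum> k \<epsilon>^k / (1 + \<epsilon>^k)\<close>, which is asymptotic to \<open>(pi\<^sup>2 / 12) / (1 - \<epsilon>)\<^sup>2\<close>.\<close>

section \<open>Dominated convergence and the heat kernel\<close>

text \<open>With \<open>w = u / 2 + \<psi>\<close> the nonlinearity
  \<open>\<psi>_u (1 + \<psi>_u)\<close> is \<open>w_u^2 - 1/4\<close>, a square up to a constant.
  This is why an exponential linearises it, why \<open>\<beta>^2 t / 4\<close> has to compensate,
  and why the slope \<open>-1/2\<close> at the origin becomes slope 0. The particle system has the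
  same structure: its rates are quadratic in the occupation numbers, but their differences are
  linear. The obstacle is the noise. At one site the Gaertner variable jumps by a relative amount of
  order \<open>1 / N\<close> at a rate of order \<open>N^2\<close>, so the noise term in the
  equation for its square is of order one. In an average over a window of fixed width
  \<open>\<tau>\<close> that term is of order \<open>1 / N\<close>; so \<open>\<tau>\<close> is
  chosen from the deviation to be detected, before \<open>N\<close> grows. The noise is proportional
  to the square of the variable and has no bound uniform over configurations. The weighted energy
  closes the estimate, because it grows under the generator at a rate independent of
  \<open>N\<close>. Since \<open>\<beta> < 1\<close>, the Gaertner variable eventually grows in
  space no faster than \<open>exp (|y| / 2)\<close>, which fixes the exponential weights.\<close>

lemma dominated_continuity:
  fixes f :: "'b::metric_space \<Rightarrow> 'a \<Rightarrow> real"
  assumes meas: "\<And>x. x \<in> S \<Longrightarrow> f x \<in> borel_measurable M"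
    and x0: "x0 \<in> S"
    and lim: "\<And>y. ((\<lambda>x. f x y) \<longlongrightarrow> f x0 y) (at x0 within S)"
    and bound: "\<And>x y. x \<in> S \<Longrightarrow> \<bar>f x y\<bar> \<le> w y"
    and w: "integrable M w"
  shows "((\<lambda>x. integral\<^sup>L M (f x)) \<longlongrightarrow> integral\<^sup>L M (f x0)) (at x0 within S)"
  unfolding tendsto_at_iff_sequentially
proof (intro allI impI)
  fix X assume X: "\<forall>i. X i \<in> S - {x0}" "X \<longlonglongrightarrow> x0"
  show "((\<lambda>x. integral\<^sup>L M (f x)) \<circ> X) \<longlonglongrightarrow> integral\<^sup>L M (f x0)"
    unfolding o_def
  proof (rule integral_dominated_convergence[where w = w])
    show "AE y in M. (\<lambda>i. f (X i) y) \<longlonglongrightarrow> f x0 y"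
      using lim X unfolding tendsto_at_iff_sequentially o_def by auto
  qed (use X meas x0 bound w in auto)
qed

text \<open>The difference quotient, completed at \<open>x0\<close> by the derivative, is bounded by
  \<open>w\<close> through the mean value inequality, so \<open>dominated_continuity\<close> applies
  to it.\<close>

lemma dominated_differentiation:
  fixes f f' :: "real \<Rightarrow> 'a \<Rightarrow> real"
  assumes x0: "x0 \<in> {a..b}"
    and int: "\<And>x. x \<in> {a..b} \<Longrightarrow> integrable M (f x)"
    and meas: "f' x0 \<in> borel_measurable M"
    and deriv: "\<And>x y. x \<in> {a..b} \<Longrightarrow> ((\<lambda>x. f x y) has_real_derivative f' x y) (at x within {a..b})"
    and bound: "\<And>x y. x \<in> {a..b} \<Longrightarrow> \<bar>f' x y\<bar> \<le> w y"
    and w: "integrable M w"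
  shows "((\<lambda>x. integral\<^sup>L M (f x)) has_real_derivative integral\<^sup>L M (f' x0)) (at x0 within {a..b})"
proof -
  define q where "q x y = (if x = x0 then f' x0 y else (f x y - f x0 y) / (x - x0))" for x y
  have lip: "\<bar>f x y - f x0 y\<bar> \<le> w y * \<bar>x - x0\<bar>" if "x \<in> {a..b}" for x y
    using field_differentiable_bound[of "{a..b}" "\<lambda>x. f x y" "\<lambda>x. f' x y" "w y" x x0]
      deriv bound that x0 by (auto simp: norm_minus_commute)
  have "((\<lambda>x. integral\<^sup>L M (q x)) \<longlongrightarrow> integral\<^sup>L M (q x0)) (at x0 within {a..b})"
  proof (rule dominated_continuity[where w = w])
    show "q x \<in> borel_measurable M" if "x \<in> {a..b}" for x
      using meas int[OF that] int[OF x0] unfolding q_def by (cases "x = x0") auto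
    show "((\<lambda>x. q x y) \<longlongrightarrow> q x0 y) (at x0 within {a..b})" for y
    proof -
      have "((\<lambda>x. (f x y - f x0 y) / (x - x0)) \<longlongrightarrow> f' x0 y) (at x0 within {a..b})"
        using deriv[OF x0] by (simp add: has_field_derivative_iff)
      moreover have "\<forall>\<^sub>F x in at x0 within {a..b}. (f x y - f x0 y) / (x - x0) = q x y"
        by (auto simp: eventually_at_filter q_def)
      ultimately show ?thesis
        by (auto simp: q_def[of x0] elim: Lim_transform_eventually)
    qed
    show "\<bar>q x y\<bar> \<le> w y" if "x \<in> {a..b}" for x y
      using lip[OF that, of y] bound[OF that, of y] by (auto simp: q_def field_simps abs_if split: if_splits)
  qed (use x0 w in auto)
  then have "((\<lambda>x. integral\<^sup>L M (q x)) \<longlongrightarrow> integral\<^sup>L M (f' x0)) (at x0 within {a..b})"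
    by (simp add: q_def[abs_def])
  moreover have "\<forall>\<^sub>F x in at x0 within {a..b}. integral\<^sup>L M (q x)
      = (integral\<^sup>L M (f x) - integral\<^sup>L M (f x0)) / (x - x0)"
    using int int[OF x0] by (auto simp: eventually_at_filter q_def[abs_def] intro!: always_eventually)
  ultimately show ?thesis
    unfolding has_field_derivative_iff by (rule Lim_transform_eventually)
qed

lemma integrable_exp_neg_abs:
  assumes c: "0 < c"
  shows "integrable lborel (\<lambda>y::real. exp (- c * \<bar>y\<bar>))"
proof -
  have 1: "integrable lborel (\<lambda>y. indicator {0<..} y * exp (- (y * c)))"
    using integrable_I0i_exp_mscale[OF c] by (simp add: set_integrable_def)
  have 2: "integrable lborel (\<lambda>y. indicator {0<..} (-y) * exp (- (- y * c)))"
    using lborel_integrable_real_affine[OF 1, of "-1" 0] by simp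
  have "integrable lborel (\<lambda>y. indicator {0<..} y * exp (- (y * c)) + indicator {0<..} (-y) * exp (- (- y * c)))"
    by (rule Bochner_Integration.integrable_add[OF 1 2])
  then show ?thesis
  proof (rule integrable_cong_AE_imp)
    show "AE x in lborel. indicator {0<..} x * exp (- (x * c)) +
        indicator {0<..} (- x) * exp (- (- x * c)) = exp (- c * \<bar>x\<bar>)"
      using AE_lborel_singleton[of "0::real"]
      by eventually_elim (auto simp: indicator_def mult.commute)
  qed simp
qed

section \<open>The heat kernel, its derivatives and their decay\<close>

definition heat_kernel :: "real \<Rightarrow> real \<Rightarrow> real" where
  "heat_kernel t z = exp (- z\<^sup>2 / (4 * t)) / sqrt (4 * pi * t)"

text \<open>The heat equation is taken without a factor 1/2, so the kernel has variance
  \<open>2 t\<close> and its second space derivative is also its time derivative. The third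
  derivative enters through the Taylor remainder of the lattice Laplacian.\<close>

definition heat_kernel1 :: "real \<Rightarrow> real \<Rightarrow> real" where
  "heat_kernel1 t z = - z / (2 * t) * heat_kernel t z"

definition heat_kernel2 :: "real \<Rightarrow> real \<Rightarrow> real" where
  "heat_kernel2 t z = (z\<^sup>2 / (4 * t\<^sup>2) - 1 / (2 * t)) * heat_kernel t z"

definition heat_kernel3 :: "real \<Rightarrow> real \<Rightarrow> real" where
  "heat_kernel3 t z = (3 * z / (4 * t\<^sup>2) - z ^ 3 / (8 * t ^ 3)) * heat_kernel t z"

lemma heat_kernel_pos: "0 < t \<Longrightarrow> 0 < heat_kernel t z"
  by (simp add: heat_kernel_def)

lemma heat_kernel_even: "heat_kernel t (- z) = heat_kernel t z"
  by (simp add: heat_kernel_def)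

lemma heat_kernel_normal_density:
  "0 < t \<Longrightarrow> heat_kernel t z = normal_density 0 (sqrt (2 * t)) z"
  by (simp add: heat_kernel_def normal_density_def)

lemma borel_measurable_heat_kernel [measurable]:
  "heat_kernel t \<in> borel_measurable borel" "heat_kernel1 t \<in> borel_measurable borel"
  "heat_kernel2 t \<in> borel_measurable borel" "heat_kernel3 t \<in> borel_measurable borel"
  unfolding heat_kernel_def[abs_def] heat_kernel1_def[abs_def] heat_kernel2_def[abs_def] heat_kernel3_def[abs_def]
  by measurable

lemma DERIV_heat_kernel_space:
  assumes "0 < t"
  shows "(heat_kernel t has_real_derivative heat_kernel1 t z) (at z)"
    "(heat_kernel1 t has_real_derivative heat_kernel2 t z) (at z)"
    "(heat_kernel2 t has_real_derivative heat_kernel3 t z) (at z)"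
proof -
  show 1: "(heat_kernel t has_real_derivative heat_kernel1 t z) (at z)"
    unfolding heat_kernel_def[abs_def] heat_kernel1_def using assms
    by (auto intro!: derivative_eq_intros simp: field_simps)
  show 2: "(heat_kernel1 t has_real_derivative heat_kernel2 t z) (at z)"
    unfolding heat_kernel1_def[abs_def] heat_kernel2_def using assms
    by (auto intro!: derivative_eq_intros 1 simp: heat_kernel1_def field_simps power2_eq_square)
  show "(heat_kernel2 t has_real_derivative heat_kernel3 t z) (at z)"
    unfolding heat_kernel2_def[abs_def] heat_kernel3_def using assms
    by (auto intro!: derivative_eq_intros 1 simp: heat_kernel1_def field_simps power2_eq_square power3_eq_cube)
qed

lemma DERIV_heat_kernel_time:
  assumes "0 < t"
  shows "((\<lambda>t. heat_kernel t z) has_real_derivative heat_kernel2 t z) (at t)"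
proof -
  define s where "s = sqrt (4 * pi * t)"
  have s: "0 < s" "s * s = 4 * pi * t" using assms by (auto simp: s_def)
  have 1: "((\<lambda>t. sqrt (4 * pi * t)) has_real_derivative (2 * pi / s)) (at t)"
    using assms unfolding s_def
    by (auto intro!: derivative_eq_intros simp: field_simps mult_less_0_iff)
  have 2: "((\<lambda>t. exp (- z\<^sup>2 / (4 * t))) has_real_derivative exp (- z\<^sup>2 / (4 * t)) * (z\<^sup>2 / (4 * t\<^sup>2))) (at t)"
    using assms by (auto intro!: derivative_eq_intros simp: field_simps power2_eq_square)
  have "((\<lambda>t. heat_kernel t z) has_real_derivative
      (exp (- z\<^sup>2 / (4 * t)) * (z\<^sup>2 / (4 * t\<^sup>2)) * s - exp (- z\<^sup>2 / (4 * t)) * (2 * pi / s)) / (s * s)) (at t)"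
    using DERIV_divide[OF 2 1] s(1) unfolding heat_kernel_def s_def by (metis less_irrefl)
  moreover have "(exp (- z\<^sup>2 / (4 * t)) * (z\<^sup>2 / (4 * t\<^sup>2)) * s - exp (- z\<^sup>2 / (4 * t)) * (2 * pi / s)) / (s * s)
      = (z\<^sup>2 / (4 * t\<^sup>2) - 2 * pi / (s * s)) * (exp (- z\<^sup>2 / (4 * t)) / s)"
    using s(1) by (simp add: field_simps)
  moreover have "2 * pi / (s * s) = 1 / (2 * t)" unfolding s(2) by simp
  ultimately show ?thesis unfolding heat_kernel2_def heat_kernel_def s_def by simp
qed

lemma power_le_fact_exp: "0 \<le> (x::real) \<Longrightarrow> x ^ k \<le> fact k * exp x"
proof -
  assume x: "0 \<le> x"
  have "x ^ k /\<^sub>R fact k \<le> (\<Sum>n. x ^ n /\<^sub>R fact n)"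
    by (rule order_trans[OF _ sum_le_suminf[OF summable_exp_generic, of "{k}"]])
       (use x in auto)
  then show ?thesis by (simp add: exp_def field_simps)
qed

text \<open>Completing the square gives \<open>z^2 / (4 b) \<ge> (c + 1) |z| - b (c + 1)^2\<close>.
  One unit of the exponential rate \<open>c + 1\<close> pays for the power of \<open>|z|\<close>,
  and rate \<open>c\<close> remains.\<close>

lemma heat_kernel_moment_bound:
  assumes "0 < a" "a \<le> t" "t \<le> b" "0 \<le> c"
  shows "\<bar>z\<bar> ^ k * heat_kernel t z \<le> fact k * exp (b * (c + 1)\<^sup>2) / sqrt (4 * pi * a) * exp (- c * \<bar>z\<bar>)"
proof -
  have t: "0 < t" "0 < b" using assms by auto
  have "z\<^sup>2 / (4 * b) + b * (c + 1)\<^sup>2 - (c + 1) * \<bar>z\<bar> = (\<bar>z\<bar> - 2 * b * (c + 1))\<^sup>2 / (4 * b)"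
    using t by (simp add: power2_eq_square field_simps)
  also have "\<dots> \<ge> 0" using t by simp
  finally have *: "- (z\<^sup>2 / (4 * b)) \<le> b * (c + 1)\<^sup>2 - (c + 1) * \<bar>z\<bar>" by simp
  have "z\<^sup>2 / (4 * b) \<le> z\<^sup>2 / (4 * t)" using assms t by (intro divide_left_mono) auto
  then have "exp (- z\<^sup>2 / (4 * t)) \<le> exp (b * (c + 1)\<^sup>2 - (c + 1) * \<bar>z\<bar>)" using * by simp
  moreover have "1 / sqrt (4 * pi * t) \<le> 1 / sqrt (4 * pi * a)"
    using assms by (intro divide_left_mono) auto
  ultimately have "heat_kernel t z \<le> exp (b * (c + 1)\<^sup>2 - (c + 1) * \<bar>z\<bar>) * (1 / sqrt (4 * pi * a))"
    unfolding heat_kernel_def divide_inverse using t by (intro mult_mono) (auto simp: field_simps)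
  then have "\<bar>z\<bar> ^ k * heat_kernel t z \<le>
     (fact k * exp \<bar>z\<bar>) * (exp (b * (c + 1)\<^sup>2 - (c + 1) * \<bar>z\<bar>) * (1 / sqrt (4 * pi * a)))"
    using heat_kernel_pos[OF t(1), of z] by (intro mult_mono power_le_fact_exp) auto
  also have "exp \<bar>z\<bar> * exp (b * (c + 1)\<^sup>2 - (c + 1) * \<bar>z\<bar>) = exp (b * (c + 1)\<^sup>2) * exp (- c * \<bar>z\<bar>)"
    by (simp add: algebra_simps flip: exp_add)
  then have "(fact k * exp \<bar>z\<bar>) * (exp (b * (c + 1)\<^sup>2 - (c + 1) * \<bar>z\<bar>) * (1 / sqrt (4 * pi * a)))
     = fact k * exp (b * (c + 1)\<^sup>2) / sqrt (4 * pi * a) * exp (- c * \<bar>z\<bar>)"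
    by (simp add: mult.assoc)
  finally show ?thesis .
qed

lemma heat_kernel_bounds:
  assumes a: "0 < a" and c: "0 \<le> c"
  shows "\<exists>C>0. \<forall>t\<in>{a..b}. \<forall>z. \<bar>heat_kernel t z\<bar> \<le> C * exp (- c * \<bar>z\<bar>)
     \<and> \<bar>heat_kernel1 t z\<bar> \<le> C * exp (- c * \<bar>z\<bar>) \<and> \<bar>heat_kernel2 t z\<bar> \<le> C * exp (- c * \<bar>z\<bar>)
     \<and> \<bar>heat_kernel3 t z\<bar> \<le> C * exp (- c * \<bar>z\<bar>)"
proof -
  define M where "M = 6 * exp (b * (c + 1)\<^sup>2) / sqrt (4 * pi * a)"
  \<comment> \<open>The sum of the coefficients in the polynomial prefactors of the four kernels,
    with \<open>t\<close> replaced by its lower bound \<open>a\<close>. The 6 in \<open>M\<close> is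
    \<open>fact 3\<close>, the largest factorial among the moments of order at most 3.\<close>
  define C where "C = M * (1 + 1 / (2 * a) + (1 / (4 * a\<^sup>2) + 1 / (2 * a)) + (3 / (4 * a\<^sup>2) + 1 / (8 * a ^ 3)))"
  have M: "0 < M" using a by (simp add: M_def)
  have C: "0 < C" unfolding C_def using a M by (intro mult_pos_pos add_pos_pos) auto
  { fix t z assume t: "t \<in> {a..b}"
    define e where "e = exp (- c * \<bar>z\<bar>)"
    define K where "K = heat_kernel t z"
    have e: "0 < e" by (simp add: e_def)
    have t0: "0 < t" using a t by auto
    have K: "0 < K" using heat_kernel_pos[OF t0] by (simp add: K_def)
    have m: "\<bar>z\<bar> ^ k * K \<le> M * e" if "k \<le> 3" for k
    proof -
      have "fact k \<le> (fact 3 :: real)" using that by (rule fact_mono)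
      then have "(fact k :: real) \<le> 6" by (simp add: fact_numeral)
      then have "fact k * exp (b * (c + 1)\<^sup>2) / sqrt (4 * pi * a) * e \<le> M * e"
        unfolding M_def using a e by (intro mult_right_mono divide_right_mono) auto
      with heat_kernel_moment_bound[OF a, of t b c z k] t c show ?thesis
        by (auto simp: e_def K_def)
    qed
    have i1: "1 / t \<le> 1 / a" "1 / t\<^sup>2 \<le> 1 / a\<^sup>2" "1 / t ^ 3 \<le> 1 / a ^ 3"
      using a t by (auto intro!: divide_left_mono power_mono)
    have pos: "0 \<le> 1 / t" "0 \<le> 1 / t\<^sup>2" "0 \<le> 1 / t ^ 3" using t0 by auto
    have Me: "0 \<le> M * e" using M e by simp
    have p1: "1 / t * (\<bar>z\<bar> * K) \<le> 1 / a * (M * e)" "1 / t * K \<le> 1 / a * (M * e)"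
      "1 / t\<^sup>2 * (\<bar>z\<bar>\<^sup>2 * K) \<le> 1 / a\<^sup>2 * (M * e)" "1 / t\<^sup>2 * (\<bar>z\<bar> * K) \<le> 1 / a\<^sup>2 * (M * e)"
      "1 / t ^ 3 * (\<bar>z\<bar> ^ 3 * K) \<le> 1 / a ^ 3 * (M * e)" "K \<le> M * e"
      using m[of 0] m[of 1] m[of 2] m[of 3] i1 pos K a Me
      by (auto intro!: mult_mono simp del: times_divide_eq_left)
    have q: "0 \<le> 1 / a * (M * e)" "0 \<le> 1 / a\<^sup>2 * (M * e)" "0 \<le> 1 / a ^ 3 * (M * e)"
      using a Me by auto
    have Ce: "C * e = M * e + 1/2 * (1 / a * (M * e)) + (1 / 4 * (1 / a\<^sup>2 * (M * e)) + 1/2 * (1 / a * (M * e)))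
        + (3/4 * (1 / a\<^sup>2 * (M * e)) + 1/8 * (1 / a ^ 3 * (M * e)))"
      unfolding C_def by (simp add: algebra_simps)
    have b0: "\<bar>heat_kernel t z\<bar> = K" using K by (simp add: K_def)
    have b1: "\<bar>heat_kernel1 t z\<bar> = 1/2 * (1 / t * (\<bar>z\<bar> * K))"
      using K t0 by (simp add: heat_kernel1_def abs_mult K_def)
    have "\<bar>heat_kernel2 t z\<bar> = \<bar>z\<^sup>2 / (4 * t\<^sup>2) - 1 / (2 * t)\<bar> * K"
      using K by (simp add: heat_kernel2_def abs_mult K_def)
    also have "\<dots> \<le> (z\<^sup>2 / (4 * t\<^sup>2) + 1 / (2 * t)) * K"
      using K t0 by (intro mult_right_mono) (auto simp: abs_le_iff)
    finally have b2: "\<bar>heat_kernel2 t z\<bar> \<le> 1/4 * (1 / t\<^sup>2 * (\<bar>z\<bar>\<^sup>2 * K)) + 1/2 * (1 / t * K)"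
      by (simp add: algebra_simps)
    have "\<bar>heat_kernel3 t z\<bar> = \<bar>3 * z / (4 * t\<^sup>2) - z ^ 3 / (8 * t ^ 3)\<bar> * K"
      using K by (simp add: heat_kernel3_def abs_mult K_def)
    also have "\<dots> \<le> (\<bar>3 * z / (4 * t\<^sup>2)\<bar> + \<bar>z ^ 3 / (8 * t ^ 3)\<bar>) * K"
      using K by (intro mult_right_mono abs_triangle_ineq4) auto
    also have "\<dots> = 3/4 * (1 / t\<^sup>2 * (\<bar>z\<bar> * K)) + 1/8 * (1 / t ^ 3 * (\<bar>z\<bar> ^ 3 * K))"
      using t0 by (simp add: algebra_simps abs_mult power_abs)
    finally have b3: "\<bar>heat_kernel3 t z\<bar> \<le> 3/4 * (1 / t\<^sup>2 * (\<bar>z\<bar> * K)) + 1/8 * (1 / t ^ 3 * (\<bar>z\<bar> ^ 3 * K))" .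
    have lin0: "x \<le> m \<Longrightarrow> 0 \<le> y1 \<Longrightarrow> 0 \<le> y2 \<Longrightarrow> 0 \<le> y3 \<Longrightarrow> x \<le> m + 1/2 * y1 + (1/4 * y2 + 1/2 * y1) + (3/4 * y2 + 1/8 * y3)" for x y1 y2 y3 m :: real by linarith
    have lin1: "x \<le> y1 \<Longrightarrow> 0 \<le> y1 \<Longrightarrow> 0 \<le> y2 \<Longrightarrow> 0 \<le> y3 \<Longrightarrow> 0 \<le> m \<Longrightarrow> 1/2 * x \<le> m + 1/2 * y1 + (1/4 * y2 + 1/2 * y1) + (3/4 * y2 + 1/8 * y3)" for x y1 y2 y3 m :: real by linarith
    have lin2: "x \<le> y2 \<Longrightarrow> x' \<le> y1 \<Longrightarrow> 0 \<le> y1 \<Longrightarrow> 0 \<le> y2 \<Longrightarrow> 0 \<le> y3 \<Longrightarrow> 0 \<le> m \<Longrightarrow> 1/4 * x + 1/2 * x' \<le> m + 1/2 * y1 + (1/4 * y2 + 1/2 * y1) + (3/4 * y2 + 1/8 * y3)" for x x' y1 y2 y3 m :: real by linarith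
    have lin3: "x \<le> y2 \<Longrightarrow> x' \<le> y3 \<Longrightarrow> 0 \<le> y1 \<Longrightarrow> 0 \<le> y2 \<Longrightarrow> 0 \<le> y3 \<Longrightarrow> 0 \<le> m \<Longrightarrow> 3/4 * x + 1/8 * x' \<le> m + 1/2 * y1 + (1/4 * y2 + 1/2 * y1) + (3/4 * y2 + 1/8 * y3)" for x x' y1 y2 y3 m :: real by linarith
    have "\<bar>heat_kernel t z\<bar> \<le> C * e \<and> \<bar>heat_kernel1 t z\<bar> \<le> C * e
      \<and> \<bar>heat_kernel2 t z\<bar> \<le> C * e \<and> \<bar>heat_kernel3 t z\<bar> \<le> C * e"
      unfolding Ce b0 b1
      using lin0[OF p1(6) q] lin1[OF p1(1) q Me] order_trans[OF b2 lin2[OF p1(3,2) q Me]]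
        order_trans[OF b3 lin3[OF p1(4,5) q Me]] by blast
  }
  with C show ?thesis by blast
qed

text \<open>What the convolution arguments use of a kernel, so that the heat kernel and its
  derivatives can share them: decay faster than every exponential, uniformly for \<open>t\<close> in
  compact subintervals of the positive axis.\<close>

definition admissible_kernel :: "(real \<Rightarrow> real \<Rightarrow> real) \<Rightarrow> bool" where
  "admissible_kernel k \<longleftrightarrow> (\<forall>t. k t \<in> borel_measurable borel)
     \<and> continuous_on ({0<..} \<times> UNIV) (\<lambda>(t, z). k t z)
     \<and> (\<forall>a b c. 0 < a \<longrightarrow> 0 \<le> c \<longrightarrow> (\<exists>C. \<forall>t\<in>{a..b}. \<forall>z. \<bar>k t z\<bar> \<le> C * exp (- c * \<bar>z\<bar>)))"

lemma admissible_heat_kernel: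
  "admissible_kernel heat_kernel" "admissible_kernel heat_kernel1" "admissible_kernel heat_kernel2"
proof -
  have c: "continuous_on ({0<..} \<times> UNIV) (\<lambda>p::real \<times> real. heat_kernel (fst p) (snd p))"
    unfolding heat_kernel_def by (intro continuous_intros) auto
  show "admissible_kernel heat_kernel"
    unfolding admissible_kernel_def
    by (intro conjI allI impI) (use c heat_kernel_bounds in \<open>auto simp: case_prod_beta\<close>, meson heat_kernel_bounds)
  show "admissible_kernel heat_kernel1"
    unfolding admissible_kernel_def
  proof (intro conjI allI impI)
    show "continuous_on ({0<..} \<times> UNIV) (\<lambda>(t, z). heat_kernel1 t z)"
      unfolding heat_kernel1_def case_prod_beta by (intro continuous_intros c) auto
  qed (rule borel_measurable_heat_kernel, meson heat_kernel_bounds)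
  show "admissible_kernel heat_kernel2"
    unfolding admissible_kernel_def
  proof (intro conjI allI impI)
    show "continuous_on ({0<..} \<times> UNIV) (\<lambda>(t, z). heat_kernel2 t z)"
      unfolding heat_kernel2_def case_prod_beta by (intro continuous_intros c) auto
  qed (rule borel_measurable_heat_kernel, meson heat_kernel_bounds)
qed

section \<open>Convolution with functions of exponential growth\<close>

definition exp_growth :: "(real \<Rightarrow> real) \<Rightarrow> bool" where
  "exp_growth f \<longleftrightarrow> f \<in> borel_measurable borel \<and> (\<exists>C c. \<forall>y. \<bar>f y\<bar> \<le> C * exp (c * \<bar>y\<bar>))"

definition heat_conv :: "(real \<Rightarrow> real \<Rightarrow> real) \<Rightarrow> (real \<Rightarrow> real) \<Rightarrow> real \<Rightarrow> real \<Rightarrow> real" where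
  "heat_conv k f t u = (LINT y|lborel. k t (u - y) * f y)"

lemma exp_growthE:
  assumes "exp_growth f"
  obtains C c where "0 \<le> C" "0 \<le> c" "\<And>y. \<bar>f y\<bar> \<le> C * exp (c * \<bar>y\<bar>)" "f \<in> borel_measurable borel"
proof -
  from assms obtain C c where C: "\<And>y. \<bar>f y\<bar> \<le> C * exp (c * \<bar>y\<bar>)" and m: "f \<in> borel_measurable borel"
    by (auto simp: exp_growth_def)
  have "\<bar>f y\<bar> \<le> max C 0 * exp (max c 0 * \<bar>y\<bar>)" for y
    by (rule order_trans[OF C[of y]], rule mult_mono) (auto intro: mult_right_mono)
  with m show ?thesis by (intro that[of "max C 0" "max c 0"]) auto
qed

text \<open>Kernel decay at rate \<open>c + d\<close> beats growth at rate \<open>c\<close> and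
  leaves rate \<open>d\<close>. As \<open>|y| \<le> |u - y| + U\<close>, transferring the decay from
  \<open>u - y\<close> to \<open>y\<close> costs the constant factor \<open>exp ((c + d) U)\<close>,
  so one dominating function serves a whole box of \<open>(t, u)\<close>.\<close>

lemma conv_dominated:
  assumes k: "admissible_kernel k" and f: "exp_growth f" and a: "0 < a" and d: "0 \<le> d"
  shows "\<exists>M\<ge>0. \<forall>t\<in>{a..b}. \<forall>u y. \<bar>u\<bar> \<le> U \<longrightarrow> \<bar>k t (u - y) * f y\<bar> \<le> M * exp (- d * \<bar>y\<bar>)"
proof -
  obtain C c where C: "0 \<le> C" "0 \<le> c" "\<And>y. \<bar>f y\<bar> \<le> C * exp (c * \<bar>y\<bar>)"
    using exp_growthE[OF f] by metis
  have "0 \<le> c + d" using C d by simp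
  with k a obtain B where B: "\<And>t z. t \<in> {a..b} \<Longrightarrow> \<bar>k t z\<bar> \<le> B * exp (- (c + d) * \<bar>z\<bar>)"
    unfolding admissible_kernel_def by metis
  define M where "M = \<bar>B\<bar> * C * exp ((c + d) * U)"
  have "\<bar>k t (u - y) * f y\<bar> \<le> M * exp (- d * \<bar>y\<bar>)" if "t \<in> {a..b}" "\<bar>u\<bar> \<le> U" for t u y
  proof -
    have "\<bar>k t (u - y) * f y\<bar> \<le> (\<bar>B\<bar> * exp (- (c + d) * \<bar>u - y\<bar>)) * (C * exp (c * \<bar>y\<bar>))"
      unfolding abs_mult
      by (intro mult_mono C order_trans[OF B[OF that(1)]] mult_right_mono) auto
    also have "\<dots> = \<bar>B\<bar> * C * exp (- (c + d) * \<bar>u - y\<bar> + c * \<bar>y\<bar>)"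
      by (simp only: exp_add mult_ac)
    also have "\<dots> \<le> \<bar>B\<bar> * C * exp ((c + d) * U - d * \<bar>y\<bar>)"
    proof -
      have "(c + d) * (\<bar>y\<bar> - \<bar>u - y\<bar>) \<le> (c + d) * U"
        using that C d by (intro mult_left_mono) auto
      then show ?thesis using C by (intro mult_left_mono) (auto simp: algebra_simps)
    qed
    also have "\<dots> = M * exp (- d * \<bar>y\<bar>)"
      by (simp only: M_def diff_conv_add_uminus exp_add mult_minus_left mult.assoc)
    finally show ?thesis .
  qed
  moreover have "0 \<le> M" using C by (simp add: M_def)
  ultimately show ?thesis by blast
qed

lemma borel_measurable_conv:
  assumes "admissible_kernel k" "exp_growth f"
  shows "(\<lambda>y. k t (u - y) * f y) \<in> borel_measurable lborel"
proof -
  have [measurable]: "k t \<in> borel_measurable borel" "f \<in> borel_measurable borel"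
    using assms by (auto simp: admissible_kernel_def exp_growth_def)
  show ?thesis by measurable
qed

lemma integrable_conv:
  assumes k: "admissible_kernel k" and f: "exp_growth f" and t: "0 < t"
  shows "integrable lborel (\<lambda>y. k t (u - y) * f y)"
proof -
  obtain M where M: "0 \<le> M" "\<And>y. \<bar>k t (u - y) * f y\<bar> \<le> M * exp (- 1 * \<bar>y\<bar>)"
    using conv_dominated[OF k f t, of 1 t "\<bar>u\<bar>"] by auto
  have "integrable lborel (\<lambda>y. M * exp (- 1 * \<bar>y\<bar>))"
    using integrable_exp_neg_abs[of 1] by simp
  from Bochner_Integration.integrable_bound[OF this borel_measurable_conv[OF k f]]
  show ?thesis using M by auto
qed

lemma continuous_on_heat_conv:
  assumes k: "admissible_kernel k" and f: "exp_growth f"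
  shows "continuous_on ({0<..} \<times> UNIV) (\<lambda>(t, u). heat_conv k f t u)"
proof (rule continuous_at_imp_continuous_on, safe)
  fix t0 u0 :: real assume t0: "0 < t0"
  define S where "S = {t0/2..2*t0} \<times> {u0-1..u0+1}"
  have int: "(t0, u0) \<in> interior S"
    using t0 by (simp add: S_def interior_Times)
  obtain M where M: "0 \<le> M"
    "\<And>t u y. t \<in> {t0/2..2*t0} \<Longrightarrow> \<bar>u\<bar> \<le> \<bar>u0\<bar> + 1 \<Longrightarrow> \<bar>k t (u - y) * f y\<bar> \<le> M * exp (- 1 * \<bar>y\<bar>)"
    using conv_dominated[OF k f, of "t0/2" 1 "2*t0" "\<bar>u0\<bar> + 1"] t0 by auto
  have kc: "continuous_on ({0<..} \<times> UNIV) (\<lambda>(t, z). k t z)"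
    using k by (simp add: admissible_kernel_def)
  have "((\<lambda>p. LINT y|lborel. (\<lambda>p y. k (fst p) (snd p - y) * f y) p y) \<longlongrightarrow>
      (LINT y|lborel. (\<lambda>p y. k (fst p) (snd p - y) * f y) (t0, u0) y)) (at (t0, u0) within S)"
  proof (rule dominated_continuity[where w = "\<lambda>y. M * exp (- 1 * \<bar>y\<bar>)"])
    show "((\<lambda>x. k (fst x) (snd x - y) * f y) \<longlongrightarrow> k (fst (t0, u0)) (snd (t0, u0) - y) * f y) (at (t0, u0) within S)" for y
    proof -
      have "continuous_on S (\<lambda>x. k (fst x) (snd x - y) * f y)"
        using t0 by (intro continuous_intros continuous_on_compose2[OF kc, where f = "\<lambda>p. (fst p, snd p - y)", simplified])
           (auto simp: S_def intro!: continuous_intros)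
      moreover have "(t0, u0) \<in> S" using int interior_subset[of S] by auto
      ultimately show ?thesis unfolding continuous_on_def by blast
    qed
    show "integrable lborel (\<lambda>y. M * exp (- 1 * \<bar>y\<bar>))"
      using integrable_exp_neg_abs[of 1] by simp
  qed (use int interior_subset[of S] M borel_measurable_conv[OF k f] in \<open>auto simp: S_def\<close>)
  then show "isCont (\<lambda>(t, u). heat_conv k f t u) (t0, u0)"
    unfolding isCont_def heat_conv_def case_prod_beta at_within_interior[OF int] by simp
qed

lemma DERIV_heat_conv_aux:
  assumes k: "admissible_kernel k" "admissible_kernel k'" and f: "exp_growth f" and t: "0 < t"
    and d: "\<And>z. (k t has_real_derivative k' t z) (at z)"
  shows "(heat_conv k f t has_real_derivative heat_conv k' f t u) (at u)"
proof -
  obtain M where M: "0 \<le> M"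
    "\<And>v y. \<bar>v\<bar> \<le> \<bar>u\<bar> + 1 \<Longrightarrow> \<bar>k' t (v - y) * f y\<bar> \<le> M * exp (- 1 * \<bar>y\<bar>)"
    using conv_dominated[OF k(2) f t, of 1 t "\<bar>u\<bar> + 1"] by auto
  have "((\<lambda>v. LINT y|lborel. (\<lambda>v y. k t (v - y) * f y) v y) has_real_derivative
      (LINT y|lborel. (\<lambda>v y. k' t (v - y) * f y) u y)) (at u within {u-1..u+1})"
  proof (rule dominated_differentiation[where w = "\<lambda>y. M * exp (- 1 * \<bar>y\<bar>)"])
    show "((\<lambda>x. k t (x - y) * f y) has_real_derivative k' t (x - y) * f y) (at x within {u - 1..u + 1})" for x y
      using DERIV_subset[OF d] by (auto intro!: derivative_eq_intros DERIV_chain2[OF d])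
    show "integrable lborel (\<lambda>y. M * exp (- 1 * \<bar>y\<bar>))"
      using integrable_exp_neg_abs[of 1] by simp
  qed (use M borel_measurable_conv[OF k(2) f] integrable_conv[OF k(1) f t] in auto)
  moreover have "at u within {u-1..u+1} = at u"
    by (rule at_within_interior) auto
  ultimately show ?thesis by (simp add: heat_conv_def[abs_def])
qed

lemma DERIV_heat_conv_space:
  assumes "exp_growth f" "0 < t"
  shows "(heat_conv heat_kernel f t has_real_derivative heat_conv heat_kernel1 f t u) (at u)"
    "(heat_conv heat_kernel1 f t has_real_derivative heat_conv heat_kernel2 f t u) (at u)"
  by (intro DERIV_heat_conv_aux admissible_heat_kernel assms DERIV_heat_kernel_space)+

lemma DERIV_heat_conv_time:
  assumes f: "exp_growth f" and t: "0 < t"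
  shows "((\<lambda>t. heat_conv heat_kernel f t u) has_real_derivative heat_conv heat_kernel2 f t u) (at t)"
proof -
  obtain M where M: "0 \<le> M"
    "\<And>s y. s \<in> {t/2..2*t} \<Longrightarrow> \<bar>heat_kernel2 s (u - y) * f y\<bar> \<le> M * exp (- 1 * \<bar>y\<bar>)"
    using conv_dominated[OF admissible_heat_kernel(3) f, of "t/2" 1 "2*t" "\<bar>u\<bar>"] t by auto
  have "((\<lambda>s. LINT y|lborel. (\<lambda>s y. heat_kernel s (u - y) * f y) s y) has_real_derivative
      (LINT y|lborel. (\<lambda>s y. heat_kernel2 s (u - y) * f y) t y)) (at t within {t/2..2*t})"
  proof (rule dominated_differentiation[where w = "\<lambda>y. M * exp (- 1 * \<bar>y\<bar>)"])
    show "((\<lambda>x. heat_kernel x (u - y) * f y) has_real_derivative heat_kernel2 x (u - y) * f y) (at x within {t/2..2*t})"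
      if "x \<in> {t/2..2*t}" for x y
      using that t by (intro DERIV_cmult_right DERIV_subset[OF DERIV_heat_kernel_time]) auto
    show "integrable lborel (\<lambda>y. M * exp (- 1 * \<bar>y\<bar>))"
      using integrable_exp_neg_abs[of 1] by simp
  qed (use t M borel_measurable_conv[OF admissible_heat_kernel(3) f] integrable_conv[OF admissible_heat_kernel(1) f] in auto)
  moreover have "at t within {t/2..2*t} = at t"
    using t by (intro at_within_interior) auto
  ultimately show ?thesis by (simp add: heat_conv_def[abs_def])
qed

text \<open>The substitution \<open>y = u + sqrt (2 t) w\<close> moves the time from the kernel into
  the argument of \<open>f\<close>. It links the kernel form, which can be differentiated for
  \<open>t > 0\<close>, to a form that remains meaningful at \<open>t = 0\<close>.\<close>

lemma heat_conv_rescale: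
  assumes t: "0 < t"
  shows "heat_conv heat_kernel f t u = (LINT w|lborel. std_normal_density w * f (u + sqrt (2 * t) * w))"
proof -
  have s: "sqrt (2 * t) > 0" using t by simp
  have "heat_conv heat_kernel f t u = sqrt (2 * t) *
      (LINT w|lborel. heat_kernel t (u - (u + sqrt (2 * t) * w)) * f (u + sqrt (2 * t) * w))"
    unfolding heat_conv_def
    using s by (subst lborel_integral_real_affine[where c = "sqrt (2 * t)" and t = u]) auto
  also have "\<dots> = (LINT w|lborel. sqrt (2 * t) * (heat_kernel t (- (sqrt (2 * t) * w)) * f (u + sqrt (2 * t) * w)))"
    by simp
  moreover have "sqrt (2 * t) * (heat_kernel t (- (sqrt (2 * t) * w)) * x) = std_normal_density w * x" for w x
  proof -
    have "(sqrt (2 * t) * w)\<^sup>2 / (4 * t) = w\<^sup>2 / 2" using t by (simp add: power_mult_distrib field_simps)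
    moreover have "sqrt (4 * pi * t) = sqrt (2 * t) * sqrt (2 * pi)"
      by (simp add: mult.commute mult.left_commute flip: real_sqrt_mult)
    ultimately show ?thesis using s by (simp add: heat_kernel_def std_normal_density_def)
  qed
  ultimately show ?thesis by simp
qed

section \<open>The limiting equation: uniqueness\<close>

lemma XR_monotone_lipschitz:
  assumes \<psi>: "\<psi> \<in> XR" and ab: "0 \<le> a" "a \<le> b"
  shows "\<psi> b \<le> \<psi> a" "\<psi> a - \<psi> b \<le> b - a"
proof -
  obtain \<psi>' where d: "\<And>u. u \<ge> 0 \<Longrightarrow> (\<psi> has_real_derivative \<psi>' u) (at u within {0..})"
    and b: "\<And>u. u \<ge> 0 \<Longrightarrow> -1 \<le> \<psi>' u \<and> \<psi>' u \<le> 0"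
    using \<psi> by (auto simp: XR_def)
  have "\<psi> b \<le> \<psi> a \<and> \<psi> a - \<psi> b \<le> b - a"
  proof (cases "a = b")
    case False
    then have "a < b" using ab by simp
    moreover have "(\<psi> has_derivative (*) (\<psi>' x)) (at x within {a..b})" if "a \<le> x" "x \<le> b" for x
      using DERIV_subset[OF d[of x], of "{a..b}"] that ab by (auto simp: has_field_derivative_def)
    ultimately obtain x where x: "x \<in> {a..b}" "\<psi> b - \<psi> a = (b - a) * \<psi>' x"
      using mvt_very_simple[of a b \<psi> "\<lambda>x. (*) (\<psi>' x)"] ab by (auto simp: mult.commute)
    have "(b - a) * \<psi>' x \<le> 0" "(b - a) * (- 1) \<le> (b - a) * \<psi>' x"
      using b[of x] x ab mult_left_mono[of "-1" "\<psi>' x" "b - a"] by (auto intro!: mult_nonneg_nonpos)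
    with x(2) show ?thesis by auto
  qed simp
  then show "\<psi> b \<le> \<psi> a" "\<psi> a - \<psi> b \<le> b - a" by auto
qed

lemma XR_nonneg: "\<psi> \<in> XR \<Longrightarrow> 0 \<le> u \<Longrightarrow> 0 \<le> \<psi> u"
  by (auto simp: XR_def)

lemma XR_continuous_on: "\<psi> \<in> XR \<Longrightarrow> continuous_on {0..} \<psi>"
  unfolding XR_def by (blast intro: DERIV_continuous_on dest: atLeast_iff[THEN iffD1])

text \<open>If \<open>D\<close> were positive, \<open>f'\<close> would be positive just to the right
  of its zero \<open>x0\<close>, and by the mean value theorem \<open>f\<close> would exceed its
  maximum there.\<close>

lemma local_max_second_derivative:
  fixes f f' :: "real \<Rightarrow> real"
  assumes d: "\<And>x. x \<in> {x0-e<..<x0+e} \<Longrightarrow> (f has_real_derivative f' x) (at x)"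
    and d2: "(f' has_real_derivative D) (at x0)" and e: "0 < e"
    and max: "\<And>x. x \<in> {x0-e<..<x0+e} \<Longrightarrow> f x \<le> f x0"
  shows "f' x0 = 0" "D \<le> 0"
proof -
  show z: "f' x0 = 0"
    by (rule DERIV_local_max[OF d[of x0] e]) (use e max in \<open>auto simp: abs_less_iff\<close>)
  show "D \<le> 0"
  proof (rule ccontr)
    assume "\<not> D \<le> 0"
    then obtain r where r: "0 < r" "\<And>h. 0 < h \<Longrightarrow> h < r \<Longrightarrow> f' x0 < f' (x0 + h)"
      using DERIV_pos_inc_right[OF d2] by auto
    define h where "h = min r e / 2"
    have h: "0 < h" "h < r" "h < e" using r e by (auto simp: h_def)
    obtain z where z': "z > x0" "z < x0 + h" "f (x0 + h) - f x0 = (x0 + h - x0) * f' z"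
      using MVT2[of x0 "x0 + h" f f'] h d by auto
    have "0 < f' z" using r(2)[of "z - x0"] z' h z by simp
    then have "0 < h * f' z" using h by (intro mult_pos_pos)
    then have "f (x0 + h) > f x0" using z'(3) by simp
    then show False using max[of "x0 + h"] h by auto
  qed
qed

text \<open>Maximum principle for the difference of two solutions minus a small multiple of a
  barrier: the barrier grows linearly in space and is strictly decreasing at the boundary, which
  excludes a maximum there because both solutions have the same slope at the origin.\<close>

lemma classical_sol_le:
  assumes \<beta>: "0 \<le> \<beta>" and p: "classical_sol \<beta> \<psi>0 \<phi>" and q: "classical_sol \<beta> \<psi>0 \<psi>"
    and t0: "0 \<le> t0" and u0: "0 \<le> u0"
  shows "\<phi> t0 u0 \<le> \<psi> t0 u0"
proof (rule ccontr)
  assume "\<not> \<phi> t0 u0 \<le> \<psi> t0 u0"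
  then have pos: "0 < \<phi> t0 u0 - \<psi> t0 u0" by simp
  \<comment> \<open>At the maximum the barrier contributes at most 2 through its second derivative
    and at most \<open>\<beta>\<close> through the nonlinear term, in units of \<open>E\<close>
    below. The time derivative contributes at least \<open>k\<close>, so any \<open>k\<close> above
    \<open>2 + \<beta>\<close> gives a contradiction.\<close>
  define k where "k = 3 + \<beta>"
  define b where "b u = u + 2 * exp (- u)" for u :: real
  have b1: "1 \<le> b u" "u \<le> b u" if "0 \<le> u" for u
  proof -
    show "u \<le> b u" by (simp add: b_def)
    show "1 \<le> b u" unfolding b_def using exp_ge_add_one_self[of "- u"] exp_gt_zero[of "-u"] by linarith
  qed
  have db: "(b has_real_derivative 1 - 2 * exp (- u)) (at u)" for u
    unfolding b_def by (auto intro!: derivative_eq_intros)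
  have db2: "((\<lambda>u. 1 - 2 * exp (- u)) has_real_derivative 2 * exp (- u)) (at u)" for u :: real
    by (auto intro!: derivative_eq_intros)
  \<comment> \<open>The barrier takes away exactly half of the supposed gap at
    \<open>(t0, u0)\<close>, so \<open>H\<close> stays positive there.\<close>
  define \<delta> where "\<delta> = (\<phi> t0 u0 - \<psi> t0 u0) / (2 * exp (k * t0) * b u0)"
  have \<delta>: "0 < \<delta>" using pos b1[OF u0] by (simp add: \<delta>_def)
  define H where "H t u = \<phi> t u - \<psi> t u - \<delta> * (exp (k * t) * b u)" for t u
  have Hpos: "0 < H t0 u0"
    using pos b1[OF u0] by (simp add: H_def \<delta>_def)
  have pX: "\<phi> t \<in> XR" "\<psi> t \<in> XR" if "0 \<le> t" for t
    using p q that by (auto simp: classical_sol_def)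
  have pc: "continuous_on ({0..} \<times> {0..}) (\<lambda>(t, u). \<phi> t u)" "continuous_on ({0..} \<times> {0..}) (\<lambda>(t, u). \<psi> t u)"
    using p q by (auto simp: classical_sol_def)
  have "continuous_on {0..t0} (\<lambda>t. \<phi> t 0)"
    using continuous_on_compose2[OF pc(1), of "{0..t0}" "\<lambda>t. (t, 0)"]
    by (auto simp: image_subset_iff continuous_on_Pair)
  then have "bounded ((\<lambda>t. \<phi> t 0) ` {0..t0})"
    by (intro compact_imp_bounded compact_continuous_image) auto
  then obtain M where M: "\<And>t. t \<in> {0..t0} \<Longrightarrow> \<phi> t 0 \<le> M"
    unfolding bounded_iff by (force simp: abs_le_iff)
  \<comment> \<open>Since \<open>\<phi>\<close> decreases in space it is at most \<open>M\<close>
    everywhere, while the barrier at \<open>R\<close> is at least \<open>\<delta> R > M\<close>.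
    Hence a positive maximum over the box cannot lie at its outer edge.\<close>
  define R where "R = max u0 ((\<bar>M\<bar> + 1) / \<delta>)"
  have R: "0 < R" "u0 \<le> R" "\<bar>M\<bar> + 1 \<le> \<delta> * R"
  proof -
    have "(\<bar>M\<bar> + 1) / \<delta> \<le> R" "0 < (\<bar>M\<bar> + 1) / \<delta>" using \<delta> by (auto simp: R_def)
    then show "0 < R" "\<bar>M\<bar> + 1 \<le> \<delta> * R"
      using \<delta> by (linarith, simp add: pos_divide_le_eq mult.commute)
  qed (simp add: R_def)
  define S where "S = {0..t0} \<times> {0..R}"
  have "continuous_on S (\<lambda>p. H (fst p) (snd p))"
  proof -
    have "continuous_on S (\<lambda>p. \<phi> (fst p) (snd p))" "continuous_on S (\<lambda>p. \<psi> (fst p) (snd p))"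
      using pc[THEN continuous_on_subset, of S] unfolding S_def split_beta' by fastforce+
    then show ?thesis unfolding H_def b_def by (intro continuous_intros)
  qed
  moreover have "compact S" "S \<noteq> {}"
    using R t0 by (auto simp: S_def intro: compact_Times)
  ultimately obtain P where P: "P \<in> S" "\<And>x. x \<in> S \<Longrightarrow> H (fst x) (snd x) \<le> H (fst P) (snd P)"
    using continuous_attains_sup[of S "\<lambda>p. H (fst p) (snd p)"] by blast
  obtain t1 u1 where P_eq: "P = (t1, u1)" by (cases P)
  from P(1) have tu: "0 \<le> t1" "t1 \<le> t0" "0 \<le> u1" "u1 \<le> R" by (auto simp: S_def P_eq)
  have max: "H t u \<le> H t1 u1" if "0 \<le> t" "t \<le> t0" "0 \<le> u" "u \<le> R" for t u
    using P(2)[of "(t, u)"] that by (simp add: S_def P_eq)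
  have H1: "0 < H t1 u1" using max[of t0 u0] Hpos t0 u0 R by simp
  define E where "E = \<delta> * exp (k * t1)"
  have E: "0 < E" using \<delta> by (simp add: E_def)
  have t1: "0 < t1"
  proof (rule ccontr)
    assume "\<not> 0 < t1"
    with tu have "t1 = 0" by simp
    then have "H t1 u1 = - (\<delta> * b u1)" using p q tu by (simp add: H_def classical_sol_def)
    then show False using H1 \<delta> b1[OF tu(3)] mult_pos_pos[of \<delta> "b u1"] by linarith
  qed
  have u1R: "u1 < R"
  proof (rule ccontr)
    assume "\<not> u1 < R"
    with tu have [simp]: "u1 = R" by simp
    have "\<phi> t1 R \<le> \<phi> t1 0" using XR_monotone_lipschitz(1)[OF pX(1)] tu by auto
    moreover have "0 \<le> \<psi> t1 R" using XR_nonneg[OF pX(2)] tu by auto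
    moreover have "\<delta> * (1 * R) \<le> \<delta> * (exp (k * t1) * b R)"
      using \<delta> \<beta> tu R b1[of R] by (intro mult_left_mono mult_mono) (auto simp: k_def)
    ultimately show False using H1 M[of t1] tu R(3) unfolding H_def by auto
  qed
  have u1: "0 < u1"
  proof (rule ccontr)
    assume "\<not> 0 < u1"
    with tu have [simp]: "u1 = 0" by simp
    have X0: "(f has_real_derivative - 1 / 2) (at 0 within {0..})" if "f \<in> XR" for f
      using that by (force simp: XR_def)
    have "(H t1 has_real_derivative (- 1/2 - - 1/2 - \<delta> * (exp (k * t1) * (1 - 2 * exp (- 0))))) (at 0 within {0..})"
      unfolding H_def using tu
      by (intro DERIV_diff DERIV_cmult X0 pX DERIV_subset[OF db]) auto
    then have "(H t1 has_real_derivative E) (at 0 within {0..})" by (simp add: E_def)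
    from has_real_derivative_pos_inc_right[OF this E]
    obtain d where d: "d > 0" "\<And>h. h > 0 \<Longrightarrow> h < d \<Longrightarrow> H t1 0 < H t1 h" by auto
    have "H t1 0 < H t1 (min d R / 2)" using d R by (intro d(2)) auto
    moreover have "0 \<le> min d R / 2" "min d R / 2 \<le> R" using d R by auto
    ultimately show False using max[of t1 "min d R / 2"] tu by auto
  qed
  have du: "(f t has_real_derivative d_u f t u) (at u)" "(d_u f t has_real_derivative d_uu f t u) (at u)"
    "((\<lambda>t. f t u) has_real_derivative d_t f t u) (at t)"
    "d_t f t u = d_uu f t u + \<beta> * d_u f t u * (1 + d_u f t u)" "- 1 \<le> d_u f t u" "d_u f t u \<le> 0"
    if "classical_sol \<beta> \<psi>0 f" "0 < t" "0 < u" for f t u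
  proof -
    show 1: "(f t has_real_derivative d_u f t u) (at u)" "(d_u f t has_real_derivative d_uu f t u) (at u)"
      "((\<lambda>t. f t u) has_real_derivative d_t f t u) (at t)"
    proof -
      have "(\<lambda>s. f s u) differentiable at t" "f t differentiable at u" "d_u f t differentiable at u"
        using that unfolding classical_sol_def by blast+
      then show "(f t has_real_derivative d_u f t u) (at u)" "(d_u f t has_real_derivative d_uu f t u) (at u)"
        "((\<lambda>t. f t u) has_real_derivative d_t f t u) (at t)"
        by (simp_all only: d_uu_def d_t_def DERIV_deriv_iff_real_differentiable)
          (simp add: d_u_def[abs_def] DERIV_deriv_iff_real_differentiable)
    qed
    show "d_t f t u = d_uu f t u + \<beta> * d_u f t u * (1 + d_u f t u)"
      using that unfolding classical_sol_def by blast
    have "f t \<in> XR" using that by (auto simp: classical_sol_def)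
    then obtain f' where f'_all: "\<forall>u\<ge>0. (f t has_real_derivative f' u) (at u within {0..})"
        "\<forall>u\<ge>0. f t u \<ge> 0 \<and> - 1 \<le> f' u \<and> f' u \<le> 0"
      unfolding XR_def mem_Collect_eq by (elim exE conjE)
    then have f': "(f t has_real_derivative f' u) (at u within {0..})" "- 1 \<le> f' u" "f' u \<le> 0"
      using that by simp_all
    have "at u within {0..} = at u" using that by (intro at_within_interior) auto
    with f'(1) 1(1) have "f' u = d_u f t u" by (auto intro: DERIV_unique)
    with f' show "- 1 \<le> d_u f t u" "d_u f t u \<le> 0" by auto
  qed
  define H' where "H' u = d_u \<phi> t1 u - d_u \<psi> t1 u - \<delta> * (exp (k * t1) * (1 - 2 * exp (- u)))" for u
  have d1: "(H t1 has_real_derivative H' u) (at u)" if "0 < u" for u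
    unfolding H_def H'_def by (intro DERIV_diff DERIV_cmult du(1) p q t1 that db)
  have d2: "(H' has_real_derivative d_uu \<phi> t1 u1 - d_uu \<psi> t1 u1 - \<delta> * (exp (k * t1) * (2 * exp (- u1)))) (at u1)"
    unfolding H'_def by (intro DERIV_diff DERIV_cmult du(2) p q t1 u1 db2)
  define e where "e = min u1 (R - u1)"
  have e: "0 < e" using u1 u1R by (simp add: e_def)
  have e_pos: "0 < u" and e_max: "H t1 u \<le> H t1 u1" if "u \<in> {u1 - e<..<u1 + e}" for u
  proof -
    from that show "0 < u" by (auto simp: e_def)
    with that tu show "H t1 u \<le> H t1 u1" by (intro max) (auto simp: e_def)
  qed
  have m: "H' u1 = 0" "d_uu \<phi> t1 u1 - d_uu \<psi> t1 u1 - \<delta> * (exp (k * t1) * (2 * exp (- u1))) \<le> 0"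
    by (rule local_max_second_derivative[OF d1[OF e_pos] d2 e e_max]; assumption)+
  then have m2: "d_uu \<phi> t1 u1 - d_uu \<psi> t1 u1 \<le> E * (2 * exp (- u1))"
    by (simp add: E_def mult.assoc)
  have dH: "((\<lambda>t. H t u1) has_real_derivative d_t \<phi> t1 u1 - d_t \<psi> t1 u1 - \<delta> * (exp (k * t1) * k * b u1)) (at t1)"
    unfolding H_def by (intro DERIV_diff DERIV_cmult DERIV_cmult_right du(3) p q t1 u1) (auto intro!: derivative_eq_intros)
  \<comment> \<open>The maximum may sit at the final time \<open>t0\<close>, so only earlier times
    can be compared and the time derivative is known to be nonnegative rather than zero.\<close>
  have "0 \<le> d_t \<phi> t1 u1 - d_t \<psi> t1 u1 - \<delta> * (exp (k * t1) * k * b u1)"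
  proof (rule ccontr)
    assume "\<not> ?thesis"
    then obtain d where d: "d > 0" "\<And>h. h > 0 \<Longrightarrow> h < d \<Longrightarrow> H t1 u1 < H (t1 - h) u1"
      using DERIV_neg_dec_left[OF dH] by auto
    have "H t1 u1 < H (t1 - min d t1 / 2) u1" using d t1 by (intro d(2)) auto
    moreover have "0 \<le> t1 - min d t1 / 2" "t1 - min d t1 / 2 \<le> t0" using d t1 tu by auto
    ultimately show False using max[of "t1 - min d t1 / 2" u1] tu by auto
  qed
  then have "E * (k * b u1) \<le> d_t \<phi> t1 u1 - d_t \<psi> t1 u1" by (simp add: E_def mult_ac)
  \<comment> \<open>From \<open>p (1 + p) - q (1 + q) = (p - q) (1 + p + q)\<close>. With both
    slopes in \<open>[-1, 0]\<close> the last factor is at most 1 in absolute value, so the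
    nonlinear term is controlled without any smallness.\<close>
  also have "\<dots> = d_uu \<phi> t1 u1 - d_uu \<psi> t1 u1
      + \<beta> * ((d_u \<phi> t1 u1 - d_u \<psi> t1 u1) * (1 + d_u \<phi> t1 u1 + d_u \<psi> t1 u1))"
    unfolding du(4)[OF p t1 u1] du(4)[OF q t1 u1] by (simp add: algebra_simps)
  also have "d_u \<phi> t1 u1 - d_u \<psi> t1 u1 = E * (1 - 2 * exp (- u1))"
    using m(1) by (simp add: H'_def E_def)
  also have "E * (1 - 2 * exp (- u1)) * (1 + d_u \<phi> t1 u1 + d_u \<psi> t1 u1) \<le> E * 1"
  proof -
    have "exp (- u1) \<le> 1" using u1 by simp
    then have "\<bar>1 - 2 * exp (- u1)\<bar> \<le> 1" using exp_gt_zero[of "- u1"] by linarith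
    moreover have "\<bar>1 + d_u \<phi> t1 u1 + d_u \<psi> t1 u1\<bar> \<le> 1"
      using du(5,6)[OF p t1 u1] du(5,6)[OF q t1 u1] by linarith
    ultimately have "\<bar>(1 - 2 * exp (- u1)) * (1 + d_u \<phi> t1 u1 + d_u \<psi> t1 u1)\<bar> \<le> 1 * 1"
      unfolding abs_mult by (intro mult_mono) auto
    then show ?thesis unfolding mult.assoc using E by (intro mult_left_mono) auto
  qed
  finally have "E * (k * b u1) \<le> d_uu \<phi> t1 u1 - d_uu \<psi> t1 u1 + \<beta> * (E * 1)"
    using \<beta> by (simp add: mult_left_mono)
  also have "\<dots> \<le> E * (2 * 1) + \<beta> * (E * 1)"
  proof -
    have "E * (2 * exp (- u1)) \<le> E * (2 * 1)" using E u1 by (intro mult_left_mono) auto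
    with m2 show ?thesis by linarith
  qed
  also have "\<dots> = E * (k * 1) - E" by (simp add: k_def algebra_simps)
  also have "\<dots> < E * (k * b u1)"
  proof -
    have "E * (k * 1) \<le> E * (k * b u1)"
      using E \<beta> b1(1)[OF tu(3)] by (intro mult_left_mono) (auto simp: k_def)
    with E show ?thesis by linarith
  qed
  finally show False by simp
qed

section \<open>The limiting equation: existence\<close>

definition half_lipschitz :: "(real \<Rightarrow> real) \<Rightarrow> bool" where
  "half_lipschitz h \<longleftrightarrow> (\<forall>x y. \<bar>h x - h y\<bar> \<le> \<bar>x - y\<bar> / 2)"

text \<open>The exponent of the transform at time 0, reflected evenly to the whole line. Adding
  \<open>|y| / 2\<close> centres the slopes from \<open>[-1, 0]\<close> to
  \<open>[-1/2, 1/2]\<close>, a condition that is compatible with the reflection.\<close>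

definition tilt :: "(real \<Rightarrow> real) \<Rightarrow> real \<Rightarrow> real" where
  "tilt \<psi> y = \<bar>y\<bar> / 2 + \<psi> \<bar>y\<bar>"

lemma half_lipschitz_tilt:
  assumes "\<psi> \<in> XR"
  shows "half_lipschitz (tilt \<psi>)"
proof -
  have *: "\<bar>tilt \<psi> x - tilt \<psi> y\<bar> \<le> \<bar>x - y\<bar> / 2" if "\<bar>x\<bar> \<le> \<bar>y\<bar>" for x y
    using XR_monotone_lipschitz[OF assms abs_ge_zero that] that abs_triangle_ineq3[of x y]
    unfolding tilt_def by (simp add: abs_if[of "_ / _ + _ - _"])
  have "\<bar>tilt \<psi> x - tilt \<psi> y\<bar> \<le> \<bar>x - y\<bar> / 2" for x y
    using *[of x y] *[of y x] by (cases "\<bar>x\<bar> \<le> \<bar>y\<bar>") (auto simp: abs_minus_commute)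
  then show ?thesis by (simp add: half_lipschitz_def)
qed

lemma half_lipschitz_continuous:
  assumes "half_lipschitz h"
  shows "continuous_on A h"
proof -
  have "(1/2)-lipschitz_on A h"
    using assms by (intro lipschitz_onI) (auto simp: half_lipschitz_def dist_real_def)
  then show ?thesis by (rule lipschitz_on_continuous_on)
qed

lemma half_lipschitz_bound:
  assumes "half_lipschitz h"
  shows "\<bar>h x\<bar> \<le> \<bar>h y\<bar> + \<bar>x - y\<bar> / 2"
proof -
  have "\<bar>h x - h y\<bar> \<le> \<bar>x - y\<bar> / 2" using assms by (simp add: half_lipschitz_def)
  then show ?thesis by linarith
qed

lemma exp_growth_exp_half_lipschitz:
  assumes h: "half_lipschitz h"
  shows "exp_growth (\<lambda>y. exp (\<beta> * h y))"
proof -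
  have [measurable]: "h \<in> borel_measurable borel"
    by (rule borel_measurable_continuous_onI[OF half_lipschitz_continuous[OF h]])
  have "\<bar>exp (\<beta> * h y)\<bar> \<le> exp (\<bar>\<beta>\<bar> * \<bar>h 0\<bar>) * exp (\<bar>\<beta>\<bar> / 2 * \<bar>y\<bar>)" for y
  proof -
    have "\<beta> * h y \<le> \<bar>\<beta>\<bar> * \<bar>h y\<bar>" by (metis abs_ge_self abs_mult)
    also have "\<dots> \<le> \<bar>\<beta>\<bar> * (\<bar>h 0\<bar> + \<bar>y\<bar> / 2)"
      using half_lipschitz_bound[OF h, of y 0] by (intro mult_left_mono) auto
    finally show ?thesis by (simp add: algebra_simps flip: exp_add)
  qed
  moreover have "(\<lambda>y. exp (\<beta> * h y)) \<in> borel_measurable borel" by measurable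
  ultimately show ?thesis unfolding exp_growth_def by blast
qed

section \<open>Gaussian averages down to time zero\<close>

lemma integrable_std_normal_exp_abs:
  "integrable lborel (\<lambda>w. std_normal_density w * exp (c * \<bar>w\<bar>))"
proof -
  have "exp_growth (\<lambda>w. exp (c * \<bar>w\<bar>))"
    unfolding exp_growth_def by (intro conjI exI[of _ 1] exI[of _ c]) auto
  from integrable_conv[OF admissible_heat_kernel(1) this, of "1/2" 0]
  show ?thesis by (simp add: heat_kernel_even heat_kernel_normal_density)
qed

lemma integral_std_normal_exp: "(LINT w|lborel. std_normal_density w * exp (a * w)) = exp (a\<^sup>2 / 2)"
proof -
  have "std_normal_density w * exp (a * w) = exp (a\<^sup>2 / 2) * normal_density a 1 w" for w
  proof -
    have "- w\<^sup>2 / 2 + a * w = a\<^sup>2 / 2 + - (w - a)\<^sup>2 / 2" by (simp add: power2_eq_square field_simps)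
    then have "exp (- w\<^sup>2 / 2) * exp (a * w) = exp (a\<^sup>2 / 2) * exp (- (w - a)\<^sup>2 / 2)"
      by (simp only: flip: exp_add)
    then show ?thesis by (simp add: std_normal_density_def normal_density_def)
  qed
  then show ?thesis by simp
qed

text \<open>The heat evolution in its rescaled form. The division by zero in the kernel at
  \<open>t = 0\<close> is avoided, and since the normal density has mass one the value there is
  \<open>f\<close> itself.\<close>

definition heat_ext :: "(real \<Rightarrow> real) \<Rightarrow> real \<Rightarrow> real \<Rightarrow> real" where
  "heat_ext f t u = (LINT w|lborel. std_normal_density w * f (u + sqrt (2 * t) * w))"

lemma heat_ext_eq_conv: "0 < t \<Longrightarrow> heat_ext f t u = heat_conv heat_kernel f t u"
  by (simp add: heat_ext_def heat_conv_rescale)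

lemma heat_ext_0: "heat_ext f 0 u = f u"
  by (simp add: heat_ext_def)

lemma exp_growth_bound_affine:
  assumes "\<And>y. \<bar>f y\<bar> \<le> C * exp (c * \<bar>y\<bar>)" "0 \<le> C" "0 \<le> c" "0 \<le> t" "t \<le> T" "\<bar>u\<bar> \<le> U"
  shows "\<bar>std_normal_density w * f (u + sqrt (2 * t) * w)\<bar>
     \<le> C * exp (c * U) * (std_normal_density w * exp (c * sqrt (2 * T) * \<bar>w\<bar>))"
proof -
  have "\<bar>u + sqrt (2 * t) * w\<bar> \<le> \<bar>u\<bar> + \<bar>sqrt (2 * t)\<bar> * \<bar>w\<bar>"
    by (metis abs_mult abs_triangle_ineq)
  also have "\<dots> \<le> U + sqrt (2 * T) * \<bar>w\<bar>"
    using assms by (intro add_mono mult_right_mono) auto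
  finally have "c * \<bar>u + sqrt (2 * t) * w\<bar> \<le> c * (U + sqrt (2 * T) * \<bar>w\<bar>)"
    using assms by (intro mult_left_mono) auto
  then have "\<bar>f (u + sqrt (2 * t) * w)\<bar> \<le> C * exp (c * U + c * sqrt (2 * T) * \<bar>w\<bar>)"
    using assms by (intro order_trans[OF assms(1)] mult_left_mono) (auto simp: algebra_simps)
  then have "std_normal_density w * \<bar>f (u + sqrt (2 * t) * w)\<bar>
      \<le> std_normal_density w * (C * exp (c * U + c * sqrt (2 * T) * \<bar>w\<bar>))"
    by (intro mult_left_mono) auto
  then show ?thesis by (simp add: abs_mult exp_add mult_ac)
qed

lemma exp_growth_affine_measurable:
  assumes "exp_growth f"
  shows "(\<lambda>w. std_normal_density w * f (u + c * w)) \<in> borel_measurable lborel"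
proof -
  have [measurable]: "f \<in> borel_measurable borel" using assms by (simp add: exp_growth_def)
  show ?thesis by measurable
qed

lemma integrable_heat_ext:
  assumes f: "exp_growth f" and t: "0 \<le> t"
  shows "integrable lborel (\<lambda>w. std_normal_density w * f (u + sqrt (2 * t) * w))"
proof -
  obtain C c where C: "0 \<le> C" "0 \<le> c" "\<And>y. \<bar>f y\<bar> \<le> C * exp (c * \<bar>y\<bar>)"
    using exp_growthE[OF f] by metis
  have "integrable lborel (\<lambda>w. C * exp (c * \<bar>u\<bar>) * (std_normal_density w * exp (c * sqrt (2 * t) * \<bar>w\<bar>)))"
    by (intro integrable_mult_right integrable_std_normal_exp_abs)
  then show ?thesis
  proof (rule Bochner_Integration.integrable_bound[OF _ exp_growth_affine_measurable[OF f] AE_I2])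
    fix w
    show "norm (std_normal_density w * f (u + sqrt (2 * t) * w))
      \<le> norm (C * exp (c * \<bar>u\<bar>) * (std_normal_density w * exp (c * sqrt (2 * t) * \<bar>w\<bar>)))"
      using exp_growth_bound_affine[where f = f and u = u and w = w, OF C(3,1,2) t order_refl order_refl] C by simp
  qed
qed

lemma continuous_on_heat_ext:
  assumes f: "exp_growth f" and cont: "continuous_on UNIV f"
  shows "continuous_on ({0..} \<times> UNIV) (\<lambda>(t, u). heat_ext f t u)"
  unfolding continuous_on_eq_continuous_within
proof safe
  fix t0 u0 :: real assume t0: "0 \<le> t0"
  obtain C c where C: "0 \<le> C" "0 \<le> c" "\<And>y. \<bar>f y\<bar> \<le> C * exp (c * \<bar>y\<bar>)"
    using exp_growthE[OF f] by metis
  define S where "S = {0..t0+1} \<times> {u0-1..u0+1}"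
  have "((\<lambda>p. LINT w|lborel. (\<lambda>p w. std_normal_density w * f (snd p + sqrt (2 * fst p) * w)) p w) \<longlongrightarrow>
      (LINT w|lborel. (\<lambda>p w. std_normal_density w * f (snd p + sqrt (2 * fst p) * w)) (t0, u0) w)) (at (t0, u0) within S)"
  proof (rule dominated_continuity)
    show "\<bar>std_normal_density w * f (snd p + sqrt (2 * fst p) * w)\<bar>
       \<le> C * exp (c * (\<bar>u0\<bar> + 1)) * (std_normal_density w * exp (c * sqrt (2 * (t0 + 1)) * \<bar>w\<bar>))"
      if "p \<in> S" for p w
      using that by (intro exp_growth_bound_affine[where f = f, OF C(3,1,2)]) (auto simp: S_def)
    show "integrable lborel (\<lambda>w. C * exp (c * (\<bar>u0\<bar> + 1)) * (std_normal_density w * exp (c * sqrt (2 * (t0 + 1)) * \<bar>w\<bar>)))"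
      by (intro integrable_mult_right integrable_std_normal_exp_abs)
    show "((\<lambda>p. std_normal_density w * f (snd p + sqrt (2 * fst p) * w)) \<longlongrightarrow>
        std_normal_density w * f (snd (t0, u0) + sqrt (2 * fst (t0, u0)) * w)) (at (t0, u0) within S)" for w
    proof -
      have "continuous_on S (\<lambda>p. std_normal_density w * f (snd p + sqrt (2 * fst p) * w))"
        by (intro continuous_intros continuous_on_compose2[OF cont]) auto
      moreover have "(t0, u0) \<in> S" using t0 by (simp add: S_def)
      ultimately show ?thesis unfolding continuous_on_def by blast
    qed
  qed (use t0 exp_growth_affine_measurable[OF f] in \<open>auto simp: S_def\<close>)
  moreover have "at (t0, u0) within S = at (t0, u0) within ({0..} \<times> UNIV)"
  proof (rule at_within_nhd[of _ "{t0-1<..<t0+1} \<times> {u0-1<..<u0+1}"])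
    show "open ({t0 - 1<..<t0 + 1} \<times> {u0 - 1<..<u0 + 1})" by (intro open_Times) auto
  qed (auto simp: S_def)
  ultimately show "continuous (at (t0, u0) within {0..} \<times> UNIV) (\<lambda>(t, u). heat_ext f t u)"
    by (simp add: continuous_within heat_ext_def split_beta')
qed

lemma heat_ext_even:
  assumes "\<And>y. f (- y) = f y"
  shows "heat_ext f t (- u) = heat_ext f t u"
proof -
  have "heat_ext f t (- u) = (LINT w|lborel. std_normal_density (- w) * f (- u + sqrt (2 * t) * - w))"
    unfolding heat_ext_def
    by (subst lborel_integral_real_affine[where c = "-1" and t = 0]) auto
  also have "\<dots> = heat_ext f t u"
    unfolding heat_ext_def
  proof (intro Bochner_Integration.integral_cong refl)
    fix w show "std_normal_density (- w) * f (- u + sqrt (2 * t) * - w) = std_normal_density w * f (u + sqrt (2 * t) * w)"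
      using assms[of "u + sqrt (2 * t) * w"] by (simp add: std_normal_density_def)
  qed
  finally show ?thesis .
qed

lemma lipschitz_DERIV_bound:
  fixes f :: "real \<Rightarrow> real"
  assumes "(f has_real_derivative D) (at x)" "\<And>y. \<bar>f y - f x\<bar> \<le> L * \<bar>y - x\<bar>"
  shows "\<bar>D\<bar> \<le> L"
proof -
  have "((\<lambda>y. \<bar>(f y - f x) / (y - x)\<bar>) \<longlongrightarrow> \<bar>D\<bar>) (at x)"
    using assms(1) unfolding has_field_derivative_iff by (rule tendsto_rabs)
  moreover have "\<forall>\<^sub>F y in at x. \<bar>(f y - f x) / (y - x)\<bar> \<le> L"
    unfolding eventually_at_filter using assms(2) by (auto simp: field_simps intro!: always_eventually)
  ultimately show ?thesis by (rule tendsto_upperbound) simp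
qed

text \<open>The transformed solution, obtained directly from the heat equation;
  \<open>profile\<close> below inverts the transform.\<close>

definition cole_hopf :: "real \<Rightarrow> (real \<Rightarrow> real) \<Rightarrow> real \<Rightarrow> real \<Rightarrow> real" where
  "cole_hopf \<beta> \<psi> = heat_ext (\<lambda>y. exp (\<beta> * tilt \<psi> y))"

section \<open>From the transformed solution back to the profile\<close>

context
  fixes \<beta> :: real and \<psi>0 :: "real \<Rightarrow> real"
  assumes \<beta>: "0 < \<beta>" and \<psi>0: "\<psi>0 \<in> XR"
begin

private abbreviation "g \<equiv> (\<lambda>y. exp (\<beta> * tilt \<psi>0 y))"
private abbreviation "V \<equiv> cole_hopf \<beta> \<psi>0"

lemma exp_growth_g: "exp_growth g"
  by (intro exp_growth_exp_half_lipschitz half_lipschitz_tilt \<psi>0)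

lemma cole_hopf_pos:
  assumes t: "0 \<le> t"
  shows "0 < V t u"
proof -
  have nn: "0 \<le> V t u"
    unfolding cole_hopf_def heat_ext_def by (intro integral_nonneg_AE) auto
  have "V t u \<noteq> 0"
  proof
    assume "V t u = 0"
    then have "AE w in lborel. std_normal_density w * g (u + sqrt (2 * t) * w) = 0"
      unfolding cole_hopf_def heat_ext_def
      by (subst (asm) integral_nonneg_eq_0_iff_AE[OF integrable_heat_ext[OF exp_growth_g t]]) auto
    then have "AE w::real in lborel. False"
      by eventually_elim (use normal_density_pos[of 1 0] in \<open>auto simp: less_le\<close>)
    then show False
      using AE_iff_measurable[of UNIV lborel "\<lambda>_::real. False"] by simp
  qed
  with nn show ?thesis by simp
qed

text \<open>Shifting the initial value by \<open>u - v\<close> changes it by a factor of at most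
  \<open>exp (\<beta> |u - v| / 2)\<close>, and a Gaussian average inherits such a factor. In this
  way the slope bounds on \<open>\<psi>0\<close> propagate to positive times.\<close>

lemma cole_hopf_lipschitz:
  assumes t: "0 \<le> t"
  shows "\<bar>ln (V t u) - ln (V t v)\<bar> \<le> \<beta> / 2 * \<bar>u - v\<bar>"
proof -
  have *: "ln (V t u) \<le> \<beta> / 2 * \<bar>u - v\<bar> + ln (V t v)" for u v
  proof -
    have "V t u \<le> (LINT w|lborel. exp (\<beta> / 2 * \<bar>u - v\<bar>) * (std_normal_density w * g (v + sqrt (2 * t) * w)))"
      unfolding cole_hopf_def heat_ext_def
    proof (intro integral_mono integrable_mult_right integrable_heat_ext exp_growth_g t)
      fix w
      have "\<bar>tilt \<psi>0 (u + sqrt (2 * t) * w) - tilt \<psi>0 (v + sqrt (2 * t) * w)\<bar> \<le> \<bar>u - v\<bar> / 2"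
        using half_lipschitz_tilt[OF \<psi>0] unfolding half_lipschitz_def
        by (metis add_diff_cancel_right)
      then have "tilt \<psi>0 (u + sqrt (2 * t) * w) \<le> \<bar>u - v\<bar> / 2 + tilt \<psi>0 (v + sqrt (2 * t) * w)" by linarith
      then have "\<beta> * tilt \<psi>0 (u + sqrt (2 * t) * w) \<le> \<beta> * (\<bar>u - v\<bar> / 2 + tilt \<psi>0 (v + sqrt (2 * t) * w))"
        using \<beta> by (intro mult_left_mono) auto
      then have "g (u + sqrt (2 * t) * w) \<le> exp (\<beta> / 2 * \<bar>u - v\<bar>) * g (v + sqrt (2 * t) * w)"
        by (simp add: algebra_simps flip: exp_add)
      from mult_left_mono[OF this, of "std_normal_density w"]
      show "std_normal_density w * g (u + sqrt (2 * t) * w)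
         \<le> exp (\<beta> / 2 * \<bar>u - v\<bar>) * (std_normal_density w * g (v + sqrt (2 * t) * w))"
        by (simp add: mult_ac)
    qed
    also have "\<dots> = exp (\<beta> / 2 * \<bar>u - v\<bar>) * V t v" by (simp add: cole_hopf_def heat_ext_def)
    finally have "ln (V t u) \<le> ln (exp (\<beta> / 2 * \<bar>u - v\<bar>) * V t v)"
      using cole_hopf_pos[OF t] by (intro ln_mono) auto
    then show ?thesis using cole_hopf_pos[OF t, of v] by (simp add: ln_mult)
  qed
  show ?thesis
    using *[of u v] *[of v u] unfolding abs_minus_commute[of v u] abs_le_iff by linarith
qed

text \<open>Far from the origin the reflection is not felt and \<open>\<psi>0\<close> vanishes, so
  the initial value looks like \<open>exp (\<beta> y / 2)\<close>, whose Gaussian average is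
  \<open>exp (\<beta> u / 2 + \<beta>^2 t / 4)\<close>. The limit explains the term
  \<open>\<beta> t / 4\<close> that \<open>profile\<close> subtracts in order to vanish at
  infinity.\<close>

lemma cole_hopf_limit:
  assumes t: "0 < t"
  shows "((\<lambda>u. V t u * exp (- \<beta> / 2 * u)) \<longlongrightarrow> exp (\<beta>\<^sup>2 * t / 4)) at_top"
proof -
  define s where "s = sqrt (2 * t)"
  have s: "0 < s" "s\<^sup>2 = 2 * t" using t by (auto simp: s_def)
  define F where "F u w = (if u \<ge> 0 then std_normal_density w * g (u + s * w) * exp (- \<beta> / 2 * u) else 0)" for u w
  have [measurable]: "tilt \<psi>0 \<in> borel_measurable borel"
    by (rule borel_measurable_continuous_onI[OF half_lipschitz_continuous[OF half_lipschitz_tilt[OF \<psi>0]]])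
  have lim\<psi>: "(\<psi>0 \<longlongrightarrow> 0) at_top" using \<psi>0 by (auto simp: XR_def)
  have "((\<lambda>u. LINT w|lborel. F u w) \<longlongrightarrow> (LINT w|lborel. std_normal_density w * exp (\<beta> * s / 2 * w))) at_top"
  proof (rule integral_dominated_convergence_at_top[where w = "\<lambda>w. exp (\<beta> * \<psi>0 0) * (std_normal_density w * exp (\<beta> * s / 2 * \<bar>w\<bar>))"])
    show "AE w in lborel. ((\<lambda>u. F u w) \<longlongrightarrow> std_normal_density w * exp (\<beta> * s / 2 * w)) at_top"
    proof (rule AE_I2)
      fix w :: real
      have ev: "\<forall>\<^sub>F u in at_top. std_normal_density w * exp (\<beta> * s / 2 * w + \<beta> * \<psi>0 (u + s * w)) = F u w"
        using eventually_ge_at_top[of "\<bar>s * w\<bar>"]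
      proof eventually_elim
        case (elim u)
        then have "\<bar>u + s * w\<bar> = u + s * w" "0 \<le> u" by auto
        then show ?case
          by (simp add: F_def tilt_def algebra_simps add_divide_distrib flip: exp_add)
      qed
      have "filterlim (\<lambda>u. u + s * w) at_top at_top"
        using filterlim_tendsto_add_at_top[OF tendsto_const[of "s * w"] filterlim_ident]
        by (simp add: add.commute)
      from filterlim_compose[OF lim\<psi> this]
      have "((\<lambda>u. std_normal_density w * exp (\<beta> * s / 2 * w + \<beta> * \<psi>0 (u + s * w))) \<longlongrightarrow>
          std_normal_density w * exp (\<beta> * s / 2 * w + \<beta> * 0)) at_top"
        by (intro tendsto_intros)
      from Lim_transform_eventually[OF this ev]
      show "((\<lambda>u. F u w) \<longlongrightarrow> std_normal_density w * exp (\<beta> * s / 2 * w)) at_top" by simp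
    qed
    show "integrable lborel (\<lambda>w. exp (\<beta> * \<psi>0 0) * (std_normal_density w * exp (\<beta> * s / 2 * \<bar>w\<bar>)))"
      by (intro integrable_mult_right integrable_std_normal_exp_abs)
    show "\<forall>\<^sub>F u in at_top. AE w in lborel. norm (F u w) \<le> exp (\<beta> * \<psi>0 0) * (std_normal_density w * exp (\<beta> * s / 2 * \<bar>w\<bar>))"
      using eventually_ge_at_top[of 0]
    proof eventually_elim
      case (elim u)
      show ?case
      proof (rule AE_I2)
        fix w
        have "tilt \<psi>0 (u + s * w) - u / 2 \<le> s * \<bar>w\<bar> / 2 + \<psi>0 0"
        proof -
          have "\<bar>u + s * w\<bar> \<le> u + s * \<bar>w\<bar>"
            using elim s abs_triangle_ineq[of u "s * w"] by (simp add: abs_mult)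
          moreover have "\<psi>0 \<bar>u + s * w\<bar> \<le> \<psi>0 0" by (rule XR_monotone_lipschitz[OF \<psi>0]) auto
          ultimately show ?thesis by (simp add: tilt_def)
        qed
        then have "\<beta> * (tilt \<psi>0 (u + s * w) - u / 2) \<le> \<beta> * (s * \<bar>w\<bar> / 2 + \<psi>0 0)"
          using \<beta> by (intro mult_left_mono) auto
        then have "g (u + s * w) * exp (- \<beta> / 2 * u) \<le> exp (\<beta> * \<psi>0 0) * exp (\<beta> * s / 2 * \<bar>w\<bar>)"
          by (simp add: algebra_simps flip: exp_add)
        from mult_left_mono[OF this, of "std_normal_density w"]
        show "norm (F u w) \<le> exp (\<beta> * \<psi>0 0) * (std_normal_density w * exp (\<beta> * s / 2 * \<bar>w\<bar>))"
          using elim by (simp add: F_def abs_mult mult_ac)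
      qed
    qed
    show "F u \<in> borel_measurable lborel" for u
      unfolding F_def[abs_def] by measurable
  qed auto
  also have "(LINT w|lborel. std_normal_density w * exp (\<beta> * s / 2 * w)) = exp (\<beta>\<^sup>2 * t / 4)"
    unfolding integral_std_normal_exp using s(2) by (simp add: power_mult_distrib power_divide)
  finally have *: "((\<lambda>u. LINT w|lborel. F u w) \<longlongrightarrow> exp (\<beta>\<^sup>2 * t / 4)) at_top" .
  show ?thesis
  proof (rule Lim_transform_eventually[OF *])
    show "\<forall>\<^sub>F u in at_top. (LINT w|lborel. F u w) = V t u * exp (- \<beta> / 2 * u)"
      using eventually_ge_at_top[of 0]
      by eventually_elim (simp add: F_def cole_hopf_def heat_ext_def s_def)
  qed
qed

text \<open>At time 0 the formula returns \<open>\<psi>0\<close> only for \<open>u \<ge> 0\<close>,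
  since the tilt is even; the case distinction makes \<open>profile 0\<close> equal to
  \<open>\<psi>0\<close> as a function.\<close>

definition profile :: "real \<Rightarrow> real \<Rightarrow> real" where
  "profile t u = (if t \<le> 0 then \<psi>0 u else ln (V t u) / \<beta> - u / 2 - \<beta> * t / 4)"

private abbreviation "V1 \<equiv> heat_conv heat_kernel1 g"
private abbreviation "V2 \<equiv> heat_conv heat_kernel2 g"

lemma DERIV_cole_hopf:
  assumes "0 < t"
  shows "(V t has_real_derivative V1 t u) (at u)"
    "(V1 t has_real_derivative V2 t u) (at u)"
    "((\<lambda>t. V t u) has_real_derivative V2 t u) (at t)"
proof -
  have eq: "V s = heat_conv heat_kernel g s" if "0 < s" for s
    using that by (simp add: fun_eq_iff cole_hopf_def heat_ext_eq_conv)
  show "(V t has_real_derivative V1 t u) (at u)" "(V1 t has_real_derivative V2 t u) (at u)"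
    using DERIV_heat_conv_space[OF exp_growth_g assms] by (simp_all add: eq assms)
  show "((\<lambda>t. V t u) has_real_derivative V2 t u) (at t)"
    by (rule has_field_derivative_transform_within_open[OF DERIV_heat_conv_time[OF exp_growth_g assms], of "{0<..}"])
      (use assms eq in auto)
qed

lemma profile_eq: "0 \<le> t \<Longrightarrow> 0 \<le> u \<Longrightarrow> profile t u = ln (V t u) / \<beta> - u / 2 - \<beta> * t / 4"
  using \<beta> by (auto simp: profile_def cole_hopf_def heat_ext_0 tilt_def field_simps)

lemma DERIV_profile_space:
  assumes t: "0 < t"
  shows "(profile t has_real_derivative V1 t u / (\<beta> * V t u) - 1 / 2) (at u)"
    "((\<lambda>u. V1 t u / (\<beta> * V t u) - 1 / 2) has_real_derivative
       (V2 t u * V t u - (V1 t u)\<^sup>2) / (\<beta> * (V t u)\<^sup>2)) (at u)"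
proof -
  have V: "0 < V t u" using cole_hopf_pos t by simp
  have p: "profile t = (\<lambda>u. ln (V t u) / \<beta> - u / 2 - \<beta> * t / 4)"
    using t by (auto simp: profile_def)
  show "(profile t has_real_derivative V1 t u / (\<beta> * V t u) - 1 / 2) (at u)"
    unfolding p using \<beta> V by (auto intro!: derivative_eq_intros DERIV_cole_hopf[OF t] simp: field_simps)
  show "((\<lambda>u. V1 t u / (\<beta> * V t u) - 1 / 2) has_real_derivative
       (V2 t u * V t u - (V1 t u)\<^sup>2) / (\<beta> * (V t u)\<^sup>2)) (at u)"
    using \<beta> V by (auto intro!: derivative_eq_intros DERIV_cole_hopf[OF t] simp: field_simps power2_eq_square)
qed

lemma DERIV_profile_time:
  assumes t: "0 < t"
  shows "((\<lambda>t. profile t u) has_real_derivative V2 t u / (\<beta> * V t u) - \<beta> / 4) (at t)"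
proof (rule has_field_derivative_transform_within_open[of "\<lambda>t. ln (V t u) / \<beta> - u / 2 - \<beta> * t / 4" _ _ "{0<..}"])
  have V: "0 < V t u" using cole_hopf_pos t by simp
  show "((\<lambda>t. ln (V t u) / \<beta> - u / 2 - \<beta> * t / 4) has_real_derivative V2 t u / (\<beta> * V t u) - \<beta> / 4) (at t)"
    using \<beta> V by (auto intro!: derivative_eq_intros DERIV_cole_hopf[OF t] simp: field_simps)
qed (use t in \<open>auto simp: profile_def\<close>)

lemma continuous_on_cole_hopf: "continuous_on ({0..} \<times> UNIV) (\<lambda>(t, u). V t u)"
  unfolding cole_hopf_def
  by (intro continuous_on_heat_ext exp_growth_g continuous_intros half_lipschitz_continuous half_lipschitz_tilt \<psi>0)

text \<open>The logarithm of \<open>V\<close> has Lipschitz constant \<open>\<beta> / 2\<close>, so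
  \<open>V1 / (\<beta> V)\<close> lies in \<open>[-1/2, 1/2]\<close>. As \<open>V\<close> is even,
  its derivative vanishes at 0, which is the boundary slope \<open>-1/2\<close> of the
  profile.\<close>

lemma profile_slope:
  assumes t: "0 < t"
  shows "-1 \<le> V1 t u / (\<beta> * V t u) - 1 / 2" "V1 t u / (\<beta> * V t u) - 1 / 2 \<le> 0"
    "V1 t 0 = 0"
proof -
  have V: "0 < V t u" using cole_hopf_pos t by simp
  have "((\<lambda>u. ln (V t u)) has_real_derivative V1 t u / V t u) (at u)"
    using V by (auto intro!: derivative_eq_intros DERIV_cole_hopf[OF t] simp: field_simps)
  then have "\<bar>V1 t u / V t u\<bar> \<le> \<beta> / 2"
    by (rule lipschitz_DERIV_bound) (use cole_hopf_lipschitz t in auto)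
  then have "\<bar>V1 t u / V t u / \<beta>\<bar> \<le> 1 / 2"
    using divide_right_mono[of "\<bar>V1 t u / V t u\<bar>" "\<beta> / 2" \<beta>] \<beta>
    by (simp only: abs_divide[of _ \<beta>] abs_of_pos) simp
  then have "\<bar>V1 t u / (\<beta> * V t u)\<bar> \<le> 1 / 2"
    by (simp only: divide_divide_eq_left mult.commute[of \<beta>])
  then show "-1 \<le> V1 t u / (\<beta> * V t u) - 1 / 2" "V1 t u / (\<beta> * V t u) - 1 / 2 \<le> 0"
    by linarith+
  have even: "V t (- u) = V t u" for u
    unfolding cole_hopf_def by (rule heat_ext_even) (simp add: tilt_def)
  have "(V t has_real_derivative - V1 t 0) (at 0)"
    using DERIV_mirror[of "V t" "- V1 t 0" 0] DERIV_cole_hopf(1)[OF t, of 0] even by simp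
  from DERIV_unique[OF this DERIV_cole_hopf(1)[OF t]] show "V1 t 0 = 0" by simp
qed

lemma continuous_on_V:
  "continuous_on ({0<..} \<times> UNIV) (\<lambda>p. V (fst p) (snd p))"
  "continuous_on ({0<..} \<times> UNIV) (\<lambda>p. V1 (fst p) (snd p))"
  "continuous_on ({0<..} \<times> UNIV) (\<lambda>p. V2 (fst p) (snd p))"
  using continuous_on_subset[OF continuous_on_cole_hopf, of "{0<..} \<times> UNIV", OF Sigma_mono[OF Ioi_le_Ico]]
    continuous_on_heat_conv[OF admissible_heat_kernel(2) exp_growth_g]
    continuous_on_heat_conv[OF admissible_heat_kernel(3) exp_growth_g]
  by (simp_all add: split_beta' greaterThan_subset_iff)

lemma profile_in_XR:
  assumes t: "0 < t"
  shows "profile t \<in> XR"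
proof -
  let ?D = "\<lambda>u. V1 t u / (\<beta> * V t u) - 1 / 2"
  have lim: "(profile t \<longlongrightarrow> 0) at_top"
  proof -
    have "((\<lambda>u. ln (V t u * exp (- \<beta> / 2 * u)) / \<beta> - \<beta> * t / 4) \<longlongrightarrow> ln (exp (\<beta>\<^sup>2 * t / 4)) / \<beta> - \<beta> * t / 4) at_top"
      using \<beta> by (intro tendsto_intros cole_hopf_limit t) auto
    moreover have "ln (V t u * exp (- \<beta> / 2 * u)) / \<beta> - \<beta> * t / 4 = profile t u" for u
      using cole_hopf_pos[of t u] t \<beta> by (simp add: profile_def ln_mult field_simps)
    ultimately show ?thesis using \<beta> by (simp add: power2_eq_square)
  qed
  have anti: "profile t v \<le> profile t u" if "u \<le> v" for u v
    by (rule DERIV_nonpos_imp_nonincreasing[OF that])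
      (use DERIV_profile_space(1)[OF t] profile_slope(2)[OF t] in blast)
  \<comment> \<open>A decreasing function with limit 0 at infinity is nonnegative.\<close>
  have nn: "0 \<le> profile t u" for u
    by (rule tendsto_upperbound[OF lim]) (auto intro!: eventually_mono[OF eventually_ge_at_top[of u]] anti)
  have "continuous_on UNIV ?D"
    by (rule continuous_at_imp_continuous_on) (use DERIV_isCont[OF DERIV_profile_space(2)[OF t]] in auto)
  then have "continuous_on {0..} ?D" by (rule continuous_on_subset) auto
  with lim nn profile_slope[OF t] show ?thesis
    unfolding XR_def by (auto intro!: exI[of _ ?D] has_field_derivative_at_within DERIV_profile_space[OF t])
qed

lemma profile_0: "profile 0 = \<psi>0"
  by (auto simp: profile_def)

lemma classical_sol_profile: "classical_sol \<beta> \<psi>0 profile"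
proof -
  have du: "d_u profile t = (\<lambda>u. V1 t u / (\<beta> * V t u) - 1 / 2)" if "0 < t" for t
    unfolding d_u_def using DERIV_profile_space(1)[OF that] by (auto intro: DERIV_imp_deriv)
  have duu: "d_uu profile t u = (V2 t u * V t u - (V1 t u)\<^sup>2) / (\<beta> * (V t u)\<^sup>2)" if "0 < t" for t u
    unfolding d_uu_def du[OF that] using DERIV_profile_space(2)[OF that] by (auto intro: DERIV_imp_deriv)
  have dt: "d_t profile t u = V2 t u / (\<beta> * V t u) - \<beta> / 4" if "0 < t" for t u
    unfolding d_t_def using DERIV_profile_time[OF that] by (auto intro: DERIV_imp_deriv)
  have sub: "{0<..} \<times> {0<..} \<subseteq> {0::real<..} \<times> (UNIV::real set)" by auto
  note cV = continuous_on_V[THEN continuous_on_subset, OF sub]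
  have nz: "\<forall>p\<in>{0<..} \<times> {0<..}. V (fst p) (snd p) \<noteq> 0"
    using cole_hopf_pos by (fastforce simp: less_le)
  show ?thesis
    unfolding classical_sol_def
  proof (intro conjI allI impI)
    have "continuous_on ({0..} \<times> {0..}) (\<lambda>p. ln (V (fst p) (snd p)) / \<beta> - snd p / 2 - \<beta> * fst p / 4)"
    proof -
      have "continuous_on ({0..} \<times> {0..}) (\<lambda>p. V (fst p) (snd p))"
        by (rule continuous_on_subset[OF continuous_on_cole_hopf[unfolded split_beta']]) auto
      moreover have "\<forall>p\<in>{0..} \<times> {0..}. V (fst p) (snd p) \<noteq> 0"
        using cole_hopf_pos by (fastforce simp: less_le)
      ultimately show ?thesis using \<beta> by (intro continuous_intros) auto
    qed
    then show "continuous_on ({0..} \<times> {0..}) (\<lambda>(t, u). profile t u)"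
      by (rule continuous_on_eq) (auto simp: profile_eq)
    have "continuous_on ({0<..} \<times> {0<..}) (\<lambda>p. V2 (fst p) (snd p) / (\<beta> * V (fst p) (snd p)) - \<beta> / 4)"
      using \<beta> nz by (intro continuous_intros cV) auto
    then show "continuous_on ({0<..} \<times> {0<..}) (\<lambda>(t, u). d_t profile t u)"
      by (rule continuous_on_eq) (auto simp: dt)
    have "continuous_on ({0<..} \<times> {0<..}) (\<lambda>p. V1 (fst p) (snd p) / (\<beta> * V (fst p) (snd p)) - 1 / 2)"
      using \<beta> nz by (intro continuous_intros cV) auto
    then show "continuous_on ({0<..} \<times> {0<..}) (\<lambda>(t, u). d_u profile t u)"
      by (rule continuous_on_eq) (auto simp: du)
    have "continuous_on ({0<..} \<times> {0<..}) (\<lambda>p. (V2 (fst p) (snd p) * V (fst p) (snd p) - (V1 (fst p) (snd p))\<^sup>2)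
        / (\<beta> * (V (fst p) (snd p))\<^sup>2))"
      using \<beta> nz by (intro continuous_intros cV) auto
    then show "continuous_on ({0<..} \<times> {0<..}) (\<lambda>(t, u). d_uu profile t u)"
      by (rule continuous_on_eq) (auto simp: duu)
    show "profile t \<in> XR" if "0 \<le> t" for t
      using profile_in_XR[of t] \<psi>0 profile_0 that by (cases "t = 0") auto
    fix t u :: real assume t: "0 < t"
    show "(\<lambda>s. profile s u) differentiable at t"
      using DERIV_profile_time[OF t] by (auto simp: real_differentiable_def)
    show "(\<lambda>v. profile t v) differentiable at u"
      using DERIV_profile_space(1)[OF t] by (auto simp: real_differentiable_def)
    show "(\<lambda>v. d_u profile t v) differentiable at u"
      unfolding du[OF t] using DERIV_profile_space(2)[OF t] by (auto simp: real_differentiable_def)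
    have V: "V t u \<noteq> 0" using cole_hopf_pos[of t u] t by simp
    \<comment> \<open>Time derivative and second space derivative of \<open>V\<close> are both
      \<open>V2\<close>. The square of \<open>V1 / V\<close> produced by differentiating the
      logarithm twice cancels against the quadratic term of the equation, and the constants
      \<open>\<beta> / 4\<close> agree.\<close>
    have "V2 t u / (\<beta> * V t u) - \<beta> / 4 = (V2 t u * V t u - (V1 t u)\<^sup>2) / (\<beta> * (V t u)\<^sup>2)
        + \<beta> * (V1 t u / (\<beta> * V t u) - 1 / 2) * (1 + (V1 t u / (\<beta> * V t u) - 1 / 2))"
      using V \<beta> by (simp add: field_simps power2_eq_square)
    then show "d_t profile t u = d_uu profile t u + \<beta> * d_u profile t u * (1 + d_u profile t u)"
      unfolding du[OF t] duu[OF t] dt[OF t] .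
  qed (simp add: profile_0)
qed

end

section \<open>Supersolutions of the backward equation\<close>

text \<open>Finitely many jumps from each state of an invariant set turn the sums over targets into
  finite sums. Exit rates may be unbounded over \<open>S\<close>, as they are for partitions with
  many gaps.\<close>

locale markov_rates =
  fixes r :: "'a \<Rightarrow> 'a \<Rightarrow> real" and S :: "'a set"
  assumes rate_nonneg: "0 \<le> r x z"
    and finite_jumps: "x \<in> S \<Longrightarrow> finite {z. r x z \<noteq> 0}"
    and closed: "x \<in> S \<Longrightarrow> r x z \<noteq> 0 \<Longrightarrow> z \<in> S"
begin

lemma infsum_rate:
  assumes "x \<in> S"
  shows "infsum (\<lambda>z. r x z * f z) UNIV = (\<Sum>z | r x z \<noteq> 0. r x z * f z)"
proof -
  have "infsum (\<lambda>z. r x z * f z) UNIV = infsum (\<lambda>z. r x z * f z) {z. r x z \<noteq> 0}"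
    by (rule infsum_cong_neutral) auto
  with finite_jumps[OF assms] show ?thesis by simp
qed

lemma exit_rate_eq:
  assumes "x \<in> S"
  shows "exit_rate r x = (\<Sum>z | r x z \<noteq> 0. r x z)"
  using infsum_rate[OF assms, of "\<lambda>_. 1"] by (simp add: exit_rate_def)

lemma mc_approx_Suc:
  assumes "x \<in> S"
  shows "mc_approx r (Suc n) t x y = (if x = y then exp (- exit_rate r x * t) else 0)
     + integral {0..t} (\<lambda>s. exp (- exit_rate r x * s) *
          (\<Sum>z | r x z \<noteq> 0. r x z * mc_approx r n (t - s) z y))"
  by (simp add: infsum_rate[OF assms])

lemma integral_reflect_shift:
  fixes f :: "real \<Rightarrow> real"
  assumes "0 \<le> t"
  shows "integral {0..t} (\<lambda>s. f (t - s)) = integral {0..t} f"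
proof -
  have "integral {0..t} (\<lambda>s. f (t - s)) = integral {-t..-0} (\<lambda>s. f (t - - s))"
    by (rule Henstock_Kurzweil_Integration.integral_reflect_real[where a = 0 and b = t and f = "\<lambda>s. f (t - s)", symmetric])
  also have "\<dots> = integral {0..t} f"
    using integral_shift_real_ivl[of 0 t t f] by (simp only: minus_zero diff_minus_eq_add diff_self diff_0 add.commute)
  finally show ?thesis .
qed

text \<open>Reflecting \<open>s\<close> to \<open>t - s\<close> and pulling out
  \<open>exp (- l t)\<close> leaves an indefinite integral whose integrand is independent of
  \<open>t\<close>.\<close>

lemma continuous_on_convolution_exp:
  fixes k :: "real \<Rightarrow> real"
  assumes k: "continuous_on {0..} k"
  shows "continuous_on {0..} (\<lambda>t. integral {0..t} (\<lambda>s. exp (- l * s) * k (t - s)))"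
proof -
  have eq: "integral {0..t} (\<lambda>s. exp (- l * s) * k (t - s))
     = exp (- l * t) * integral {0..t} (\<lambda>s. exp (l * s) * k s)" if "0 \<le> t" for t
  proof -
    have "integral {0..t} (\<lambda>s. exp (- l * s) * k (t - s))
        = integral {0..t} (\<lambda>s. exp (- l * (t - s)) * k s)"
      using integral_reflect_shift[OF that, of "\<lambda>s. exp (- l * (t - s)) * k s"] by simp
    also have "\<dots> = integral {0..t} (\<lambda>s. exp (- l * t) * (exp (l * s) * k s))"
      by (simp add: algebra_simps flip: exp_add)
    finally show ?thesis by simp
  qed
  have "continuous_on {0..} (\<lambda>t. integral {0..t} (\<lambda>s. exp (l * s) * k s))"
  proof (rule continuous_on_eq_continuous_within[THEN iffD2], intro ballI)
    fix x :: real assume x: "x \<in> {0..}"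
    have "continuous_on {0..x+1} (\<lambda>s. exp (l * s) * k s)"
      by (intro continuous_intros continuous_on_subset[OF k]) auto
    then have "continuous_on {0..x+1} (\<lambda>t. integral {0..t} (\<lambda>s. exp (l * s) * k s))"
      by (intro indefinite_integral_continuous_1 integrable_continuous_interval)
    then have c: "continuous (at x within {0..x+1}) (\<lambda>t. integral {0..t} (\<lambda>s. exp (l * s) * k s))"
      using x by (auto simp: continuous_on_eq_continuous_within)
    have "at x within {0..x+1} = at x within {0..}"
    proof (rule at_within_nhd[of x "{..<x+1}"])
      show "{0..x + 1} \<inter> {..<x + 1} - {x} = {0..} \<inter> {..<x + 1} - {x}" by auto
    qed auto
    with c show "continuous (at x within {0..}) (\<lambda>t. integral {0..t} (\<lambda>s. exp (l * s) * k s))"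
      by (simp add: continuous_within)
  qed
  then have "continuous_on {0..} (\<lambda>t. exp (- l * t) * integral {0..t} (\<lambda>s. exp (l * s) * k s))"
    by (intro continuous_intros)
  then show ?thesis
    by (rule continuous_on_eq) (subst eq, auto)
qed

lemma continuous_on_mc_approx:
  "x \<in> S \<Longrightarrow> continuous_on {0..} (\<lambda>t. mc_approx r n t x y)"
proof (induction n arbitrary: x)
  case 0
  then show ?case by (cases "x = y") (auto intro!: continuous_intros)
next
  case (Suc n)
  have k: "continuous_on {0..} (\<lambda>t. \<Sum>z | r x z \<noteq> 0. r x z * mc_approx r n t z y)"
    using Suc closed by (intro continuous_intros) auto
  show ?case
    unfolding mc_approx_Suc[OF Suc.prems]
    using continuous_on_convolution_exp[OF k, of "exit_rate r x"]
    by (cases "x = y") (auto intro!: continuous_intros)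
qed

lemma continuous_on_mc_integrand:
  assumes "x \<in> S"
  shows "continuous_on {0..t} (\<lambda>s. exp (- exit_rate r x * s) *
          (\<Sum>z | r x z \<noteq> 0. r x z * mc_approx r n (t - s) z y))"
proof (intro continuous_intros)
  fix z assume "z \<in> {z. r x z \<noteq> 0}"
  then have "continuous_on {0..} (\<lambda>t. mc_approx r n t z y)"
    using continuous_on_mc_approx closed[OF assms] by auto
  then show "continuous_on {0..t} (\<lambda>s. mc_approx r n (t - s) z y)"
    by (rule continuous_on_compose2[of _ _ _ "\<lambda>s. t - s"]) (auto intro!: continuous_intros)
qed

lemma mc_approx_nonneg: "x \<in> S \<Longrightarrow> 0 \<le> mc_approx r n t x y"
proof (induction n arbitrary: x t)
  case (Suc n)
  have "0 \<le> integral {0..t} (\<lambda>s. exp (- exit_rate r x * s) *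
          (\<Sum>z | r x z \<noteq> 0. r x z * mc_approx r n (t - s) z y))"
    by (intro integral_nonneg integrable_continuous_interval continuous_on_mc_integrand Suc.prems
         mult_nonneg_nonneg sum_nonneg rate_nonneg Suc.IH)
       (use closed[OF Suc.prems] in auto)
  then show ?case unfolding mc_approx_Suc[OF Suc.prems] by simp
qed simp

lemma mc_approx_mono:
  "x \<in> S \<Longrightarrow> mc_approx r n t x y \<le> mc_approx r (Suc n) t x y"
proof (induction n arbitrary: x t)
  case 0
  have "0 \<le> integral {0..t} (\<lambda>s. exp (- exit_rate r x * s) *
          (\<Sum>z | r x z \<noteq> 0. r x z * mc_approx r 0 (t - s) z y))"
    by (intro integral_nonneg integrable_continuous_interval continuous_on_mc_integrand 0
         mult_nonneg_nonneg sum_nonneg rate_nonneg mc_approx_nonneg)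
       (use closed[OF 0] in auto)
  then show ?case unfolding mc_approx_Suc[OF 0] by simp
next
  case (Suc n)
  show ?case
    unfolding mc_approx_Suc[OF Suc.prems]
    by (intro add_mono order_refl integral_le integrable_continuous_interval
         continuous_on_mc_integrand Suc.prems mult_left_mono sum_mono rate_nonneg Suc.IH)
       (use closed[OF Suc.prems] in auto)
qed

lemma mc_approx_outside:
  "x \<in> S \<Longrightarrow> y \<notin> S \<Longrightarrow> mc_approx r n t x y = 0"
proof (induction n arbitrary: x t)
  case (Suc n)
  have "(\<Sum>z | r x z \<noteq> 0. r x z * mc_approx r n s z y) = 0" for s
    using Suc closed[OF Suc.prems(1)] by (intro sum.neutral) auto
  with Suc.prems show ?case unfolding mc_approx_Suc[OF Suc.prems(1)] by auto
qed auto

text \<open>Integrated against \<open>exp (- l * s)\<close>, the supersolution inequality becomes the recursion that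
  defines \<^const>\<open>mc_approx\<close>, with an inequality in place of the equation.\<close>

lemma mc_approx_supersolution:
  fixes G G' :: "real \<Rightarrow> 'a \<Rightarrow> real"
  assumes nonneg: "\<And>t x. 0 \<le> t \<Longrightarrow> t \<le> T \<Longrightarrow> x \<in> S \<Longrightarrow> 0 \<le> G t x"
    and deriv: "\<And>t x. 0 \<le> t \<Longrightarrow> t \<le> T \<Longrightarrow> x \<in> S \<Longrightarrow>
        ((\<lambda>t. G t x) has_real_derivative G' t x) (at t within {0..T})"
    and super: "\<And>t x. 0 \<le> t \<Longrightarrow> t \<le> T \<Longrightarrow> x \<in> S \<Longrightarrow>
        (\<Sum>z | r x z \<noteq> 0. r x z * (G t z - G t x)) \<le> G' t x"
    and fin: "finite Y" and YS: "Y \<subseteq> S"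
  shows "0 \<le> t \<Longrightarrow> t \<le> T \<Longrightarrow> x \<in> S \<Longrightarrow> (\<Sum>y\<in>Y. mc_approx r n t x y * G 0 y) \<le> G t x"
proof (induction n arbitrary: t x)
  \<comment> \<open>Variation of constants over the waiting time \<open>s\<close> of the first jump;
    \<open>l\<close> will be the exit rate of \<open>x\<close>. The term \<open>l * G\<close> then
    cancels the diagonal part of the generator and leaves only the sum over jump targets, as
    \<open>lower\<close> records.\<close>
  have ftc: "((\<lambda>s. exp (- l * s) * (l * G (t - s) x + G' (t - s) x)) has_integral
      (G t x - exp (- l * t) * G 0 x)) {0..t}" if t: "0 \<le> t" "t \<le> T" and x: "x \<in> S" for l t x
  proof -
    have "((\<lambda>s. - (exp (- l * s) * G (t - s) x)) has_vector_derivative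
        exp (- l * s) * (l * G (t - s) x + G' (t - s) x)) (at s within {0..t})" if "s \<in> {0..t}" for s
    proof -
      have "((\<lambda>s. G s x) has_real_derivative G' (t - s) x) (at (t - s) within (\<lambda>s. t - s) ` {0..t})"
        by (rule DERIV_subset[OF deriv]) (use that t x in auto)
      moreover have "((\<lambda>s. t - s) has_real_derivative - 1) (at s within {0..t})"
        by (auto intro!: derivative_eq_intros)
      ultimately have "((\<lambda>s. G (t - s) x) has_real_derivative - G' (t - s) x) (at s within {0..t})"
        using DERIV_image_chain by (fastforce simp: o_def)
      then show ?thesis
        unfolding has_real_derivative_iff_has_vector_derivative[symmetric]
        by (auto intro!: derivative_eq_intros simp: algebra_simps)
    qed
    from fundamental_theorem_of_calculus[OF t(1) this] show ?thesis by simp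
  qed
  have lower: "l * G s x + G' s x \<ge> (\<Sum>z | r x z \<noteq> 0. r x z * G s z)"
    if "l = exit_rate r x" "0 \<le> s" "s \<le> T" "x \<in> S" for l s x
    using super[OF that(2-)] that(1) exit_rate_eq[OF that(4)]
    by (simp add: sum_subtractf sum_distrib_right right_diff_distrib)
  {
    case (0 t x)
    let ?l = "exit_rate r x"
    have "0 \<le> G t x - exp (- ?l * t) * G 0 x"
    proof (rule has_integral_nonneg[OF ftc[OF 0(1-3), of ?l]])
      fix s assume "s \<in> {0..t}"
      moreover from this 0 have "0 \<le> (\<Sum>z | r x z \<noteq> 0. r x z * G (t - s) z)"
        using closed[OF 0(3)] by (intro sum_nonneg mult_nonneg_nonneg rate_nonneg nonneg) auto
      ultimately show "0 \<le> exp (- ?l * s) * (?l * G (t - s) x + G' (t - s) x)"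
        using lower[OF refl _ _ 0(3), of "t - s"] 0 by (intro mult_nonneg_nonneg) auto
    qed
    moreover have "(\<Sum>y\<in>Y. mc_approx r 0 t x y * G 0 y) \<le> exp (- ?l * t) * G 0 x"
    proof -
      have "(\<Sum>y\<in>Y. mc_approx r 0 t x y * G 0 y)
          = (\<Sum>y\<in>Y. if y = x then exp (- ?l * t) * G 0 x else 0)"
        by (intro sum.cong) auto
      also have "\<dots> \<le> exp (- ?l * t) * G 0 x"
        using nonneg[of 0 x] 0 fin by (auto simp: sum.delta)
      finally show ?thesis .
    qed
    ultimately show ?case by linarith
  next
    case (Suc n t x)
    let ?l = "exit_rate r x"
    let ?f = "\<lambda>y s. exp (- ?l * s) * (\<Sum>z | r x z \<noteq> 0. r x z * mc_approx r n (t - s) z y)"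
    note int = integrable_continuous_interval[OF continuous_on_mc_integrand[OF Suc.prems(3)]]
    have "(\<Sum>y\<in>Y. mc_approx r (Suc n) t x y * G 0 y)
        = (\<Sum>y\<in>Y. if y = x then exp (- ?l * t) * G 0 x else 0)
          + (\<Sum>y\<in>Y. integral {0..t} (?f y) * G 0 y)"
      unfolding mc_approx_Suc[OF Suc.prems(3)] sum.distrib[symmetric]
      by (intro sum.cong refl) (simp add: algebra_simps)
    also have "(\<Sum>y\<in>Y. if y = x then exp (- ?l * t) * G 0 x else 0) \<le> exp (- ?l * t) * G 0 x"
      using nonneg[of 0 x] Suc.prems fin by (auto simp: sum.delta)
    also have "(\<Sum>y\<in>Y. integral {0..t} (?f y) * G 0 y)
        = integral {0..t} (\<lambda>s. \<Sum>y\<in>Y. ?f y s * G 0 y)"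
      by (subst integral_sum[OF fin])
        (rule integrable_on_mult_left, rule int, simp only: integral_mult_left)
    also have "\<dots> \<le> G t x - exp (- ?l * t) * G 0 x"
    proof (rule has_integral_le[OF integrable_integral ftc[OF Suc.prems, of ?l]])
      show "(\<lambda>s. \<Sum>y\<in>Y. ?f y s * G 0 y) integrable_on {0..t}"
        by (intro integrable_sum fin integrable_on_mult_left int)
      fix s assume s: "s \<in> {0..t}"
      have "(\<Sum>y\<in>Y. ?f y s * G 0 y)
         = exp (- ?l * s) * (\<Sum>z | r x z \<noteq> 0. r x z * (\<Sum>y\<in>Y. mc_approx r n (t - s) z y * G 0 y))"
        by (simp add: sum_distrib_left sum_distrib_right mult.assoc) (rule sum.swap)
      also have "\<dots> \<le> exp (- ?l * s) * (\<Sum>z | r x z \<noteq> 0. r x z * G (t - s) z)"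
        using s Suc.prems closed[OF Suc.prems(3)]
        by (intro mult_left_mono sum_mono rate_nonneg Suc.IH) auto
      also have "\<dots> \<le> exp (- ?l * s) * (?l * G (t - s) x + G' (t - s) x)"
        using s Suc.prems by (intro mult_left_mono lower) auto
      finally show "(\<Sum>y\<in>Y. ?f y s * G 0 y) \<le> exp (- ?l * s) * (?l * G (t - s) x + G' (t - s) x)" .
    qed
    finally show ?case by simp
  }
qed

text \<open>The constant 1 is a supersolution. The bound turns the supremum that defines
  \<open>mc_trans\<close> into the limit of a bounded increasing sequence.\<close>

lemma mc_approx_le_1:
  assumes "x \<in> S" "0 \<le> t"
  shows "mc_approx r n t x y \<le> 1"
proof (cases "y \<in> S")
  case True
  have "(\<Sum>y\<in>{y}. mc_approx r n t x y * 1) \<le> 1"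
    by (rule mc_approx_supersolution[where G = "\<lambda>_ _. 1" and G' = "\<lambda>_ _. 0" and T = t])
      (use assms True in auto)
  then show ?thesis by simp
qed (use assms mc_approx_outside in auto)

lemma mc_approx_tendsto:
  assumes "x \<in> S" "0 \<le> t"
  shows "(\<lambda>n. mc_approx r n t x y) \<longlonglongrightarrow> mc_trans r t x y"
  unfolding mc_trans_def
  by (rule LIMSEQ_incseq_SUP)
    (use assms mc_approx_le_1 mc_approx_mono in \<open>auto intro!: bdd_aboveI2 incseq_SucI\<close>)

lemma mc_trans_nonneg: "x \<in> S \<Longrightarrow> 0 \<le> t \<Longrightarrow> 0 \<le> mc_trans r t x y"
  by (rule LIMSEQ_le_const[OF mc_approx_tendsto]) (auto intro: mc_approx_nonneg)

lemma mc_trans_outside: "x \<in> S \<Longrightarrow> y \<notin> S \<Longrightarrow> mc_trans r t x y = 0"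
  by (simp add: mc_trans_def mc_approx_outside)

text \<open>The time argument of \<open>G\<close> is the time still to run: \<open>G 0\<close> is
  the function observed at the end, and \<open>G T\<close> bounds its expectation from the
  start.\<close>

lemma mc_trans_supersolution:
  fixes G G' :: "real \<Rightarrow> 'a \<Rightarrow> real"
  assumes "\<And>t x. 0 \<le> t \<Longrightarrow> t \<le> T \<Longrightarrow> x \<in> S \<Longrightarrow> 0 \<le> G t x"
    and "\<And>t x. 0 \<le> t \<Longrightarrow> t \<le> T \<Longrightarrow> x \<in> S \<Longrightarrow>
        ((\<lambda>t. G t x) has_real_derivative G' t x) (at t within {0..T})"
    and "\<And>t x. 0 \<le> t \<Longrightarrow> t \<le> T \<Longrightarrow> x \<in> S \<Longrightarrow>
        (\<Sum>z | r x z \<noteq> 0. r x z * (G t z - G t x)) \<le> G' t x"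
    and "finite Y" "Y \<subseteq> S" "0 \<le> T" "x \<in> S"
  shows "(\<Sum>y\<in>Y. mc_trans r T x y * G 0 y) \<le> G T x"
proof (rule LIMSEQ_le_const2)
  show "(\<lambda>n. \<Sum>y\<in>Y. mc_approx r n T x y * G 0 y) \<longlonglongrightarrow> (\<Sum>y\<in>Y. mc_trans r T x y * G 0 y)"
    using assms by (intro tendsto_intros mc_approx_tendsto)
  show "\<exists>N. \<forall>n\<ge>N. (\<Sum>y\<in>Y. mc_approx r n T x y * G 0 y) \<le> G T x"
    using mc_approx_supersolution[of T G G' Y T x] assms by auto
qed

text \<open>Markov's inequality for the transition function, with no path space involved. It is
  proved on finite subsets of \<open>A\<close>, so that summability comes out together with the
  bound.\<close>

lemma mc_trans_markov_inequality:
  fixes G G' :: "real \<Rightarrow> 'a \<Rightarrow> real"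
  assumes G: "\<And>t x. 0 \<le> t \<Longrightarrow> t \<le> T \<Longrightarrow> x \<in> S \<Longrightarrow> 0 \<le> G t x"
    "\<And>t x. 0 \<le> t \<Longrightarrow> t \<le> T \<Longrightarrow> x \<in> S \<Longrightarrow>
        ((\<lambda>t. G t x) has_real_derivative G' t x) (at t within {0..T})"
    "\<And>t x. 0 \<le> t \<Longrightarrow> t \<le> T \<Longrightarrow> x \<in> S \<Longrightarrow>
        (\<Sum>z | r x z \<noteq> 0. r x z * (G t z - G t x)) \<le> G' t x"
    and x: "0 \<le> T" "x \<in> S"
    and c: "0 < c" "\<And>y. y \<in> A \<Longrightarrow> y \<in> S \<Longrightarrow> c \<le> G 0 y"
  shows "(\<lambda>y. mc_trans r T x y) summable_on A" "infsum (mc_trans r T x) A \<le> G T x / c"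
proof -
  have bound: "sum (mc_trans r T x) F \<le> G T x / c" if "finite F" "F \<subseteq> A" for F
  proof -
    have "sum (mc_trans r T x) F = sum (mc_trans r T x) (F \<inter> S)"
      using that by (intro sum.mono_neutral_right) (auto simp: mc_trans_outside[OF x(2)])
    also have "c * \<dots> \<le> (\<Sum>y\<in>F \<inter> S. mc_trans r T x y * G 0 y)"
      unfolding sum_distrib_left
    proof (intro sum_mono)
      fix y assume "y \<in> F \<inter> S"
      with that have "c \<le> G 0 y" by (intro c) auto
      from mult_left_mono[OF this mc_trans_nonneg[OF x(2,1)], of y]
      show "c * mc_trans r T x y \<le> mc_trans r T x y * G 0 y" by (simp add: mult.commute)
    qed
    also have "\<dots> \<le> G T x"
      by (rule mc_trans_supersolution[OF G]) (use x that in auto)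
    finally show ?thesis using c by (simp add: field_simps)
  qed
  show "(\<lambda>y. mc_trans r T x y) summable_on A"
    by (rule nonneg_bdd_above_summable_on) (use mc_trans_nonneg[OF x(2,1)] bound in \<open>auto intro!: bdd_aboveI\<close>)
  then show "infsum (mc_trans r T x) A \<le> G T x / c"
    by (rule infsum_le_finite_sums) (use bound in auto)
qed

lemma infsum_mc_trans_bounds:
  assumes "x \<in> S" "0 \<le> t"
  shows "0 \<le> infsum (mc_trans r t x) A" "infsum (mc_trans r t x) A \<le> 1"
  using mc_trans_markov_inequality(2)[where G = "\<lambda>_ _. 1" and G' = "\<lambda>_ _. 0" and c = 1 and T = t and x = x and A = A]
    assms by (auto intro!: infsum_nonneg mc_trans_nonneg)

end

section \<open>Jumps of partitions and the Gaertner variable\<close>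

lemma Qset_stepD:
  assumes "q \<in> Qset"
  shows "q 0 = 0" "finite {i. q i \<noteq> 0}" "1 \<le> i \<Longrightarrow> q (Suc i) \<le> q i"
    "1 \<le> i \<Longrightarrow> 0 < q i \<Longrightarrow> q (Suc i) < q i"
proof -
  have *: "q 0 = 0 \<and> (\<forall>i\<ge>1. q (Suc i) \<le> q i) \<and> finite {i. q i \<noteq> 0} \<and> (\<forall>i\<ge>1. q i > 0 \<longrightarrow> q i > q (Suc i))"
    using assms unfolding Qset_def mem_Collect_eq .
  note 1 = conjunct1[OF *] and 2 = conjunct1[OF conjunct2[OF *]]
    and 3 = conjunct1[OF conjunct2[OF conjunct2[OF *]]] and 4 = conjunct2[OF conjunct2[OF conjunct2[OF *]]]
  show "q 0 = 0" "finite {i. q i \<noteq> 0}" by (rule 1 3)+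
  show "1 \<le> i \<Longrightarrow> q (Suc i) \<le> q i" by (rule 2[rule_format])
  show "1 \<le> i \<Longrightarrow> 0 < q i \<Longrightarrow> q (Suc i) < q i" by (rule 4[rule_format])
qed

lemma Qset_antimono:
  assumes "q \<in> Qset" "1 \<le> i" "i \<le> j"
  shows "q j \<le> q i"
  using assms(3,2)
proof (induction j rule: dec_induct)
  case (step n)
  then have "1 \<le> n" by simp
  then have "q (Suc n) \<le> q n" by (rule Qset_stepD[OF assms(1)])
  with step show ?case by (meson le_trans)
qed simp

lemma Qset_strict:
  assumes "q \<in> Qset" "1 \<le> i" "i < j" "0 < q i"
  shows "q j < q i"
proof -
  have "q (Suc i) < q i" by (rule Qset_stepD(4)[OF assms(1,2,4)])
  moreover have "q j \<le> q (Suc i)" by (rule Qset_antimono[OF assms(1)]) (use assms in auto)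
  ultimately show ?thesis by simp
qed

definition hgt :: "config \<Rightarrow> nat \<Rightarrow> nat" where
  "hgt q x = card {i. 1 \<le> i \<and> x < q i}"

text \<open>The partition as a particle system: for \<open>x > 0\<close> the parts are distinct, so
  the cardinality is an occupation number 0 or 1. For \<open>x = 0\<close> and \<open>q\<close> in
  \<open>Qset\<close> the set is infinite and its cardinality has the default value 0, so site 0 is
  treated separately below.\<close>

definition occ :: "config \<Rightarrow> nat \<Rightarrow> nat set" where
  "occ q x = {i. 1 \<le> i \<and> q i = x}"

lemma finite_above: "q \<in> Qset \<Longrightarrow> finite {i. 1 \<le> i \<and> x < q i}"
  by (rule finite_subset[OF _ Qset_stepD(2)]) auto

lemma occ_unique:
  assumes "q \<in> Qset" "0 < x" "i \<in> occ q x" "j \<in> occ q x"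
  shows "i = j"
  using Qset_strict[OF assms(1), of i j] Qset_strict[OF assms(1), of j i] assms
  by (cases i j rule: linorder_cases) (auto simp: occ_def)

lemma occ_cases:
  assumes "q \<in> Qset" "0 < x"
  obtains "occ q x = {}" | i where "occ q x = {i}" "1 \<le> i" "q i = x"
proof (cases "occ q x = {}")
  case False
  then obtain i where i: "i \<in> occ q x" by auto
  then have "occ q x = {i}" using occ_unique[OF assms _ i] by blast
  with i that(2) show ?thesis by (auto simp: occ_def)
qed (use that in auto)

lemma card_occ_le_1: "q \<in> Qset \<Longrightarrow> 0 < x \<Longrightarrow> card (occ q x) = 0 \<or> card (occ q x) = 1"
  by (cases rule: occ_cases[of q x]) auto

lemma hgt_Suc:
  assumes "q \<in> Qset"
  shows "hgt q x = hgt q (Suc x) + card (occ q (Suc x))"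
proof -
  have "{i. 1 \<le> i \<and> x < q i} = {i. 1 \<le> i \<and> Suc x < q i} \<union> occ q (Suc x)"
    by (auto simp: occ_def)
  moreover have "finite (occ q (Suc x))"
    by (rule finite_subset[OF _ finite_above[OF assms, of x]]) (auto simp: occ_def)
  ultimately show ?thesis
    unfolding hgt_def using finite_above[OF assms, of "Suc x"]
    by (subst card_Un_disjoint[symmetric]) (auto simp: occ_def)
qed

section \<open>The generator as a finite sum over moves\<close>

definition up_set :: "config \<Rightarrow> nat set" where "up_set q = {i. up_ok q i}"
definition down_set :: "config \<Rightarrow> nat set" where "down_set q = {i. down_ok q i}"

lemma Qset_zero_from:
  assumes "q \<in> Qset"
  shows "\<exists>n\<ge>1. \<forall>i\<ge>n. q i = 0"
proof -
  have "finite {i. q i \<noteq> 0}" by (rule Qset_stepD(2)[OF assms])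
  then obtain n where "\<forall>i\<in>{i. q i \<noteq> 0}. i < n" using finite_nat_set_iff_bounded by auto
  then show ?thesis by (intro exI[of _ "Suc n"]) fastforce
qed

lemma finite_up_set:
  assumes "q \<in> Qset" shows "finite (up_set q)"
proof -
  obtain n where n: "1 \<le> n" "\<And>i. n \<le> i \<Longrightarrow> q i = 0" using Qset_zero_from[OF assms] by auto
  have "i \<le> n" if "up_ok q i" for i
  proof (rule ccontr)
    assume "\<not> i \<le> n"
    then have "q (i - 1) = 0" "i \<noteq> 1" using n by auto
    with that show False by (simp add: up_ok_def)
  qed
  then have "up_set q \<subseteq> {..n}" by (auto simp: up_set_def)
  then show ?thesis by (rule finite_subset) simp
qed

lemma finite_down_set:
  assumes "q \<in> Qset" shows "finite (down_set q)"
  by (rule finite_subset[OF _ Qset_stepD(2)[OF assms]]) (auto simp: down_set_def down_ok_def)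

abbreviation up_at :: "config \<Rightarrow> nat \<Rightarrow> config" where "up_at q i \<equiv> q(i := q i + 1)"
abbreviation down_at :: "config \<Rightarrow> nat \<Rightarrow> config" where "down_at q i \<equiv> q(i := q i - 1)"

lemma finite_support_upd: "finite {i. q i \<noteq> (0::nat)} \<Longrightarrow> finite {j. (q(i := y)) j \<noteq> 0}"
  by (rule finite_subset[of _ "insert i {i. q i \<noteq> 0}"]) auto

lemma up_at_in_Qset:
  assumes q: "q \<in> Qset" and i: "i \<in> up_set q"
  shows "up_at q i \<in> Qset"
proof -
  have i1: "1 \<le> i" "i = 1 \<or> q (i - 1) > q i + 1" using i by (auto simp: up_set_def up_ok_def)
  note Q = Qset_stepD(1)[OF q] Qset_stepD(3)[OF q] Qset_stepD(4)[OF q] Qset_stepD(2)[OF q]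
  show ?thesis
    unfolding Qset_def
  proof (intro CollectI conjI allI impI finite_support_upd Q(4))
    fix j :: nat assume j: "1 \<le> j"
    show "(up_at q i) (Suc j) \<le> (up_at q i) j" using Q(2)[OF j] i1 j by auto
    assume "(up_at q i) j > 0"
    then show "(up_at q i) (Suc j) < (up_at q i) j" using Q(2,3)[OF j] i1 j by (auto split: if_splits)
  qed (use Q i1 in auto)
qed

lemma down_at_in_Qset:
  assumes q: "q \<in> Qset" and i: "i \<in> down_set q"
  shows "down_at q i \<in> Qset"
proof -
  have i1: "1 \<le> i" "q i > q (Suc i) + 1 \<or> q i = 1" using i by (auto simp: down_set_def down_ok_def)
  note Q = Qset_stepD(1)[OF q] Qset_stepD(3)[OF q] Qset_stepD(4)[OF q] Qset_stepD(2)[OF q]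
  have z: "q (Suc i) = 0" if "q i = 1" using Q(3)[OF i1(1)] that by simp
  show ?thesis
    unfolding Qset_def
  proof (intro CollectI conjI allI impI finite_support_upd Q(4))
    fix j :: nat assume j: "1 \<le> j"
    show "(down_at q i) (Suc j) \<le> (down_at q i) j" using Q(2)[OF j] i1 j z by (auto simp: le_diff_conv2)
    assume "(down_at q i) j > 0"
    then show "(down_at q i) (Suc j) < (down_at q i) j" using Q(2,3)[OF j] i1 j z by (auto split: if_splits)
  qed (use Q i1 in auto)
qed

lemma rateR_eq:
  assumes "q \<in> Qset"
  shows "rateR \<epsilon> q q' = (\<Sum>i\<in>up_set q. if q' = up_at q i then \<epsilon> else 0)
     + (\<Sum>i\<in>down_set q. if q' = down_at q i then 1 else 0)"
proof -
  let ?f = "\<lambda>i. (if up_ok q i \<and> q' = up_at q i then \<epsilon> else 0) + (if down_ok q i \<and> q' = down_at q i then 1 else 0)"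
  have "rateR \<epsilon> q q' = infsum ?f (up_set q \<union> down_set q)"
    unfolding rateR_def by (rule infsum_cong_neutral) (auto simp: up_set_def down_set_def up_ok_def down_ok_def)
  also have "\<dots> = (\<Sum>i\<in>up_set q \<union> down_set q. ?f i)"
    using finite_up_set finite_down_set assms by simp
  also have "\<dots> = (\<Sum>i\<in>up_set q \<union> down_set q. if up_ok q i \<and> q' = up_at q i then \<epsilon> else 0)
      + (\<Sum>i\<in>up_set q \<union> down_set q. if down_ok q i \<and> q' = down_at q i then 1 else 0)"
    by (rule sum.distrib)
  also have "(\<Sum>i\<in>up_set q \<union> down_set q. if up_ok q i \<and> q' = up_at q i then \<epsilon> else 0)
      = (\<Sum>i\<in>up_set q. if q' = up_at q i then \<epsilon> else 0)"
    using finite_up_set finite_down_set assms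
    by (intro sum.mono_neutral_cong_right) (auto simp: up_set_def)
  also have "(\<Sum>i\<in>up_set q \<union> down_set q. if down_ok q i \<and> q' = down_at q i then 1 else (0::real))
      = (\<Sum>i\<in>down_set q. if q' = down_at q i then 1 else 0)"
    using finite_up_set finite_down_set assms
    by (intro sum.mono_neutral_cong_right) (auto simp: down_set_def)
  finally show ?thesis .
qed

lemma rateR_support:
  assumes "q \<in> Qset" "rateR \<epsilon> q q' \<noteq> 0"
  shows "q' \<in> up_at q ` up_set q \<union> down_at q ` down_set q"
proof (rule ccontr)
  assume "\<not> ?thesis"
  then have "(\<Sum>i\<in>up_set q. if q' = up_at q i then \<epsilon> else 0) = 0"
    "(\<Sum>i\<in>down_set q. if q' = down_at q i then 1 else (0::real)) = 0"
    by (intro sum.neutral, force)+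
  then have "rateR \<epsilon> q q' = 0" unfolding rateR_eq[OF assms(1)] by linarith
  with assms show False by simp
qed

text \<open>The generator before the acceleration by \<open>N^2\<close>, summed over the index that
  moves instead of over the target configuration.\<close>

definition gen :: "real \<Rightarrow> (config \<Rightarrow> real) \<Rightarrow> config \<Rightarrow> real" where
  "gen \<epsilon> F q = (\<Sum>i\<in>up_set q. \<epsilon> * (F (up_at q i) - F q)) + (\<Sum>i\<in>down_set q. F (down_at q i) - F q)"

lemma sum_rateR:
  assumes q: "q \<in> Qset" and M: "finite M" "up_at q ` up_set q \<union> down_at q ` down_set q \<subseteq> M"
  shows "(\<Sum>q'\<in>M. rateR \<epsilon> q q' * F q') = (\<Sum>i\<in>up_set q. \<epsilon> * F (up_at q i)) + (\<Sum>i\<in>down_set q. F (down_at q i))"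
proof -
  have "(\<Sum>q'\<in>M. rateR \<epsilon> q q' * F q')
     = (\<Sum>q'\<in>M. \<Sum>i\<in>up_set q. if q' = up_at q i then \<epsilon> * F q' else 0)
       + (\<Sum>q'\<in>M. \<Sum>i\<in>down_set q. if q' = down_at q i then F q' else 0)"
    unfolding rateR_eq[OF q] sum.distrib[symmetric] distrib_right sum_distrib_right
    by (intro sum.cong arg_cong2[of _ _ _ _ "(+)"] refl) auto
  also have "(\<Sum>q'\<in>M. \<Sum>i\<in>up_set q. if q' = up_at q i then \<epsilon> * F q' else 0) = (\<Sum>i\<in>up_set q. \<epsilon> * F (up_at q i))"
    by (subst sum.swap) (use M in \<open>auto intro!: sum.cong simp: sum.delta\<close>)
  also have "(\<Sum>q'\<in>M. \<Sum>i\<in>down_set q. if q' = down_at q i then F q' else 0) = (\<Sum>i\<in>down_set q. F (down_at q i))"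
    by (subst sum.swap) (use M in \<open>auto intro!: sum.cong simp: sum.delta\<close>)
  finally show ?thesis .
qed

lemma sum_rateR_gen:
  assumes q: "q \<in> Qset" and c: "c \<noteq> 0"
  shows "(\<Sum>q' | c * rateR \<epsilon> q q' \<noteq> 0. c * rateR \<epsilon> q q' * (F q' - F q)) = c * gen \<epsilon> F q"
proof -
  let ?M = "up_at q ` up_set q \<union> down_at q ` down_set q"
  have fin: "finite ?M" using finite_up_set finite_down_set q by auto
  have "(\<Sum>q' | c * rateR \<epsilon> q q' \<noteq> 0. c * rateR \<epsilon> q q' * (F q' - F q))
     = (\<Sum>q'\<in>?M. c * rateR \<epsilon> q q' * (F q' - F q))"
    using rateR_support[OF q] fin c by (intro sum.mono_neutral_left) auto
  also have "\<dots> = c * (\<Sum>q'\<in>?M. rateR \<epsilon> q q' * (F q' - F q))"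
    by (simp add: sum_distrib_left mult.assoc)
  also have "\<dots> = c * gen \<epsilon> F q"
    using sum_rateR[OF q fin order_refl, of \<epsilon> "\<lambda>q'. F q' - F q"] by (simp add: gen_def)
  finally show ?thesis .
qed

lemma markov_rates_rateR:
  assumes "0 \<le> \<epsilon>" "c > 0"
  shows "markov_rates (\<lambda>q q'. c * rateR \<epsilon> q q') Qset"
proof
  show "0 \<le> c * rateR \<epsilon> q q'" for q q'
    unfolding rateR_def using assms by (intro mult_nonneg_nonneg infsum_nonneg) auto
  fix q assume q: "q \<in> Qset"
  have sub: "q' \<in> up_at q ` up_set q \<union> down_at q ` down_set q" if "c * rateR \<epsilon> q q' \<noteq> 0" for q'
    using rateR_support[OF q] that by auto
  show "finite {z. c * rateR \<epsilon> q z \<noteq> 0}"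
    by (rule finite_subset[of _ "up_at q ` up_set q \<union> down_at q ` down_set q"])
      (use sub finite_up_set[OF q] finite_down_set[OF q] in auto)
  show "z \<in> Qset" if "c * rateR \<epsilon> q z \<noteq> 0" for z
    using sub[OF that] up_at_in_Qset[OF q] down_at_in_Qset[OF q] by auto
qed

section \<open>Jumps seen from a site: exclusion and linearity\<close>

lemma hgt_up:
  assumes q: "q \<in> Qset" and i: "i \<in> up_set q"
  shows "hgt (up_at q i) x = (if x = q i then hgt q x + 1 else hgt q x)"
proof -
  have i1: "1 \<le> i" using i by (auto simp: up_set_def up_ok_def)
  have "{j. 1 \<le> j \<and> x < (up_at q i) j} = (if x = q i then insert i {j. 1 \<le> j \<and> x < q j} else {j. 1 \<le> j \<and> x < q j})"
    using i1 by auto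
  then show ?thesis unfolding hgt_def using finite_above[OF q, of x] by auto
qed

lemma hgt_down:
  assumes q: "q \<in> Qset" and i: "i \<in> down_set q"
  shows "hgt (down_at q i) x = (if Suc x = q i then hgt q x - 1 else hgt q x)"
    "Suc x = q i \<Longrightarrow> 1 \<le> hgt q x"
proof -
  have i1: "1 \<le> i" "0 < q i" using i by (auto simp: down_set_def down_ok_def)
  have "{j. 1 \<le> j \<and> x < (down_at q i) j} = (if Suc x = q i then {j. 1 \<le> j \<and> x < q j} - {i} else {j. 1 \<le> j \<and> x < q j})"
    using i1 by auto
  then show "hgt (down_at q i) x = (if Suc x = q i then hgt q x - 1 else hgt q x)"
    unfolding hgt_def using finite_above[OF q, of x] i1 by (auto simp: card_Diff_singleton_if)
  assume "Suc x = q i"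
  then have "i \<in> {j. 1 \<le> j \<and> x < q j}" using i1 by auto
  then show "1 \<le> hgt q x" unfolding hgt_def
    using finite_above[OF q, of x] by (metis One_nat_def Suc_leI card_gt_0_iff empty_iff)
qed

text \<open>Numbers of moves that raise, respectively lower, the height at site \<open>x\<close>:
  the height there counts the parts above \<open>x\<close>, so it changes when a part passes between
  \<open>x\<close> and \<open>x + 1\<close>.\<close>

definition n_up :: "config \<Rightarrow> nat \<Rightarrow> nat" where "n_up q x = card {i \<in> up_set q. q i = x}"
definition n_down :: "config \<Rightarrow> nat \<Rightarrow> nat" where "n_down q x = card {i \<in> down_set q. q i = Suc x}"

text \<open>The exclusion rule. Parts are listed in decreasing order, so if site
  \<open>x + 1\<close> is occupied, then by the index just before that of the part at
  \<open>x\<close>, and this is what \<open>up_ok\<close> tests.\<close>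

lemma n_up_pos:
  assumes q: "q \<in> Qset" and x: "0 < x"
  shows "n_up q x = (if occ q (Suc x) = {} then card (occ q x) else 0)"
proof -
  have e: "{i \<in> up_set q. q i = x} = {j \<in> occ q x. up_ok q j}"
    by (auto simp: occ_def up_set_def up_ok_def)
  have "{i \<in> up_set q. q i = x} = (if occ q (Suc x) = {} then occ q x else {})"
    unfolding e
  proof (cases rule: occ_cases[OF q x])
    case 1
    then show "{j \<in> occ q x. up_ok q j} = (if occ q (Suc x) = {} then occ q x else {})" by simp
  next
    case (2 i)
    have "up_ok q i \<longleftrightarrow> occ q (Suc x) = {}"
    proof
      assume up: "up_ok q i"
      have False if "j \<in> occ q (Suc x)" for j
      proof -
        have j: "1 \<le> j" "q j = Suc x" using that by (auto simp: occ_def)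
        have "j < i" using Qset_antimono[OF q 2(2), of j] j 2 by (cases "j < i") auto
        then have "i \<noteq> 1" using j by auto
        moreover have "q (i - 1) \<le> q j"
          by (rule Qset_antimono[OF q]) (use \<open>j < i\<close> j in auto)
        ultimately show False using up j 2 by (auto simp: up_ok_def)
      qed
      then show "occ q (Suc x) = {}" by auto
    next
      assume e: "occ q (Suc x) = {}"
      show "up_ok q i"
      proof (cases "i = 1")
        case False
        then have i': "1 \<le> i - 1" "i - 1 < i" using 2(2) by auto
        have "q i \<le> q (i - 1)" by (rule Qset_antimono[OF q i'(1)]) simp
        then have "q i < q (i - 1)" using Qset_strict[OF q i'] 2 x by simp
        moreover have "q (i - 1) \<noteq> Suc x" using e False 2 by (auto simp: occ_def)
        ultimately show ?thesis using 2 by (auto simp: up_ok_def)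
      qed (simp add: up_ok_def)
    qed
    then show "{j \<in> occ q x. up_ok q j} = (if occ q (Suc x) = {} then occ q x else {})"
      unfolding 2(1) by auto
  qed
  then show ?thesis by (simp add: n_up_def)
qed

text \<open>A configuration has infinitely many zero parts, but only the first of them, at index
  \<open>l\<close>, can be raised: each later one has a zero before it. Site 0 thus acts as a
  reservoir that feeds site 1 whenever that is empty.\<close>

lemma n_up_0:
  assumes q: "q \<in> Qset"
  shows "n_up q 0 = (if occ q 1 = {} then 1 else 0)"
proof -
  obtain n where n: "1 \<le> n" "\<And>i. n \<le> i \<Longrightarrow> q i = 0" using Qset_zero_from[OF q] by auto
  define l where "l = (LEAST i. 1 \<le> i \<and> q i = 0)"
  have l: "1 \<le> l" "q l = 0" using LeastI[of "\<lambda>i. 1 \<le> i \<and> q i = 0" n] n by (auto simp: l_def)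
  have lmin: "q i \<noteq> 0" if "1 \<le> i" "i < l" for i
    using not_less_Least[of i "\<lambda>i. 1 \<le> i \<and> q i = 0"] that by (auto simp: l_def)
  have only: "i = l" if "up_ok q i" "q i = 0" for i
  proof (rule ccontr)
    assume "i \<noteq> l"
    moreover have "l \<le> i" using lmin[of i] that by (cases "i < l") (auto simp: up_ok_def)
    ultimately have "i \<noteq> 1" "q (i - 1) = 0" using Qset_antimono[OF q l(1), of "i - 1"] l by auto
    with that show False by (simp add: up_ok_def)
  qed
  have "up_ok q l \<longleftrightarrow> occ q 1 = {}"
  proof (cases "l = 1")
    case True
    then have "q j = 0" if "1 \<le> j" for j using Qset_antimono[OF q _ that] l by auto
    then show ?thesis using True by (auto simp: occ_def up_ok_def)
  next
    case False
    have "occ q 1 = {} \<longleftrightarrow> q (l - 1) \<noteq> 1"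
    proof
      assume "q (l - 1) \<noteq> 1"
      moreover have "q (l - 1) \<noteq> 0" using lmin[of "l - 1"] l False by auto
      ultimately have g: "1 < q (l - 1)" by simp
      have "q j \<noteq> 1" if "1 \<le> j" for j
      proof (cases "j < l")
        case True
        then have "q (l - 1) \<le> q j" by (intro Qset_antimono[OF q that]) simp
        then show ?thesis using g by simp
      next
        case False
        then have "q j \<le> q l" by (intro Qset_antimono[OF q l(1)]) simp
        then show ?thesis using l by simp
      qed
      then show "occ q 1 = {}" by (auto simp: occ_def)
    next
      assume "occ q 1 = {}"
      then have "l - 1 \<notin> occ q 1" by simp
      then show "q (l - 1) \<noteq> 1" using False l by (simp add: occ_def)
    qed
    moreover have "q (l - 1) \<noteq> 0" using lmin[of "l - 1"] l False by auto
    ultimately show ?thesis using False l by (auto simp: up_ok_def)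
  qed
  then have "{i \<in> up_set q. q i = 0} = (if occ q 1 = {} then {l} else {})"
    using only l by (auto simp: up_set_def)
  then show ?thesis by (simp add: n_up_def)
qed

text \<open>Again exclusion, now for a part at \<open>x + 1\<close> moving to \<open>x\<close>. A
  part of size 1 may always be removed, hence the exception at \<open>x = 0\<close>.\<close>

lemma n_down_eq:
  assumes q: "q \<in> Qset"
  shows "n_down q x = (if x = 0 \<or> occ q x = {} then card (occ q (Suc x)) else 0)"
proof -
  have e: "{i \<in> down_set q. q i = Suc x} = {j \<in> occ q (Suc x). down_ok q j}"
    by (auto simp: occ_def down_set_def down_ok_def)
  have "{i \<in> down_set q. q i = Suc x} = (if x = 0 \<or> occ q x = {} then occ q (Suc x) else {})"
    unfolding e
  proof (cases rule: occ_cases[OF q zero_less_Suc[of x]])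
    case 1
    then show "{j \<in> occ q (Suc x). down_ok q j} = (if x = 0 \<or> occ q x = {} then occ q (Suc x) else {})" by simp
  next
    case (2 i)
    have "down_ok q i \<longleftrightarrow> x = 0 \<or> occ q x = {}"
    proof (cases "x = 0")
      case False
      have less: "q (Suc i) < Suc x" using Qset_strict[OF q 2(2), of "Suc i"] 2 by auto
      have "occ q x = {} \<longleftrightarrow> q (Suc i) \<noteq> x"
      proof
        assume ne: "q (Suc i) \<noteq> x"
        have "q j \<noteq> x" if "1 \<le> j" for j
        proof (cases "j \<le> i")
          case True
          then show ?thesis using Qset_antimono[OF q that True] 2(3) by simp
        next
          case False
          then show ?thesis using Qset_antimono[OF q, of "Suc i" j] less ne by auto
        qed
        then show "occ q x = {}" unfolding occ_def by blast
      next
        assume "occ q x = {}"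
        then have "Suc i \<notin> occ q x" by simp
        then show "q (Suc i) \<noteq> x" by (simp add: occ_def)
      qed
      with less False 2(2,3) show ?thesis by (auto simp: down_ok_def)
    qed (use 2(2,3) in \<open>auto simp: down_ok_def\<close>)
    then show "{j \<in> occ q (Suc x). down_ok q j} = (if x = 0 \<or> occ q x = {} then occ q (Suc x) else {})"
      unfolding 2(1) by auto
  qed
  then show ?thesis by (simp add: n_down_def)
qed

text \<open>With occupation numbers \<open>c\<close>, the moves up are
  \<open>c x (1 - c (x + 1))\<close> and the moves down \<open>c (x + 1) (1 - c x)\<close>: the
  quadratic terms agree, and the difference is linear. At the reservoir the counts are
  \<open>1 - c 1\<close> and \<open>c 1\<close>.\<close>

lemma n_up_diff_n_down:
  assumes q: "q \<in> Qset"
  shows "real (n_up q x) - real (n_down q x) =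
     (if x = 0 then 1 - real (card (occ q 1)) else real (card (occ q x))) - real (card (occ q (Suc x)))"
    "n_up q x \<le> 1" "n_down q x \<le> 1"
proof -
  have f: "finite (occ q y)" if "0 < y" for y
    using occ_cases[OF q that] by (metis finite.emptyI finite.insertI)
  have c: "card (occ q y) = (if occ q y = {} then 0 else 1)" if "0 < y" for y
    using card_occ_le_1[OF q that] f[OF that] by auto
  show "real (n_up q x) - real (n_down q x) =
     (if x = 0 then 1 - real (card (occ q 1)) else real (card (occ q x))) - real (card (occ q (Suc x)))"
    using n_up_0[OF q] n_up_pos[OF q, of x] n_down_eq[OF q, of x] c[of x] c[of "Suc x"]
    by (cases "x = 0") auto
  show "n_up q x \<le> 1" "n_down q x \<le> 1"
    using n_up_0[OF q] n_up_pos[OF q, of x] n_down_eq[OF q, of x] c[of x] c[of "Suc x"]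
    by (cases "x = 0"; auto)+
qed

text \<open>The microscopic Cole--Hopf (Gaertner) variable. For \<open>\<epsilon> = 1 / a\<^sup>2\<close> the quadratic terms of the
  jump rates cancel and the generator acts on it as a discrete heat operator; the even extension
  to negative sites makes this true at the boundary as well.\<close>

definition gaertner :: "real \<Rightarrow> config \<Rightarrow> int \<Rightarrow> real" where
  "gaertner a q z = a ^ (nat \<bar>z\<bar> + 2 * hgt q (nat \<bar>z\<bar>))"

lemma gaertner_pos: "0 < a \<Longrightarrow> 0 < gaertner a q z"
  by (simp add: gaertner_def)

lemma gaertner_up:
  assumes "q \<in> Qset" "i \<in> up_set q"
  shows "gaertner a (up_at q i) z = gaertner a q z * (if q i = nat \<bar>z\<bar> then a\<^sup>2 else 1)"
  using hgt_up[OF assms, of "nat \<bar>z\<bar>"] by (auto simp: gaertner_def power_add power2_eq_square)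

lemma gaertner_down:
  assumes q: "q \<in> Qset" "i \<in> down_set q" and a: "a \<noteq> 0"
  shows "gaertner a (down_at q i) z = gaertner a q z * (if q i = Suc (nat \<bar>z\<bar>) then 1 / a\<^sup>2 else 1)"
proof (cases "q i = Suc (nat \<bar>z\<bar>)")
  case True
  with hgt_down(2)[OF q, of "nat \<bar>z\<bar>"] obtain m where m: "hgt q (nat \<bar>z\<bar>) = Suc m"
    by (cases "hgt q (nat \<bar>z\<bar>)") auto
  with True hgt_down(1)[OF q, of "nat \<bar>z\<bar>"] have "hgt (down_at q i) (nat \<bar>z\<bar>) = m" by simp
  with m True a show ?thesis by (simp add: gaertner_def power_add power2_eq_square)
next
  case False
  with hgt_down(1)[OF q, of "nat \<bar>z\<bar>"] show ?thesis by (simp add: gaertner_def)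
qed

lemma sum_jump:
  assumes "finite A"
  shows "(\<Sum>i\<in>A. if P i then c else 0) = real (card {i\<in>A. P i}) * (c::real)"
  using assms by (simp flip: sum.inter_filter)

lemma gaertner_neighbour:
  assumes q: "q \<in> Qset" and a: "0 < a"
  shows "gaertner a q (int (Suc x)) = gaertner a q (int x) * a / a ^ (2 * card (occ q (Suc x)))"
  using hgt_Suc[OF q, of x] a by (simp add: gaertner_def nat_add_distrib power_add field_simps flip: of_nat_Suc)

text \<open>For \<open>c\<close> equal to 0 or 1 the power \<open>a ^ (- 2 c)\<close> is the affine
  function \<open>1 - (1 - 1 / a^2) c\<close>. So the neighbouring values are affine in the
  occupation numbers, like the difference of the rates.\<close>

lemma gaertner_neighbour':
  assumes q: "q \<in> Qset" and a: "0 < a"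
  shows "gaertner a q (int (Suc x)) / a = gaertner a q (int x) * (1 - (1 - 1 / a\<^sup>2) * real (card (occ q (Suc x))))"
    "gaertner a q (int x) / a = gaertner a q (int (Suc x)) * (1 / a\<^sup>2 + (1 - 1 / a\<^sup>2) * real (card (occ q (Suc x))))"
  using card_occ_le_1[OF q, of "Suc x"] gaertner_neighbour[OF q a, of x] a
  by (auto simp: field_simps power2_eq_square)

text \<open>A jump up has rate \<open>1 / a^2\<close> and multiplies the variable by
  \<open>a^2\<close>; a jump down has rate 1 and divides by \<open>a^2\<close>. The two
  contributions have equal size \<open>1 - 1 / a^2\<close> and opposite signs, so only
  \<open>n_up - n_down\<close> enters, which is linear.\<close>

lemma gen_gaertner:
  assumes q: "q \<in> Qset" and a: "0 < a"
  shows "gen (1 / a\<^sup>2) (\<lambda>q. gaertner a q z) q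
    = (gaertner a q (z - 1) + gaertner a q (z + 1)) / a - (1 + 1 / a\<^sup>2) * gaertner a q z"
proof -
  define x where "x = nat \<bar>z\<bar>"
  have sym: "gaertner a q (- z) = gaertner a q z" for z by (simp add: gaertner_def)
  have v: "gaertner a q z = gaertner a q (int x)" by (simp add: x_def gaertner_def)
  let ?v = "gaertner a q (int x)"
  have up: "1 / a\<^sup>2 * (gaertner a (up_at q i) z - gaertner a q z) = (if q i = x then 1 / a\<^sup>2 * (a\<^sup>2 - 1) * ?v else 0)"
    if "i \<in> up_set q" for i
    unfolding gaertner_up[OF q that] x_def[symmetric] v using a by (auto simp: field_simps)
  have down: "gaertner a (down_at q i) z - gaertner a q z = (if q i = Suc x then (1 / a\<^sup>2 - 1) * ?v else 0)"
    if "i \<in> down_set q" for i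
    unfolding gaertner_down[OF q that less_imp_neq[OF a, symmetric]] x_def[symmetric] v by (simp add: algebra_simps)
  have "gen (1 / a\<^sup>2) (\<lambda>q. gaertner a q z) q
     = (\<Sum>i\<in>up_set q. if q i = x then 1 / a\<^sup>2 * (a\<^sup>2 - 1) * ?v else 0)
       + (\<Sum>i\<in>down_set q. if q i = Suc x then (1 / a\<^sup>2 - 1) * ?v else 0)"
    unfolding gen_def by (simp only: up down cong: sum.cong)
  also have "\<dots> = real (n_up q x) * (1 / a\<^sup>2 * (a\<^sup>2 - 1) * ?v) + real (n_down q x) * ((1 / a\<^sup>2 - 1) * ?v)"
    unfolding n_up_def n_down_def sum_jump[OF finite_up_set[OF q]] sum_jump[OF finite_down_set[OF q]] by simp
  also have "\<dots> = (1 - 1 / a\<^sup>2) * ?v * (real (n_up q x) - real (n_down q x))"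
    using a by (simp add: field_simps)
  also have "\<dots> = (gaertner a q (z - 1) + gaertner a q (z + 1)) / a - (1 + 1 / a\<^sup>2) * ?v"
  \<comment> \<open>At the origin both neighbours of \<open>z\<close> are site 1 in absolute value,
    and the reservoir makes the difference of rates \<open>1 - 2 c\<close>; this is what the even
    extension requires.\<close>
  proof (cases "x = 0")
    case True
    then have z: "z = 0" by (simp add: x_def)
    define w where "w = gaertner a q (int (Suc 0))"
    have "gaertner a q (-1) = w" "gaertner a q 1 = w" using sym[of 1] by (simp_all add: w_def)
    then have "(gaertner a q (z - 1) + gaertner a q (z + 1)) / a = 2 * (w / a)" unfolding z by simp
    also have "w / a = ?v * (1 - (1 - 1 / a\<^sup>2) * real (card (occ q 1)))"
      using gaertner_neighbour'(1)[OF q a, of 0] unfolding True w_def One_nat_def .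
    finally have l: "(gaertner a q (z - 1) + gaertner a q (z + 1)) / a = 2 * (?v * (1 - (1 - 1 / a\<^sup>2) * real (card (occ q 1))))" .
    have n: "real (n_up q x) - real (n_down q x) = 1 - 2 * real (card (occ q 1))"
      using n_up_diff_n_down(1)[OF q, of 0] True by simp
    have alg: "(1 - e) * v * (1 - 2 * c) = 2 * (v * (1 - (1 - e) * c)) - (1 + e) * v" for e v c :: real
      by (simp add: algebra_simps)
    show ?thesis unfolding l n by (rule alg)
  next
    case False
    then obtain y where y: "x = Suc y" by (cases x) auto
    have "gaertner a q (z - 1) + gaertner a q (z + 1) = gaertner a q (int y) + gaertner a q (int (Suc x))"
    proof (cases "z \<ge> 0")
      case True
      then have "z - 1 = int y" "z + 1 = int (Suc x)" using y x_def by auto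
      then show ?thesis by (simp only:)
    next
      case False
      then have "- (z + 1) = int y" "- (z - 1) = int (Suc x)" using y x_def by auto
      then show ?thesis using sym[of "z + 1"] sym[of "z - 1"] by (simp only: add.commute)
    qed
    then have l: "(gaertner a q (z - 1) + gaertner a q (z + 1)) / a
        = ?v * (1 / a\<^sup>2 + (1 - 1 / a\<^sup>2) * real (card (occ q x))) + ?v * (1 - (1 - 1 / a\<^sup>2) * real (card (occ q (Suc x))))"
      using gaertner_neighbour'(1)[OF q a, of x] gaertner_neighbour'(2)[OF q a, of y]
      unfolding y[symmetric] by (simp only: add_divide_distrib)
    have n: "real (n_up q x) - real (n_down q x) = real (card (occ q x)) - real (card (occ q (Suc x)))"
      using n_up_diff_n_down(1)[OF q, of x] False by simp
    have alg: "(1 - e) * v * (c - d) = v * (e + (1 - e) * c) + v * (1 - (1 - e) * d) - (1 + e) * v" for e v c d :: real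
      by (simp add: algebra_simps)
    show ?thesis unfolding l n by (rule alg)
  qed
  finally show ?thesis by (simp add: v)
qed

text \<open>The carre du champ, that is, the rate at which the squared jumps of \<open>F\<close>
  accumulate.\<close>

definition gen_sq :: "real \<Rightarrow> (config \<Rightarrow> real) \<Rightarrow> config \<Rightarrow> real" where
  "gen_sq \<epsilon> F q = (\<Sum>i\<in>up_set q. \<epsilon> * (F (up_at q i) - F q)\<^sup>2) + (\<Sum>i\<in>down_set q. (F (down_at q i) - F q)\<^sup>2)"

lemma gen_square: "gen \<epsilon> (\<lambda>q. (F q)\<^sup>2) q = 2 * F q * gen \<epsilon> F q + gen_sq \<epsilon> F q"
proof -
  have "gen \<epsilon> (\<lambda>q. (F q)\<^sup>2) q =
     (\<Sum>i\<in>up_set q. 2 * F q * (\<epsilon> * (F (up_at q i) - F q)) + \<epsilon> * (F (up_at q i) - F q)\<^sup>2)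
     + (\<Sum>i\<in>down_set q. 2 * F q * (F (down_at q i) - F q) + (F (down_at q i) - F q)\<^sup>2)"
    unfolding gen_def by (intro arg_cong2[of _ _ _ _ "(+)"] sum.cong refl) (auto simp: algebra_simps power2_eq_square)
  then show ?thesis
    by (simp add: gen_def gen_sq_def sum.distrib distrib_left flip: sum_distrib_left)
qed

text \<open>At most one move up and one move down affect a given site. The first contributes
  \<open>(a - 1 / a)^2\<close> times the squared value, the second the same divided by
  \<open>a^2\<close>, hence the factor 2.\<close>

lemma gen_sq_gaertner:
  assumes q: "q \<in> Qset" and a: "1 \<le> a"
  shows "gen_sq (1 / a\<^sup>2) (\<lambda>q. gaertner a q z) q \<le> 2 * (a - 1 / a)\<^sup>2 * (gaertner a q z)\<^sup>2"
proof -
  define x where "x = nat \<bar>z\<bar>"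
  let ?v = "gaertner a q z"
  have a0: "0 < a" using a by simp
  have up: "1 / a\<^sup>2 * (gaertner a (up_at q i) z - gaertner a q z)\<^sup>2 = (if q i = x then (a - 1 / a)\<^sup>2 * ?v\<^sup>2 else 0)"
    if "i \<in> up_set q" for i
  proof -
    have "a * (?v * a\<^sup>2 - ?v) = a\<^sup>2 * ((a - 1 / a) * ?v)" using a0 by (simp add: field_simps power2_eq_square)
    then have "?v * a\<^sup>2 - ?v = a * ((a - 1 / a) * ?v)" using a0 by (simp add: power2_eq_square)
    then show ?thesis
      unfolding gaertner_up[OF q that] x_def[symmetric] using a0 by (simp add: power_mult_distrib)
  qed
  have down: "(gaertner a (down_at q i) z - gaertner a q z)\<^sup>2 = (if q i = Suc x then ((a - 1 / a) / a)\<^sup>2 * ?v\<^sup>2 else 0)"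
    if "i \<in> down_set q" for i
  proof -
    have "?v * (1 / a\<^sup>2) - ?v = - ((a - 1 / a) / a * ?v)" using a0 by (simp add: field_simps power2_eq_square)
    then have "(?v * (1 / a\<^sup>2) - ?v)\<^sup>2 = ((a - 1 / a) / a)\<^sup>2 * ?v\<^sup>2"
      by (simp only: power2_minus power_mult_distrib)
    then show ?thesis
      unfolding gaertner_down[OF q that less_imp_neq[OF a0, symmetric]] x_def[symmetric]
      by (simp only: split: if_split) simp
  qed
  have "gen_sq (1 / a\<^sup>2) (\<lambda>q. gaertner a q z) q
     = (\<Sum>i\<in>up_set q. if q i = x then (a - 1 / a)\<^sup>2 * ?v\<^sup>2 else 0)
       + (\<Sum>i\<in>down_set q. if q i = Suc x then ((a - 1 / a) / a)\<^sup>2 * ?v\<^sup>2 else 0)"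
    unfolding gen_sq_def by (simp only: up down cong: sum.cong)
  also have "\<dots> = real (n_up q x) * ((a - 1 / a)\<^sup>2 * ?v\<^sup>2) + real (n_down q x) * (((a - 1 / a) / a)\<^sup>2 * ?v\<^sup>2)"
    unfolding n_up_def n_down_def sum_jump[OF finite_up_set[OF q]] sum_jump[OF finite_down_set[OF q]] by simp
  also have "\<dots> \<le> 1 * ((a - 1 / a)\<^sup>2 * ?v\<^sup>2) + 1 * ((a - 1 / a)\<^sup>2 * ?v\<^sup>2)"
  proof (intro add_mono mult_mono)
    have "1 / a \<le> 1" using a by simp
    then have d: "0 \<le> a - 1 / a" using a by linarith
    have "(a - 1 / a) * (1 / a) \<le> (a - 1 / a) * 1" by (rule mult_left_mono) fact+
    then have "(a - 1 / a) / a \<le> a - 1 / a" "0 \<le> (a - 1 / a) / a" using d a by simp_all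
    then show "((a - 1 / a) / a)\<^sup>2 \<le> (a - 1 / a)\<^sup>2" by (rule power_mono)
  qed (use n_up_diff_n_down(2,3)[OF q, of x] in auto)
  finally show ?thesis by (simp only: mult_1 mult_2 distrib_right)
qed

text \<open>Apart from the noise, replacing \<open>2 v l\<close> by \<open>l^2 + v^2\<close> for
  each neighbour loses only squares, so the squared variable satisfies a discrete heat inequality
  without a zeroth order drift.\<close>

lemma gen_gaertner_square:
  assumes q: "q \<in> Qset" and a: "1 \<le> a"
  shows "gen (1 / a\<^sup>2) (\<lambda>q. (gaertner a q z)\<^sup>2) q
    \<le> ((gaertner a q (z - 1))\<^sup>2 + (gaertner a q (z + 1))\<^sup>2 - 2 * (gaertner a q z)\<^sup>2) / a
      + 2 * (a - 1 / a)\<^sup>2 * (gaertner a q z)\<^sup>2"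
proof -
  let ?v = "gaertner a q z" and ?l = "gaertner a q (z - 1)" and ?r = "gaertner a q (z + 1)"
  have a0: "0 < a" using a by simp
  have "2 * ?v * ((?l + ?r) / a - (1 + 1 / a\<^sup>2) * ?v) \<le> (?l\<^sup>2 + ?r\<^sup>2 - 2 * ?v\<^sup>2) / a"
  proof -
    have "(?l\<^sup>2 + ?r\<^sup>2 - 2 * ?v\<^sup>2) / a - 2 * ?v * ((?l + ?r) / a - (1 + 1 / a\<^sup>2) * ?v)
       = (?l - ?v)\<^sup>2 / a + (?r - ?v)\<^sup>2 / a + 2 * ?v\<^sup>2 * (1 - 1 / a)\<^sup>2"
      using a0 by (simp add: field_simps power2_eq_square)
    moreover have "0 \<le> \<dots>" using a0 by (intro add_nonneg_nonneg) auto
    ultimately show ?thesis by linarith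
  qed
  then show ?thesis
    unfolding gen_square gen_gaertner[OF q a0] using gen_sq_gaertner[OF q a, of z] by linarith
qed

lemma gaertner_step:
  assumes q: "q \<in> Qset" and a: "1 \<le> a"
  shows "gaertner a q (z + 1) \<le> a * gaertner a q z" "gaertner a q z \<le> a * gaertner a q (z + 1)"
proof -
  have a0: "0 < a" using a by simp
  have *: "gaertner a q (int (Suc x)) \<le> a * gaertner a q (int x) \<and> gaertner a q (int x) \<le> a * gaertner a q (int (Suc x))" for x
  proof -
    let ?v = "gaertner a q (int x)" and ?w = "gaertner a q (int (Suc x))"
    have v: "0 < ?v" "0 < ?w" using gaertner_pos[OF a0] by auto
    have "?w = ?v * a \<or> ?v = ?w * a"
      using card_occ_le_1[OF q, of "Suc x"] gaertner_neighbour[OF q a0, of x] a0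
      by (auto simp: field_simps power2_eq_square)
    moreover have "?v \<le> a * (?v * a)" if "0 < ?v" for v :: real
    proof -
      have "1 * 1 * ?v \<le> a * a * ?v" using a v by (intro mult_right_mono mult_mono) auto
      then show ?thesis by (simp add: mult_ac)
    qed
    moreover have "?w \<le> a * (?w * a)"
    proof -
      have "1 * 1 * ?w \<le> a * a * ?w" using a v by (intro mult_right_mono mult_mono) auto
      then show ?thesis by (simp add: mult_ac)
    qed
    ultimately show ?thesis using v by (auto simp: mult.commute)
  qed
  have sym: "gaertner a q (- z) = gaertner a q z" for z by (simp add: gaertner_def)
  have "gaertner a q (z + 1) \<le> a * gaertner a q z \<and> gaertner a q z \<le> a * gaertner a q (z + 1)"
  proof (cases "0 \<le> z")
    case True
    then obtain x where "z = int x" by (rule nonneg_eq_int)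
    then show ?thesis using *[of x] by (simp add: add.commute)
  next
    case False
    then have "0 \<le> - (z + 1)" by simp
    then obtain x where "- (z + 1) = int x" by (rule nonneg_eq_int)
    then have "- (z + 1) = int x" "- z = int (Suc x)" by auto
    then show ?thesis using *[of x] sym[of z] sym[of "z + 1"] by auto
  qed
  then show "gaertner a q (z + 1) \<le> a * gaertner a q z" "gaertner a q z \<le> a * gaertner a q (z + 1)" by auto
qed

lemma gaertner_ratio:
  assumes q: "q \<in> Qset" and a: "1 \<le> a"
  shows "gaertner a q z \<le> a ^ nat \<bar>z - z'\<bar> * gaertner a q z'"
proof -
  have fwd: "gaertner a q (z + int n) \<le> a ^ n * gaertner a q z \<and> gaertner a q z \<le> a ^ n * gaertner a q (z + int n)" for n z
  proof (induction n)
    case (Suc n)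
    have e: "z + int (Suc n) = (z + int n) + 1" by simp
    have "gaertner a q (z + int (Suc n)) \<le> a * gaertner a q (z + int n)"
      unfolding e by (rule gaertner_step[OF q a])
    also have "\<dots> \<le> a * (a ^ n * gaertner a q z)" using Suc a by (intro mult_left_mono) auto
    finally have 1: "gaertner a q (z + int (Suc n)) \<le> a ^ Suc n * gaertner a q z" by (simp add: mult.assoc)
    have "gaertner a q z \<le> a ^ n * gaertner a q (z + int n)" using Suc by simp
    also have "\<dots> \<le> a ^ n * (a * gaertner a q (z + int (Suc n)))"
      unfolding e using a by (intro mult_left_mono gaertner_step[OF q a]) auto
    finally show ?case using 1 by (simp add: mult_ac)
  qed simp
  show ?thesis
  proof (cases "z' \<le> z")
    case True
    then have "z' + int (nat \<bar>z - z'\<bar>) = z" by simp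
    with fwd[of z' "nat \<bar>z - z'\<bar>"] show ?thesis by simp
  next
    case False
    then have "z + int (nat \<bar>z - z'\<bar>) = z'" by simp
    with fwd[of z "nat \<bar>z - z'\<bar>"] show ?thesis by simp
  qed
qed

lemma height_eq_hgt:
  assumes "0 \<le> u"
  shows "height q u = real (hgt q (nat \<lfloor>u\<rfloor>))"
proof -
  have "u < real n \<longleftrightarrow> nat \<lfloor>u\<rfloor> < n" for n using assms by linarith
  then show ?thesis by (simp add: height_def hgt_def)
qed

lemma hgt_antimono_lipschitz:
  assumes q: "q \<in> Qset"
  shows "x \<le> y \<Longrightarrow> hgt q y \<le> hgt q x \<and> hgt q x \<le> hgt q y + (y - x)"
proof (induction y rule: dec_induct)
  case (step n)
  then show ?case using hgt_Suc[OF q, of n] card_occ_le_1[OF q, of "Suc n"] by auto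
qed simp

lemma height_antimono_lipschitz:
  assumes q: "q \<in> Qset" and u: "0 \<le> u" "u \<le> v"
  shows "height q v \<le> height q u" "height q u \<le> height q v + (v - u) + 1"
proof -
  have le: "nat \<lfloor>u\<rfloor> \<le> nat \<lfloor>v\<rfloor>" using u by (intro nat_mono floor_mono)
  have "real (nat \<lfloor>v\<rfloor> - nat \<lfloor>u\<rfloor>) \<le> v - u + 1" using u by linarith
  then show "height q v \<le> height q u" "height q u \<le> height q v + (v - u) + 1"
    using hgt_antimono_lipschitz[OF q le] u by (auto simp: height_eq_hgt)
qed

section \<open>The mean size and the parameter of the dynamics\<close>

definition parts :: "config \<Rightarrow> nat set" where
  "parts q = q ` {i. 1 \<le> i \<and> 0 < q i}"

text \<open>A partition into distinct parts is the set of its parts; on finite sets of positive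
  integers the weight \<open>x ^ \<Sum>F\<close> factorises over the possible elements.\<close>

definition part_sets :: "nat set set" where
  "part_sets = {F. finite F \<and> 0 \<notin> F}"

lemma inj_on_Qset:
  assumes "q \<in> Qset"
  shows "inj_on q {i. 1 \<le> i \<and> 0 < q i}"
proof (rule inj_onI)
  fix i j assume ij: "i \<in> {i. 1 \<le> i \<and> 0 < q i}" "j \<in> {i. 1 \<le> i \<and> 0 < q i}" "q i = q j"
  then show "i = j"
    using Qset_strict[OF assms, of i j] Qset_strict[OF assms, of j i]
    by (cases i j rule: linorder_cases) simp_all
qed

lemma parts_in_part_sets: "q \<in> Qset \<Longrightarrow> parts q \<in> part_sets"
  using finite_above[of q 0] by (auto simp: parts_def part_sets_def)

lemma npart_eq_sum_parts:
  assumes "q \<in> Qset"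
  shows "npart q = \<Sum>(parts q)"
proof -
  have "{i. 1 \<le> i \<and> q i \<noteq> 0} = {i. 1 \<le> i \<and> 0 < q i}" by auto
  then show ?thesis
    unfolding npart_def parts_def using sum.reindex[OF inj_on_Qset[OF assms], of id] by simp
qed

text \<open>Conjugation of partitions: the indices whose parts exceed \<open>x\<close> form an
  initial segment of length \<open>hgt q x\<close>. Hence the heights determine the
  configuration.\<close>

lemma less_iff_le_hgt:
  assumes q: "q \<in> Qset" and i: "1 \<le> i"
  shows "x < q i \<longleftrightarrow> i \<le> hgt q x"
proof
  assume x: "x < q i"
  have "{1..i} \<subseteq> {j. 1 \<le> j \<and> x < q j}"
  proof
    fix j assume "j \<in> {1..i}"
    then have "q i \<le> q j" "1 \<le> j" by (auto intro: Qset_antimono[OF q])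
    with x show "j \<in> {j. 1 \<le> j \<and> x < q j}" by simp
  qed
  from card_mono[OF finite_above[OF q] this] show "i \<le> hgt q x" by (simp add: hgt_def)
next
  assume h: "i \<le> hgt q x"
  show "x < q i"
  proof (rule ccontr)
    assume "\<not> x < q i"
    then have le: "q i \<le> x" by simp
    have "{j. 1 \<le> j \<and> x < q j} \<subseteq> {1..<i}"
    proof
      fix j assume j: "j \<in> {j. 1 \<le> j \<and> x < q j}"
      have "j < i"
      proof (rule ccontr)
        assume "\<not> j < i"
        then have "q j \<le> q i" by (intro Qset_antimono[OF q i]) simp
        with j le show False by simp
      qed
      with j show "j \<in> {1..<i}" by simp
    qed
    from card_mono[OF _ this] have "hgt q x \<le> i - 1" by (simp add: hgt_def)
    with h i show False by simp
  qed
qed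

lemma hgt_eq_card_parts:
  assumes q: "q \<in> Qset"
  shows "hgt q x = card {y \<in> parts q. x < y}"
proof -
  have "{y \<in> parts q. x < y} = q ` {i. 1 \<le> i \<and> x < q i}" by (auto simp: parts_def)
  moreover have "inj_on q {i. 1 \<le> i \<and> x < q i}"
    by (rule inj_on_subset[OF inj_on_Qset[OF q]]) auto
  ultimately show ?thesis by (simp add: hgt_def card_image)
qed

lemma parts_inj: "inj_on parts Qset"
proof (rule inj_onI)
  fix q q' assume q: "q \<in> Qset" "q' \<in> Qset" and eq: "parts q = parts q'"
  have "hgt q x = hgt q' x" for x using hgt_eq_card_parts[of _ x] q eq by simp
  then have less: "x < q i \<longleftrightarrow> x < q' i" if "1 \<le> i" for x i
    using less_iff_le_hgt[OF q(1) that] less_iff_le_hgt[OF q(2) that] by simp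
  have "q i = q' i" for i
  proof (cases "i = 0")
    case True
    then show ?thesis using Qset_stepD(1)[OF q(1)] Qset_stepD(1)[OF q(2)] by simp
  next
    case False
    then show ?thesis using less[of i "q i"] less[of i "q' i"] by (metis less_one linorder_not_less linorder_neqE_nat less_irrefl)
  qed
  then show "q = q'" by (rule ext)
qed

text \<open>Induction that adds a new maximum: it becomes the first part, and all other parts move
  one index further.\<close>

lemma parts_surj:
  assumes "finite F"
  shows "0 \<notin> F \<Longrightarrow> \<exists>q\<in>Qset. parts q = F"
  using assms
proof (induction F rule: finite_linorder_max_induct)
  case empty
  have "(\<lambda>_. 0) \<in> Qset" "parts (\<lambda>_. 0) = {}" by (auto simp: Qset_def parts_def)
  then show ?case by blast
next
  case (insert m F)
  then obtain q where q: "q \<in> Qset" "parts q = F" by auto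
  define q' where "q' i = (if i = 0 then 0 else if i = 1 then m else q (i - 1))" for i
  have m: "0 < m" using insert by (cases m) auto
  have lt: "q i < m" if "1 \<le> i" for i
    using insert(2) q(2) that m by (cases "q i = 0") (auto simp: parts_def)
  have "q' \<in> Qset"
    unfolding Qset_def
  proof (intro CollectI conjI allI impI)
    have "{i. q' i \<noteq> 0} \<subseteq> insert 1 (Suc ` {i. q i \<noteq> 0})"
    proof
      fix i assume i: "i \<in> {i. q' i \<noteq> 0}"
      show "i \<in> insert 1 (Suc ` {i. q i \<noteq> 0})"
      proof (cases "i = 1")
        case False
        then have "i = Suc (i - 1)" "q (i - 1) \<noteq> 0" using i by (auto simp: q'_def split: if_splits)
        then show ?thesis by blast
      qed simp
    qed
    then show "finite {i. q' i \<noteq> 0}" by (rule finite_subset) (simp only: finite_insert finite_imageI Qset_stepD(2)[OF q(1)])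
    fix i :: nat assume i: "1 \<le> i"
    show "q' (Suc i) \<le> q' i"
      using lt[of 1] Qset_stepD(3)[OF q(1), of "i - 1"] i by (auto simp: q'_def)
    show "q' (Suc i) < q' i" if "0 < q' i"
      using that lt[of 1] Qset_stepD(4)[OF q(1), of "i - 1"] i by (auto simp: q'_def split: if_splits)
  qed (simp add: q'_def)
  moreover have "parts q' = insert m F"
  proof -
    have "{i. 1 \<le> i \<and> 0 < q' i} = insert 1 (Suc ` {i. 1 \<le> i \<and> 0 < q i})"
    proof (intro set_eqI iffI)
      fix i assume i: "i \<in> {i. 1 \<le> i \<and> 0 < q' i}"
      show "i \<in> insert 1 (Suc ` {i. 1 \<le> i \<and> 0 < q i})"
      proof (cases "i = 1")
        case False
        then have "i = Suc (i - 1)" "1 \<le> i - 1" "0 < q (i - 1)" using i by (auto simp: q'_def split: if_splits)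
        then show ?thesis by blast
      qed simp
    qed (use m in \<open>auto simp: q'_def\<close>)
    moreover have "q' 1 = m" by (simp add: q'_def)
    moreover have "q' ` Suc ` {i. 1 \<le> i \<and> 0 < q i} = q ` {i. 1 \<le> i \<and> 0 < q i}"
      unfolding image_image by (intro image_cong) (auto simp: q'_def)
    ultimately show ?thesis using q(2) by (simp add: parts_def)
  qed
  ultimately show ?case by blast
qed

lemma bij_betw_parts: "bij_betw parts Qset part_sets"
  unfolding bij_betw_def
proof
  show "parts ` Qset = part_sets"
  proof
    show "part_sets \<subseteq> parts ` Qset"
      using parts_surj by (fastforce simp: part_sets_def)
  qed (use parts_in_part_sets in auto)
qed (rule parts_inj)

lemma sum_Pow_insert:
  assumes "finite A" "m \<notin> A"
  shows "(\<Sum>F\<in>Pow (insert m A). f F) = (\<Sum>F\<in>Pow A. f F) + (\<Sum>F\<in>Pow A. f (insert m F))"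
proof -
  have "inj_on (insert m) (Pow A)" using assms(2) by (auto simp: inj_on_def)
  then show ?thesis
    unfolding Pow_insert using assms
    by (subst sum.union_disjoint) (auto simp: sum.reindex o_def)
qed

text \<open>Deciding whether \<open>n + 1\<close> belongs to the set multiplies the generating
  function by \<open>1 + x ^ (n + 1)\<close>. The second identity is the derivative
  \<open>x d/dx\<close> of the first, proved by the same induction.\<close>

lemma sum_subsets_power:
  fixes x :: real
  assumes x: "0 \<le> x"
  shows "(\<Sum>F\<in>Pow {1..n}. x ^ \<Sum>F) = (\<Prod>k<n. 1 + x ^ Suc k)"
    "(\<Sum>F\<in>Pow {1..n}. real (\<Sum>F) * x ^ \<Sum>F)
      = (\<Prod>k<n. 1 + x ^ Suc k) * (\<Sum>k<n. real (Suc k) * x ^ Suc k / (1 + x ^ Suc k))"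
proof -
  have ins: "{1..Suc n} = insert (Suc n) {1..n}" for n by auto
  have S: "\<Sum>(insert (Suc n) F) = Suc n + \<Sum>F" if "F \<in> Pow {1..n}" for F n
    using that finite_subset[of F "{1..n}"] by (subst sum.insert) auto
  have P: "(\<Sum>F\<in>Pow {1..n}. x ^ \<Sum>F) = (\<Prod>k<n. 1 + x ^ Suc k)" for n
  proof (induction n)
    case (Suc n)
    have "(\<Sum>F\<in>Pow {1..n}. x ^ \<Sum>(insert (Suc n) F)) = (\<Sum>F\<in>Pow {1..n}. x ^ Suc n * x ^ \<Sum>F)"
      by (intro sum.cong refl) (simp add: S power_add)
    also have "\<dots> = x ^ Suc n * (\<Prod>k<n. 1 + x ^ Suc k)" by (simp only: sum_distrib_left[symmetric] Suc)
    finally have t: "(\<Sum>F\<in>Pow {1..n}. x ^ \<Sum>(insert (Suc n) F)) = x ^ Suc n * (\<Prod>k<n. 1 + x ^ Suc k)" .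
    show ?case
      unfolding ins by (subst sum_Pow_insert)
        (simp_all only: t Suc finite_atLeastAtMost prod.lessThan_Suc, simp_all add: algebra_simps del: power_Suc)
  qed simp
  have "(\<Sum>F\<in>Pow {1..n}. real (\<Sum>F) * x ^ \<Sum>F)
      = (\<Prod>k<n. 1 + x ^ Suc k) * (\<Sum>k<n. real (Suc k) * x ^ Suc k / (1 + x ^ Suc k))" for n
  proof (induction n)
    case (Suc n)
    define y where "y = x ^ Suc n"
    have y: "0 \<le> y" using x by (simp add: y_def)
    let ?P = "\<Prod>k<n. 1 + x ^ Suc k" and ?T = "\<Sum>k<n. real (Suc k) * x ^ Suc k / (1 + x ^ Suc k)"
    have "(\<Sum>F\<in>Pow {1..n}. real (\<Sum>(insert (Suc n) F)) * x ^ \<Sum>(insert (Suc n) F))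
        = (\<Sum>F\<in>Pow {1..n}. y * (real (\<Sum>F) * x ^ \<Sum>F) + real (Suc n) * y * x ^ \<Sum>F)"
      by (intro sum.cong refl) (simp add: S power_add y_def algebra_simps)
    also have "\<dots> = y * (?P * ?T) + real (Suc n) * y * ?P"
      by (simp only: sum.distrib sum_distrib_left[symmetric] Suc P)
    finally have e: "(\<Sum>F\<in>Pow {1..Suc n}. real (\<Sum>F) * x ^ \<Sum>F) = ?P * ?T + (y * (?P * ?T) + real (Suc n) * y * ?P)"
      unfolding ins by (subst sum_Pow_insert) (simp_all only: Suc finite_atLeastAtMost, simp_all)
    have "(?P * (1 + y)) * (?T + real (Suc n) * y / (1 + y)) = ?P * ?T + (y * (?P * ?T) + real (Suc n) * y * ?P)"
      using y by (simp add: field_simps)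
    then show ?case unfolding e by (simp only: prod.lessThan_Suc sum.lessThan_Suc y_def[symmetric])
  qed simp
  then show "(\<Sum>F\<in>Pow {1..n}. x ^ \<Sum>F) = (\<Prod>k<n. 1 + x ^ Suc k)"
    "(\<Sum>F\<in>Pow {1..n}. real (\<Sum>F) * x ^ \<Sum>F)
      = (\<Prod>k<n. 1 + x ^ Suc k) * (\<Sum>k<n. real (Suc k) * x ^ Suc k / (1 + x ^ Suc k))"
    using P by auto
qed

lemma infsum_exhaustion:
  fixes f :: "'a \<Rightarrow> real"
  assumes nonneg: "\<And>x. x \<in> A \<Longrightarrow> 0 \<le> f x"
    and X: "\<And>n. finite (X n)" "\<And>n. X n \<subseteq> A" "incseq X"
    and cover: "\<And>F. finite F \<Longrightarrow> F \<subseteq> A \<Longrightarrow> \<exists>n. F \<subseteq> X n"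
    and lim: "(\<lambda>n. sum f (X n)) \<longlonglongrightarrow> L"
  shows "infsum f A = L"
proof -
  have nonneg': "0 \<le> f x" if "x \<in> X n - F" for x n F using X(2) that by (intro nonneg) blast
  have "incseq (\<lambda>n. sum f (X n))"
  proof (rule incseq_SucI)
    show "sum f (X n) \<le> sum f (X (Suc n))" for n
      by (rule sum_mono2[OF X(1) incseq_SucD[OF X(3)] nonneg'])
  qed
  from incseq_le[OF this lim] have le: "sum f (X n) \<le> L" for n .
  have bound: "sum f F \<le> L" if F: "finite F" "F \<subseteq> A" for F
  proof -
    obtain n where n: "F \<subseteq> X n" using cover[OF F] by blast
    have "sum f F \<le> sum f (X n)" by (rule sum_mono2[OF X(1) n nonneg'])
    also have "\<dots> \<le> L" by (rule le)
    finally show ?thesis .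
  qed
  have s: "f summable_on A"
    by (rule nonneg_bdd_above_summable_on) (use nonneg bound in \<open>auto intro!: bdd_aboveI\<close>)
  show ?thesis
  proof (rule antisym)
    show "infsum f A \<le> L" by (rule infsum_le_finite_sums[OF s]) (use bound in auto)
    show "L \<le> infsum f A"
      by (rule LIMSEQ_le_const2[OF lim]) (use finite_sum_le_infsum[OF s X(1,2)] nonneg in auto)
  qed
qed

section \<open>The mean size as a series\<close>

lemma ZR_LIMSEQ:
  assumes x: "0 \<le> x" "x < 1"
  shows "(\<lambda>n. \<Prod>k<n. 1 + x ^ Suc k) \<longlonglongrightarrow> ZR x" "0 < ZR x"
proof -
  have "summable (\<lambda>k. norm ((1 + x ^ Suc k) - 1))"
    using x by (simp add: abs_mult power_abs summable_mult)
  then have "convergent_prod (\<lambda>k. 1 + x ^ Suc k)"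
    by (intro abs_convergent_prod_imp_convergent_prod summable_imp_abs_convergent_prod)
  then have "(\<lambda>n. \<Prod>k\<le>n. 1 + x ^ Suc k) \<longlonglongrightarrow> ZR x"
    unfolding ZR_def by (rule convergent_prod_LIMSEQ)
  then have "(\<lambda>n. \<Prod>k<Suc n. 1 + x ^ Suc k) \<longlonglongrightarrow> ZR x" by (simp only: lessThan_Suc_atMost)
  then show l: "(\<lambda>n. \<Prod>k<n. 1 + x ^ Suc k) \<longlonglongrightarrow> ZR x" by (rule LIMSEQ_imp_Suc)
  have "1 \<le> (\<Prod>k<n. 1 + x ^ Suc k)" for n using x by (intro prod_ge_1) auto
  then have "1 \<le> ZR x" using LIMSEQ_le_const[OF l] by blast
  then show "0 < ZR x" by simp
qed

text \<open>Under the measure the possible parts \<open>k\<close> are present independently with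
  probability \<open>x^k / (1 + x^k)\<close>. The sets with all parts at most \<open>n\<close>
  exhaust \<open>part_sets\<close>, and the partial products cancel against \<open>ZR\<close> in the
  limit.\<close>

lemma mean_n_eq:
  assumes x: "0 \<le> x" "x < 1" and s: "(\<lambda>k. real (Suc k) * x ^ Suc k / (1 + x ^ Suc k)) sums m"
  shows "mean_n x = m"
proof -
  have "mean_n x = infsum (\<lambda>q. real (\<Sum>(parts q)) * x ^ \<Sum>(parts q) / ZR x) Qset"
    unfolding mean_n_def muR_def by (intro infsum_cong) (simp add: npart_eq_sum_parts)
  also have "\<dots> = infsum (\<lambda>F. real (\<Sum>F) * x ^ \<Sum>F / ZR x) part_sets"
    by (rule infsum_reindex_bij_betw[OF bij_betw_parts])
  also have "\<dots> = m"
  proof (rule infsum_exhaustion[where X = "\<lambda>n. Pow {1..n}"])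
    show "0 \<le> real (\<Sum>F) * x ^ \<Sum>F / ZR x" for F
      using x ZR_LIMSEQ(2)[OF x] by (intro divide_nonneg_pos mult_nonneg_nonneg zero_le_power of_nat_0_le_iff)
    show "incseq (\<lambda>n. Pow {1..n::nat})" by (rule incseq_SucI) auto
    show "Pow {1..n} \<subseteq> part_sets" for n by (auto simp: part_sets_def intro: finite_subset)
    show "\<exists>n. \<F> \<subseteq> Pow {1..n}" if "finite \<F>" "\<F> \<subseteq> part_sets" for \<F>
    proof -
      have "finite (\<Union>\<F>)" using that by (auto simp: part_sets_def)
      then obtain n where n: "\<forall>y\<in>\<Union>\<F>. y \<le> n" using finite_nat_set_iff_bounded_le by auto
      moreover have "0 \<notin> \<Union>\<F>" using that by (auto simp: part_sets_def)
      ultimately have "\<F> \<subseteq> Pow {1..n}" by (force simp: Suc_le_eq intro!: gr0I)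
      then show ?thesis by blast
    qed
    have "(\<lambda>n. (\<Prod>k<n. 1 + x ^ Suc k) * (\<Sum>k<n. real (Suc k) * x ^ Suc k / (1 + x ^ Suc k)) / ZR x)
        \<longlonglongrightarrow> ZR x * m / ZR x"
      using s ZR_LIMSEQ[OF x] by (intro tendsto_intros) (auto simp: sums_def)
    then show "(\<lambda>n. \<Sum>F\<in>Pow {1..n}. real (\<Sum>F) * x ^ \<Sum>F / ZR x) \<longlonglongrightarrow> m"
      using ZR_LIMSEQ(2)[OF x] sum_subsets_power(2)[OF x(1)]
      by (simp add: sum_divide_distrib[symmetric])
  qed simp
  finally show ?thesis .
qed

section \<open>Lambert series and their asymptotics\<close>

lemma sums_swap_nonneg:
  fixes f :: "nat \<Rightarrow> nat \<Rightarrow> real"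
  assumes nonneg: "\<And>i j. 0 \<le> f i j" and row: "\<And>i. f i sums g i" and col: "\<And>j. (\<lambda>i. f i j) sums h j"
    and g: "g sums S"
  shows "h sums S"
proof -
  have g0: "0 \<le> g i" for i using sums_le[OF _ sums_zero row[of i]] nonneg by simp
  have row': "((\<lambda>y. (case_prod f) (x, y)) has_sum g x) UNIV" for x
    using sums_nonneg_imp_has_sum[OF row nonneg] by simp
  have g': "(g has_sum S) UNIV" by (rule sums_nonneg_imp_has_sum[OF g g0])
  have "case_prod f summable_on Sigma UNIV (\<lambda>_. UNIV)"
    by (rule summable_on_SigmaI[OF row']) (use g' nonneg in \<open>auto intro: has_sum_imp_summable\<close>)
  then have "(case_prod f has_sum S) (Sigma UNIV (\<lambda>_. UNIV))"
    using has_sum_SigmaI[OF row' g'] by simp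
  then have "((\<lambda>(x, y). f y x) has_sum S) (Sigma UNIV (\<lambda>_. UNIV))"
    by (subst (asm) has_sum_swap) (simp add: case_prod_unfold)
  then have "(h has_sum S) UNIV"
    by (rule has_sum_SigmaD) (use sums_nonneg_imp_has_sum[OF col nonneg] in simp)
  then show ?thesis by (rule has_sum_imp_sums)
qed

text \<open>The Lambert series of \<open>k x^k / (1 - x^k)\<close> after exchanging summations. In
  this form each term has an explicit limit after multiplication by
  \<open>(1 - x)^2\<close>.\<close>

definition lambert :: "real \<Rightarrow> real" where
  "lambert x = (\<Sum>j. x ^ Suc j / (1 - x ^ Suc j)\<^sup>2)"

definition mean_series :: "real \<Rightarrow> real" where
  "mean_series x = (\<Sum>k. real (Suc k) * x ^ Suc k / (1 + x ^ Suc k))"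

lemma power_Suc_lt_one: "0 \<le> (x::real) \<Longrightarrow> x < 1 \<Longrightarrow> x ^ Suc k < 1"
  using power_Suc_le_self[of x k] by linarith

text \<open>Both series are iterated sums of the nonnegative double series \<open>k x^(i k)\<close>,
  once over \<open>k\<close> first and once over \<open>i\<close> first.\<close>

lemma lambert_sums:
  fixes x :: real
  assumes x: "0 \<le> x" "x < 1"
  shows "(\<lambda>j. x ^ Suc j / (1 - x ^ Suc j)\<^sup>2) sums lambert x"
    "(\<lambda>k. real (Suc k) * x ^ Suc k / (1 - x ^ Suc k)) sums lambert x"
proof -
  have x1: "0 \<le> x ^ Suc j" "x ^ Suc j < 1" "x ^ Suc j \<le> x" for j
    using x power_Suc_lt_one[of x j] power_Suc_le_self[of x j] by simp_all
  have "summable (\<lambda>j. x ^ Suc j / (1 - x ^ Suc j)\<^sup>2)"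
  proof (rule summable_comparison_test)
    show "summable (\<lambda>j. x ^ Suc j * (1 / (1 - x)\<^sup>2))"
      using x by (intro summable_mult2) (simp add: summable_mult)
    have "norm (x ^ Suc j / (1 - x ^ Suc j)\<^sup>2) \<le> x ^ Suc j * (1 / (1 - x)\<^sup>2)" for j
    proof -
      have "1 / (1 - x ^ Suc j)\<^sup>2 \<le> 1 / (1 - x)\<^sup>2"
        using x x1[of j] by (intro divide_left_mono power_mono mult_pos_pos zero_less_power) auto
      then have "x ^ Suc j * (1 / (1 - x ^ Suc j)\<^sup>2) \<le> x ^ Suc j * (1 / (1 - x)\<^sup>2)"
        by (rule mult_left_mono) (rule x1)
      then show ?thesis using x1[of j] by simp
    qed
    then show "\<exists>N. \<forall>n\<ge>N. norm (x ^ Suc n / (1 - x ^ Suc n)\<^sup>2) \<le> x ^ Suc n * (1 / (1 - x)\<^sup>2)" by blast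
  qed
  then show 1: "(\<lambda>j. x ^ Suc j / (1 - x ^ Suc j)\<^sup>2) sums lambert x"
    unfolding lambert_def by (rule summable_sums)
  have geo: "(\<lambda>k. y ^ Suc k) sums (y / (1 - y))" if "0 \<le> y" "y < 1" for y :: real
    using sums_mult[OF geometric_sums[of y], of y] that by simp
  show "(\<lambda>k. real (Suc k) * x ^ Suc k / (1 - x ^ Suc k)) sums lambert x"
  proof (rule sums_swap_nonneg[OF _ _ _ 1])
    fix i j
    show "(\<lambda>k. real (Suc k) * (x ^ Suc i) ^ Suc k) sums (x ^ Suc i / (1 - x ^ Suc i)\<^sup>2)"
      using sums_mult[OF geometric_deriv_sums[of "x ^ Suc i"], of "x ^ Suc i"] x1[of i]
      by (simp add: mult_ac)
    have c: "(\<lambda>i. (x ^ Suc i) ^ Suc j) = (\<lambda>i. (x ^ Suc j) ^ Suc i)"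
    proof
      fix i show "(x ^ Suc i) ^ Suc j = (x ^ Suc j) ^ Suc i" by (metis mult.commute power_mult)
    qed
    have "(\<lambda>i. (x ^ Suc i) ^ Suc j) sums (x ^ Suc j / (1 - x ^ Suc j))"
      unfolding c by (rule geo[OF x1(1,2)])
    from sums_mult[OF this, of "real (Suc j)"]
    show "(\<lambda>i. real (Suc j) * (x ^ Suc i) ^ Suc j) sums (real (Suc j) * x ^ Suc j / (1 - x ^ Suc j))"
      by (simp only: times_divide_eq_right)
    show "0 \<le> real (Suc j) * (x ^ Suc i) ^ Suc j" using x1[of i] by simp
  qed
qed

text \<open>With \<open>y = x^k\<close> one has
  \<open>y / (1 + y) = y / (1 - y) - 2 y^2 / (1 - y^2)\<close>, which reduces distinct parts to
  unrestricted ones.\<close>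

lemma mean_series_sums:
  fixes x :: real
  assumes x: "0 \<le> x" "x < 1"
  shows "(\<lambda>k. real (Suc k) * x ^ Suc k / (1 + x ^ Suc k)) sums mean_series x"
    "mean_series x = lambert x - 2 * lambert (x\<^sup>2)"
proof -
  have x2: "0 \<le> x\<^sup>2" "x\<^sup>2 < 1" using x by (auto simp: power_less_one_iff)
  have eq: "real (Suc k) * x ^ Suc k / (1 - x ^ Suc k) - 2 * (real (Suc k) * (x\<^sup>2) ^ Suc k / (1 - (x\<^sup>2) ^ Suc k))
      = real (Suc k) * x ^ Suc k / (1 + x ^ Suc k)" for k
  proof -
    define y where "y = x ^ Suc k"
    have y: "0 \<le> y" "y < 1" "(x\<^sup>2) ^ Suc k = y * y"
      using x power_Suc_lt_one[of x k] by (auto simp: y_def power2_eq_square power_mult_distrib)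
    have f: "1 - y * y = (1 - y) * (1 + y)" by (simp add: algebra_simps)
    show ?thesis unfolding y(3) y_def[symmetric] f using y by (simp add: divide_simps) (simp add: algebra_simps)
  qed
  have "(\<lambda>k. real (Suc k) * x ^ Suc k / (1 + x ^ Suc k)) sums (lambert x - 2 * lambert (x\<^sup>2))"
    using sums_diff[OF lambert_sums(2)[OF x] sums_mult[OF lambert_sums(2)[OF x2], of 2]] by (simp only: eq)
  then show "(\<lambda>k. real (Suc k) * x ^ Suc k / (1 + x ^ Suc k)) sums mean_series x"
    "mean_series x = lambert x - 2 * lambert (x\<^sup>2)"
    by (auto simp: mean_series_def sums_iff)
qed

text \<open>Only the first half of the geometric sum is used: its terms are at least \<open>x ^ ((m-1)/2)\<close>.\<close>

lemma geometric_sum_square_bound: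
  fixes x :: real
  assumes x: "0 \<le> x" "x \<le> 1"
  shows "(real m)\<^sup>2 * x ^ m \<le> 4 * (\<Sum>i<m. x ^ i)\<^sup>2"
proof (cases "m = 0")
  case False
  define k where "k = (m + 1) div 2"
  have k: "real m \<le> 2 * real k" "k \<le> m" "2 * (k - 1) \<le> m" using False by (auto simp: k_def)
  have "real k * x ^ (k - 1) = (\<Sum>i<k. x ^ (k - 1))" by simp
  also have "\<dots> \<le> (\<Sum>i<k. x ^ i)" using x by (intro sum_mono power_decreasing) auto
  also have "\<dots> \<le> (\<Sum>i<m. x ^ i)" using x k by (intro sum_mono2) auto
  finally have "(real k * x ^ (k - 1))\<^sup>2 \<le> (\<Sum>i<m. x ^ i)\<^sup>2" using x by (intro power_mono) auto
  moreover have "(real m)\<^sup>2 * x ^ m \<le> (2 * real k)\<^sup>2 * x ^ (2 * (k - 1))"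
    using k x by (intro mult_mono power_mono power_decreasing) auto
  moreover have "(2 * real k)\<^sup>2 * x ^ (2 * (k - 1)) = 4 * (real k * x ^ (k - 1))\<^sup>2"
    by (simp add: power_mult_distrib power_mult[symmetric] mult.commute)
  ultimately show ?thesis by linarith
qed simp

lemma one_minus_power: "(1 - x) * (\<Sum>i<m. x ^ i) = 1 - (x::real) ^ m"
  by (simp add: one_diff_power_eq)

text \<open>Factoring \<open>1 - x^m\<close> into \<open>1 - x\<close> and a geometric sum cancels
  \<open>(1 - x)^2\<close>. The term with \<open>m = j + 1\<close> then tends to
  \<open>1 / m^2\<close> and is dominated by \<open>4 / m^2\<close>, so Tannery's theorem gives the
  sum of the inverse squares.\<close>

lemma lambert_asymptotics: "((\<lambda>x. (1 - x)\<^sup>2 * lambert x) \<longlongrightarrow> pi\<^sup>2 / 6) (at_left 1)"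
proof -
  define a where "a j x = (1 - x)\<^sup>2 * (x ^ Suc j / (1 - x ^ Suc j)\<^sup>2)" for j and x :: real
  have ev: "\<forall>\<^sub>F x in at_left (1::real). 0 < x \<and> x < 1"
    using eventually_at_left_real[of 0 1] by (auto elim: eventually_mono)
  have a_eq: "a j x = x ^ Suc j / (\<Sum>i<Suc j. x ^ i)\<^sup>2" if "0 < x" "x < 1" for j x
  proof -
    have "1 - x ^ Suc j = (1 - x) * (\<Sum>i<Suc j. x ^ i)" by (rule one_minus_power[symmetric])
    then show ?thesis using that unfolding a_def by (simp add: power_mult_distrib del: sum.lessThan_Suc)
  qed
  have lim: "((\<lambda>x. a j x) \<longlongrightarrow> 1 / (real (j + 1))\<^sup>2) (at_left 1)" for j
  proof -
    have "((\<lambda>x::real. x ^ Suc j / (\<Sum>i<Suc j. x ^ i)\<^sup>2) \<longlongrightarrow> 1 ^ Suc j / (\<Sum>i<Suc j. 1 ^ i)\<^sup>2) (at_left 1)"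
      by (intro tendsto_intros) (simp del: sum.lessThan_Suc)
    then have "((\<lambda>x::real. x ^ Suc j / (\<Sum>i<Suc j. x ^ i)\<^sup>2) \<longlongrightarrow> 1 / (real (j + 1))\<^sup>2) (at_left 1)"
      by (simp del: sum.lessThan_Suc)
    then show ?thesis
      by (rule Lim_transform_eventually) (use ev a_eq in \<open>auto elim!: eventually_mono\<close>)
  qed
  have bound: "norm (a j x) \<le> 4 * (1 / (real (j + 1))\<^sup>2)" if x: "0 < x" "x < 1" for j x
  proof -
    have s: "0 < (\<Sum>i<Suc j. x ^ i)" using x by (intro sum_pos) auto
    have "(real (Suc j))\<^sup>2 * x ^ Suc j \<le> 4 * (\<Sum>i<Suc j. x ^ i)\<^sup>2"
      using geometric_sum_square_bound[of x "Suc j"] x by auto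
    then have "x ^ Suc j / (\<Sum>i<Suc j. x ^ i)\<^sup>2 \<le> 4 / (real (Suc j))\<^sup>2"
      using s by (simp add: divide_simps mult.commute del: sum.lessThan_Suc power_Suc of_nat_Suc)
    then show ?thesis unfolding a_eq[OF x] using x by (simp del: sum.lessThan_Suc power_Suc)
  qed
  have "((\<lambda>x. suminf (\<lambda>k. a k x)) \<longlongrightarrow> (\<Sum>j. 1 / (real (j + 1))\<^sup>2)) (at_left 1)"
  proof (rule tannerys_theorem[THEN conjunct2, THEN conjunct2])
    show "\<forall>\<^sub>F (k, x) in sequentially \<times>\<^sub>F at_left 1. norm (a k x) \<le> 4 * (1 / (real (k + 1))\<^sup>2)"
      by (rule eventually_mono[OF eventually_prodI[OF eventually_True ev]]) (use bound in auto)
    show "summable (\<lambda>k. 4 * (1 / (real (k + 1))\<^sup>2))"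
      using inverse_squares_sums by (intro summable_mult) (auto simp: sums_iff)
  qed (use lim in auto)
  also have "(\<Sum>j. 1 / (real (j + 1))\<^sup>2) = pi\<^sup>2 / 6"
    using inverse_squares_sums by (simp add: sums_iff)
  finally show ?thesis
  proof (rule Lim_transform_eventually)
    show "\<forall>\<^sub>F x in at_left 1. (\<Sum>k. a k x) = (1 - x)\<^sup>2 * lambert x"
      using ev
    proof eventually_elim
      case (elim x)
      then show ?case
        using sums_mult[OF lambert_sums(1)[of x], of "(1 - x)\<^sup>2"] by (simp add: a_def sums_iff)
    qed
  qed
qed

text \<open>As \<open>(1 - x^2)^2 = (1 - x)^2 (1 + x)^2\<close> and \<open>(1 + x)^2\<close> tends
  to 4, the limit is \<open>pi^2 / 6 - 2 (pi^2 / 6) / 4\<close>.\<close>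

lemma mean_series_asymptotics: "((\<lambda>x. (1 - x)\<^sup>2 * mean_series x) \<longlongrightarrow> pi\<^sup>2 / 12) (at_left 1)"
proof -
  have ev: "\<forall>\<^sub>F x in at_left (1::real). 0 < x \<and> x < 1"
    using eventually_at_left_real[of 0 1] by (auto elim: eventually_mono)
  have "filterlim (\<lambda>x::real. x\<^sup>2) (at_left 1) (at_left 1)"
    unfolding filterlim_at
  proof
    show "\<forall>\<^sub>F x in at_left (1::real). x\<^sup>2 \<in> {..<1} \<and> x\<^sup>2 \<noteq> 1"
      using ev by eventually_elim (auto simp: power_less_one_iff power2_eq_1_iff)
    have "((\<lambda>x::real. x\<^sup>2) \<longlongrightarrow> 1\<^sup>2) (at_left 1)" by (intro tendsto_intros)
    then show "((\<lambda>x::real. x\<^sup>2) \<longlongrightarrow> 1) (at_left 1)" by simp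
  qed
  from filterlim_compose[OF lambert_asymptotics this]
  have 2: "((\<lambda>x. (1 - x\<^sup>2)\<^sup>2 * lambert (x\<^sup>2)) \<longlongrightarrow> pi\<^sup>2 / 6) (at_left 1)" .
  have "((\<lambda>x. (1 - x)\<^sup>2 * lambert x - 2 * ((1 - x\<^sup>2)\<^sup>2 * lambert (x\<^sup>2)) / (1 + x)\<^sup>2)
      \<longlongrightarrow> pi\<^sup>2 / 6 - 2 * (pi\<^sup>2 / 6) / (1 + 1)\<^sup>2) (at_left 1)"
    by (intro tendsto_intros lambert_asymptotics 2) auto
  then have "((\<lambda>x. (1 - x)\<^sup>2 * lambert x - 2 * ((1 - x\<^sup>2)\<^sup>2 * lambert (x\<^sup>2)) / (1 + x)\<^sup>2) \<longlongrightarrow> pi\<^sup>2 / 12) (at_left 1)"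
    by (simp add: power2_eq_square)
  then show ?thesis
  proof (rule Lim_transform_eventually)
    show "\<forall>\<^sub>F x in at_left 1. (1 - x)\<^sup>2 * lambert x - 2 * ((1 - x\<^sup>2)\<^sup>2 * lambert (x\<^sup>2)) / (1 + x)\<^sup>2 = (1 - x)\<^sup>2 * mean_series x"
      using ev
    proof eventually_elim
      case (elim x)
      have "(1 - x\<^sup>2)\<^sup>2 = (1 - x)\<^sup>2 * (1 + x)\<^sup>2" by (simp add: power2_eq_square algebra_simps)
      with elim show ?case
        by (simp add: mean_series_sums(2) right_diff_distrib)
    qed
  qed
qed

section \<open>The parameter of the dynamics and its rate of convergence\<close>

lemma mean_series_strict_mono:
  fixes x y :: real
  assumes "0 \<le> x" "x < y" "y < 1"
  shows "mean_series x < mean_series y"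
proof -
  have s: "(\<lambda>k. real (Suc k) * y ^ Suc k / (1 + y ^ Suc k) - real (Suc k) * x ^ Suc k / (1 + x ^ Suc k))
      sums (mean_series y - mean_series x)"
    using assms by (intro sums_diff mean_series_sums) auto
  have less: "real (Suc k) * x ^ Suc k / (1 + x ^ Suc k) < real (Suc k) * y ^ Suc k / (1 + y ^ Suc k)" for k
  proof -
    have "0 \<le> x ^ Suc k" using assms by simp
    moreover have "x ^ Suc k < y ^ Suc k" using assms by (intro power_strict_mono) auto
    ultimately have "x ^ Suc k / (1 + x ^ Suc k) < y ^ Suc k / (1 + y ^ Suc k)"
      by (simp add: divide_simps algebra_simps del: power_Suc)
    then have "real (Suc k) * (x ^ Suc k / (1 + x ^ Suc k)) < real (Suc k) * (y ^ Suc k / (1 + y ^ Suc k))"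
      by (rule mult_strict_left_mono) simp
    then show ?thesis by simp
  qed
  have "0 < mean_series y - mean_series x"
    using suminf_pos[OF sums_summable[OF s]] less sums_unique[OF s] by (simp del: power_Suc of_nat_Suc)
  then show ?thesis by simp
qed

lemma mean_series_continuous:
  assumes r: "0 \<le> r" "r < 1"
  shows "continuous_on {0..r} mean_series"
  unfolding mean_series_def[abs_def]
proof (rule uniform_limit_theorem[OF _ Weierstrass_m_test])
  show "summable (\<lambda>k. real (Suc k) * r ^ Suc k)"
    using sums_summable[OF sums_mult[OF geometric_deriv_sums[of r], of r]] r by (simp add: mult_ac)
  show "norm (real (Suc k) * x ^ Suc k / (1 + x ^ Suc k)) \<le> real (Suc k) * r ^ Suc k" if "x \<in> {0..r}" for k x
  proof -
    have x: "0 \<le> x ^ Suc k" "x ^ Suc k \<le> r ^ Suc k" using that by (auto simp del: power_Suc intro: power_mono)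
    have "x ^ Suc k / (1 + x ^ Suc k) \<le> x ^ Suc k / 1" using x by (intro divide_left_mono) auto
    then have "real (Suc k) * (x ^ Suc k / (1 + x ^ Suc k)) \<le> real (Suc k) * r ^ Suc k"
      using x by (intro mult_left_mono) auto
    then show ?thesis using x by (simp del: power_Suc of_nat_Suc)
  qed
  have nz: "1 + x ^ Suc k \<noteq> 0" if "x \<in> {0..r}" for x :: real and k
    using that zero_le_power[of x "Suc k"] by (auto simp del: power_Suc zero_le_power)
  show "\<forall>\<^sub>F n in sequentially. continuous_on {0..r} (\<lambda>x. \<Sum>i<n. real (Suc i) * x ^ Suc i / (1 + x ^ Suc i))"
    using nz by (intro always_eventually allI continuous_intros) auto
qed simp

lemma mean_series_0: "mean_series 0 = 0"
  by (simp add: mean_series_def)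

lemma mean_n_eq_mean_series: "0 \<le> x \<Longrightarrow> x < 1 \<Longrightarrow> mean_n x = mean_series x"
  by (rule mean_n_eq[OF _ _ mean_series_sums(1)])

lemma mean_series_unbounded: "\<exists>r. 0 < r \<and> r < 1 \<and> B \<le> mean_series r"
proof -
  have ev: "\<forall>\<^sub>F x in at_left (1::real). 0 < x \<and> x < 1"
    using eventually_at_left_real[of 0 1] by (auto elim: eventually_mono)
  have "\<forall>\<^sub>F x in at_left 1. pi\<^sup>2 / 24 < (1 - x)\<^sup>2 * mean_series x"
    by (rule order_tendstoD(1)[OF mean_series_asymptotics]) simp
  moreover have "((\<lambda>x::real. (1 - x)\<^sup>2 * B) \<longlongrightarrow> (1 - 1)\<^sup>2 * B) (at_left 1)"
    by (intro tendsto_intros)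
  then have "((\<lambda>x::real. (1 - x)\<^sup>2 * B) \<longlongrightarrow> 0) (at_left 1)" by simp
  then have "\<forall>\<^sub>F x in at_left 1. (1 - x)\<^sup>2 * B < pi\<^sup>2 / 24"
    by (rule order_tendstoD(2)) simp
  ultimately have "\<forall>\<^sub>F x in at_left (1::real). 0 < x \<and> x < 1 \<and> B \<le> mean_series x"
    using ev
  proof eventually_elim
    case (elim x)
    then have "(1 - x)\<^sup>2 * B \<le> (1 - x)\<^sup>2 * mean_series x" by linarith
    with elim show ?case by simp
  qed
  from eventually_happens[OF this] show ?thesis by auto
qed

text \<open>The intermediate value theorem gives existence and strict monotonicity gives uniqueness;
  both are required to evaluate the definite description in \<open>epsN\<close>.\<close>

lemma epsN_props:
  assumes N: "1 \<le> N"
  shows "0 < epsN N" "epsN N < 1" "mean_series (epsN N) = (real N)\<^sup>2"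
proof -
  obtain r where r: "0 < r" "r < 1" "(real N)\<^sup>2 \<le> mean_series r"
    using mean_series_unbounded by blast
  have "mean_series 0 \<le> (real N)\<^sup>2" by (simp add: mean_series_0)
  then obtain x where x: "0 \<le> x" "x \<le> r" "mean_series x = (real N)\<^sup>2"
    using IVT'[of mean_series 0 "(real N)\<^sup>2" r] r mean_series_continuous[of r] by auto
  have "x \<noteq> 0" using x(3) N mean_series_0 by auto
  then have x': "0 < x" "x < 1" using x r by auto
  have uniq: "y = x" if y: "0 < y \<and> y < 1 \<and> mean_n y = (real N)\<^sup>2" for y
  proof -
    have "mean_series y = mean_series x" using y x(3) mean_n_eq_mean_series[of y] by simp
    then show ?thesis
      using mean_series_strict_mono[of x y] mean_series_strict_mono[of y x] y x'
      by (cases x y rule: linorder_cases) simp_all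
  qed
  have "epsN N = x"
    unfolding epsN_def
    by (rule the_equality) (use uniq x x' mean_n_eq_mean_series in auto)
  with x x' show "0 < epsN N" "epsN N < 1" "mean_series (epsN N) = (real N)\<^sup>2" by auto
qed

lemma filterlim_epsN: "filterlim epsN (at_left 1) sequentially"
proof -
  have "\<forall>\<^sub>F N in sequentially. r < epsN N" if "r < 1" for r
  proof -
    define s where "s = max r 0"
    have s: "0 \<le> s" "s < 1" "r \<le> s" using that by (auto simp: s_def)
    have "\<forall>\<^sub>F N in sequentially. mean_series s < real N"
      using filterlim_real_sequentially unfolding filterlim_at_top_dense by blast
    then show ?thesis
      using eventually_ge_at_top[of 1]
    proof eventually_elim
      case (elim N)
      note e = epsN_props[OF elim(2)]
      have "1 * real N \<le> real N * real N" using elim(2) by (intro mult_right_mono) auto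
      then have less: "mean_series s < mean_series (epsN N)"
        using elim(1) e(3) unfolding power2_eq_square by linarith
      have "s < epsN N"
      proof (rule ccontr)
        assume "\<not> s < epsN N"
        then have "mean_series (epsN N) \<le> mean_series s"
          using mean_series_strict_mono[of "epsN N" s] e s by (cases "epsN N = s") auto
        with less show False by simp
      qed
      with s show ?case by simp
    qed
  qed
  moreover have "\<forall>\<^sub>F N in sequentially. epsN N < 1"
    using eventually_ge_at_top[of 1] by eventually_elim (rule epsN_props)
  ultimately show ?thesis
    unfolding filterlim_at
    by (auto intro!: order_tendstoI elim: eventually_mono)
qed

definition beta :: real where "beta = pi / sqrt 12"

text \<open>The upper bound fixes all exponential weights: \<open>betaN\<close> is eventually at
  most 1, and then the Gaertner variable grows at most like \<open>exp (|y| / 2)\<close>.\<close>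

lemma beta_bounds: "0 < beta" "beta < 1"
proof -
  show "0 < beta" by (simp add: beta_def)
  have "pi\<^sup>2 < 12"
  proof -
    have "pi < 3.2" using pi_approx by simp
    then have "pi\<^sup>2 < 3.2\<^sup>2" by (intro power_strict_mono) auto
    then show ?thesis by (simp add: power2_eq_square)
  qed
  then have "pi < sqrt 12" by (intro real_less_rsqrt)
  then show "beta < 1" by (simp add: beta_def)
qed

text \<open>The mean size is \<open>N^2\<close> by choice of the parameter and asymptotically
  \<open>(pi^2 / 12) / (1 - \<epsilon>)^2\<close>; the square root of this relation is the
  claim.\<close>

lemma epsN_rate: "(\<lambda>N. real N * (1 - epsN N)) \<longlonglongrightarrow> beta"
proof -
  have "(\<lambda>N. sqrt ((1 - epsN N)\<^sup>2 * mean_series (epsN N))) \<longlonglongrightarrow> sqrt (pi\<^sup>2 / 12)"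
    by (rule tendsto_real_sqrt[OF filterlim_compose[OF mean_series_asymptotics filterlim_epsN]])
  moreover have "sqrt (pi\<^sup>2 / 12) = beta" by (simp add: beta_def real_sqrt_divide)
  moreover have "\<forall>\<^sub>F N in sequentially. sqrt ((1 - epsN N)\<^sup>2 * mean_series (epsN N)) = real N * (1 - epsN N)"
    using eventually_ge_at_top[of 1]
  proof eventually_elim
    case (elim N)
    then show ?case using epsN_props[OF elim] by (simp add: real_sqrt_mult)
  qed
  ultimately show ?thesis using Lim_transform_eventually by fastforce
qed

definition gbase :: "nat \<Rightarrow> real" where "gbase N = 1 / sqrt (epsN N)"

text \<open>The value of \<open>\<beta>\<close> at finite \<open>N\<close>: at
  \<open>u = x / N\<close> the Gaertner variable is \<open>exp (betaN N (u / 2 + h / N))\<close>,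
  the macroscopic transform of the rescaled height.\<close>

definition betaN :: "nat \<Rightarrow> real" where "betaN N = 2 * real N * ln (gbase N)"

lemma gbase_props:
  assumes "1 \<le> N"
  shows "1 < gbase N" "epsN N = 1 / (gbase N)\<^sup>2" "0 < betaN N" "gbase N = exp (betaN N / (2 * real N))"
proof -
  note e = epsN_props[OF assms]
  show g: "1 < gbase N" using e by (simp add: gbase_def)
  show "epsN N = 1 / (gbase N)\<^sup>2" using e by (simp add: gbase_def power_divide)
  show "0 < betaN N" "gbase N = exp (betaN N / (2 * real N))"
    using g assms by (auto simp: betaN_def)
qed

lemma betaN_limit: "betaN \<longlonglongrightarrow> beta"
proof -
  have "((\<lambda>x::real. ln x) has_real_derivative 1) (at 1)" by (auto intro!: derivative_eq_intros)
  then have "((\<lambda>x::real. (ln x - ln 1) / (x - 1)) \<longlongrightarrow> 1) (at 1)" unfolding has_field_derivative_iff .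
  then have "((\<lambda>x::real. ln x / (x - 1)) \<longlongrightarrow> 1) (at_left 1)"
    by (simp add: filterlim_at_split)
  from filterlim_compose[OF this filterlim_epsN]
  have "(\<lambda>N. (ln (epsN N) / (epsN N - 1)) * (real N * (1 - epsN N))) \<longlonglongrightarrow> 1 * beta"
    by (rule tendsto_mult[OF _ epsN_rate])
  then have l: "(\<lambda>N. (ln (epsN N) / (epsN N - 1)) * (real N * (1 - epsN N))) \<longlonglongrightarrow> beta" by simp
  have "\<forall>\<^sub>F N in sequentially. (ln (epsN N) / (epsN N - 1)) * (real N * (1 - epsN N)) = betaN N"
    using eventually_ge_at_top[of 1]
  proof eventually_elim
    case (elim N)
    note e = epsN_props[OF elim]
    have "ln (gbase N) = - ln (epsN N) / 2" using e by (simp add: gbase_def ln_div ln_sqrt)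
    moreover have "ln (epsN N) / (epsN N - 1) * (real N * (1 - epsN N)) = - ln (epsN N) * real N"
      using e by (simp add: field_simps)
    ultimately show ?case by (simp add: betaN_def)
  qed
  then show ?thesis by (rule Lim_transform_eventually[OF l])
qed

section \<open>The second moment estimate\<close>

lemma weighted_cauchy_schwarz:
  fixes k f :: "'a \<Rightarrow> real"
  assumes k: "integrable M k" "\<And>x. 0 \<le> k x" and kf: "integrable M (\<lambda>x. k x * f x)"
    and kf2: "integrable M (\<lambda>x. k x * (f x)\<^sup>2)"
  shows "(LINT x|M. k x * f x)\<^sup>2 \<le> (LINT x|M. k x) * (LINT x|M. k x * (f x)\<^sup>2)"
proof -
  define X where "X = (LINT x|M. k x * f x)"
  define K where "K = (LINT x|M. k x)"
  define W where "W = (LINT x|M. k x * (f x)\<^sup>2)"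
  have q: "0 \<le> W - 2 * s * X + s\<^sup>2 * K" for s
  proof -
    have "0 \<le> (LINT x|M. k x * (f x - s)\<^sup>2)"
      by (rule Bochner_Integration.integral_nonneg) (simp add: k)
    also have "(\<lambda>x. k x * (f x - s)\<^sup>2) = (\<lambda>x. k x * (f x)\<^sup>2 - 2 * s * (k x * f x) + s\<^sup>2 * k x)"
      by (auto simp: power2_eq_square algebra_simps)
    also have "(LINT x|M. k x * (f x)\<^sup>2 - 2 * s * (k x * f x) + s\<^sup>2 * k x) = W - 2 * s * X + s\<^sup>2 * K"
      unfolding X_def K_def W_def using k(1) kf kf2 by simp
    finally show ?thesis .
  qed
  have K: "0 \<le> K" unfolding K_def by (rule Bochner_Integration.integral_nonneg) (simp add: k)
  have "X\<^sup>2 \<le> K * W"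
  proof (cases "K = 0")
    case True
    have "X = 0"
    proof (rule ccontr)
      assume "X \<noteq> 0"
      \<comment> \<open>For \<open>K = 0\<close> the polynomial is affine in \<open>s\<close>, and
        at this point its value is \<open>-1\<close>.\<close>
      then show False using q[of "(W + 1) / (2 * X)"] True by simp
    qed
    with True show ?thesis by simp
  next
    case False
    then have "0 \<le> K * (W - 2 * (X / K) * X + (X / K)\<^sup>2 * K)" using K q[of "X / K"] by simp
    also have "\<dots> = K * W - X\<^sup>2" using False by (simp add: field_simps power2_eq_square)
    finally show ?thesis by simp
  qed
  then show ?thesis by (simp add: X_def K_def W_def)
qed

text \<open>Rate 2 is calibrated to squares of Gaertner variables: these grow at most like
  \<open>exp |y|\<close>, which leaves the integrable factor \<open>exp (- |y|)\<close>.\<close>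

definition exp_decay :: "(real \<Rightarrow> real) \<Rightarrow> bool" where
  "exp_decay k \<longleftrightarrow> k \<in> borel_measurable borel \<and> (\<exists>C. \<forall>y. \<bar>k y\<bar> \<le> C * exp (- 2 * \<bar>y\<bar>))"

lemma exp_decay_integrable:
  assumes k: "exp_decay k" and f: "f \<in> borel_measurable borel" "\<And>y. \<bar>f y\<bar> \<le> B * exp \<bar>y\<bar>"
  shows "integrable lborel (\<lambda>y. k y * f y)"
proof -
  have [measurable]: "k \<in> borel_measurable borel" "f \<in> borel_measurable borel"
    using k f by (auto simp: exp_decay_def)
  obtain C where C: "\<And>y. \<bar>k y\<bar> \<le> C * exp (- 2 * \<bar>y\<bar>)" using k by (auto simp: exp_decay_def)
  have "integrable lborel (\<lambda>y. C * B * exp (- 1 * \<bar>y\<bar>))"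
    by (intro integrable_mult_right integrable_exp_neg_abs) simp
  then show ?thesis
  proof (rule Bochner_Integration.integrable_bound[OF _ _ AE_I2])
    fix y
    have "\<bar>k y * f y\<bar> \<le> (C * exp (- 2 * \<bar>y\<bar>)) * (B * exp \<bar>y\<bar>)"
      unfolding abs_mult by (rule mult_mono[OF C f(2)]) (use order_trans[OF abs_ge_zero C] in auto)
    also have "\<dots> = C * B * exp (- 1 * \<bar>y\<bar>)" by (simp add: flip: exp_add)
    finally show "norm (k y * f y) \<le> norm (C * B * exp (- 1 * \<bar>y\<bar>))" by simp
  qed measurable
qed

lemma exp_decay_weight: "exp_decay (\<lambda>y. exp (- 2 * \<bar>y\<bar>))"
  unfolding exp_decay_def by (intro conjI exI[of _ 1]) auto

lemma exp_decay_shift: "exp_decay k \<Longrightarrow> exp_decay (\<lambda>y. k (y + s))"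
proof -
  assume k: "exp_decay k"
  obtain C where C: "\<And>y. \<bar>k y\<bar> \<le> C * exp (- 2 * \<bar>y\<bar>)" using k by (auto simp: exp_decay_def)
  have C0: "0 \<le> C" using order_trans[OF abs_ge_zero C[of 0]] by simp
  have "\<bar>k (y + s)\<bar> \<le> (C * exp (2 * \<bar>s\<bar>)) * exp (- 2 * \<bar>y\<bar>)" for y
  proof -
    have "exp (- 2 * \<bar>y + s\<bar>) \<le> exp (2 * \<bar>s\<bar>) * exp (- 2 * \<bar>y\<bar>)"
      unfolding exp_add[symmetric] exp_le_cancel_iff using abs_triangle_ineq4[of "y + s" s] by simp
    from mult_left_mono[OF this C0] C[of "y + s"] show ?thesis by (simp add: mult.assoc)
  qed
  moreover have [measurable]: "k \<in> borel_measurable borel" using k by (auto simp: exp_decay_def)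
  have "(\<lambda>y. k (y + s)) \<in> borel_measurable borel" by measurable
  ultimately show ?thesis unfolding exp_decay_def by blast
qed

lemma integral_shift_lborel:
  fixes f :: "real \<Rightarrow> real"
  shows "(LINT y|lborel. f (y + s)) = (LINT y|lborel. f y)"
  by (subst lborel_integral_real_affine[where c = 1 and t = s]) (simp_all add: add.commute)

text \<open>At a fixed configuration the generator is a finite linear combination of values at
  configurations in \<open>Qset\<close>, so linearity of the integral suffices.\<close>

lemma gen_integral:
  assumes q: "q \<in> Qset" and int: "\<And>q. q \<in> Qset \<Longrightarrow> integrable M (\<lambda>y. k y * f q y)"
  shows "gen \<epsilon> (\<lambda>q. LINT y|M. k y * f q y) q = (LINT y|M. k y * gen \<epsilon> (\<lambda>q. f q y) q)"
    "integrable M (\<lambda>y. k y * gen \<epsilon> (\<lambda>q. f q y) q)"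
proof -
  have i0: "integrable M (\<lambda>y. k y * f q y)" by (rule int[OF q])
  have iu: "integrable M (\<lambda>y. k y * f (up_at q i) y)" if "i \<in> up_set q" for i
    by (rule int[OF up_at_in_Qset[OF q that]])
  have id: "integrable M (\<lambda>y. k y * f (down_at q i) y)" if "i \<in> down_set q" for i
    by (rule int[OF down_at_in_Qset[OF q that]])
  have eq: "(\<lambda>y. k y * gen \<epsilon> (\<lambda>q. f q y) q) =
      (\<lambda>y. (\<Sum>i\<in>up_set q. \<epsilon> * (k y * f (up_at q i) y - k y * f q y))
        + (\<Sum>i\<in>down_set q. k y * f (down_at q i) y - k y * f q y))"
    by (auto simp: gen_def distrib_left sum_distrib_left algebra_simps intro!: ext)
  have int1: "integrable M (\<lambda>y. \<Sum>i\<in>up_set q. \<epsilon> * (k y * f (up_at q i) y - k y * f q y))"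
    by (intro Bochner_Integration.integrable_sum integrable_mult_right Bochner_Integration.integrable_diff iu i0)
  have int2: "integrable M (\<lambda>y. \<Sum>i\<in>down_set q. k y * f (down_at q i) y - k y * f q y)"
    by (intro Bochner_Integration.integrable_sum Bochner_Integration.integrable_diff id i0)
  show "integrable M (\<lambda>y. k y * gen \<epsilon> (\<lambda>q. f q y) q)"
    unfolding eq by (intro Bochner_Integration.integrable_add int1 int2)
  have u: "(LINT y|M. \<epsilon> * (k y * f (up_at q i) y - k y * f q y)) = \<epsilon> * ((LINT y|M. k y * f (up_at q i) y) - (LINT y|M. k y * f q y))"
    if "i \<in> up_set q" for i
    by (simp only: integral_mult_right_zero Bochner_Integration.integral_diff[OF iu[OF that] i0])
  have s1: "(LINT y|M. (\<Sum>i\<in>up_set q. \<epsilon> * (k y * f (up_at q i) y - k y * f q y)))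
      = (\<Sum>i\<in>up_set q. \<epsilon> * ((LINT y|M. k y * f (up_at q i) y) - (LINT y|M. k y * f q y)))"
    by (subst Bochner_Integration.integral_sum)
      (intro integrable_mult_right Bochner_Integration.integrable_diff iu i0, assumption, simp only: u cong: sum.cong)
  have s2: "(LINT y|M. (\<Sum>i\<in>down_set q. k y * f (down_at q i) y - k y * f q y))
      = (\<Sum>i\<in>down_set q. (LINT y|M. k y * f (down_at q i) y) - (LINT y|M. k y * f q y))"
    by (subst Bochner_Integration.integral_sum)
      (intro Bochner_Integration.integrable_diff id i0, assumption, simp only: Bochner_Integration.integral_diff[OF id i0] cong: sum.cong)
  show "gen \<epsilon> (\<lambda>q. LINT y|M. k y * f q y) q = (LINT y|M. k y * gen \<epsilon> (\<lambda>q. f q y) q)"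
    unfolding eq Bochner_Integration.integral_add[OF int1 int2] s1 s2 by (simp only: gen_def)
qed

lemma exp_diff_bound:
  assumes "0 \<le> (x::real)"
  shows "exp x - exp (- x) \<le> 2 * x * exp x" "0 \<le> exp x - exp (- x)"
proof -
  have "1 - 2 * x \<le> exp (- (2 * x))" using exp_ge_add_one_self[of "- (2 * x)"] by simp
  then have "exp x * (1 - 2 * x) \<le> exp x * exp (- (2 * x))" by (intro mult_left_mono) auto
  also have "exp x * exp (- (2 * x)) = exp (- x)" by (simp flip: exp_add)
  finally show "exp x - exp (- x) \<le> 2 * x * exp x" by (simp add: algebra_simps)
  show "0 \<le> exp x - exp (- x)" using assms by simp
qed

text \<open>Taylor expansion to third order at both neighbours. First order terms cancel; the two
  remainders have different intermediate points and add up to at most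
  \<open>h^3 (B + B) / 6\<close>. After multiplication by \<open>N^2\<close> this is still of order
  \<open>1 / N\<close>.\<close>

lemma heat_kernel_second_difference:
  assumes t: "0 < t" and h: "0 < h"
    and B: "\<And>s. \<bar>s\<bar> \<le> h \<Longrightarrow> \<bar>heat_kernel3 t (z + s)\<bar> \<le> B"
  shows "\<bar>heat_kernel t (z + h) + heat_kernel t (z - h) - 2 * heat_kernel t z - h\<^sup>2 * heat_kernel2 t z\<bar> \<le> h ^ 3 * B"
proof -
  define d where "d n = (if n = (0::nat) then heat_kernel t else if n = 1 then heat_kernel1 t
      else if n = 2 then heat_kernel2 t else heat_kernel3 t)" for n
  have der: "\<forall>m x. m < 3 \<and> z - h \<le> x \<and> x \<le> z + h \<longrightarrow> (d m has_real_derivative d (Suc m) x) (at x)"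
    using DERIV_heat_kernel_space[OF t] by (auto simp: d_def less_Suc_eq numeral_3_eq_3)
  have d0: "d 0 = heat_kernel t" by (simp add: d_def)
  have T: "\<exists>s. \<bar>s\<bar> \<le> h \<and> heat_kernel t x = heat_kernel t z + heat_kernel1 t z * (x - z)
      + heat_kernel2 t z / 2 * (x - z)\<^sup>2 + heat_kernel3 t (z + s) / 6 * (x - z) ^ 3"
    if x: "x = z + h \<or> x = z - h" for x
  proof -
    obtain s where s: "if x < z then x < s \<and> s < z else z < s \<and> s < x"
      "heat_kernel t x = (\<Sum>m<3. d m z / fact m * (x - z) ^ m) + d 3 s / fact 3 * (x - z) ^ 3"
      using Taylor[of 3 d "heat_kernel t" "z - h" "z + h" z x] der d0 h x by auto
    have "\<bar>s - z\<bar> \<le> h" using s(1) x h by (auto split: if_splits)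
    then show ?thesis
      using s(2) by (intro exI[of _ "s - z"]) (simp add: d_def numeral_3_eq_3 fact_numeral lessThan_Suc power2_eq_square)
  qed
  obtain s1 where s1: "\<bar>s1\<bar> \<le> h" "heat_kernel t (z + h) = heat_kernel t z + heat_kernel1 t z * h
      + heat_kernel2 t z / 2 * h\<^sup>2 + heat_kernel3 t (z + s1) / 6 * h ^ 3"
    using T[of "z + h"] by auto
  obtain s2 where s2: "\<bar>s2\<bar> \<le> h" "heat_kernel t (z - h) = heat_kernel t z - heat_kernel1 t z * h
      + heat_kernel2 t z / 2 * h\<^sup>2 - heat_kernel3 t (z + s2) / 6 * h ^ 3"
    using T[of "z - h"] by auto
  have "heat_kernel t (z + h) + heat_kernel t (z - h) - 2 * heat_kernel t z - h\<^sup>2 * heat_kernel2 t z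
     = h ^ 3 * ((heat_kernel3 t (z + s1) - heat_kernel3 t (z + s2)) / 6)"
    unfolding s1(2) s2(2) by (simp add: field_simps)
  then have "\<bar>heat_kernel t (z + h) + heat_kernel t (z - h) - 2 * heat_kernel t z - h\<^sup>2 * heat_kernel2 t z\<bar>
     = \<bar>h ^ 3 * ((heat_kernel3 t (z + s1) - heat_kernel3 t (z + s2)) / 6)\<bar>" by (rule arg_cong)
  also have "\<dots> = h ^ 3 * \<bar>(heat_kernel3 t (z + s1) - heat_kernel3 t (z + s2)) / 6\<bar>"
    using h by (simp add: abs_mult)
  also have "\<dots> \<le> h ^ 3 * B"
    using B[OF s1(1)] B[OF s2(1)] h by (intro mult_left_mono) auto
  finally show ?thesis .
qed

text \<open>The Gaertner variable as a step function of the macroscopic coordinate. Lattice shifts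
  become translations by \<open>1 / N\<close>, so sums over sites can be treated as Lebesgue
  integrals.\<close>

definition cell :: "nat \<Rightarrow> real \<Rightarrow> config \<Rightarrow> real \<Rightarrow> real" where
  "cell N a q y = gaertner a q \<lfloor>real N * y\<rfloor>"

lemma borel_measurable_cell [measurable]: "cell N a q \<in> borel_measurable borel"
  unfolding cell_def[abs_def] by measurable

section \<open>Estimates at fixed \<open>N\<close>: cells, energy and jump noise\<close>

context
  fixes N :: nat and a b \<epsilon> :: real
  assumes N: "1 \<le> N" and b: "0 < b" "b \<le> 1" and a: "a = exp (b / (2 * real N))" and \<epsilon>: "\<epsilon> = 1 / a\<^sup>2"
begin

private definition h :: real where "h = 1 / real N"

lemma h_pos: "0 < h" "h \<le> 1" "real N * h = 1"
  using N by (auto simp: h_def)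

lemma a_ge_1: "1 \<le> a"
  using N b by (simp add: a)

lemma cell_pos: "0 < cell N a q y"
  unfolding cell_def using a_ge_1 by (intro gaertner_pos) simp

lemma cell_shift:
  "cell N a q (y + h) = gaertner a q (\<lfloor>real N * y\<rfloor> + 1)" "cell N a q (y - h) = gaertner a q (\<lfloor>real N * y\<rfloor> - 1)"
proof -
  have "real N * (y + h) = real N * y + of_int 1" "real N * (y - h) = real N * y - of_int 1"
    using h_pos by (simp_all add: algebra_simps)
  then have "\<lfloor>real N * (y + h)\<rfloor> = \<lfloor>real N * y\<rfloor> + 1" "\<lfloor>real N * (y - h)\<rfloor> = \<lfloor>real N * y\<rfloor> - 1"
    by (simp_all only: floor_add_int[symmetric] floor_diff_of_int)
  then show "cell N a q (y + h) = gaertner a q (\<lfloor>real N * y\<rfloor> + 1)" "cell N a q (y - h) = gaertner a q (\<lfloor>real N * y\<rfloor> - 1)"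
    by (simp_all only: cell_def)
qed

lemma a_power_bound: "real n \<le> real N * x + c \<Longrightarrow> 0 \<le> c \<Longrightarrow> c \<le> 2 \<Longrightarrow> 0 \<le> x \<Longrightarrow> a ^ n \<le> exp (x / 2 + 1)"
proof -
  assume n: "real n \<le> real N * x + c" and c: "0 \<le> c" "c \<le> 2" and x: "0 \<le> x"
  have "real n * (b / (2 * real N)) \<le> (real N * x + c) * (b / (2 * real N))"
    using n b N by (intro mult_right_mono) auto
  also have "\<dots> = b * (x / 2) + b * (c / (2 * real N))" using N by (simp add: field_simps)
  also have "\<dots> \<le> 1 * (x / 2) + 1 * 1"
  proof (intro add_mono mult_mono)
    show "c / (2 * real N) \<le> 1" using c N by (simp add: divide_le_eq)
  qed (use b x c in auto)
  finally show ?thesis unfolding a exp_of_nat_mult[symmetric] by simp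
qed

text \<open>The site contributes \<open>exp (|y| / 2)\<close> because \<open>b \<le> 1\<close>,
  rounding costs \<open>exp 1\<close>, and the height is at most its value at 0. The constant
  depends on \<open>q\<close>; the bound supplies integrability, not uniform control.\<close>

lemma cell_bound:
  assumes q: "q \<in> Qset"
  shows "\<bar>cell N a q y\<bar> \<le> (exp 1 * a ^ (2 * hgt q 0)) * exp (\<bar>y\<bar> / 2)"
proof -
  define n where "n = nat \<bar>\<lfloor>real N * y\<rfloor>\<bar>"
  have "real n \<le> \<bar>real N * y\<bar> + 1" unfolding n_def by linarith
  then have "real n \<le> real N * \<bar>y\<bar> + 1" by (simp add: abs_mult)
  then have "a ^ n \<le> exp (\<bar>y\<bar> / 2 + 1)" by (rule a_power_bound) auto
  moreover have "a ^ (2 * hgt q n) \<le> a ^ (2 * hgt q 0)"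
    using hgt_antimono_lipschitz[OF q, of 0 n] a_ge_1 by (intro power_increasing) auto
  ultimately have "a ^ n * a ^ (2 * hgt q n) \<le> exp (\<bar>y\<bar> / 2 + 1) * a ^ (2 * hgt q 0)"
    using a_ge_1 by (intro mult_mono) auto
  moreover have "cell N a q y = a ^ n * a ^ (2 * hgt q n)"
    by (simp add: cell_def gaertner_def n_def power_add)
  ultimately show ?thesis
    unfolding abs_of_pos[OF cell_pos] by (simp only: exp_add mult_ac)
qed

lemma integrable_cell:
  assumes q: "q \<in> Qset" and k: "exp_decay k"
  shows "integrable lborel (\<lambda>y. k y * cell N a q y)" "integrable lborel (\<lambda>y. k y * (cell N a q y)\<^sup>2)"
proof -
  define B where "B = exp 1 * a ^ (2 * hgt q 0)"
  have B: "0 \<le> B" using a_ge_1 by (simp add: B_def)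
  have c: "\<bar>cell N a q y\<bar> \<le> B * exp (\<bar>y\<bar> / 2)" for y using cell_bound[OF q] by (simp add: B_def)
  have "\<bar>cell N a q y\<bar> \<le> B * exp \<bar>y\<bar>" for y
    by (rule order_trans[OF c mult_left_mono[OF _ B]]) simp
  then show "integrable lborel (\<lambda>y. k y * cell N a q y)"
    by (intro exp_decay_integrable[OF k]) auto
  have "\<bar>(cell N a q y)\<^sup>2\<bar> \<le> B\<^sup>2 * exp \<bar>y\<bar>" for y
  proof -
    have "\<bar>cell N a q y\<bar>\<^sup>2 \<le> (B * exp (\<bar>y\<bar> / 2))\<^sup>2" by (intro power_mono c) simp
    also have "\<dots> = B\<^sup>2 * exp \<bar>y\<bar>" by (simp add: power_mult_distrib exp_double[symmetric])
    finally show ?thesis by simp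
  qed
  then show "integrable lborel (\<lambda>y. k y * (cell N a q y)\<^sup>2)"
    by (intro exp_decay_integrable[OF k]) auto
qed

lemma shift_cell:
  assumes q: "q \<in> Qset" and k: "exp_decay k"
  shows "(LINT y|lborel. k y * cell N a q (y + s)) = (LINT y|lborel. k (y - s) * cell N a q y)"
    "integrable lborel (\<lambda>y. k y * cell N a q (y + s))"
    "(LINT y|lborel. k y * (cell N a q (y + s))\<^sup>2) = (LINT y|lborel. k (y - s) * (cell N a q y)\<^sup>2)"
    "integrable lborel (\<lambda>y. k y * (cell N a q (y + s))\<^sup>2)"
proof -
  have ks: "exp_decay (\<lambda>y. k (y - s))" using exp_decay_shift[OF k, of "- s"] by simp
  show "(LINT y|lborel. k y * cell N a q (y + s)) = (LINT y|lborel. k (y - s) * cell N a q y)"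
    "(LINT y|lborel. k y * (cell N a q (y + s))\<^sup>2) = (LINT y|lborel. k (y - s) * (cell N a q y)\<^sup>2)"
    using integral_shift_lborel[of "\<lambda>y. k (y - s) * cell N a q y" s]
      integral_shift_lborel[of "\<lambda>y. k (y - s) * (cell N a q y)\<^sup>2" s] by simp_all
  show "integrable lborel (\<lambda>y. k y * cell N a q (y + s))" "integrable lborel (\<lambda>y. k y * (cell N a q (y + s))\<^sup>2)"
    using lborel_integrable_real_affine[OF integrable_cell(1)[OF q ks], of 1 s]
      lborel_integrable_real_affine[OF integrable_cell(2)[OF q ks], of 1 s] by (simp_all add: add.commute)
qed

text \<open>Summation by parts: translation invariance of Lebesgue measure moves the lattice
  operator of \<open>gen_gaertner\<close> from the cells to the smooth kernel.\<close>

lemma gen_cell_integral: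
  assumes q: "q \<in> Qset" and k: "exp_decay k"
  shows "gen \<epsilon> (\<lambda>q. LINT y|lborel. k y * cell N a q y) q
    = (LINT y|lborel. ((k (y + h) + k (y - h)) / a - (1 + 1 / a\<^sup>2) * k y) * cell N a q y)"
proof -
  have a0: "0 < a" using a_ge_1 by simp
  have g: "gen \<epsilon> (\<lambda>q. cell N a q y) q = (cell N a q (y + - h) + cell N a q (y + h)) / a - (1 + 1 / a\<^sup>2) * cell N a q y" for y
    using gen_gaertner[OF q a0, of "\<lfloor>real N * y\<rfloor>"] cell_shift[of q y] by (simp add: cell_def \<epsilon>)
  note sh = shift_cell(1,2)[OF q k]
  have k1: "exp_decay (\<lambda>y. k (y + h))" "exp_decay (\<lambda>y. k (y - h))"
    using exp_decay_shift[OF k, of h] exp_decay_shift[OF k, of "- h"] by simp_all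
  have i1: "integrable lborel (\<lambda>y. k (y + h) * cell N a q y)" "integrable lborel (\<lambda>y. k (y - h) * cell N a q y)"
    by (intro integrable_cell(1)[OF q] k1)+
  note i2 = integrable_cell(1)[OF q k]
  have "gen \<epsilon> (\<lambda>q. LINT y|lborel. k y * cell N a q y) q = (LINT y|lborel. k y * gen \<epsilon> (\<lambda>q. cell N a q y) q)"
    by (rule gen_integral(1)[OF q]) (rule integrable_cell(1)[OF _ k])
  also have "\<dots> = (LINT y|lborel. (k y * cell N a q (y + - h) + k y * cell N a q (y + h)) / a - (1 + 1 / a\<^sup>2) * (k y * cell N a q y))"
    unfolding g by (intro Bochner_Integration.integral_cong refl) (simp add: field_simps)
  also have "\<dots> = ((LINT y|lborel. k (y + h) * cell N a q y) + (LINT y|lborel. k (y - h) * cell N a q y)) / a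
      - (1 + 1 / a\<^sup>2) * (LINT y|lborel. k y * cell N a q y)"
    using sh(1)[of h] sh(1)[of "- h"] sh(2)[of h] sh(2)[of "- h"] i2 by simp
  also have "\<dots> = (LINT y|lborel. (k (y + h) * cell N a q y + k (y - h) * cell N a q y) / a - (1 + 1 / a\<^sup>2) * (k y * cell N a q y))"
    using i1 i2 by simp
  also have "\<dots> = (LINT y|lborel. ((k (y + h) + k (y - h)) / a - (1 + 1 / a\<^sup>2) * k y) * cell N a q y)"
    by (intro Bochner_Integration.integral_cong refl) (simp add: field_simps)
  finally show ?thesis .
qed

text \<open>With \<open>x = b / (2 N)\<close> one has \<open>a - 1 / a = exp x - exp (- x)\<close>,
  which is of order \<open>1 / N\<close>; the acceleration \<open>N^2\<close> is thus balanced
  exactly by the squared jump.\<close>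

lemma N_sq_jump: "(real N)\<^sup>2 * (a - 1 / a)\<^sup>2 \<le> exp 2"
proof -
  define x where "x = b / (2 * real N)"
  have x: "0 \<le> x" "2 * (real N * x) = b" "x \<le> 1" using b N by (auto simp: x_def field_simps intro: order_trans[OF b(2)])
  have "0 \<le> real N * (exp x - exp (- x))" using exp_diff_bound(2)[OF x(1)] by simp
  moreover have "real N * (exp x - exp (- x)) \<le> real N * (2 * x * exp x)"
    by (intro mult_left_mono exp_diff_bound(1) x) simp
  moreover have "real N * (2 * x * exp x) = b * exp x" using x(2) by (simp add: mult_ac)
  moreover have "b * exp x \<le> 1 * exp 1" using b x by (intro mult_mono) auto
  ultimately have "(real N * (exp x - exp (- x)))\<^sup>2 \<le> (exp 1)\<^sup>2" by (intro power_mono) auto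
  moreover have "(exp 1 :: real)\<^sup>2 = exp 2" by (simp flip: exp_double)
  moreover have "1 / a = exp (- x)" "a = exp x" by (simp_all add: a x_def exp_minus field_simps)
  ultimately show ?thesis by (simp add: power_mult_distrib)
qed

text \<open>The weighted square norm of the Gaertner variable, the quantity in which both the jump
  noise and the discretisation error of an averaged variable can be bounded.\<close>

definition energy :: "config \<Rightarrow> real" where
  "energy q = (LINT y|lborel. exp (- 2 * \<bar>y\<bar>) * (cell N a q y)\<^sup>2)"

lemma energy_nonneg: "0 \<le> energy q"
  unfolding energy_def by (rule Bochner_Integration.integral_nonneg) simp

text \<open>The weight has a peak at the origin, which only lowers its second difference. Away from
  it the relative second difference is \<open>(exp h - exp (- h))^2\<close>, of order
  \<open>1 / N^2\<close>.\<close>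

lemma weight_second_difference:
  "(real N)\<^sup>2 * (exp (- 2 * \<bar>y + h\<bar>) + exp (- 2 * \<bar>y - h\<bar>) - 2 * exp (- 2 * \<bar>y\<bar>)) \<le> 4 * exp 2 * exp (- 2 * \<bar>y\<bar>)"
proof -
  have "exp (- 2 * \<bar>y + h\<bar>) + exp (- 2 * \<bar>y - h\<bar>) \<le> exp (- 2 * \<bar>y\<bar>) * (exp (- 2 * h) + exp (2 * h))"
  proof (cases "0 \<le> y")
    case True
    then have "exp (- 2 * \<bar>y + h\<bar>) \<le> exp (- 2 * \<bar>y\<bar> + - 2 * h)" "exp (- 2 * \<bar>y - h\<bar>) \<le> exp (- 2 * \<bar>y\<bar> + 2 * h)"
      using h_pos(1) by (auto simp: abs_if)
    then show ?thesis unfolding exp_add distrib_left by linarith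
  next
    case False
    then have "exp (- 2 * \<bar>y + h\<bar>) \<le> exp (- 2 * \<bar>y\<bar> + 2 * h)" "exp (- 2 * \<bar>y - h\<bar>) \<le> exp (- 2 * \<bar>y\<bar> + - 2 * h)"
      using h_pos(1) by (auto simp: abs_if)
    then show ?thesis unfolding exp_add distrib_left by linarith
  qed
  then have "exp (- 2 * \<bar>y + h\<bar>) + exp (- 2 * \<bar>y - h\<bar>) - 2 * exp (- 2 * \<bar>y\<bar>)
      \<le> exp (- 2 * \<bar>y\<bar>) * (exp (- 2 * h) + exp (2 * h) - 2)" by (simp add: algebra_simps)
  also have "exp (- 2 * h) + exp (2 * h) - 2 = (exp h - exp (- h))\<^sup>2"
    by (simp add: power2_eq_square algebra_simps flip: exp_add)
  finally have "(real N)\<^sup>2 * (exp (- 2 * \<bar>y + h\<bar>) + exp (- 2 * \<bar>y - h\<bar>) - 2 * exp (- 2 * \<bar>y\<bar>))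
      \<le> (real N)\<^sup>2 * (exp (- 2 * \<bar>y\<bar>) * (exp h - exp (- h))\<^sup>2)"
    by (rule mult_left_mono) simp
  also have "\<dots> = (real N * (exp h - exp (- h)))\<^sup>2 * exp (- 2 * \<bar>y\<bar>)" by (simp add: power_mult_distrib)
  also have "\<dots> \<le> (2 * exp 1)\<^sup>2 * exp (- 2 * \<bar>y\<bar>)"
  proof (intro mult_right_mono power_mono)
    have "real N * (exp h - exp (- h)) \<le> real N * (2 * h * exp h)"
      using h_pos by (intro mult_left_mono exp_diff_bound) auto
    also have "\<dots> = 2 * exp h" using h_pos(3) by (simp add: mult_ac)
    also have "\<dots> \<le> 2 * exp 1" using h_pos by simp
    finally show "real N * (exp h - exp (- h)) \<le> 2 * exp 1" .
    show "0 \<le> real N * (exp h - exp (- h))" using h_pos by simp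
  qed simp
  also have "(2 * exp 1)\<^sup>2 = 4 * exp (2::real)" by (simp add: power_mult_distrib flip: exp_double)
  finally show ?thesis .
qed

text \<open>Moving the lattice Laplacian onto the weight costs \<open>4 * exp 2\<close>, and the
  jump noise of \<open>gen_gaertner_square\<close> costs \<open>2 * exp 2\<close>; both are
  independent of \<open>N\<close>.\<close>

lemma gen_energy:
  assumes q: "q \<in> Qset"
  shows "(real N)\<^sup>2 * gen \<epsilon> energy q \<le> 6 * exp 2 * energy q"
proof -
  let ?w = "\<lambda>y::real. exp (- 2 * \<bar>y\<bar>)" and ?v = "\<lambda>y. (cell N a q y)\<^sup>2"
  have a0: "0 < a" using a_ge_1 by simp
  note sh = shift_cell(3,4)[OF q exp_decay_weight]
  note i0 = integrable_cell(2)[OF q exp_decay_weight]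
  have w1: "exp_decay (\<lambda>y. ?w (y + h))" "exp_decay (\<lambda>y. ?w (y - h))"
    using exp_decay_shift[OF exp_decay_weight, of h] exp_decay_shift[OF exp_decay_weight, of "- h"] by simp_all
  note i1 = integrable_cell(2)[OF q w1(1)] integrable_cell(2)[OF q w1(2)]
  have g: "gen \<epsilon> (\<lambda>q. (cell N a q y)\<^sup>2) q \<le> (?v (y + - h) + ?v (y + h) - 2 * ?v y) / a + 2 * (a - 1 / a)\<^sup>2 * ?v y" for y
    using gen_gaertner_square[OF q a_ge_1, of "\<lfloor>real N * y\<rfloor>"] cell_shift[of q y] by (simp add: cell_def \<epsilon>)
  have "gen \<epsilon> energy q = (LINT y|lborel. ?w y * gen \<epsilon> (\<lambda>q. (cell N a q y)\<^sup>2) q)"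
    unfolding energy_def[abs_def] by (rule gen_integral(1)[OF q]) (rule integrable_cell(2)[OF _ exp_decay_weight])
  also have "\<dots> \<le> (LINT y|lborel. (?w y * ?v (y + - h) + ?w y * ?v (y + h) - 2 * (?w y * ?v y)) / a + 2 * (a - 1 / a)\<^sup>2 * (?w y * ?v y))"
  proof (rule integral_mono)
    show "integrable lborel (\<lambda>y. ?w y * gen \<epsilon> (\<lambda>q. (cell N a q y)\<^sup>2) q)"
      by (rule gen_integral(2)[OF q]) (rule integrable_cell(2)[OF _ exp_decay_weight])
    show "integrable lborel (\<lambda>y. (?w y * ?v (y + - h) + ?w y * ?v (y + h) - 2 * (?w y * ?v y)) / a + 2 * (a - 1 / a)\<^sup>2 * (?w y * ?v y))"
      using sh(2)[of h] sh(2)[of "- h"] i0 by simp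
    fix y
    have "?w y * gen \<epsilon> (\<lambda>q. (cell N a q y)\<^sup>2) q \<le> ?w y * ((?v (y + - h) + ?v (y + h) - 2 * ?v y) / a + 2 * (a - 1 / a)\<^sup>2 * ?v y)"
      by (intro mult_left_mono g) simp
    then show "?w y * gen \<epsilon> (\<lambda>q. (cell N a q y)\<^sup>2) q \<le> (?w y * ?v (y + - h) + ?w y * ?v (y + h) - 2 * (?w y * ?v y)) / a + 2 * (a - 1 / a)\<^sup>2 * (?w y * ?v y)"
      by (simp add: algebra_simps add_divide_distrib diff_divide_distrib)
  qed
  also have "\<dots> = ((LINT y|lborel. ?w (y + h) * ?v y) + (LINT y|lborel. ?w (y - h) * ?v y) - 2 * energy q) / a
      + 2 * (a - 1 / a)\<^sup>2 * energy q"
    using sh(1)[of h] sh(1)[of "- h"] sh(2)[of h] sh(2)[of "- h"] i0 by (simp add: energy_def)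
  also have "(LINT y|lborel. ?w (y + h) * ?v y) + (LINT y|lborel. ?w (y - h) * ?v y) - 2 * energy q
      = (LINT y|lborel. (?w (y + h) + ?w (y - h) - 2 * ?w y) * ?v y)"
    unfolding distrib_right left_diff_distrib energy_def using i0 i1 by (simp add: mult.assoc)
  finally have *: "gen \<epsilon> energy q \<le> (LINT y|lborel. (?w (y + h) + ?w (y - h) - 2 * ?w y) * ?v y) / a + 2 * (a - 1 / a)\<^sup>2 * energy q" .
  have "(real N)\<^sup>2 * (LINT y|lborel. (?w (y + h) + ?w (y - h) - 2 * ?w y) * ?v y)
      = (LINT y|lborel. (real N)\<^sup>2 * (?w (y + h) + ?w (y - h) - 2 * ?w y) * ?v y)" by (simp add: mult.assoc)
  also have "\<dots> \<le> (LINT y|lborel. 4 * exp 2 * (?w y * ?v y))"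
  proof (rule integral_mono)
    show "integrable lborel (\<lambda>y. (real N)\<^sup>2 * (?w (y + h) + ?w (y - h) - 2 * ?w y) * ?v y)"
      unfolding mult.assoc distrib_right left_diff_distrib using i0 i1 by (simp add: mult.assoc)
    show "integrable lborel (\<lambda>y. 4 * exp 2 * (?w y * ?v y))" using i0 by simp
    show "(real N)\<^sup>2 * (?w (y + h) + ?w (y - h) - 2 * ?w y) * ?v y \<le> 4 * exp 2 * (?w y * ?v y)" for y
      using mult_right_mono[OF weight_second_difference[of y], of "?v y"] by (simp add: mult.assoc)
  qed
  also have "\<dots> = 4 * exp 2 * energy q" by (simp add: energy_def)
  finally have 1: "(real N)\<^sup>2 * (LINT y|lborel. (?w (y + h) + ?w (y - h) - 2 * ?w y) * ?v y) \<le> 4 * exp 2 * energy q" .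
  have "(real N)\<^sup>2 * gen \<epsilon> energy q \<le> (real N)\<^sup>2 * ((LINT y|lborel. (?w (y + h) + ?w (y - h) - 2 * ?w y) * ?v y) / a + 2 * (a - 1 / a)\<^sup>2 * energy q)"
    by (intro mult_left_mono *) simp
  also have "\<dots> = ((real N)\<^sup>2 * (LINT y|lborel. (?w (y + h) + ?w (y - h) - 2 * ?w y) * ?v y)) / a + 2 * ((real N)\<^sup>2 * (a - 1 / a)\<^sup>2) * energy q"
    by (simp add: algebra_simps)
  also have "\<dots> \<le> (4 * exp 2 * energy q) / a + 2 * exp 2 * energy q"
    by (intro add_mono divide_right_mono 1 mult_right_mono mult_left_mono N_sq_jump energy_nonneg) (use a0 in auto)
  also have "(4 * exp 2 * energy q) / a \<le> 4 * exp 2 * energy q / 1"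
    using a_ge_1 energy_nonneg[of q] by (intro divide_left_mono) auto
  finally show ?thesis by (simp add: algebra_simps)
qed

lemma integrable_jump_square:
  assumes q: "q \<in> Qset" "q' \<in> Qset" and k: "exp_decay k"
  shows "integrable lborel (\<lambda>y. k y * (cell N a q' y - cell N a q y)\<^sup>2)"
proof -
  define B where "B = exp 1 * a ^ (2 * hgt q' 0) + exp 1 * a ^ (2 * hgt q 0)"
  have c: "\<bar>cell N a q' y - cell N a q y\<bar> \<le> B * exp (\<bar>y\<bar> / 2)" for y
    using cell_bound[OF q(1), of y] cell_bound[OF q(2), of y] unfolding B_def distrib_right by linarith
  have "\<bar>(cell N a q' y - cell N a q y)\<^sup>2\<bar> \<le> B\<^sup>2 * exp \<bar>y\<bar>" for y
  proof -
    have "\<bar>cell N a q' y - cell N a q y\<bar>\<^sup>2 \<le> (B * exp (\<bar>y\<bar> / 2))\<^sup>2" by (intro power_mono c) simp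
    also have "\<dots> = B\<^sup>2 * exp \<bar>y\<bar>" by (simp add: power_mult_distrib exp_double[symmetric])
    finally show ?thesis by simp
  qed
  then show ?thesis by (intro exp_decay_integrable[OF k]) auto
qed

text \<open>A jump changes the Gaertner variable only on the two cells at a given distance from the
  origin, of total length at most \<open>2 / N\<close>.\<close>

lemma jump_square_bound:
  assumes q: "q \<in> Qset" "q' \<in> Qset" and k: "exp_decay k" "\<And>y. 0 \<le> k y" "\<And>y. k y \<le> C"
    and jump: "\<And>z. nat \<bar>z\<bar> \<noteq> x \<Longrightarrow> gaertner a q' z = gaertner a q z"
  shows "((LINT y|lborel. k y * cell N a q' y) - (LINT y|lborel. k y * cell N a q y))\<^sup>2
     \<le> 2 * C / real N * (LINT y|lborel. k y * (cell N a q' y - cell N a q y)\<^sup>2)"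
proof -
  define S where "S = {y. nat \<bar>\<lfloor>real N * y\<rfloor>\<bar> = x}"
  define D where "D y = cell N a q' y - cell N a q y" for y
  \<comment> \<open>Restricting the weight to the cells that change makes the Cauchy-Schwarz
    inequality produce the mass of two cells in place of the mass of the whole kernel. This is the
    gain of \<open>1 / N\<close>.\<close>
  define k1 where "k1 y = k y * indicator S y" for y
  have C: "0 \<le> C" using k(2,3)[of 0] by linarith
  have [measurable]: "k \<in> borel_measurable borel" using k by (auto simp: exp_decay_def)
  have [measurable]: "S \<in> sets borel" unfolding S_def by measurable
  have D: "D y = 0" if "y \<notin> S" for y using jump[of "\<lfloor>real N * y\<rfloor>"] that by (auto simp: D_def S_def cell_def)
  have eq: "k1 y * D y = k y * D y" "k1 y * (D y)\<^sup>2 = k y * (D y)\<^sup>2" for y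
    using D[of y] by (auto simp: k1_def indicator_def)
  have kD: "integrable lborel (\<lambda>y. k y * D y)"
    unfolding D_def right_diff_distrib by (intro Bochner_Integration.integrable_diff integrable_cell k q)
  have kD2: "integrable lborel (\<lambda>y. k y * (D y)\<^sup>2)"
    unfolding D_def by (rule integrable_jump_square[OF q k(1)])
  \<comment> \<open>Rounding is downwards on both sides of the origin, so the cell of
    \<open>- x\<close> starts at \<open>- x h\<close> and is not the mirror image of the cell of
    \<open>x\<close>.\<close>
  define I where "I = {real x * h..real x * h + h} \<union> {- real x * h..- real x * h + h}"
  have SI: "S \<subseteq> I"
  proof
    fix y assume "y \<in> S"
    then have z: "\<lfloor>real N * y\<rfloor> = int x \<or> \<lfloor>real N * y\<rfloor> = - int x" by (auto simp: S_def)
    have fl: "of_int \<lfloor>real N * y\<rfloor> \<le> real N * y" "real N * y \<le> of_int \<lfloor>real N * y\<rfloor> + 1" by linarith+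
    have y: "y = real N * y * h" using h_pos by (simp add: mult_ac)
    have "of_int \<lfloor>real N * y\<rfloor> * h \<le> real N * y * h" "real N * y * h \<le> (of_int \<lfloor>real N * y\<rfloor> + 1) * h"
      using fl h_pos by (auto intro!: mult_right_mono)
    then show "y \<in> I" unfolding y[symmetric] I_def using z by (auto simp: algebra_simps)
  qed
  have int_ind: "integrable lborel (indicator {s..t} :: real \<Rightarrow> real)" for s t :: real
    by (rule integrable_real_indicator) (auto simp: emeasure_lborel_Icc_eq)
  have k1b: "\<bar>k1 y\<bar> \<le> C * (indicator {real x * h..real x * h + h} y + indicator {- real x * h..- real x * h + h} y)" for y
    using SI k(2,3)[of y] C by (auto simp: k1_def indicator_def I_def)
  have int_b: "integrable lborel (\<lambda>y. C * (indicator {real x * h..real x * h + h} y + indicator {- real x * h..- real x * h + h} y))"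
    by (intro integrable_mult_right Bochner_Integration.integrable_add int_ind)
  have k1: "integrable lborel k1"
  proof (rule Bochner_Integration.integrable_bound[OF int_b _ AE_I2])
    show "k1 \<in> borel_measurable lborel" unfolding k1_def[abs_def] by measurable
    show "norm (k1 y) \<le> norm (C * (indicator {real x * h..real x * h + h} y + indicator {- real x * h..- real x * h + h} y))" for y
      by (rule order_trans[OF _ abs_ge_self[of "C * _", folded real_norm_def]]) (use k1b in simp)
  qed
  have k10: "0 \<le> k1 y" for y using k(2)[of y] by (simp add: k1_def)
  have "(LINT y|lborel. k1 y) \<le> (LINT y|lborel. C * (indicator {real x * h..real x * h + h} y + indicator {- real x * h..- real x * h + h} y))"
    by (rule integral_mono[OF k1 int_b]) (use k1b in \<open>auto intro: order_trans[OF abs_ge_self]\<close>)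
  also have "\<dots> = 2 * C / real N"
    using h_pos int_ind by (simp add: h_def)
  finally have K: "(LINT y|lborel. k1 y) \<le> 2 * C / real N" .
  have "((LINT y|lborel. k y * cell N a q' y) - (LINT y|lborel. k y * cell N a q y))\<^sup>2 = (LINT y|lborel. k y * D y)\<^sup>2"
    by (simp add: D_def right_diff_distrib integrable_cell k q)
  also have "\<dots> = (LINT y|lborel. k1 y * D y)\<^sup>2" by (simp only: eq)
  also have "\<dots> \<le> (LINT y|lborel. k1 y) * (LINT y|lborel. k1 y * (D y)\<^sup>2)"
    by (rule weighted_cauchy_schwarz) (simp_all only: k1 k10 eq kD kD2)
  also have "\<dots> \<le> 2 * C / real N * (LINT y|lborel. k y * (D y)\<^sup>2)"
    unfolding eq by (intro mult_right_mono K Bochner_Integration.integral_nonneg mult_nonneg_nonneg k) simp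
  finally show ?thesis by (simp add: D_def)
qed

text \<open>Each jump brings \<open>2 C / N\<close> from \<open>jump_square_bound\<close>, the sum
  over jumps brings \<open>2 (a - 1 / a)^2 C\<close> times the energy, and
  \<open>N^2 (a - 1 / a)^2\<close> is at most \<open>exp 2\<close>.\<close>

lemma gen_sq_cell_integral:
  assumes q: "q \<in> Qset" and k: "exp_decay k" "\<And>y. 0 \<le> k y" "\<And>y. k y \<le> C * exp (- 2 * \<bar>y\<bar>)"
  shows "(real N)\<^sup>2 * gen_sq \<epsilon> (\<lambda>q. LINT y|lborel. k y * cell N a q y) q \<le> 4 * exp 2 * C\<^sup>2 / real N * energy q"
proof -
  let ?F = "\<lambda>q. LINT y|lborel. k y * cell N a q y"
  let ?J = "\<lambda>q'. LINT y|lborel. k y * (cell N a q' y - cell N a q y)\<^sup>2"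
  have a0: "0 < a" using a_ge_1 by simp
  have \<epsilon>0: "0 \<le> \<epsilon>" by (simp add: \<epsilon>)
  have C: "0 \<le> C" using order_trans[OF k(2,3)[of 0]] by simp
  have kC: "k y \<le> C" for y
    by (rule order_trans[OF k(3)]) (use C in \<open>auto intro: mult_left_le\<close>)
  have up: "(?F (up_at q i) - ?F q)\<^sup>2 \<le> 2 * C / real N * ?J (up_at q i)" if "i \<in> up_set q" for i
  proof (rule jump_square_bound[OF q up_at_in_Qset[OF q that] k(1,2) kC, of "q i"])
    fix z assume "nat \<bar>z\<bar> \<noteq> q i"
    then show "gaertner a (up_at q i) z = gaertner a q z"
      using gaertner_up[OF q that, of a z] by auto
  qed
  have down: "(?F (down_at q i) - ?F q)\<^sup>2 \<le> 2 * C / real N * ?J (down_at q i)" if "i \<in> down_set q" for i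
  proof (rule jump_square_bound[OF q down_at_in_Qset[OF q that] k(1,2) kC, of "q i - 1"])
    fix z assume z: "nat \<bar>z\<bar> \<noteq> q i - 1"
    have "0 < q i" using that by (auto simp: down_set_def down_ok_def)
    with z have "q i \<noteq> Suc (nat \<bar>z\<bar>)" by simp
    then show "gaertner a (down_at q i) z = gaertner a q z"
      using gaertner_down[OF q that, of a z] a0 by simp
  qed
  have iu: "integrable lborel (\<lambda>y. k y * (cell N a (up_at q i) y - cell N a q y)\<^sup>2)" if "i \<in> up_set q" for i
    by (rule integrable_jump_square[OF q up_at_in_Qset[OF q that] k(1)])
  have id: "integrable lborel (\<lambda>y. k y * (cell N a (down_at q i) y - cell N a q y)\<^sup>2)" if "i \<in> down_set q" for i
    by (rule integrable_jump_square[OF q down_at_in_Qset[OF q that] k(1)])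
  have "gen_sq \<epsilon> ?F q \<le> (\<Sum>i\<in>up_set q. \<epsilon> * (2 * C / real N * ?J (up_at q i))) + (\<Sum>i\<in>down_set q. 2 * C / real N * ?J (down_at q i))"
    unfolding gen_sq_def by (intro add_mono sum_mono mult_left_mono up down \<epsilon>0)
  also have "\<dots> = 2 * C / real N * ((\<Sum>i\<in>up_set q. \<epsilon> * ?J (up_at q i)) + (\<Sum>i\<in>down_set q. ?J (down_at q i)))"
    by (simp only: distrib_left sum_distrib_left mult.left_commute[of "2 * C / real N" \<epsilon>])
  finally have J: "gen_sq \<epsilon> ?F q \<le> 2 * C / real N * ((\<Sum>i\<in>up_set q. \<epsilon> * ?J (up_at q i)) + (\<Sum>i\<in>down_set q. ?J (down_at q i)))" .
  have "(\<Sum>i\<in>up_set q. \<epsilon> * ?J (up_at q i)) + (\<Sum>i\<in>down_set q. ?J (down_at q i))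
      = (LINT y|lborel. (\<Sum>i\<in>up_set q. \<epsilon> * (k y * (cell N a (up_at q i) y - cell N a q y)\<^sup>2))
          + (\<Sum>i\<in>down_set q. k y * (cell N a (down_at q i) y - cell N a q y)\<^sup>2))"
    by (subst Bochner_Integration.integral_add)
      (intro Bochner_Integration.integrable_sum integrable_mult_right iu, assumption,
       intro Bochner_Integration.integrable_sum id, assumption,
       simp only: Bochner_Integration.integral_sum[OF integrable_mult_right[OF iu]] Bochner_Integration.integral_sum[OF id] integral_mult_right_zero)
  also have "\<dots> = (LINT y|lborel. k y * gen_sq \<epsilon> (\<lambda>q. cell N a q y) q)"
    unfolding gen_sq_def distrib_left sum_distrib_left by (simp only: mult.left_commute[of _ \<epsilon>])
  also have "\<dots> \<le> (LINT y|lborel. 2 * (a - 1 / a)\<^sup>2 * C * (exp (- 2 * \<bar>y\<bar>) * (cell N a q y)\<^sup>2))"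
  proof (rule integral_mono')
    show "integrable lborel (\<lambda>y. 2 * (a - 1 / a)\<^sup>2 * C * (exp (- 2 * \<bar>y\<bar>) * (cell N a q y)\<^sup>2))"
      by (intro integrable_mult_right integrable_cell(2)[OF q exp_decay_weight])
    fix y
    have g: "gen_sq \<epsilon> (\<lambda>q. cell N a q y) q \<le> 2 * (a - 1 / a)\<^sup>2 * (cell N a q y)\<^sup>2"
      unfolding cell_def \<epsilon> by (rule gen_sq_gaertner[OF q a_ge_1])
    have "k y * gen_sq \<epsilon> (\<lambda>q. cell N a q y) q \<le> (C * exp (- 2 * \<bar>y\<bar>)) * (2 * (a - 1 / a)\<^sup>2 * (cell N a q y)\<^sup>2)"
      by (rule order_trans[OF mult_left_mono[OF g k(2)] mult_right_mono[OF k(3)]]) simp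
    then show "k y * gen_sq \<epsilon> (\<lambda>q. cell N a q y) q \<le> 2 * (a - 1 / a)\<^sup>2 * C * (exp (- 2 * \<bar>y\<bar>) * (cell N a q y)\<^sup>2)"
      by (simp add: mult_ac)
    show "0 \<le> 2 * (a - 1 / a)\<^sup>2 * C * (exp (- 2 * \<bar>y\<bar>) * (cell N a q y)\<^sup>2)" using C by simp
  qed
  also have "\<dots> = 2 * (a - 1 / a)\<^sup>2 * C * energy q" by (simp add: energy_def)
  finally have J2: "(\<Sum>i\<in>up_set q. \<epsilon> * ?J (up_at q i)) + (\<Sum>i\<in>down_set q. ?J (down_at q i)) \<le> 2 * (a - 1 / a)\<^sup>2 * C * energy q" .
  have "0 \<le> 2 * C / real N" using C by simp
  then have "gen_sq \<epsilon> ?F q \<le> 2 * C / real N * (2 * (a - 1 / a)\<^sup>2 * C * energy q)"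
    by (rule order_trans[OF J mult_left_mono[OF J2]])
  then have "(real N)\<^sup>2 * gen_sq \<epsilon> ?F q \<le> (real N)\<^sup>2 * (2 * C / real N * (2 * (a - 1 / a)\<^sup>2 * C * energy q))"
    by (intro mult_left_mono) auto
  also have "\<dots> = (real N)\<^sup>2 * (a - 1 / a)\<^sup>2 * (4 * C\<^sup>2 / real N * energy q)"
    by (simp add: power2_eq_square)
  also have "\<dots> \<le> exp 2 * (4 * C\<^sup>2 / real N * energy q)"
    using energy_nonneg by (intro mult_right_mono N_sq_jump) auto
  finally show ?thesis by (simp add: mult_ac)
qed

text \<open>The supersolution is the squared error of the averaged Gaertner variable plus a small multiple
  of the energy, which absorbs the jump noise (of order \<open>1 / N\<close>) and the discretisation error \<open>\<eta>\<close>.\<close>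

lemma tracer_inequality:
  fixes u \<tau> T \<kappa> C \<eta> m c :: real
  assumes \<tau>: "0 < \<tau>" and T: "0 \<le> T" and C: "0 \<le> C" and \<eta>: "0 \<le> \<eta>"
    and bound: "\<And>t y. 0 \<le> t \<Longrightarrow> t \<le> T \<Longrightarrow> exp (- \<kappa> * t) * heat_kernel (t + \<tau>) (u - y) \<le> C * exp (- 2 * \<bar>y\<bar>)"
    and error: "\<And>t y. 0 \<le> t \<Longrightarrow> t \<le> T \<Longrightarrow>
      \<bar>exp (- \<kappa> * t) * (heat_kernel2 (t + \<tau>) (u - y) - \<kappa> * heat_kernel (t + \<tau>) (u - y)
         - (real N)\<^sup>2 * ((heat_kernel (t + \<tau>) (u - (y + 1 / real N)) + heat_kernel (t + \<tau>) (u - (y - 1 / real N))) / a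
            - (1 + 1 / a\<^sup>2) * heat_kernel (t + \<tau>) (u - y)))\<bar> \<le> C * \<eta> * exp (- 2 * \<bar>y\<bar>)"
    and q: "q \<in> Qset" and c: "0 < c" "\<And>y. y \<in> Y \<Longrightarrow> y \<in> Qset \<Longrightarrow> c \<le> (heat_conv heat_kernel (cell N a y) \<tau> u - m)\<^sup>2"
    and \<Omega>: "\<Omega> = (LINT y|lborel. exp (- 2 * \<bar>y::real\<bar>))"
    and \<rho>: "\<rho> = 2 * \<eta> * C * (C + \<bar>m\<bar>) * (\<Omega> + 1) + 4 * exp 2 * C\<^sup>2 / real N"
  shows "infsum (mc_trans (\<lambda>q q'. (real N)\<^sup>2 * rateR \<epsilon> q q') T q) Y
    \<le> ((exp (- \<kappa> * T) * heat_conv heat_kernel (cell N a q) (T + \<tau>) u - m)\<^sup>2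
        + \<rho> * exp ((6 * exp 2 + 1) * T) * (energy q + 1)) / c"
proof -
  \<comment> \<open>The energy grows at rate at most \<open>6 * exp 2\<close>; the additional 1 pays
    for the source \<open>\<rho> * (energy q + 1)\<close>, which collects the jump noise and the
    discretisation error.\<close>
  define \<Lambda> where "\<Lambda> = 6 * exp 2 + (1::real)"
  \<comment> \<open>Here \<open>t\<close> is the time left, so at the end the averaging window still
    has the positive width parameter \<open>\<tau>\<close>. The exponential accounts for the zeroth
    order term of the lattice operator, whose rate approaches \<open>\<kappa>\<close>.\<close>
  define k where "k t y = exp (- \<kappa> * t) * heat_kernel (t + \<tau>) (u - y)" for t y
  define A where "A t q = (LINT y|lborel. k t y * cell N a q y)" for t q
  define A' where "A' t q = exp (- \<kappa> * t) * heat_conv heat_kernel2 (cell N a q) (t + \<tau>) u - \<kappa> * A t q" for t q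
  define G where "G t q = (A t q - m)\<^sup>2 + \<rho> * exp (\<Lambda> * t) * (energy q + 1)" for t q
  define G' where "G' t q = 2 * (A t q - m) * A' t q + \<rho> * \<Lambda> * exp (\<Lambda> * t) * (energy q + 1)" for t q
  have A_conv: "A t q = exp (- \<kappa> * t) * heat_conv heat_kernel (cell N a q) (t + \<tau>) u" for t q
    unfolding A_def k_def heat_conv_def by (simp add: mult.assoc)
  have A_fun: "A t = (\<lambda>q. LINT y|lborel. k t y * cell N a q y)" for t by (rule ext) (simp add: A_def)
  have \<epsilon>0: "0 \<le> \<epsilon>" by (simp add: \<epsilon>)
  have a0: "0 < a" using a_ge_1 by simp
  have N2: "0 < (real N)\<^sup>2" using N by simp
  have \<Omega>0: "0 \<le> \<Omega>" unfolding \<Omega> by (rule Bochner_Integration.integral_nonneg) simp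
  have \<rho>0: "0 \<le> \<rho>" unfolding \<rho> using \<eta> C \<Omega>0 by (intro add_nonneg_nonneg mult_nonneg_nonneg divide_nonneg_nonneg) auto
  have growth: "exp_growth (cell N a q)" if "q \<in> Qset" for q
    unfolding exp_growth_def
  proof (intro conjI exI allI)
    show "\<bar>cell N a q y\<bar> \<le> (exp 1 * a ^ (2 * hgt q 0)) * exp (1 / 2 * \<bar>y\<bar>)" for y
      using cell_bound[OF that, of y] by simp
  qed measurable
  interpret markov_rates "\<lambda>q q'. (real N)\<^sup>2 * rateR \<epsilon> q q'" Qset
    by (rule markov_rates_rateR[OF \<epsilon>0 N2])
  have dA: "((\<lambda>t. A t q) has_real_derivative A' t q) (at t)" if "0 \<le> t" "q \<in> Qset" for t q
  proof -
    have "((\<lambda>t. heat_conv heat_kernel (cell N a q) (t + \<tau>) u) has_real_derivative heat_conv heat_kernel2 (cell N a q) (t + \<tau>) u * 1) (at t)"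
      by (rule DERIV_chain2[where f = "\<lambda>s. heat_conv heat_kernel (cell N a q) s u", OF DERIV_heat_conv_time[OF growth[OF that(2)]]])
        (use \<tau> that in \<open>auto intro!: derivative_eq_intros\<close>)
    then show ?thesis unfolding A_conv A'_def
      by (auto intro!: derivative_eq_intros simp: algebra_simps)
  qed
  have dG: "((\<lambda>t. G t q) has_real_derivative G' t q) (at t within {0..T})" if "0 \<le> t" "q \<in> Qset" for t q
    unfolding G_def G'_def
    by (auto intro!: derivative_eq_intros has_field_derivative_at_within[OF dA[OF that]] simp: algebra_simps)
  have k_decay: "exp_decay (k t)" and k_nonneg: "0 \<le> k t y" and k_bound: "k t y \<le> C * exp (- 2 * \<bar>y\<bar>)"
    if t: "0 \<le> t" "t \<le> T" for t y
  proof -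
    show nn: "0 \<le> k t y" for y using heat_kernel_pos[of "t + \<tau>" "u - y"] t \<tau> by (simp add: k_def)
    show b: "k t y \<le> C * exp (- 2 * \<bar>y\<bar>)" for y using bound[OF t] by (simp add: k_def)
    have "k t \<in> borel_measurable borel" unfolding k_def[abs_def] by measurable
    moreover have "\<bar>k t y\<bar> \<le> C * exp (- 2 * \<bar>y\<bar>)" for y using b[of y] nn[of y] by simp
    ultimately show "exp_decay (k t)" unfolding exp_decay_def by blast
  qed
  have super: "(real N)\<^sup>2 * gen \<epsilon> (G t) q \<le> G' t q" if t: "0 \<le> t" "t \<le> T" and q: "q \<in> Qset" for t q
  proof -
    note kd = k_decay[OF t]
    define X where "X = (LINT y|lborel. exp (- 2 * \<bar>y\<bar>) * cell N a q y)"
    \<comment> \<open>The defect of the averaged variable in the backward equation; its only source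
      is the discretisation error of the kernel.\<close>
    define E where "E = A' t q - (real N)\<^sup>2 * gen \<epsilon> (A t) q"
    have X0: "0 \<le> X" unfolding X_def
      by (intro Bochner_Integration.integral_nonneg mult_nonneg_nonneg less_imp_le[OF cell_pos]) simp
    have X2: "X\<^sup>2 \<le> \<Omega> * energy q"
      unfolding X_def \<Omega> energy_def
      by (rule weighted_cauchy_schwarz) (use integrable_cell[OF q exp_decay_weight] integrable_exp_neg_abs[of 2] in auto)
    have iX: "integrable lborel (\<lambda>y. B * (exp (- 2 * \<bar>y\<bar>) * cell N a q y))" for B
      by (intro integrable_mult_right integrable_cell(1)[OF q exp_decay_weight])
    have A_abs: "\<bar>A t q\<bar> \<le> C * X"
    proof -
      have "0 \<le> A t q" unfolding A_def
        by (intro Bochner_Integration.integral_nonneg mult_nonneg_nonneg less_imp_le[OF cell_pos] k_nonneg[OF t])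
      moreover have "A t q \<le> (LINT y|lborel. C * (exp (- 2 * \<bar>y\<bar>) * cell N a q y))"
        unfolding A_def
      proof (rule integral_mono[OF integrable_cell(1)[OF q kd] iX])
        show "k t y * cell N a q y \<le> C * (exp (- 2 * \<bar>y\<bar>) * cell N a q y)" for y
          using mult_right_mono[OF k_bound[OF t, of y] less_imp_le[OF cell_pos[of q y]]] by (simp add: mult.assoc)
      qed
      ultimately show ?thesis by (simp add: X_def)
    qed
    have E_abs: "\<bar>E\<bar> \<le> C * \<eta> * X"
    proof -
      define e where "e y = exp (- \<kappa> * t) * (heat_kernel2 (t + \<tau>) (u - y) - \<kappa> * heat_kernel (t + \<tau>) (u - y)
         - (real N)\<^sup>2 * ((heat_kernel (t + \<tau>) (u - (y + h)) + heat_kernel (t + \<tau>) (u - (y - h))) / a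
            - (1 + 1 / a\<^sup>2) * heat_kernel (t + \<tau>) (u - y)))" for y
      have e_bound: "\<bar>e y\<bar> \<le> C * \<eta> * exp (- 2 * \<bar>y\<bar>)" for y
        unfolding e_def h_def by (rule error[OF t])
      have i2: "integrable lborel (\<lambda>y. exp (- \<kappa> * t) * (heat_kernel2 (t + \<tau>) (u - y) * cell N a q y))"
        using integrable_conv[OF admissible_heat_kernel(3) growth[OF q], of "t + \<tau>" u] t \<tau> by simp
      have i1: "integrable lborel (\<lambda>y. \<kappa> * (k t y * cell N a q y))" using integrable_cell(1)[OF q kd] by simp
      have k1: "exp_decay (\<lambda>y. k t (y + h))" "exp_decay (\<lambda>y. k t (y - h))"
        using exp_decay_shift[OF kd, of h] exp_decay_shift[OF kd, of "- h"] by simp_all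
      have i3: "integrable lborel (\<lambda>y. (real N)\<^sup>2 * (((k t (y + h) + k t (y - h)) / a - (1 + 1 / a\<^sup>2) * k t y) * cell N a q y))"
      proof -
        have eq: "(\<lambda>y. (real N)\<^sup>2 * (((k t (y + h) + k t (y - h)) / a - (1 + 1 / a\<^sup>2) * k t y) * cell N a q y))
           = (\<lambda>y. (real N)\<^sup>2 * ((k t (y + h) * cell N a q y + k t (y - h) * cell N a q y) / a - (1 + 1 / a\<^sup>2) * (k t y * cell N a q y)))"
          by (rule ext) (simp add: algebra_simps add_divide_distrib)
        show ?thesis
          unfolding eq by (intro integrable_mult_right Bochner_Integration.integrable_diff integrable_divide
              Bochner_Integration.integrable_add integrable_cell(1)[OF q] k1 kd)
      qed
      have "E = (LINT y|lborel. exp (- \<kappa> * t) * (heat_kernel2 (t + \<tau>) (u - y) * cell N a q y)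
          - \<kappa> * (k t y * cell N a q y)
          - (real N)\<^sup>2 * (((k t (y + h) + k t (y - h)) / a - (1 + 1 / a\<^sup>2) * k t y) * cell N a q y))"
        unfolding Bochner_Integration.integral_diff[OF Bochner_Integration.integrable_diff[OF i2 i1] i3]
          Bochner_Integration.integral_diff[OF i2 i1]
        using gen_cell_integral[OF q kd] unfolding A_fun[symmetric]
        by (simp add: E_def A'_def A_def heat_conv_def)
      also have "\<dots> = (LINT y|lborel. e y * cell N a q y)"
        by (intro Bochner_Integration.integral_cong refl) (simp add: e_def k_def algebra_simps add_divide_distrib)
      finally have E_eq: "E = (LINT y|lborel. e y * cell N a q y)" .
      have "\<bar>E\<bar> \<le> (LINT y|lborel. norm (e y * cell N a q y))"
        unfolding E_eq using integral_norm_bound[of lborel "\<lambda>y. e y * cell N a q y"] by simp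
      also have "\<dots> \<le> (LINT y|lborel. C * \<eta> * (exp (- 2 * \<bar>y\<bar>) * cell N a q y))"
      proof (rule integral_mono'[OF iX])
        fix y
        show "norm (e y * cell N a q y) \<le> C * \<eta> * (exp (- 2 * \<bar>y\<bar>) * cell N a q y)"
          using mult_right_mono[OF e_bound[of y] less_imp_le[OF cell_pos[of q y]]] cell_pos[of q y]
          by (simp add: abs_mult mult.assoc)
        then show "0 \<le> C * \<eta> * (exp (- 2 * \<bar>y\<bar>) * cell N a q y)" by (rule order_trans[OF norm_ge_zero])
      qed
      finally show ?thesis by (simp add: X_def)
    qed
    \<comment> \<open>Both factors are linear in the weighted mean \<open>X\<close>. Their product
      is quadratic, and \<open>X^2\<close> is bounded by the energy through Cauchy-Schwarz; the
      linear part is absorbed by \<open>X \<le> X^2 + 1\<close>.\<close>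
    have cross: "2 * (A t q - m) * - E \<le> 2 * \<eta> * C * (C + \<bar>m\<bar>) * (\<Omega> + 1) * (energy q + 1)"
    proof -
      have X1: "X \<le> X\<^sup>2 + 1" using zero_le_power2[of "X - 1"] X0 by (simp add: power2_eq_square algebra_simps)
      have "(A t q - m) * - E \<le> \<bar>A t q - m\<bar> * \<bar>E\<bar>"
        using abs_ge_self[of "(A t q - m) * - E"] by (simp only: abs_mult abs_minus_cancel)
      from mult_left_mono[OF this, of 2]
      have "2 * (A t q - m) * - E \<le> 2 * (\<bar>A t q - m\<bar> * \<bar>E\<bar>)" by (simp only: mult.assoc)
      also have "\<dots> \<le> 2 * ((C * X + \<bar>m\<bar>) * (C * \<eta> * X))"
        using A_abs E_abs C X0 by (intro mult_left_mono mult_mono) auto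
      also have "\<dots> = 2 * \<eta> * C * (C * X\<^sup>2 + \<bar>m\<bar> * X)" by (simp add: algebra_simps power2_eq_square)
      also have "\<dots> \<le> 2 * \<eta> * C * (C * (X\<^sup>2 + 1) + \<bar>m\<bar> * (X\<^sup>2 + 1))"
        using C \<eta> X1 by (intro mult_left_mono add_mono) auto
      also have "\<dots> = 2 * \<eta> * C * (C + \<bar>m\<bar>) * (X\<^sup>2 + 1)" by (simp add: algebra_simps)
      also have "\<dots> \<le> 2 * \<eta> * C * (C + \<bar>m\<bar>) * ((\<Omega> + 1) * (energy q + 1))"
      proof (rule mult_left_mono)
        show "X\<^sup>2 + 1 \<le> (\<Omega> + 1) * (energy q + 1)"
          using X2 \<Omega>0 energy_nonneg[of q] by (simp add: algebra_simps)
      qed (use C \<eta> in auto)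
      finally show ?thesis by (simp add: mult.assoc)
    qed
    have gs: "(real N)\<^sup>2 * gen_sq \<epsilon> (A t) q \<le> 4 * exp 2 * C\<^sup>2 / real N * (energy q + 1)"
    proof -
      have "(real N)\<^sup>2 * gen_sq \<epsilon> (A t) q \<le> 4 * exp 2 * C\<^sup>2 / real N * energy q"
        unfolding A_fun by (rule gen_sq_cell_integral[OF q kd k_nonneg[OF t] k_bound[OF t]])
      also have "\<dots> \<le> 4 * exp 2 * C\<^sup>2 / real N * (energy q + 1)" by (intro mult_left_mono) auto
      finally show ?thesis .
    qed
    have gen_m: "gen \<epsilon> (\<lambda>q. A t q - m) q = gen \<epsilon> (A t) q" "gen_sq \<epsilon> (\<lambda>q. A t q - m) q = gen_sq \<epsilon> (A t) q"
      by (simp_all add: gen_def gen_sq_def)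
    have "gen \<epsilon> (G t) q = gen \<epsilon> (\<lambda>q. (A t q - m)\<^sup>2) q + \<rho> * exp (\<Lambda> * t) * gen \<epsilon> energy q"
      unfolding G_def gen_def by (simp add: sum.distrib sum_distrib_left algebra_simps sum_subtractf)
    then have gG: "gen \<epsilon> (G t) q = 2 * (A t q - m) * gen \<epsilon> (A t) q + gen_sq \<epsilon> (A t) q
        + \<rho> * exp (\<Lambda> * t) * gen \<epsilon> energy q"
      unfolding gen_square gen_m .
    have "(real N)\<^sup>2 * gen \<epsilon> (G t) q = 2 * (A t q - m) * ((real N)\<^sup>2 * gen \<epsilon> (A t) q) + (real N)\<^sup>2 * gen_sq \<epsilon> (A t) q
        + \<rho> * exp (\<Lambda> * t) * ((real N)\<^sup>2 * gen \<epsilon> energy q)"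
      unfolding gG by (simp add: algebra_simps)
    also have "2 * (A t q - m) * ((real N)\<^sup>2 * gen \<epsilon> (A t) q) = 2 * (A t q - m) * A' t q + 2 * (A t q - m) * - E"
      by (simp add: E_def algebra_simps)
    also have "2 * (A t q - m) * A' t q + 2 * (A t q - m) * - E + (real N)\<^sup>2 * gen_sq \<epsilon> (A t) q + \<rho> * exp (\<Lambda> * t) * ((real N)\<^sup>2 * gen \<epsilon> energy q)
       \<le> 2 * (A t q - m) * A' t q + \<rho> * (energy q + 1) + \<rho> * exp (\<Lambda> * t) * (6 * exp 2 * energy q)"
    proof -
      have "\<rho> * exp (\<Lambda> * t) * ((real N)\<^sup>2 * gen \<epsilon> energy q) \<le> \<rho> * exp (\<Lambda> * t) * (6 * exp 2 * energy q)"
        using \<rho>0 by (intro mult_left_mono gen_energy q) auto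
      moreover have "\<rho> * (energy q + 1) = 2 * \<eta> * C * (C + \<bar>m\<bar>) * (\<Omega> + 1) * (energy q + 1) + 4 * exp 2 * C\<^sup>2 / real N * (energy q + 1)"
        unfolding \<rho> by (rule distrib_right)
      ultimately show ?thesis using cross gs by linarith
    qed
    also have "\<dots> \<le> G' t q"
    proof -
      have "1 \<le> exp (\<Lambda> * t)" using t by (simp add: \<Lambda>_def)
      then have "\<rho> * (energy q + 1) * 1 \<le> \<rho> * (energy q + 1) * exp (\<Lambda> * t)"
        using \<rho>0 energy_nonneg[of q] by (intro mult_left_mono) auto
      moreover have "0 \<le> \<rho> * exp (\<Lambda> * t) * (6 * exp 2)" using \<rho>0 by simp
      moreover have "\<rho> * \<Lambda> * exp (\<Lambda> * t) * (energy q + 1) = \<rho> * (energy q + 1) * exp (\<Lambda> * t)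
          + \<rho> * exp (\<Lambda> * t) * (6 * exp 2 * energy q) + \<rho> * exp (\<Lambda> * t) * (6 * exp 2)"
        unfolding \<Lambda>_def by (simp add: algebra_simps)
      ultimately show ?thesis unfolding G'_def by linarith
    qed
    finally show ?thesis .
  qed
  have "infsum (mc_trans (\<lambda>q q'. (real N)\<^sup>2 * rateR \<epsilon> q q') T q) Y \<le> G T q / c"
  proof (rule mc_trans_markov_inequality(2)[where G = G and G' = G'])
    show "0 \<le> G t q" if "0 \<le> t" "t \<le> T" "q \<in> Qset" for t q
      unfolding G_def using \<rho>0 energy_nonneg[of q] by simp
    show "(\<Sum>z | (real N)\<^sup>2 * rateR \<epsilon> x z \<noteq> 0. (real N)\<^sup>2 * rateR \<epsilon> x z * (G t z - G t x)) \<le> G' t x"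
      if "0 \<le> t" "t \<le> T" "x \<in> Qset" for t x
      using super[OF that] N2 by (subst sum_rateR_gen[OF that(3)]) auto
    show "c \<le> G 0 y" if "y \<in> Y" "y \<in> Qset" for y
    proof -
      have "c \<le> (A 0 y - m)\<^sup>2" using c(2)[OF that] by (simp add: A_conv)
      moreover have "0 \<le> \<rho> * exp (\<Lambda> * 0) * (energy y + 1)" using \<rho>0 energy_nonneg[of y] by simp
      ultimately show ?thesis unfolding G_def by linarith
    qed
  qed (use dG T q c in auto)
  then show ?thesis unfolding G_def A_conv \<Lambda>_def .
qed

end

text \<open>Since \<open>2 / a - 1 - 1 / a^2 = - (1 - 1 / a)^2\<close>, the defect has three parts:
  the prefactor \<open>1 / a\<close> of the Laplacian, the Taylor remainder, and the mismatch
  between \<open>\<kappa>\<close> and \<open>N^2 (1 - 1 / a)^2\<close>. They are the three summands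
  of the bound, and \<open>C\<close> is uniform in \<open>N\<close>, \<open>a\<close> and
  \<open>t\<close>.\<close>

lemma kernel_error:
  fixes u \<tau> T \<kappa> :: real
  assumes \<tau>: "0 < \<tau>" and \<kappa>: "0 \<le> \<kappa>"
  shows "\<exists>C\<ge>0. \<forall>N\<ge>1. \<forall>a\<ge>1. \<forall>t\<in>{0..T}. \<forall>y.
     exp (- \<kappa> * t) * heat_kernel (t + \<tau>) (u - y) \<le> C * exp (- 2 * \<bar>y\<bar>)
   \<and> \<bar>exp (- \<kappa> * t) * (heat_kernel2 (t + \<tau>) (u - y) - \<kappa> * heat_kernel (t + \<tau>) (u - y)
         - (real N)\<^sup>2 * ((heat_kernel (t + \<tau>) (u - (y + 1 / real N)) + heat_kernel (t + \<tau>) (u - (y - 1 / real N))) / a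
            - (1 + 1 / a\<^sup>2) * heat_kernel (t + \<tau>) (u - y)))\<bar>
     \<le> C * (1 / real N + (1 - 1 / a) + \<bar>(real N)\<^sup>2 * (1 - 1 / a)\<^sup>2 - \<kappa>\<bar>) * exp (- 2 * \<bar>y\<bar>)"
proof -
  obtain B where B: "0 < B" "\<And>t z. t \<in> {\<tau>..T + \<tau>} \<Longrightarrow> \<bar>heat_kernel t z\<bar> \<le> B * exp (- 2 * \<bar>z\<bar>)
     \<and> \<bar>heat_kernel2 t z\<bar> \<le> B * exp (- 2 * \<bar>z\<bar>) \<and> \<bar>heat_kernel3 t z\<bar> \<le> B * exp (- 2 * \<bar>z\<bar>)"
    using heat_kernel_bounds[OF \<tau>, of 2 "T + \<tau>"] by auto
  define C where "C = B * exp 2 * exp (2 * \<bar>u\<bar>)"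
  { fix N :: nat and a t y :: real
    assume N: "1 \<le> N" and a: "1 \<le> a" and t: "t \<in> {0..T}"
    define z where "z = u - y"
    define h where "h = 1 / real N"
    define s where "s = t + \<tau>"
    \<comment> \<open>The factor \<open>exp 2\<close> pays for evaluating the kernels at points
      shifted by at most \<open>h \<le> 1\<close>.\<close>
    define w where "w = B * exp 2 * exp (- 2 * \<bar>z\<bar>)"
    define r where "r = (real N)\<^sup>2 * (heat_kernel s (z + h) + heat_kernel s (z - h) - 2 * heat_kernel s z) - heat_kernel2 s z"
    define \<eta> where "\<eta> = 1 / real N + (1 - 1 / a) + \<bar>(real N)\<^sup>2 * (1 - 1 / a)\<^sup>2 - \<kappa>\<bar>"
    have h: "0 < h" "h \<le> 1" "real N * h = 1" using N by (auto simp: h_def)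
    have s: "s \<in> {\<tau>..T + \<tau>}" "0 < s" using t \<tau> by (auto simp: s_def)
    have wC: "w \<le> C * exp (- 2 * \<bar>y\<bar>)"
    proof -
      have "exp (- 2 * \<bar>z\<bar>) \<le> exp (2 * \<bar>u\<bar>) * exp (- 2 * \<bar>y\<bar>)"
        unfolding exp_add[symmetric] exp_le_cancel_iff z_def using abs_triangle_ineq4[of u "u - y"] by simp
      from mult_left_mono[OF this, of "B * exp 2"] show ?thesis
        using B by (simp add: w_def C_def mult.assoc)
    qed
    have e2: "1 \<le> exp (2::real)" by simp
    have Bw: "B * exp (- 2 * \<bar>z\<bar>) \<le> w"
      unfolding w_def using B(1) mult_right_mono[OF e2, of "B * exp (- 2 * \<bar>z\<bar>)"] by (simp add: mult_ac)
    have K: "\<bar>heat_kernel s z\<bar> \<le> w" "\<bar>heat_kernel2 s z\<bar> \<le> w" using B(2)[OF s(1), of z] Bw by auto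
    have ek: "exp (- \<kappa> * t) \<le> 1" "0 < exp (- \<kappa> * t)" using \<kappa> t by auto
    have K3: "\<bar>heat_kernel3 s (z + x)\<bar> \<le> w" if "\<bar>x\<bar> \<le> h" for x
    proof -
      have "exp (- 2 * \<bar>z + x\<bar>) \<le> exp 2 * exp (- 2 * \<bar>z\<bar>)"
        unfolding exp_add[symmetric] exp_le_cancel_iff using that h abs_triangle_ineq4[of "z + x" x] by simp
      from mult_left_mono[OF this, of B]
      have "B * exp (- 2 * \<bar>z + x\<bar>) \<le> w" using B(1) by (simp add: w_def mult.assoc)
      moreover have "\<bar>heat_kernel3 s (z + x)\<bar> \<le> B * exp (- 2 * \<bar>z + x\<bar>)" using B(2)[OF s(1)] by blast
      ultimately show ?thesis by linarith
    qed
    have r: "\<bar>r\<bar> \<le> h * w"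
    proof -
      have N2h: "(real N)\<^sup>2 * h\<^sup>2 = 1" "(real N)\<^sup>2 * h ^ 3 = h"
        using h(3) by (simp_all add: power_mult_distrib[symmetric] power3_eq_cube power2_eq_square mult_ac)
      have "r = (real N)\<^sup>2 * (heat_kernel s (z + h) + heat_kernel s (z - h) - 2 * heat_kernel s z - h\<^sup>2 * heat_kernel2 s z)"
        unfolding r_def using N2h(1) by (simp add: right_diff_distrib mult.assoc[symmetric])
      then have "\<bar>r\<bar> = (real N)\<^sup>2 * \<bar>heat_kernel s (z + h) + heat_kernel s (z - h) - 2 * heat_kernel s z - h\<^sup>2 * heat_kernel2 s z\<bar>"
        by (simp add: abs_mult)
      also have "\<dots> \<le> (real N)\<^sup>2 * (h ^ 3 * w)"
        by (intro mult_left_mono heat_kernel_second_difference s h K3) auto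
      also have "\<dots> = h * w" using N2h(2) by (simp add: mult.assoc[symmetric])
      finally show ?thesis .
    qed
    define e where "e = heat_kernel2 s z - \<kappa> * heat_kernel s z
         - (real N)\<^sup>2 * ((heat_kernel s (z - h) + heat_kernel s (z + h)) / a - (1 + 1 / a\<^sup>2) * heat_kernel s z)"
    have "e = (1 - 1 / a) * heat_kernel2 s z - r / a + ((real N)\<^sup>2 * (1 - 1 / a)\<^sup>2 - \<kappa>) * heat_kernel s z"
      unfolding e_def r_def using a by (simp add: field_simps power2_eq_square)
    then have "\<bar>e\<bar> \<le> \<bar>(1 - 1 / a) * heat_kernel2 s z\<bar> + \<bar>r / a\<bar> + \<bar>((real N)\<^sup>2 * (1 - 1 / a)\<^sup>2 - \<kappa>) * heat_kernel s z\<bar>"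
      by linarith
    also have "\<dots> \<le> (1 - 1 / a) * w + h * w + \<bar>(real N)\<^sup>2 * (1 - 1 / a)\<^sup>2 - \<kappa>\<bar> * w"
    proof (intro add_mono)
      show "\<bar>(1 - 1 / a) * heat_kernel2 s z\<bar> \<le> (1 - 1 / a) * w"
        using K(2) a by (simp add: abs_mult mult_left_mono)
      have "\<bar>r / a\<bar> \<le> \<bar>r\<bar> / 1" unfolding abs_divide using a by (intro divide_left_mono) auto
      with r show "\<bar>r / a\<bar> \<le> h * w" by simp
      show "\<bar>((real N)\<^sup>2 * (1 - 1 / a)\<^sup>2 - \<kappa>) * heat_kernel s z\<bar> \<le> \<bar>(real N)\<^sup>2 * (1 - 1 / a)\<^sup>2 - \<kappa>\<bar> * w"
        unfolding abs_mult using K(1) by (intro mult_left_mono) auto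
    qed
    also have "\<dots> = \<eta> * w" by (simp add: \<eta>_def h_def algebra_simps)
    also have "\<dots> \<le> \<eta> * (C * exp (- 2 * \<bar>y\<bar>))"
      using wC a by (intro mult_left_mono) (auto simp: \<eta>_def)
    finally have e: "\<bar>e\<bar> \<le> C * \<eta> * exp (- 2 * \<bar>y\<bar>)" by (simp add: mult_ac)
    have "\<bar>exp (- \<kappa> * t) * e\<bar> \<le> 1 * (C * \<eta> * exp (- 2 * \<bar>y\<bar>))"
      unfolding abs_mult using ek e by (intro mult_mono) auto
    moreover have "exp (- \<kappa> * t) * heat_kernel s z \<le> 1 * (C * exp (- 2 * \<bar>y\<bar>))"
      using ek K(1) wC heat_kernel_pos[OF s(2), of z] by (intro mult_mono) auto
    moreover have "u - (y + 1 / real N) = z - h" "u - (y - 1 / real N) = z + h" by (auto simp: z_def h_def)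
    ultimately have "exp (- \<kappa> * t) * heat_kernel (t + \<tau>) (u - y) \<le> C * exp (- 2 * \<bar>y\<bar>)
      \<and> \<bar>exp (- \<kappa> * t) * (heat_kernel2 (t + \<tau>) (u - y) - \<kappa> * heat_kernel (t + \<tau>) (u - y)
         - (real N)\<^sup>2 * ((heat_kernel (t + \<tau>) (u - (y + 1 / real N)) + heat_kernel (t + \<tau>) (u - (y - 1 / real N))) / a
            - (1 + 1 / a\<^sup>2) * heat_kernel (t + \<tau>) (u - y)))\<bar>
      \<le> C * (1 / real N + (1 - 1 / a) + \<bar>(real N)\<^sup>2 * (1 - 1 / a)\<^sup>2 - \<kappa>\<bar>) * exp (- 2 * \<bar>y\<bar>)"
      unfolding e_def \<eta>_def s_def z_def[symmetric] by simp
  }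
  moreover have "0 \<le> C" using B(1) by (simp add: C_def)
  ultimately show ?thesis by blast
qed

section \<open>Heights and test functions\<close>

text \<open>Rounding up keeps the index at least 1: grid points will be left ends of test functions,
  whose supports must stay away from 0.\<close>

lemma grid_point:
  fixes r u :: real
  assumes r: "0 < r" and u: "0 \<le> u" "u \<le> real M * r" and M: "1 \<le> M"
  shows "\<exists>k\<in>{1..M}. u \<le> real k * r \<and> real k * r \<le> u + r"
proof (cases "u = 0")
  case True
  then show ?thesis using r M by (intro bexI[of _ 1]) auto
next
  case False
  define k where "k = nat \<lceil>u / r\<rceil>"
  have pos: "0 < u / r" using u False r by simp
  have k: "u / r \<le> real k" "real k < u / r + 1" using pos unfolding k_def by linarith+
  have "u / r \<le> real M" using u r by (simp add: divide_le_eq)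
  then have "real k < real M + 1" using k(2) by linarith
  then have "k \<le> M" by simp
  moreover have "1 \<le> k" using k(1) pos by (cases k) auto
  moreover have "u \<le> real k * r" using k(1) r by (simp add: divide_le_eq)
  moreover have "real k * r \<le> u + r" using k(2) r by (simp add: field_simps)
  ultimately show ?thesis by auto
qed

text \<open>Shared by profiles, with \<open>e = 0\<close>, and by rescaled heights, where
  \<open>e = 1 / N\<close> is the lattice error. It lets values on a grid control all
  values.\<close>

definition almost_lipschitz :: "real \<Rightarrow> (real \<Rightarrow> real) \<Rightarrow> bool" where
  "almost_lipschitz e \<xi> \<longleftrightarrow> (\<forall>u v. 0 \<le> u \<longrightarrow> u \<le> v \<longrightarrow> 0 \<le> \<xi> v \<and> \<xi> v \<le> \<xi> u \<and> \<xi> u \<le> \<xi> v + (v - u) + e)"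

lemma almost_lipschitzD:
  assumes "almost_lipschitz e \<xi>" "0 \<le> u" "u \<le> v"
  shows "0 \<le> \<xi> v" "\<xi> v \<le> \<xi> u" "\<xi> u \<le> \<xi> v + (v - u) + e"
  using assms by (auto simp: almost_lipschitz_def)

lemma almost_lipschitz_XR:
  assumes \<psi>: "\<psi> \<in> XR"
  shows "almost_lipschitz 0 \<psi>"
  unfolding almost_lipschitz_def
proof (intro allI impI conjI)
  fix u v :: real assume uv: "0 \<le> u" "u \<le> v"
  show "0 \<le> \<psi> v" using XR_nonneg[OF \<psi>] uv by simp
  show "\<psi> v \<le> \<psi> u" "\<psi> u \<le> \<psi> v + (v - u) + 0"
    using XR_monotone_lipschitz[OF \<psi> uv] by simp_all
qed

lemma almost_lipschitz_height:
  assumes q: "q \<in> Qset" and N: "1 \<le> N"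
  shows "almost_lipschitz (1 / real N) (height_resc N q)"
  unfolding almost_lipschitz_def height_resc_def
proof (intro allI impI conjI)
  fix u v :: real assume uv: "0 \<le> u" "u \<le> v"
  have N0: "0 < real N" using N by simp
  have uv': "0 \<le> real N * u" "real N * u \<le> real N * v" using uv by (auto intro: mult_left_mono)
  note h = height_antimono_lipschitz[OF q uv']
  show "0 \<le> Defs.height q (real N * v) / real N" by (simp add: Defs.height_def)
  show "Defs.height q (real N * v) / real N \<le> Defs.height q (real N * u) / real N"
    using h(1) N0 by (simp add: divide_right_mono)
  have "Defs.height q (real N * u) / real N \<le> (Defs.height q (real N * v) + (real N * v - real N * u) + 1) / real N"
    using h(2) N0 by (intro divide_right_mono) auto
  also have "\<dots> = Defs.height q (real N * v) / real N + (v - u) + 1 / real N"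
    using N0 by (simp add: field_simps)
  finally show "Defs.height q (real N * u) / real N \<le> Defs.height q (real N * v) / real N + (v - u) + 1 / real N" .
qed

text \<open>At the next grid point to the right, one function is compared by monotonicity and the
  other by its Lipschitz bound, so the mesh \<open>r\<close> is paid only once.\<close>

lemma close_from_grid:
  assumes \<xi>: "almost_lipschitz e \<xi>" and \<phi>: "almost_lipschitz e' \<phi>" and e: "0 \<le> e" "0 \<le> e'"
    and r: "0 < r" and M: "1 \<le> M" and c: "0 \<le> c"
    and grid: "\<And>k. k \<in> {1..M} \<Longrightarrow> \<bar>\<xi> (real k * r) - \<phi> (real k * r)\<bar> \<le> c"
    and u: "0 \<le> u" "u \<le> real M * r"
  shows "\<bar>\<xi> u - \<phi> u\<bar> \<le> c + r + e + e'"
proof -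
  obtain k where k: "k \<in> {1..M}" "u \<le> real k * r" "real k * r \<le> u + r"
    using grid_point[OF r u M] by auto
  show ?thesis
    using almost_lipschitzD(2,3)[OF \<xi> u(1) k(2)] almost_lipschitzD(2,3)[OF \<phi> u(1) k(2)] grid[OF k(1)] k(3) e
    by (simp add: abs_le_iff)
qed

lemma borel_measurable_height_on:
  "(\<lambda>u. real (hgt q (nat \<lfloor>real N * u\<rfloor>)) / real N) \<in> borel_measurable borel"
  by measurable

section \<open>Integrals against test functions\<close>

lemma integrable_test_on:
  fixes f g \<xi> :: "real \<Rightarrow> real"
  assumes f: "continuous_on UNIV f" and a: "0 \<le> a" and \<xi>: "almost_lipschitz e \<xi>"
    and g: "g \<in> borel_measurable borel" "\<And>u. a \<le> u \<Longrightarrow> g u = \<xi> u"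
  shows "(\<lambda>u. f u * \<xi> u) integrable_on {a..b}"
proof (rule measurable_bounded_by_integrable_imp_integrable)
  have "f \<in> borel_measurable borel" using f by (rule borel_measurable_continuous_onI)
  with g have "(\<lambda>u. f u * g u) \<in> borel_measurable borel" by simp
  then have "(\<lambda>u. f u * g u) \<in> borel_measurable (lebesgue_on {a..b})"
    by (intro measurable_restrict_space1 measurable_completion) simp
  then show "(\<lambda>u. f u * \<xi> u) \<in> borel_measurable (lebesgue_on {a..b})"
    by (rule measurable_cong[THEN iffD1, rotated]) (simp add: g space_restrict_space)
  show "(\<lambda>u. \<bar>f u\<bar> * \<xi> a) integrable_on {a..b}"
    by (intro integrable_continuous_interval continuous_intros continuous_on_subset[OF f]) auto
  show "norm (f u * \<xi> u) \<le> \<bar>f u\<bar> * \<xi> a" if "u \<in> {a..b}" for u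
    using almost_lipschitzD(1,2)[OF \<xi> a, of u] that by (auto simp: abs_mult intro!: mult_left_mono)
qed auto

lemma integral_halfline_eq:
  fixes F :: "real \<Rightarrow> real"
  assumes "\<And>u. u \<notin> {a..b} \<Longrightarrow> F u = 0" "0 \<le> a" "F integrable_on {a..b}"
  shows "integral {0..} F = integral {a..b} F"
  by (rule integral_unique[OF has_integral_on_superset[OF integrable_integral[OF assms(3)]]]) (use assms in auto)

text \<open>At \<open>u < 0\<close> the set counted by \<^const>\<open>height\<close> is infinite and the height is the junk value 0;
  measurability is taken from the floor formula, which agrees with the height only for \<open>u \<ge> 0\<close>.\<close>

lemma integrable_height_test:
  assumes q: "q \<in> Qset" and N: "1 \<le> N" and f: "continuous_on UNIV f" and a: "0 \<le> a"
  shows "(\<lambda>u. f u * height_resc N q u) integrable_on {a..b}"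
  by (rule integrable_test_on[OF f a almost_lipschitz_height[OF q N] borel_measurable_height_on[of q N]])
    (use a in \<open>simp add: height_resc_def height_eq_hgt\<close>)

lemma integrable_XR_test:
  assumes \<psi>: "\<psi> \<in> XR" and f: "continuous_on UNIV f" and a: "0 \<le> a"
  shows "(\<lambda>u. f u * \<psi> u) integrable_on {a..b}"
  by (intro integrable_continuous_interval continuous_intros continuous_on_subset[OF f]
      continuous_on_subset[OF XR_continuous_on[OF \<psi>]]) (use a in auto)

definition bump :: "real \<Rightarrow> real \<Rightarrow> real \<Rightarrow> real" where
  "bump s r y = max 0 (min (y - s) (s + r - y))"

lemma bump_props:
  assumes "0 < s" "0 < r"
  shows "C0pos (bump s r)" "continuous_on UNIV (bump s r)" "0 \<le> bump s r y"
    "y \<notin> {s..s + r} \<Longrightarrow> bump s r y = 0" "0 < integral {s..s + r} (bump s r)"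
proof -
  show c: "continuous_on UNIV (bump s r)" unfolding bump_def[abs_def] by (intro continuous_intros)
  show z: "y \<notin> {s..s + r} \<Longrightarrow> bump s r y = 0" for y by (auto simp: bump_def)
  show nn: "0 \<le> bump s r y" for y by (simp add: bump_def)
  show "C0pos (bump s r)" unfolding C0pos_def
    using c z assms by (intro conjI exI[of _ s] exI[of _ "s + r"]) auto
  have i: "bump s r integrable_on {x..y}" for x y
    by (intro integrable_continuous_interval continuous_on_subset[OF c]) auto
  \<comment> \<open>On its middle third the tent is at least \<open>r / 3\<close> high.\<close>
  have "0 < r / 3 * (r / 3)" using assms by simp
  also have "\<dots> = integral {s + r / 3..s + 2 * r / 3} (\<lambda>_. r / 3)" using assms by (simp add: field_simps)
  also have "\<dots> \<le> integral {s + r / 3..s + 2 * r / 3} (bump s r)"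
    by (intro integral_le i) (auto simp: bump_def)
  also have "\<dots> \<le> integral {s..s + r} (bump s r)"
    by (rule integral_subset_le) (use assms i nn in auto)
  finally show "0 < integral {s..s + r} (bump s r)" .
qed

text \<open>For a decreasing function the bump average lies between the values at
  \<open>s + r\<close> and at \<open>s\<close>. Comparing the two averages crosswise costs
  \<open>r\<close>, and returning from \<open>s + r\<close> to \<open>s\<close> costs another
  \<open>r\<close> by the Lipschitz bound.\<close>

lemma close_at_point_from_test:
  assumes \<xi>: "almost_lipschitz e \<xi>" and \<phi>: "almost_lipschitz e' \<phi>" and e: "0 \<le> e" "0 \<le> e'"
    and s: "0 < s" and r: "0 < r"
    and int: "(\<lambda>u. bump s r u * \<xi> u) integrable_on {s..s + r}" "(\<lambda>u. bump s r u * \<phi> u) integrable_on {s..s + r}"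
    and test: "\<bar>integral {0..} (\<lambda>u. bump s r u * \<xi> u) - integral {0..} (\<lambda>u. bump s r u * \<phi> u)\<bar>
        \<le> r * integral {s..s + r} (bump s r)"
  shows "\<bar>\<xi> s - \<phi> s\<bar> \<le> 2 * r + e + e'"
proof -
  let ?f = "bump s r"
  define I where "I = integral {s..s + r} ?f"
  note b = bump_props[OF s r]
  have I: "0 < I" unfolding I_def by (rule b)
  have fi: "?f integrable_on {s..s + r}"
    by (intro integrable_continuous_interval continuous_on_subset[OF b(2)]) auto
  have lo_hi: "\<theta> (s + r) * I \<le> integral {0..} (\<lambda>u. ?f u * \<theta> u) \<and> integral {0..} (\<lambda>u. ?f u * \<theta> u) \<le> \<theta> s * I"
    if \<theta>: "almost_lipschitz e'' \<theta>" and i: "(\<lambda>u. ?f u * \<theta> u) integrable_on {s..s + r}" for \<theta> e''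
  proof -
    have eq: "integral {0..} (\<lambda>u. ?f u * \<theta> u) = integral {s..s + r} (\<lambda>u. ?f u * \<theta> u)"
      by (rule integral_halfline_eq) (use b(4) s i in auto)
    have "integral {s..s + r} (\<lambda>u. ?f u * \<theta> (s + r)) \<le> integral {s..s + r} (\<lambda>u. ?f u * \<theta> u)"
      by (intro integral_le i integrable_on_mult_left fi mult_left_mono b)
        (use almost_lipschitzD(2)[OF \<theta>] s in auto)
    moreover have "integral {s..s + r} (\<lambda>u. ?f u * \<theta> u) \<le> integral {s..s + r} (\<lambda>u. ?f u * \<theta> s)"
      by (intro integral_le i integrable_on_mult_left fi mult_left_mono b)
        (use almost_lipschitzD(2)[OF \<theta>] s in auto)
    ultimately show ?thesis unfolding eq by (simp add: I_def mult.commute)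
  qed
  have "\<xi> (s + r) * I \<le> \<phi> s * I + r * I" "\<phi> (s + r) * I \<le> \<xi> s * I + r * I"
    using lo_hi[OF \<xi> int(1)] lo_hi[OF \<phi> int(2)] test unfolding I_def[symmetric] by linarith+
  then have "\<xi> (s + r) \<le> \<phi> s + r" "\<phi> (s + r) \<le> \<xi> s + r"
    using I by (simp_all flip: distrib_right)
  then show ?thesis
    using almost_lipschitzD(3)[OF \<xi>, of s "s + r"] almost_lipschitzD(3)[OF \<phi>, of s "s + r"] s r e
    by (simp add: abs_le_iff)
qed

definition good :: "(real \<Rightarrow> real) \<Rightarrow> nat \<Rightarrow> real \<Rightarrow> config \<Rightarrow> bool" where
  "good \<psi>0 N d q \<longleftrightarrow> (\<forall>u\<ge>0. \<bar>height_resc N q u - \<psi>0 u\<bar> \<le> d)"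

text \<open>Bumps at finitely many grid points give closeness on a compact interval. Beyond it
  \<open>\<psi>0\<close> is small, and the height, being decreasing, is no larger than at the last
  grid point, where it is close to \<open>\<psi>0\<close>.\<close>

lemma good_from_tests:
  assumes \<psi>0: "\<psi>0 \<in> XR" and d: "0 < d"
  shows "\<exists>\<delta>>0. \<exists>M r. 0 < r \<and> (\<forall>N. 1 \<le> N \<longrightarrow> 1 / real N \<le> d / 8 \<longrightarrow> (\<forall>q\<in>Qset.
    (\<forall>k\<in>{1..M}. \<bar>integral {0..} (\<lambda>u. bump (real k * r) r u * height_resc N q u)
        - integral {0..} (\<lambda>u. bump (real k * r) r u * \<psi>0 u)\<bar> \<le> \<delta>) \<longrightarrow> good \<psi>0 N d q))"
proof -
  \<comment> \<open>On the interval the errors add up to \<open>3 r + 2 / N\<close>, and beyond it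
    to at most \<open>3 r + 1 / N\<close>; both fit into \<open>d\<close>.\<close>
  define r where "r = d / 8"
  have r: "0 < r" using d by (simp add: r_def)
  have "(\<psi>0 \<longlongrightarrow> 0) at_top" using \<psi>0 by (auto simp: XR_def)
  then have "\<forall>\<^sub>F u in at_top. \<psi>0 u < r" using r by (rule order_tendstoD(2))
  then obtain U where U: "\<And>u. U \<le> u \<Longrightarrow> \<psi>0 u < r" by (auto simp: eventually_at_top_linorder)
  define M where "M = nat \<lceil>\<bar>U\<bar> / r\<rceil> + 1"
  have M: "1 \<le> M" "\<bar>U\<bar> \<le> real M * r"
  proof -
    have "\<bar>U\<bar> / r \<le> real M" unfolding M_def by linarith
    then show "\<bar>U\<bar> \<le> real M * r" using r by (simp add: divide_le_eq)
  qed (simp add: M_def)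
  define \<delta> where "\<delta> = r * Min ((\<lambda>k. integral {real k * r..real k * r + r} (bump (real k * r) r)) ` {1..M})"
  have \<delta>: "0 < \<delta>"
    unfolding \<delta>_def using r M by (intro mult_pos_pos) (auto simp: Min_gr_iff intro!: bump_props)
  have "good \<psi>0 N d q"
    if N: "1 \<le> N" "1 / real N \<le> d / 8" and q: "q \<in> Qset"
      and t: "\<And>k. k \<in> {1..M} \<Longrightarrow> \<bar>integral {0..} (\<lambda>u. bump (real k * r) r u * height_resc N q u)
        - integral {0..} (\<lambda>u. bump (real k * r) r u * \<psi>0 u)\<bar> \<le> \<delta>" for N q
  proof -
    note L = almost_lipschitz_height[OF q N(1)] almost_lipschitz_XR[OF \<psi>0]
    have grid: "\<bar>height_resc N q (real k * r) - \<psi>0 (real k * r)\<bar> \<le> 2 * r + 1 / real N + 0" if k: "k \<in> {1..M}" for k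
    proof (rule close_at_point_from_test[OF L _ _ _ r])
      show s: "0 < real k * r" using k r by simp
      note b = bump_props(2)[OF s r]
      show "(\<lambda>u. bump (real k * r) r u * height_resc N q u) integrable_on {real k * r..real k * r + r}"
        "(\<lambda>u. bump (real k * r) r u * \<psi>0 u) integrable_on {real k * r..real k * r + r}"
        using s by (auto intro!: integrable_height_test[OF q N(1) b] integrable_XR_test[OF \<psi>0 b])
      have "\<delta> \<le> r * integral {real k * r..real k * r + r} (bump (real k * r) r)"
        unfolding \<delta>_def using r k by (intro mult_left_mono Min_le) auto
      with t[OF k] show "\<bar>integral {0..} (\<lambda>u. bump (real k * r) r u * height_resc N q u)
        - integral {0..} (\<lambda>u. bump (real k * r) r u * \<psi>0 u)\<bar> \<le> r * integral {real k * r..real k * r + r} (bump (real k * r) r)"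
        by linarith
    qed auto
    show ?thesis
      unfolding good_def
    proof (intro allI impI)
      fix u :: real assume u: "0 \<le> u"
      show "\<bar>height_resc N q u - \<psi>0 u\<bar> \<le> d"
      proof (cases "u \<le> real M * r")
        case True
        have "\<bar>height_resc N q u - \<psi>0 u\<bar> \<le> (2 * r + 1 / real N + 0) + r + 1 / real N + 0"
          by (rule close_from_grid[OF L _ _ r M(1) _ grid u True]) (use r in auto)
        also have "\<dots> \<le> d" using N(2) d by (simp add: r_def)
        finally show ?thesis .
      next
        case False
        define s where "s = real M * r"
        have s: "0 \<le> s" "s \<le> u" "U \<le> s" using False M r by (auto simp: s_def)
        have "\<bar>height_resc N q s - \<psi>0 s\<bar> \<le> 2 * r + 1 / real N + 0" unfolding s_def using M(1) by (intro grid) auto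
        moreover have "\<psi>0 s < r" "\<psi>0 u < r" using U s by auto
        ultimately show ?thesis
          using almost_lipschitzD(1,2)[OF L(1) s(1,2)] almost_lipschitzD(1)[OF L(2) s(1,2)] N(2) d
          unfolding r_def by (simp add: abs_le_iff)
      qed
    qed
  qed
  with \<delta> r show ?thesis by blast
qed

lemma tests_from_grid:
  assumes \<phi>: "\<phi> \<in> XR" and f: "C0pos f" and \<delta>: "0 < \<delta>"
  shows "\<exists>c>0. \<exists>M r. 0 < r \<and> (\<forall>N. 1 \<le> N \<longrightarrow> 1 / real N \<le> c \<longrightarrow> (\<forall>q\<in>Qset.
    (\<forall>k\<in>{1..M}. \<bar>height_resc N q (real k * r) - \<phi> (real k * r)\<bar> \<le> c) \<longrightarrow>
    \<bar>integral {0..} (\<lambda>u. f u * height_resc N q u) - integral {0..} (\<lambda>u. f u * \<phi> u)\<bar> \<le> \<delta>))"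
proof -
  obtain a b where ab: "0 < a" "a \<le> b" "\<And>u. u \<notin> {a..b} \<Longrightarrow> f u = 0" and fc: "continuous_on UNIV f"
    using f by (auto simp: C0pos_def)
  define I where "I = integral {a..b} (\<lambda>u. \<bar>f u\<bar>)"
  have fi: "(\<lambda>u. \<bar>f u\<bar>) integrable_on {a..b}"
    by (intro integrable_continuous_interval continuous_intros continuous_on_subset[OF fc]) auto
  have I: "0 \<le> I" unfolding I_def by (intro integral_nonneg fi) auto
  \<comment> \<open>The pointwise error on the support is \<open>3 c\<close>: grid closeness, mesh
    and lattice error \<open>1 / N\<close> contribute \<open>c\<close> each. The \<open>+ 1\<close>
    covers the case of vanishing \<open>f\<close>.\<close>
  define c where "c = \<delta> / (3 * (I + 1))"
  have c: "0 < c" using \<delta> I by (simp add: c_def)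
  define M where "M = nat \<lceil>b / c\<rceil> + 1"
  have M: "1 \<le> M" "b \<le> real M * c"
  proof -
    have "b / c \<le> real M" unfolding M_def by linarith
    then show "b \<le> real M * c" using c by (simp add: divide_le_eq)
  qed (simp add: M_def)
  have "\<bar>integral {0..} (\<lambda>u. f u * height_resc N q u) - integral {0..} (\<lambda>u. f u * \<phi> u)\<bar> \<le> \<delta>"
    if N: "1 \<le> N" "1 / real N \<le> c" and q: "q \<in> Qset"
      and grid: "\<And>k. k \<in> {1..M} \<Longrightarrow> \<bar>height_resc N q (real k * c) - \<phi> (real k * c)\<bar> \<le> c" for N q
  proof -
    note L = almost_lipschitz_height[OF q N(1)] almost_lipschitz_XR[OF \<phi>]
    have a0: "0 \<le> a" using ab by simp
    note i = integrable_height_test[OF q N(1) fc a0, of b] integrable_XR_test[OF \<phi> fc a0, of b]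
    have eq: "integral {0..} (\<lambda>u. f u * height_resc N q u) = integral {a..b} (\<lambda>u. f u * height_resc N q u)"
      "integral {0..} (\<lambda>u. f u * \<phi> u) = integral {a..b} (\<lambda>u. f u * \<phi> u)"
      by (intro integral_halfline_eq; use ab i in simp)+
    have close: "\<bar>height_resc N q u - \<phi> u\<bar> \<le> 3 * c" if "u \<in> {a..b}" for u
    proof -
      have "\<bar>height_resc N q u - \<phi> u\<bar> \<le> c + c + 1 / real N + 0"
        by (rule close_from_grid[OF L _ _ c M(1) _ grid]) (use c that ab M in auto)
      with N show ?thesis by simp
    qed
    have "\<bar>integral {0..} (\<lambda>u. f u * height_resc N q u) - integral {0..} (\<lambda>u. f u * \<phi> u)\<bar>
        = norm (integral {a..b} (\<lambda>u. f u * height_resc N q u - f u * \<phi> u))"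
      unfolding eq by (simp add: integral_diff[OF i])
    also have "\<dots> \<le> integral {a..b} (\<lambda>u. \<bar>f u\<bar> * (3 * c))"
    proof (rule integral_norm_bound_integral)
      show "norm (f u * height_resc N q u - f u * \<phi> u) \<le> \<bar>f u\<bar> * (3 * c)" if "u \<in> {a..b}" for u
        unfolding right_diff_distrib[symmetric] norm_mult using close[OF that] by (auto intro: mult_left_mono)
    qed (intro integrable_diff i integrable_on_mult_left fi)+
    also have "\<dots> = I * (3 * c)" by (simp add: I_def)
    also have "\<dots> \<le> \<delta>"
    proof -
      have "I * (3 * c) \<le> (I + 1) * (3 * c)" using c by (intro mult_right_mono) auto
      also have "\<dots> = \<delta>" using I by (simp add: c_def field_simps)
      finally show ?thesis .
    qed
    finally show ?thesis .
  qed
  with c show ?thesis by blast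
qed

section \<open>Convergence\<close>

lemma exp_growth_exp_abs: "exp_growth (\<lambda>y. exp (c * \<bar>y\<bar>))"
  unfolding exp_growth_def by (intro conjI exI[of _ 1] exI[of _ c]) auto

text \<open>Continuity of the heat evolution at time 0, where it returns \<open>exp 0\<close>. These
  averages are the distortion that a narrow kernel causes to a log-Lipschitz function.\<close>

lemma heat_conv_exp_abs_limit:
  "((\<lambda>\<tau>. heat_conv heat_kernel (\<lambda>y. exp (c * \<bar>y\<bar>)) \<tau> 0) \<longlongrightarrow> 1) (at_right 0)"
proof -
  have "continuous_on {0..} (\<lambda>t. heat_ext (\<lambda>y. exp (c * \<bar>y\<bar>)) t 0)"
  proof -
    have c: "continuous_on UNIV (\<lambda>y. exp (c * \<bar>y\<bar>))" by (intro continuous_intros)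
    have t: "continuous_on {0..} (\<lambda>t::real. (t, 0::real))" by (intro continuous_intros)
    show ?thesis
      using continuous_on_compose2[OF continuous_on_heat_ext[OF exp_growth_exp_abs c] t] by (simp add: image_subset_iff)
  qed
  then have "((\<lambda>t. heat_ext (\<lambda>y. exp (c * \<bar>y\<bar>)) t 0) \<longlongrightarrow> heat_ext (\<lambda>y. exp (c * \<bar>y\<bar>)) 0 0) (at 0 within {0..})"
    unfolding continuous_on_def by auto
  then have "((\<lambda>t. heat_ext (\<lambda>y. exp (c * \<bar>y\<bar>)) t 0) \<longlongrightarrow> 1) (at_right 0)"
    using tendsto_within_subset[OF _ Ioi_le_Ico] unfolding heat_ext_0 by force
  then show ?thesis
    by (rule Lim_transform_eventually) (auto simp: heat_ext_eq_conv eventually_at_filter)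
qed

lemma one_minus_exp_rate:
  assumes b: "b \<longlonglongrightarrow> \<beta>" and pos: "\<And>N. 1 \<le> N \<Longrightarrow> 0 < b N"
  shows "(\<lambda>N. real N * (1 - exp (- (b N / (2 * real N))))) \<longlonglongrightarrow> \<beta> / 2"
proof -
  have "((\<lambda>x::real. exp x) has_real_derivative 1) (at 0)" by (auto intro!: derivative_eq_intros)
  then have d: "((\<lambda>x::real. (exp x - 1) / x) \<longlongrightarrow> 1) (at 0)" unfolding has_field_derivative_iff by simp
  define x where "x N = - (b N / (2 * real N))" for N
  have "(\<lambda>N. b N * (1 / 2) * (1 / real N)) \<longlonglongrightarrow> \<beta> * (1 / 2) * 0"
    by (intro tendsto_mult b tendsto_const lim_1_over_n)
  then have x0: "x \<longlonglongrightarrow> 0"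
    using tendsto_minus[of "\<lambda>N. b N * (1 / 2) * (1 / real N)" 0] by (simp add: x_def[abs_def])
  have "\<forall>\<^sub>F N in sequentially. x N \<noteq> 0"
    using eventually_ge_at_top[of 1]
  proof eventually_elim
    case (elim N)
    then show ?case using pos[OF elim] by (simp add: x_def)
  qed
  with x0 have "filterlim x (at 0) sequentially" unfolding filterlim_at by auto
  from filterlim_compose[OF d this]
  have "(\<lambda>N. (exp (x N) - 1) / x N * (b N / 2)) \<longlonglongrightarrow> 1 * (\<beta> / 2)"
    by (intro tendsto_mult b tendsto_divide tendsto_const) auto
  then have l: "(\<lambda>N. (exp (x N) - 1) / x N * (b N / 2)) \<longlonglongrightarrow> \<beta> / 2" by simp
  have "\<forall>\<^sub>F N in sequentially. (exp (x N) - 1) / x N * (b N / 2) = real N * (1 - exp (- (b N / (2 * real N))))"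
    using eventually_ge_at_top[of 1]
  proof eventually_elim
    case (elim N)
    then show ?case using pos[OF elim] unfolding x_def by (simp add: field_simps)
  qed
  then show ?thesis by (rule Lim_transform_eventually[OF l])
qed

text \<open>\<open>1 - 1 / a\<close> is asymptotically \<open>beta / (2 N)\<close>. The second limit
  identifies the decay rate of the lattice operator with \<open>beta^2 / 4\<close>, the rate that
  the macroscopic transform compensates.\<close>

lemma gbase_limits:
  "(\<lambda>N. 1 - 1 / gbase N) \<longlonglongrightarrow> 0"
  "(\<lambda>N. (real N)\<^sup>2 * (1 - 1 / gbase N)\<^sup>2) \<longlonglongrightarrow> beta\<^sup>2 / 4"
proof -
  have eq: "exp (- (betaN N / (2 * real N))) = 1 / gbase N" if "1 \<le> N" for N
    unfolding gbase_props(4)[OF that] by (simp add: exp_minus inverse_eq_divide)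
  have "(\<lambda>N. real N * (1 - exp (- (betaN N / (2 * real N))))) \<longlonglongrightarrow> beta / 2"
    by (rule one_minus_exp_rate[OF betaN_limit gbase_props(3)])
  then have l: "(\<lambda>N. real N * (1 - 1 / gbase N)) \<longlonglongrightarrow> beta / 2"
    by (rule Lim_transform_eventually) (use eq in \<open>auto intro!: eventually_mono[OF eventually_ge_at_top[of 1]]\<close>)
  from tendsto_power[OF this, of 2]
  show "(\<lambda>N. (real N)\<^sup>2 * (1 - 1 / gbase N)\<^sup>2) \<longlonglongrightarrow> beta\<^sup>2 / 4"
    by (simp add: power_mult_distrib power_divide)
  have "(\<lambda>N. 1 / real N * (real N * (1 - 1 / gbase N))) \<longlonglongrightarrow> 0 * (beta / 2)"
    by (intro tendsto_mult lim_1_over_n l)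
  then have z: "(\<lambda>N. 1 / real N * (real N * (1 - 1 / gbase N))) \<longlonglongrightarrow> 0" by simp
  show "(\<lambda>N. 1 - 1 / gbase N) \<longlonglongrightarrow> 0"
  proof (rule Lim_transform_eventually[OF z])
    show "\<forall>\<^sub>F N in sequentially. 1 / real N * (real N * (1 - 1 / gbase N)) = 1 - 1 / gbase N"
      using eventually_ge_at_top[of 1] by eventually_elim simp
  qed
qed

section \<open>From heights to the transformed variable at time zero\<close>

lemma ln_cell:
  assumes N: "1 \<le> N"
  shows "ln (cell N (gbase N) q y) = betaN N * (real (nat \<bar>\<lfloor>real N * y\<rfloor>\<bar>) / (2 * real N)
      + height_resc N q (real (nat \<bar>\<lfloor>real N * y\<rfloor>\<bar>) / real N))"
proof -
  define n where "n = nat \<bar>\<lfloor>real N * y\<rfloor>\<bar>"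
  have N0: "0 < real N" using N by simp
  have h: "height_resc N q (real n / real N) = real (hgt q n) / real N"
    using N0 by (simp add: height_resc_def height_eq_hgt)
  have g: "1 < gbase N" by (rule gbase_props[OF N])
  have "ln (cell N (gbase N) q y) = real (n + 2 * hgt q n) * ln (gbase N)"
    unfolding cell_def gaertner_def n_def[symmetric] using g by (subst ln_realpow) auto
  also have "\<dots> = betaN N * (real n / (2 * real N) + real (hgt q n) / real N)"
    using N0 by (simp add: betaN_def field_simps)
  finally show ?thesis unfolding h n_def[symmetric] .
qed

lemma abs_floor_approx:
  assumes N: "1 \<le> N"
  shows "\<bar>real (nat \<bar>\<lfloor>real N * y\<rfloor>\<bar>) / real N - \<bar>y\<bar>\<bar> \<le> 1 / real N"
proof -
  have N0: "0 < real N" using N by simp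
  have "\<bar>real (nat \<bar>\<lfloor>real N * y\<rfloor>\<bar>) - \<bar>real N * y\<bar>\<bar> \<le> 1" by linarith
  then have "\<bar>real (nat \<bar>\<lfloor>real N * y\<rfloor>\<bar>) - real N * \<bar>y\<bar>\<bar> / real N \<le> 1 / real N"
    using N0 by (intro divide_right_mono) (auto simp: abs_mult)
  moreover have eq: "real (nat \<bar>\<lfloor>real N * y\<rfloor>\<bar>) / real N - \<bar>y\<bar> = (real (nat \<bar>\<lfloor>real N * y\<rfloor>\<bar>) - real N * \<bar>y\<bar>) / real N"
    using N0 by (simp add: field_simps)
  ultimately show ?thesis unfolding eq abs_divide using N0 by simp
qed

lemma cell_tilt_close:
  assumes N: "1 \<le> N" and \<psi>0: "\<psi>0 \<in> XR" and good: "good \<psi>0 N d q"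
  shows "\<bar>ln (cell N (gbase N) q y) - betaN N * tilt \<psi>0 y\<bar> \<le> betaN N * (d + 2 / real N)"
proof -
  define x where "x = real (nat \<bar>\<lfloor>real N * y\<rfloor>\<bar>) / real N"
  have x: "0 \<le> x" "\<bar>x - \<bar>y\<bar>\<bar> \<le> 1 / real N" using abs_floor_approx[OF N, of y] by (auto simp: x_def)
  have b: "0 < betaN N" by (rule gbase_props[OF N])
  have "\<bar>height_resc N q x - \<psi>0 x\<bar> \<le> d" using good x by (simp add: good_def)
  moreover have "\<bar>x / 2 + \<psi>0 x - tilt \<psi>0 y\<bar> \<le> 1 / real N"
  proof -
    have "\<bar>tilt \<psi>0 x - tilt \<psi>0 \<bar>y\<bar>\<bar> \<le> \<bar>x - \<bar>y\<bar>\<bar> / 2"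
      using half_lipschitz_tilt[OF \<psi>0] unfolding half_lipschitz_def by blast
    moreover have t: "tilt \<psi>0 x = x / 2 + \<psi>0 x" "tilt \<psi>0 \<bar>y\<bar> = tilt \<psi>0 y" using x by (auto simp: tilt_def)
    ultimately have "\<bar>x / 2 + \<psi>0 x - tilt \<psi>0 y\<bar> \<le> \<bar>x - \<bar>y\<bar>\<bar> / 2" by (simp only: t)
    also have "\<dots> \<le> \<bar>x - \<bar>y\<bar>\<bar>" by simp
    also note x(2)
    finally show ?thesis .
  qed
  ultimately have "\<bar>(x / 2 + height_resc N q x) - tilt \<psi>0 y\<bar> \<le> d + 2 / real N"
    using x(1) by (simp add: abs_le_iff)
  then have "betaN N * \<bar>(x / 2 + height_resc N q x) - tilt \<psi>0 y\<bar> \<le> betaN N * (d + 2 / real N)"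
    using b by (intro mult_left_mono) auto
  moreover have "ln (cell N (gbase N) q y) - betaN N * tilt \<psi>0 y = betaN N * ((x / 2 + height_resc N q x) - tilt \<psi>0 y)"
    unfolding ln_cell[OF N] x_def by (simp add: algebra_simps)
  ultimately show ?thesis using b by (simp add: abs_mult)
qed

lemma abs_exp_minus_1: "\<bar>exp x - 1\<bar> \<le> \<bar>x\<bar> * exp \<bar>x::real\<bar>"
proof (cases "0 \<le> x")
  case True
  have "1 - x \<le> exp (- x)" using exp_ge_add_one_self[of "- x"] by simp
  then have "exp x * (1 - x) \<le> exp x * exp (- x)" by (intro mult_left_mono) auto
  then show ?thesis using True by (simp add: algebra_simps flip: exp_add)
next
  case False
  then have "exp x \<le> 1" by simp
  then have "\<bar>exp x - 1\<bar> \<le> \<bar>x\<bar> * 1" using False exp_ge_add_one_self[of x] by linarith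
  also have "\<dots> \<le> \<bar>x\<bar> * exp \<bar>x\<bar>" by (intro mult_left_mono) auto
  finally show ?thesis .
qed

lemma cell_initial_close:
  assumes N: "1 \<le> N" and \<psi>0: "\<psi>0 \<in> XR" and good: "good \<psi>0 N d q" and b: "betaN N \<le> 1" and d: "0 \<le> d"
    and \<eta>: "d + 2 / real N + \<bar>betaN N - beta\<bar> \<le> \<eta>" "\<eta> \<le> 1"
  shows "\<bar>cell N (gbase N) q y - exp (beta * tilt \<psi>0 y)\<bar> \<le> \<eta> * exp (3 * \<psi>0 0 + 2) * exp (3/2 * \<bar>y\<bar>)"
    "cell N (gbase N) q y \<le> exp (\<psi>0 0 + 1) * exp (\<bar>y\<bar> / 2)"
proof -
  define P where "P = \<psi>0 0"
  have P: "0 \<le> P" using XR_nonneg[OF \<psi>0] by (simp add: P_def)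
  have b0: "0 < betaN N" by (rule gbase_props[OF N])
  have N0: "0 < real N" using N by simp
  have t: "0 \<le> tilt \<psi>0 y" "tilt \<psi>0 y \<le> \<bar>y\<bar> / 2 + P"
    using XR_monotone_lipschitz(1)[OF \<psi>0, of 0 "\<bar>y\<bar>"] XR_nonneg[OF \<psi>0, of "\<bar>y\<bar>"] by (auto simp: tilt_def P_def)
  have dN: "0 \<le> d + 2 / real N" using d by simp
  define v where "v = cell N (gbase N) q y"
  have v: "0 < v" unfolding v_def cell_def using gbase_props(1)[OF N] by (intro gaertner_pos) simp
  have c: "\<bar>ln v - betaN N * tilt \<psi>0 y\<bar> \<le> d + 2 / real N"
    using order_trans[OF cell_tilt_close[OF N \<psi>0 good, of y] mult_right_mono[OF b dN]] by (simp add: v_def)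
  define x where "x = ln v - beta * tilt \<psi>0 y"
  \<comment> \<open>The error in the logarithm is at most \<open>\<eta> * s\<close>. Exponentiating
    costs \<open>exp s\<close>, the bound \<open>s \<le> exp s\<close> costs another, and the
    reference value is at most \<open>exp (P + |y| / 2)\<close>; together these give the exponent
    \<open>3 P + 2 + 3/2 |y|\<close> of the claim.\<close>
  define s where "s = 1 + P + \<bar>y\<bar> / 2"
  have s: "1 \<le> s" using P by (simp add: s_def)
  have se: "s \<le> exp s" using exp_ge_add_one_self[of s] by linarith
  have \<eta>0: "0 \<le> \<eta>" using \<eta>(1) dN abs_ge_zero[of "betaN N - beta"] by linarith
  have x: "\<bar>x\<bar> \<le> \<eta> * s"
  proof -
    have "x = (ln v - betaN N * tilt \<psi>0 y) + (betaN N - beta) * tilt \<psi>0 y" by (simp add: x_def algebra_simps)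
    then have "\<bar>x\<bar> \<le> (d + 2 / real N) + \<bar>betaN N - beta\<bar> * tilt \<psi>0 y"
      using c abs_triangle_ineq[of "ln v - betaN N * tilt \<psi>0 y" "(betaN N - beta) * tilt \<psi>0 y"] t(1) by (simp add: abs_mult)
    also have "\<dots> \<le> (d + 2 / real N) * s + \<bar>betaN N - beta\<bar> * s"
    proof (intro add_mono mult_left_mono)
      show "d + 2 / real N \<le> (d + 2 / real N) * s" using mult_left_mono[OF s dN] by simp
    qed (use t in \<open>auto simp: s_def\<close>)
    also have "\<dots> \<le> \<eta> * s" unfolding distrib_right[symmetric] using \<eta> s by (intro mult_right_mono) auto
    finally show ?thesis .
  qed
  have xs: "\<bar>x\<bar> \<le> s" using x mult_right_mono[OF \<eta>(2), of s] s by linarith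
  have "\<bar>v - exp (beta * tilt \<psi>0 y)\<bar> = exp (beta * tilt \<psi>0 y) * \<bar>exp x - 1\<bar>"
  proof -
    have "v = exp (beta * tilt \<psi>0 y) * exp x" using v by (simp add: x_def flip: exp_add)
    then have "v - exp (beta * tilt \<psi>0 y) = exp (beta * tilt \<psi>0 y) * (exp x - 1)" by (simp add: algebra_simps)
    then show ?thesis by (simp add: abs_mult)
  qed
  also have "\<dots> \<le> exp (P + \<bar>y\<bar> / 2) * ((\<eta> * s) * exp s)"
  proof (intro mult_mono)
    have "beta * tilt \<psi>0 y \<le> 1 * (P + \<bar>y\<bar> / 2)" using beta_bounds t by (intro mult_mono) auto
    then show "exp (beta * tilt \<psi>0 y) \<le> exp (P + \<bar>y\<bar> / 2)" by simp
    have "\<bar>x\<bar> * exp \<bar>x\<bar> \<le> (\<eta> * s) * exp s" using x xs by (intro mult_mono) auto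
    then show "\<bar>exp x - 1\<bar> \<le> (\<eta> * s) * exp s" using abs_exp_minus_1[of x] by linarith
  qed auto
  also have "\<dots> \<le> exp (P + \<bar>y\<bar> / 2) * ((\<eta> * exp s) * exp s)"
    using \<eta>0 by (intro mult_left_mono mult_right_mono se) auto
  also have "\<dots> = \<eta> * exp (3 * P + 2) * exp (3/2 * \<bar>y\<bar>)"
  proof -
    have "exp (P + \<bar>y\<bar> / 2) * (exp s * exp s) = exp (3 * P + 2) * exp (3/2 * \<bar>y\<bar>)"
      unfolding exp_add[symmetric] by (simp add: s_def)
    then show ?thesis by (simp add: mult_ac)
  qed
  finally show "\<bar>cell N (gbase N) q y - exp (beta * tilt \<psi>0 y)\<bar> \<le> \<eta> * exp (3 * \<psi>0 0 + 2) * exp (3/2 * \<bar>y\<bar>)"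
    by (simp add: v_def P_def)
  have "ln v \<le> betaN N * tilt \<psi>0 y + (d + 2 / real N)" using c by linarith
  also have "\<dots> \<le> 1 * (\<bar>y\<bar> / 2 + P) + 1"
    using b b0 t \<eta> abs_ge_zero[of "betaN N - beta"] by (intro add_mono mult_mono) auto
  finally have "exp (ln v) \<le> exp (1 * (\<bar>y\<bar> / 2 + P) + 1)" by simp
  then show "cell N (gbase N) q y \<le> exp (\<psi>0 0 + 1) * exp (\<bar>y\<bar> / 2)"
    using v by (simp add: v_def[symmetric] P_def exp_add[symmetric] add_ac)
qed

lemma exp_growth_cell:
  assumes N: "1 \<le> N" and b: "betaN N \<le> 1" and q: "q \<in> Qset"
  shows "exp_growth (cell N (gbase N) q)"
  unfolding exp_growth_def
proof (intro conjI exI allI)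
  show "\<bar>cell N (gbase N) q y\<bar> \<le> (exp 1 * gbase N ^ (2 * hgt q 0)) * exp (1 / 2 * \<bar>y\<bar>)" for y
    using cell_bound[OF N gbase_props(3)[OF N] b gbase_props(4)[OF N] refl q, of y] by simp
qed measurable

text \<open>The Gaertner variable is log-Lipschitz at the macroscopic scale, so averaging it against a
  narrow heat kernel changes it by a factor close to one.\<close>

lemma heat_conv_cell_bounds:
  assumes N: "1 \<le> N" and b: "betaN N \<le> 1" and q: "q \<in> Qset" and \<tau>: "0 < \<tau>"
  shows "heat_conv heat_kernel (cell N (gbase N) q) \<tau> u
      \<le> cell N (gbase N) q u * exp (1 / (2 * real N)) * heat_conv heat_kernel (\<lambda>y. exp (1/2 * \<bar>y\<bar>)) \<tau> 0"
    "cell N (gbase N) q u * exp (- (1 / (2 * real N))) * heat_conv heat_kernel (\<lambda>y. exp (- 1/2 * \<bar>y\<bar>)) \<tau> 0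
      \<le> heat_conv heat_kernel (cell N (gbase N) q) \<tau> u"
proof -
  let ?v = "cell N (gbase N) q"
  have g: "1 < gbase N" "gbase N = exp (betaN N / (2 * real N))" "0 < betaN N" using gbase_props[OF N] by auto
  have N0: "0 < real N" using N by simp
  have v: "0 < ?v y" for y unfolding cell_def using g by (intro gaertner_pos) simp
  have ratio: "?v y \<le> ?v x * exp (1 / (2 * real N)) * exp (1/2 * \<bar>y - x\<bar>)" for x y
  proof -
    define n where "n = nat \<bar>\<lfloor>real N * y\<rfloor> - \<lfloor>real N * x\<rfloor>\<bar>"
    have "real n \<le> \<bar>real N * y - real N * x\<bar> + 1" unfolding n_def by linarith
    also have "\<bar>real N * y - real N * x\<bar> = real N * \<bar>y - x\<bar>" by (simp add: abs_mult flip: right_diff_distrib)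
    finally have "real n * (betaN N / (2 * real N)) \<le> (real N * \<bar>y - x\<bar> + 1) * (1 / (2 * real N))"
      using b g(3) N0 by (intro mult_mono divide_right_mono) auto
    also have "\<dots> = 1/2 * \<bar>y - x\<bar> + 1 / (2 * real N)" using N0 by (simp add: field_simps)
    finally have "gbase N ^ n \<le> exp (1/2 * \<bar>y - x\<bar> + 1 / (2 * real N))"
      unfolding g(2) exp_of_nat_mult[symmetric] by simp
    note pw = this
    have "?v y \<le> gbase N ^ n * ?v x"
      unfolding cell_def n_def by (rule gaertner_ratio[OF q]) (use g in simp)
    also have "\<dots> \<le> exp (1/2 * \<bar>y - x\<bar> + 1 / (2 * real N)) * ?v x"
      by (rule mult_right_mono[OF pw less_imp_le[OF v]])
    finally show ?thesis by (simp only: exp_add mult_ac)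
  qed
  have conv: "heat_conv heat_kernel (\<lambda>y. exp (c * \<bar>y\<bar>)) \<tau> 0 = (LINT y|lborel. heat_kernel \<tau> (u - y) * exp (c * \<bar>y - u\<bar>))" for c
  proof -
    have "(LINT y|lborel. heat_kernel \<tau> (u - y) * exp (c * \<bar>y - u\<bar>))
        = (LINT y|lborel. heat_kernel \<tau> (u - (y + u)) * exp (c * \<bar>y + u - u\<bar>))"
      using integral_shift_lborel[of "\<lambda>y. heat_kernel \<tau> (u - y) * exp (c * \<bar>y - u\<bar>)" u] by simp
    then show ?thesis by (simp add: heat_conv_def)
  qed
  have int_exp: "integrable lborel (\<lambda>y. heat_kernel \<tau> (u - y) * exp (c * \<bar>y - u\<bar>))" for c
  proof -
    have "integrable lborel (\<lambda>y. heat_kernel \<tau> (0 - y) * exp (c * \<bar>y\<bar>))"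
      by (rule integrable_conv[OF admissible_heat_kernel(1) exp_growth_exp_abs \<tau>])
    from lborel_integrable_real_affine[OF this, of 1 "- u"]
    show ?thesis by simp
  qed
  have int_v: "integrable lborel (\<lambda>y. heat_kernel \<tau> (u - y) * ?v y)"
    by (rule integrable_conv[OF admissible_heat_kernel(1) exp_growth_cell[OF N b q] \<tau>])
  have K: "0 \<le> heat_kernel \<tau> z" for z using heat_kernel_pos[OF \<tau>, of z] by simp
  have "heat_conv heat_kernel ?v \<tau> u \<le> (LINT y|lborel. ?v u * exp (1 / (2 * real N)) * (heat_kernel \<tau> (u - y) * exp (1/2 * \<bar>y - u\<bar>)))"
    unfolding heat_conv_def
  proof (intro integral_mono int_v integrable_mult_right int_exp)
    show "heat_kernel \<tau> (u - y) * ?v y \<le> ?v u * exp (1 / (2 * real N)) * (heat_kernel \<tau> (u - y) * exp (1/2 * \<bar>y - u\<bar>))" for y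
      using mult_left_mono[OF ratio[of y u] K[of "u - y"]] by (simp only: mult_ac)
  qed
  then show "heat_conv heat_kernel ?v \<tau> u \<le> ?v u * exp (1 / (2 * real N)) * heat_conv heat_kernel (\<lambda>y. exp (1/2 * \<bar>y\<bar>)) \<tau> 0"
    unfolding conv integral_mult_right_zero .
  have "(LINT y|lborel. ?v u * exp (- (1 / (2 * real N))) * (heat_kernel \<tau> (u - y) * exp (- 1/2 * \<bar>y - u\<bar>))) \<le> heat_conv heat_kernel ?v \<tau> u"
    unfolding heat_conv_def
  proof (intro integral_mono int_v integrable_mult_right int_exp)
    fix y
    have "?v u * (exp (- (1 / (2 * real N))) * exp (- 1/2 * \<bar>y - u\<bar>))
       \<le> (?v y * exp (1 / (2 * real N)) * exp (1/2 * \<bar>u - y\<bar>)) * (exp (- (1 / (2 * real N))) * exp (- 1/2 * \<bar>y - u\<bar>))"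
      by (intro mult_right_mono ratio) auto
    also have "\<dots> = ?v y" by (simp add: exp_minus abs_minus_commute field_simps)
    finally have "?v u * (exp (- (1 / (2 * real N))) * exp (- 1/2 * \<bar>y - u\<bar>)) \<le> ?v y" .
    from mult_left_mono[OF this K[of "u - y"]]
    show "?v u * exp (- (1 / (2 * real N))) * (heat_kernel \<tau> (u - y) * exp (- 1/2 * \<bar>y - u\<bar>)) \<le> heat_kernel \<tau> (u - y) * ?v y"
      by (simp only: mult_ac)
  qed
  then show "?v u * exp (- (1 / (2 * real N))) * heat_conv heat_kernel (\<lambda>y. exp (- 1/2 * \<bar>y\<bar>)) \<tau> 0 \<le> heat_conv heat_kernel ?v \<tau> u"
    unfolding conv integral_mult_right_zero .
qed

lemma betaN_le_1: "\<forall>\<^sub>F N in sequentially. betaN N \<le> 1"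
  using order_tendstoD(2)[OF betaN_limit beta_bounds(2)] by eventually_elim simp

text \<open>A deviation of the height at \<open>u\<close> moves the averaged Gaertner variable away from its
  predicted value \<open>m\<close>, once the averaging scale \<open>\<tau>\<close> is small.\<close>

lemma deviation_detected:
  assumes \<psi>0: "\<psi>0 \<in> XR" and T: "0 < T" and u: "0 < u" and \<delta>: "0 < \<delta>"
  shows "\<exists>\<tau>>0. \<exists>c>0. \<forall>\<^sub>F N in sequentially. \<forall>y\<in>Qset.
    \<delta> < \<bar>height_resc N y u - profile beta \<psi>0 T u\<bar> \<longrightarrow>
    c \<le> (heat_conv heat_kernel (cell N (gbase N) y) \<tau> u
          - exp (- (beta\<^sup>2 / 4) * T) * cole_hopf beta \<psi>0 (T + \<tau>) u)\<^sup>2"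
proof -
  \<comment> \<open>A deviation \<open>\<delta>\<close> of the height moves the logarithm by about
    \<open>4 * \<theta>\<close>. One \<open>\<theta>\<close> is spent on finite \<open>N\<close> and
    rounding, one on the averaging kernel, one on replacing \<open>m \<tau>\<close> by
    \<open>m 0\<close>; one is left as the gap behind \<open>c1\<close>.\<close>
  define \<theta> where "\<theta> = beta * \<delta> / 4"
  have \<theta>: "0 < \<theta>" using \<delta> beta_bounds by (simp add: \<theta>_def)
  define p where "p = profile beta \<psi>0 T u"
  define m where "m \<tau> = exp (- (beta\<^sup>2 / 4) * T) * cole_hopf beta \<psi>0 (T + \<tau>) u" for \<tau>
  have m_pos: "0 < m 0" unfolding m_def using cole_hopf_pos[OF beta_bounds(1) \<psi>0, of T u] T by simp
  have ln_m: "ln (m 0) = beta * (u / 2 + p)"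
    unfolding m_def p_def using cole_hopf_pos[OF beta_bounds(1) \<psi>0, of T u] T u beta_bounds
    by (simp add: ln_mult profile_eq[OF beta_bounds(1) \<psi>0] field_simps power2_eq_square)
  have m0: "m 0 = exp (beta * (u / 2 + p))" using m_pos by (simp flip: ln_m)
  define Jp where "Jp \<tau> = heat_conv heat_kernel (\<lambda>y. exp (1/2 * \<bar>y\<bar>)) \<tau> 0" for \<tau>
  define Jm where "Jm \<tau> = heat_conv heat_kernel (\<lambda>y. exp (- 1/2 * \<bar>y\<bar>)) \<tau> 0" for \<tau>
  have "(m \<longlongrightarrow> m 0) (at_right 0)"
  proof -
    have "continuous_on {0..} (\<lambda>\<tau>. cole_hopf beta \<psi>0 (T + \<tau>) u)"
    proof -
      have t: "continuous_on {0..} (\<lambda>\<tau>::real. (T + \<tau>, u))" by (intro continuous_intros)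
      show ?thesis
        using continuous_on_compose2[OF continuous_on_cole_hopf[OF beta_bounds(1) \<psi>0] t] T by (simp add: image_subset_iff)
    qed
    then have "continuous_on {0..} m" unfolding m_def[abs_def] by (intro continuous_intros)
    then have "(m \<longlongrightarrow> m 0) (at 0 within {0..})" unfolding continuous_on_def by auto
    then show ?thesis using tendsto_within_subset[OF _ Ioi_le_Ico] by force
  qed
  note lm = this
  have "\<forall>\<^sub>F \<tau> in at_right 0. m 0 * exp (- \<theta>) < m \<tau>"
    by (rule order_tendstoD(1)[OF lm]) (use m_pos \<theta> in simp)
  moreover have "\<forall>\<^sub>F \<tau> in at_right 0. m \<tau> < m 0 * exp \<theta>"
    by (rule order_tendstoD(2)[OF lm]) (use m_pos \<theta> in simp)
  moreover have "\<forall>\<^sub>F \<tau> in at_right 0. exp (- \<theta>) < Jm \<tau>"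
    unfolding Jm_def by (rule order_tendstoD(1)[OF heat_conv_exp_abs_limit]) (use \<theta> in simp)
  moreover have "\<forall>\<^sub>F \<tau> in at_right 0. Jp \<tau> < exp \<theta>"
    unfolding Jp_def by (rule order_tendstoD(2)[OF heat_conv_exp_abs_limit]) (use \<theta> in simp)
  moreover have "\<forall>\<^sub>F \<tau> in at_right (0::real). 0 < \<tau>" by (simp add: eventually_at_filter)
  ultimately have "\<forall>\<^sub>F \<tau> in at_right 0. 0 < \<tau> \<and> m 0 * exp (- \<theta>) < m \<tau> \<and> m \<tau> < m 0 * exp \<theta> \<and> exp (- \<theta>) < Jm \<tau> \<and> Jp \<tau> < exp \<theta>"
    by eventually_elim simp
  then obtain \<tau> where \<tau>: "0 < \<tau>" "m 0 * exp (- \<theta>) < m \<tau>" "m \<tau> < m 0 * exp \<theta>" "exp (- \<theta>) < Jm \<tau>" "Jp \<tau> < exp \<theta>"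
    using eventually_happens[of _ "at_right (0::real)"] by force
  define c1 where "c1 = m 0 * min (exp (2 * \<theta>) - exp \<theta>) (exp (- \<theta>) - exp (- 2 * \<theta>))"
  have c1: "0 < c1" using m_pos \<theta> by (simp add: c1_def)
  have l1: "(\<lambda>N. 1 / (2 * real N)) \<longlonglongrightarrow> 0"
    using tendsto_mult[OF tendsto_const[of "1/2"] lim_1_over_n] by simp
  have up: "(\<lambda>N. betaN N * (u / 2 - 1 / (2 * real N) + (p + \<delta>)) - 1 / (2 * real N)) \<longlonglongrightarrow> beta * (u / 2 - 0 + (p + \<delta>)) - 0"
    by (intro tendsto_intros betaN_limit l1)
  have lo: "(\<lambda>N. betaN N * (u / 2 + (p - \<delta>)) + 1 / (2 * real N)) \<longlonglongrightarrow> beta * (u / 2 + (p - \<delta>)) + 0"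
    by (intro tendsto_intros betaN_limit l1)
  have "\<forall>\<^sub>F N in sequentially. beta * (u / 2 + p) + 3 * \<theta> < betaN N * (u / 2 - 1 / (2 * real N) + (p + \<delta>)) - 1 / (2 * real N)"
    by (rule order_tendstoD(1)[OF up]) (use \<theta> in \<open>simp add: \<theta>_def algebra_simps\<close>)
  moreover have "\<forall>\<^sub>F N in sequentially. betaN N * (u / 2 + (p - \<delta>)) + 1 / (2 * real N) < beta * (u / 2 + p) - 3 * \<theta>"
    by (rule order_tendstoD(2)[OF lo]) (use \<theta> in \<open>simp add: \<theta>_def algebra_simps\<close>)
  ultimately have "\<forall>\<^sub>F N in sequentially. \<forall>y\<in>Qset. \<delta> < \<bar>height_resc N y u - p\<bar> \<longrightarrow>
      c1\<^sup>2 \<le> (heat_conv heat_kernel (cell N (gbase N) y) \<tau> u - m \<tau>)\<^sup>2"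
    using betaN_le_1 eventually_ge_at_top[of 1]
  proof eventually_elim
    case (elim N)
    note N = elim(4) and b = elim(3)
    have N0: "0 < real N" using N by simp
    have b0: "0 < betaN N" by (rule gbase_props[OF N])
    show ?case
    proof (intro ballI impI)
      fix y assume y: "y \<in> Qset" and dev: "\<delta> < \<bar>height_resc N y u - p\<bar>"
      define v where "v = cell N (gbase N) y u"
      define A where "A = heat_conv heat_kernel (cell N (gbase N) y) \<tau> u"
      define n where "n = nat \<bar>\<lfloor>real N * u\<rfloor>\<bar>"
      have v: "0 < v" unfolding v_def cell_def using gbase_props(1)[OF N] by (intro gaertner_pos) simp
      have fl: "0 \<le> \<lfloor>real N * u\<rfloor>" using u by simp
      have n: "real n \<le> real N * u" "real N * u - 1 \<le> real n" unfolding n_def using fl by linarith+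
      have h: "height_resc N y (real n / real N) = height_resc N y u"
      proof -
        have "nat \<lfloor>real N * u\<rfloor> = n" unfolding n_def using fl by simp
        moreover have "0 \<le> real N * u" using u by simp
        ultimately show ?thesis using N0 by (simp add: height_resc_def height_eq_hgt)
      qed
      have lnv: "ln v = betaN N * (real n / (2 * real N) + height_resc N y u)"
        unfolding v_def ln_cell[OF N] n_def[symmetric] h ..
      have nN: "real n / (2 * real N) \<le> u / 2" "u / 2 - 1 / (2 * real N) \<le> real n / (2 * real N)"
      proof -
        have "0 \<le> 2 * real N" by simp
        note divide_right_mono[OF n(1) this] divide_right_mono[OF n(2) this]
        moreover have "real N * u / (2 * real N) = u / 2" "(real N * u - 1) / (2 * real N) = u / 2 - 1 / (2 * real N)"
          using N0 by (simp_all add: field_simps)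
        ultimately show "real n / (2 * real N) \<le> u / 2" "u / 2 - 1 / (2 * real N) \<le> real n / (2 * real N)"
          by simp_all
      qed
      note bounds = heat_conv_cell_bounds[OF N b y \<tau>(1), of u, folded A_def v_def Jp_def Jm_def]
      have "c1 \<le> \<bar>A - m \<tau>\<bar>"
      proof (cases "p + \<delta> < height_resc N y u")
        case True
        have "betaN N * (u / 2 - 1 / (2 * real N) + (p + \<delta>)) \<le> ln v"
          unfolding lnv using b0 nN True by (intro mult_left_mono) auto
        then have "beta * (u / 2 + p) + 3 * \<theta> \<le> ln v - 1 / (2 * real N)" using elim(1) by linarith
        then have "exp (beta * (u / 2 + p) + 3 * \<theta>) \<le> exp (ln v + - (1 / (2 * real N)))" by simp
        then have 1: "m 0 * exp (3 * \<theta>) \<le> v * exp (- (1 / (2 * real N)))"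
          unfolding m0 using v by (simp only: exp_add exp_ln)
        have "m 0 * exp (3 * \<theta>) * exp (- \<theta>) \<le> v * exp (- (1 / (2 * real N))) * Jm \<tau>"
          by (rule mult_mono[OF 1 less_imp_le[OF \<tau>(4)]]) (use m_pos v in auto)
        then have "m 0 * exp (2 * \<theta>) \<le> A"
          using bounds(2) by (simp add: mult.assoc flip: exp_add)
        then have "m 0 * (exp (2 * \<theta>) - exp \<theta>) \<le> A - m \<tau>" using \<tau>(3) by (simp add: right_diff_distrib)
        moreover have "c1 \<le> m 0 * (exp (2 * \<theta>) - exp \<theta>)" unfolding c1_def using m_pos by (intro mult_left_mono) auto
        ultimately show ?thesis by linarith
      next
        case False
        then have F: "height_resc N y u < p - \<delta>" using dev by linarith
        have "ln v \<le> betaN N * (u / 2 + (p - \<delta>))"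
          unfolding lnv using b0 nN F by (intro mult_left_mono) auto
        then have "ln v + 1 / (2 * real N) \<le> beta * (u / 2 + p) - 3 * \<theta>" using elim(2) by linarith
        then have "exp (ln v + 1 / (2 * real N)) \<le> exp (beta * (u / 2 + p) + - (3 * \<theta>))" by simp
        then have 1: "v * exp (1 / (2 * real N)) \<le> m 0 * exp (- (3 * \<theta>))"
          unfolding m0 using v by (simp only: exp_add exp_ln)
        have J0: "0 \<le> Jp \<tau>" unfolding Jp_def heat_conv_def
          by (intro Bochner_Integration.integral_nonneg mult_nonneg_nonneg less_imp_le[OF heat_kernel_pos[OF \<tau>(1)]]) simp
        have "v * exp (1 / (2 * real N)) * Jp \<tau> \<le> m 0 * exp (- (3 * \<theta>)) * exp \<theta>"
          by (rule mult_mono[OF 1 less_imp_le[OF \<tau>(5)]]) (use m_pos J0 in auto)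
        then have "A \<le> m 0 * exp (- 2 * \<theta>)"
          using bounds(1) by (simp add: mult.assoc flip: exp_add)
        then have "m 0 * (exp (- \<theta>) - exp (- 2 * \<theta>)) \<le> m \<tau> - A" using \<tau>(2) by (simp add: right_diff_distrib)
        moreover have "c1 \<le> m 0 * (exp (- \<theta>) - exp (- 2 * \<theta>))" unfolding c1_def using m_pos by (intro mult_left_mono) auto
        ultimately show ?thesis by linarith
      qed
      then show "c1\<^sup>2 \<le> (heat_conv heat_kernel (cell N (gbase N) y) \<tau> u - m \<tau>)\<^sup>2"
        using c1 unfolding A_def[symmetric] by (metis abs_le_square_iff abs_of_pos)
    qed
  qed
  then show ?thesis
    using \<tau>(1) c1 unfolding m_def p_def by (intro exI[of _ \<tau>] conjI exI[of _ "c1\<^sup>2"]) simp_all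
qed

text \<open>The order of choices matters: the deviation fixes \<open>\<tau>\<close> and
  \<open>c\<close>, these fix the constants of the kernel, then the quality \<open>d\<close> of the
  start is chosen, and \<open>N\<close> comes last. The estimate is uniform over all good starting
  configurations.\<close>

lemma point_estimate:
  assumes \<psi>0: "\<psi>0 \<in> XR" and T: "0 < T" and u: "0 < u" and \<delta>: "0 < \<delta>" and \<rho>: "0 < \<rho>"
  shows "\<exists>d>0. \<forall>\<^sub>F N in sequentially. \<forall>q\<in>Qset. good \<psi>0 N d q \<longrightarrow>
    infsum (mc_trans (\<lambda>q q'. (real N)\<^sup>2 * rateR (epsN N) q q') T q)
      {y. \<delta> < \<bar>height_resc N y u - profile beta \<psi>0 T u\<bar>} \<le> \<rho>"
proof -
  obtain \<tau> c where \<tau>: "0 < \<tau>" and c: "0 < c"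
    and detect: "\<forall>\<^sub>F N in sequentially. \<forall>y\<in>Qset. \<delta> < \<bar>height_resc N y u - profile beta \<psi>0 T u\<bar> \<longrightarrow>
    c \<le> (heat_conv heat_kernel (cell N (gbase N) y) \<tau> u
          - exp (- (beta\<^sup>2 / 4) * T) * cole_hopf beta \<psi>0 (T + \<tau>) u)\<^sup>2"
    using deviation_detected[OF \<psi>0 T u \<delta>] by blast
  define \<kappa> where "\<kappa> = beta\<^sup>2 / 4"
  have \<kappa>: "0 \<le> \<kappa>" by (simp add: \<kappa>_def)
  define m where "m = exp (- \<kappa> * T) * cole_hopf beta \<psi>0 (T + \<tau>) u"
  obtain C where C: "0 \<le> C" and err: "\<And>N a t y. 1 \<le> N \<Longrightarrow> 1 \<le> a \<Longrightarrow> t \<in> {0..T} \<Longrightarrow>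
     exp (- \<kappa> * t) * heat_kernel (t + \<tau>) (u - y) \<le> C * exp (- 2 * \<bar>y\<bar>)
   \<and> \<bar>exp (- \<kappa> * t) * (heat_kernel2 (t + \<tau>) (u - y) - \<kappa> * heat_kernel (t + \<tau>) (u - y)
         - (real N)\<^sup>2 * ((heat_kernel (t + \<tau>) (u - (y + 1 / real N)) + heat_kernel (t + \<tau>) (u - (y - 1 / real N))) / a
            - (1 + 1 / a\<^sup>2) * heat_kernel (t + \<tau>) (u - y)))\<bar>
     \<le> C * (1 / real N + (1 - 1 / a) + \<bar>(real N)\<^sup>2 * (1 - 1 / a)\<^sup>2 - \<kappa>\<bar>) * exp (- 2 * \<bar>y\<bar>)"
    using kernel_error[OF \<tau> \<kappa>, of T u] by blast
  define \<Omega> where "\<Omega> = (LINT y|lborel. exp (- 2 * \<bar>y::real\<bar>))"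
  define \<eta>1 where "\<eta>1 N = 1 / real N + (1 - 1 / gbase N) + \<bar>(real N)\<^sup>2 * (1 - 1 / gbase N)\<^sup>2 - \<kappa>\<bar>" for N
  define R where "R N = 2 * \<eta>1 N * C * (C + \<bar>m\<bar>) * (\<Omega> + 1) + 4 * exp 2 * C\<^sup>2 / real N" for N
  \<comment> \<open>A bound on the energy of good configurations: there the squared variable is at
    most \<open>exp (2 * \<psi>0 0 + 2 + |y|)\<close>, to be multiplied by the weight of rate
    2.\<close>
  define E0 where "E0 = exp (2 * \<psi>0 0 + 2) * (LINT y|lborel. exp (- 1 * \<bar>y::real\<bar>))"
  define D where "D = exp (3 * \<psi>0 0 + 2) * heat_conv heat_kernel (\<lambda>y. exp (3/2 * \<bar>y\<bar>)) (T + \<tau>) u"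
  have T\<tau>: "0 < T + \<tau>" using T \<tau> by simp
  have D0: "0 \<le> D" unfolding D_def heat_conv_def
    by (intro mult_nonneg_nonneg Bochner_Integration.integral_nonneg less_imp_le[OF heat_kernel_pos[OF T\<tau>]]) auto
  have \<eta>1: "\<eta>1 \<longlonglongrightarrow> 0"
  proof -
    have "\<eta>1 \<longlonglongrightarrow> 0 + 0 + \<bar>beta\<^sup>2 / 4 - \<kappa>\<bar>"
      unfolding \<eta>1_def by (intro tendsto_intros gbase_limits lim_1_over_n)
    then show ?thesis by (simp add: \<kappa>_def)
  qed
  have R0: "R \<longlonglongrightarrow> 0"
  proof -
    have "(\<lambda>N. 2 * \<eta>1 N * C * (C + \<bar>m\<bar>) * (\<Omega> + 1) + 4 * exp 2 * C\<^sup>2 * (1 / real N)) \<longlonglongrightarrow> 2 * 0 * C * (C + \<bar>m\<bar>) * (\<Omega> + 1) + 4 * exp 2 * C\<^sup>2 * 0"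
      by (intro tendsto_intros \<eta>1 lim_1_over_n)
    then show ?thesis by (simp add: R_def[abs_def])
  qed
  \<comment> \<open>The budget \<open>\<rho> * c\<close> is halved: the squared error of the initial
    value is at most \<open>(e * D)^2\<close> and takes one half, the noise and the discretisation
    error take the other.\<close>
  define e where "e = min 1 (sqrt (\<rho> * c / 2) / (D + 1))"
  have e: "0 < e" "e \<le> 1" "(e * D)\<^sup>2 \<le> \<rho> * c / 2"
  proof -
    have s: "0 < sqrt (\<rho> * c / 2)" using \<rho> c by simp
    then show "0 < e" "e \<le> 1" using D0 by (auto simp: e_def)
    have "e * D \<le> sqrt (\<rho> * c / 2) / (D + 1) * (D + 1)"
      using s D0 by (intro mult_mono) (auto simp: e_def)
    also have "\<dots> = sqrt (\<rho> * c / 2)" using D0 by simp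
    finally have "(e * D)\<^sup>2 \<le> (sqrt (\<rho> * c / 2))\<^sup>2" using \<open>0 < e\<close> D0 by (intro power_mono) auto
    then show "(e * D)\<^sup>2 \<le> \<rho> * c / 2" using \<rho> c by simp
  qed
  \<comment> \<open>The other half of \<open>e\<close> is left for the lattice error
    \<open>2 / N\<close> and for the distance of \<open>betaN\<close> from its limit.\<close>
  define d where "d = e / 2"
  have d: "0 < d" using e by (simp add: d_def)
  have "(\<lambda>N. d + 2 * (1 / real N) + \<bar>betaN N - beta\<bar>) \<longlonglongrightarrow> d + 2 * 0 + \<bar>beta - beta\<bar>"
    by (intro tendsto_intros betaN_limit lim_1_over_n)
  then have ev1: "\<forall>\<^sub>F N in sequentially. d + 2 * (1 / real N) + \<bar>betaN N - beta\<bar> < e"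
    by (rule order_tendstoD(2)) (use e in \<open>simp add: d_def\<close>)
  have "(\<lambda>N. R N * exp ((6 * exp 2 + 1) * T) * (E0 + 1)) \<longlonglongrightarrow> 0 * exp ((6 * exp 2 + 1) * T) * (E0 + 1)"
    by (intro tendsto_intros R0)
  then have ev2: "\<forall>\<^sub>F N in sequentially. R N * exp ((6 * exp 2 + 1) * T) * (E0 + 1) < \<rho> * c / 2"
    by (rule order_tendstoD(2)) (use \<rho> c in simp)
  have "\<forall>\<^sub>F N in sequentially. \<forall>q\<in>Qset. good \<psi>0 N d q \<longrightarrow>
    infsum (mc_trans (\<lambda>q q'. (real N)\<^sup>2 * rateR (epsN N) q q') T q)
      {y. \<delta> < \<bar>height_resc N y u - profile beta \<psi>0 T u\<bar>} \<le> \<rho>"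
    using ev1 ev2 detect betaN_le_1 eventually_ge_at_top[of 1]
  proof eventually_elim
    case (elim N)
    note N = elim(5) and b = elim(4)
    note g = gbase_props[OF N]
    show ?case
    proof (intro ballI impI)
      fix q assume q: "q \<in> Qset" and good: "good \<psi>0 N d q"
      let ?v = "cell N (gbase N) q"
      have g1: "1 \<le> gbase N" using g(1) by simp
      have v0: "0 < ?v y" for y unfolding cell_def using g(1) by (intro gaertner_pos) simp
      have e': "d + 2 / real N + \<bar>betaN N - beta\<bar> \<le> e" using elim(1) by simp
      note init = cell_initial_close[OF N \<psi>0 good b less_imp_le[OF d] e' e(2)]
      have \<eta>0: "0 \<le> \<eta>1 N" unfolding \<eta>1_def using g1 by (intro add_nonneg_nonneg) auto
      have \<Omega>0: "0 \<le> \<Omega>" unfolding \<Omega>_def by (rule Bochner_Integration.integral_nonneg) simp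
      have RN: "0 \<le> R N" unfolding R_def using \<eta>0 C \<Omega>0
        by (intro add_nonneg_nonneg mult_nonneg_nonneg divide_nonneg_nonneg) auto
      have "infsum (mc_trans (\<lambda>q q'. (real N)\<^sup>2 * rateR (epsN N) q q') T q) {y. \<delta> < \<bar>height_resc N y u - profile beta \<psi>0 T u\<bar>}
        \<le> ((exp (- \<kappa> * T) * heat_conv heat_kernel ?v (T + \<tau>) u - m)\<^sup>2
          + R N * exp ((6 * exp 2 + 1) * T) * (energy N (gbase N) q + 1)) / c"
      proof (rule tracer_inequality[OF N g(3) b g(4) g(2) \<tau> less_imp_le[OF T] C \<eta>0 _ _ q c _ \<Omega>_def R_def[of N]])
        show "exp (- \<kappa> * t) * heat_kernel (t + \<tau>) (u - y) \<le> C * exp (- 2 * \<bar>y\<bar>)" if "0 \<le> t" "t \<le> T" for t y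
          using err[OF N g1, of t y] that by auto
        show "\<bar>exp (- \<kappa> * t) * (heat_kernel2 (t + \<tau>) (u - y) - \<kappa> * heat_kernel (t + \<tau>) (u - y)
         - (real N)\<^sup>2 * ((heat_kernel (t + \<tau>) (u - (y + 1 / real N)) + heat_kernel (t + \<tau>) (u - (y - 1 / real N))) / gbase N
            - (1 + 1 / (gbase N)\<^sup>2) * heat_kernel (t + \<tau>) (u - y)))\<bar> \<le> C * \<eta>1 N * exp (- 2 * \<bar>y\<bar>)" if "0 \<le> t" "t \<le> T" for t y
          using err[OF N g1, of t y] that unfolding \<eta>1_def by auto
        show "c \<le> (heat_conv heat_kernel (cell N (gbase N) y) \<tau> u - m)\<^sup>2"
          if "y \<in> {y. \<delta> < \<bar>height_resc N y u - profile beta \<psi>0 T u\<bar>}" "y \<in> Qset" for y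
          using elim(3) that unfolding m_def \<kappa>_def by blast
      qed
      also have "\<dots> \<le> (\<rho> * c / 2 + \<rho> * c / 2) / c"
      proof (intro divide_right_mono add_mono)
        have int_v: "integrable lborel (\<lambda>y. heat_kernel (T + \<tau>) (u - y) * ?v y)"
          by (rule integrable_conv[OF admissible_heat_kernel(1) exp_growth_cell[OF N b q] T\<tau>])
        have int_g: "integrable lborel (\<lambda>y. heat_kernel (T + \<tau>) (u - y) * exp (beta * tilt \<psi>0 y))"
          by (rule integrable_conv[OF admissible_heat_kernel(1) exp_growth_exp_half_lipschitz[OF half_lipschitz_tilt[OF \<psi>0]] T\<tau>])
        have int_e: "integrable lborel (\<lambda>y. e * exp (3 * \<psi>0 0 + 2) * (heat_kernel (T + \<tau>) (u - y) * exp (3/2 * \<bar>y\<bar>)))"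
          by (rule integrable_mult_right[OF integrable_conv[OF admissible_heat_kernel(1) exp_growth_exp_abs T\<tau>]])
        have "\<bar>heat_conv heat_kernel ?v (T + \<tau>) u - cole_hopf beta \<psi>0 (T + \<tau>) u\<bar>
            = \<bar>LINT y|lborel. heat_kernel (T + \<tau>) (u - y) * ?v y - heat_kernel (T + \<tau>) (u - y) * exp (beta * tilt \<psi>0 y)\<bar>"
          unfolding cole_hopf_def heat_ext_eq_conv[OF T\<tau>] heat_conv_def
          by (simp only: Bochner_Integration.integral_diff[OF int_v int_g])
        also have "\<dots> \<le> (LINT y|lborel. \<bar>heat_kernel (T + \<tau>) (u - y) * ?v y - heat_kernel (T + \<tau>) (u - y) * exp (beta * tilt \<psi>0 y)\<bar>)"
          using integral_norm_bound[of lborel "\<lambda>y. heat_kernel (T + \<tau>) (u - y) * ?v y - heat_kernel (T + \<tau>) (u - y) * exp (beta * tilt \<psi>0 y)"] by simp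
        also have "\<dots> \<le> (LINT y|lborel. e * exp (3 * \<psi>0 0 + 2) * (heat_kernel (T + \<tau>) (u - y) * exp (3/2 * \<bar>y\<bar>)))"
        proof (rule integral_mono[OF _ int_e])
          show "integrable lborel (\<lambda>y. \<bar>heat_kernel (T + \<tau>) (u - y) * ?v y - heat_kernel (T + \<tau>) (u - y) * exp (beta * tilt \<psi>0 y)\<bar>)"
            by (rule integrable_abs[OF Bochner_Integration.integrable_diff[OF int_v int_g]])
          fix y
          have K: "0 \<le> heat_kernel (T + \<tau>) (u - y)" using heat_kernel_pos[OF T\<tau>, of "u - y"] by simp
          have "\<bar>heat_kernel (T + \<tau>) (u - y) * ?v y - heat_kernel (T + \<tau>) (u - y) * exp (beta * tilt \<psi>0 y)\<bar>
             = heat_kernel (T + \<tau>) (u - y) * \<bar>?v y - exp (beta * tilt \<psi>0 y)\<bar>"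
            using K by (simp add: abs_mult flip: right_diff_distrib)
          also have "\<dots> \<le> heat_kernel (T + \<tau>) (u - y) * (e * exp (3 * \<psi>0 0 + 2) * exp (3/2 * \<bar>y\<bar>))"
            by (rule mult_left_mono[OF init(1) K])
          finally show "\<bar>heat_kernel (T + \<tau>) (u - y) * ?v y - heat_kernel (T + \<tau>) (u - y) * exp (beta * tilt \<psi>0 y)\<bar>
            \<le> e * exp (3 * \<psi>0 0 + 2) * (heat_kernel (T + \<tau>) (u - y) * exp (3/2 * \<bar>y\<bar>))" by (simp only: mult_ac)
        qed
        also have "\<dots> = e * D" by (simp add: D_def heat_conv_def)
        finally have close: "\<bar>heat_conv heat_kernel ?v (T + \<tau>) u - cole_hopf beta \<psi>0 (T + \<tau>) u\<bar> \<le> e * D" .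
        have ek: "exp (- \<kappa> * T) \<le> 1" using \<kappa> T by simp
        have "\<bar>exp (- \<kappa> * T) * heat_conv heat_kernel ?v (T + \<tau>) u - m\<bar>
            = exp (- \<kappa> * T) * \<bar>heat_conv heat_kernel ?v (T + \<tau>) u - cole_hopf beta \<psi>0 (T + \<tau>) u\<bar>"
          unfolding m_def right_diff_distrib[symmetric] abs_mult by simp
        also have "\<dots> \<le> 1 * (e * D)" by (rule mult_mono[OF ek close]) auto
        finally have "\<bar>exp (- \<kappa> * T) * heat_conv heat_kernel ?v (T + \<tau>) u - m\<bar>\<^sup>2 \<le> (e * D)\<^sup>2" by (intro power_mono) auto
        then show "(exp (- \<kappa> * T) * heat_conv heat_kernel ?v (T + \<tau>) u - m)\<^sup>2 \<le> \<rho> * c / 2" using e(3) by simp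
        have "energy N (gbase N) q \<le> E0"
        proof -
          have "energy N (gbase N) q \<le> (LINT y|lborel. exp (2 * \<psi>0 0 + 2) * exp (- 1 * \<bar>y\<bar>))"
            unfolding energy_def[OF N g(3) b g(4) g(2)]
          proof (rule integral_mono')
            show "integrable lborel (\<lambda>y. exp (2 * \<psi>0 0 + 2) * exp (- 1 * \<bar>y\<bar>))"
              by (intro integrable_mult_right integrable_exp_neg_abs) simp
            fix y
            have "(?v y)\<^sup>2 \<le> (exp (\<psi>0 0 + 1) * exp (\<bar>y\<bar> / 2))\<^sup>2"
              using init(2)[of y] v0[of y] by (intro power_mono) auto
            also have "\<dots> = exp (2 * \<psi>0 0 + 2 + \<bar>y\<bar>)"
              by (simp add: power2_eq_square flip: exp_add)
            finally have "exp (- 2 * \<bar>y\<bar>) * (?v y)\<^sup>2 \<le> exp (- 2 * \<bar>y\<bar>) * exp (2 * \<psi>0 0 + 2 + \<bar>y\<bar>)"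
              by (rule mult_left_mono) simp
            also have "\<dots> = exp (2 * \<psi>0 0 + 2) * exp (- 1 * \<bar>y\<bar>)" unfolding exp_add[symmetric] by simp
            finally show "exp (- 2 * \<bar>y\<bar>) * (?v y)\<^sup>2 \<le> exp (2 * \<psi>0 0 + 2) * exp (- 1 * \<bar>y\<bar>)" .
          qed simp
          then show ?thesis by (simp add: E0_def)
        qed
        then have "R N * exp ((6 * exp 2 + 1) * T) * (energy N (gbase N) q + 1) \<le> R N * exp ((6 * exp 2 + 1) * T) * (E0 + 1)"
          using RN by (intro mult_left_mono) auto
        then show "R N * exp ((6 * exp 2 + 1) * T) * (energy N (gbase N) q + 1) \<le> \<rho> * c / 2" using elim(2) by linarith
      qed (use c in simp)
      also have "\<dots> = \<rho>" using c by simp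
      finally show "infsum (mc_trans (\<lambda>q q'. (real N)\<^sup>2 * rateR (epsN N) q q') T q)
        {y. \<delta> < \<bar>height_resc N y u - profile beta \<psi>0 T u\<bar>} \<le> \<rho>" .
    qed
  qed
  with d show ?thesis by blast
qed

section \<open>Union bounds and averaging over the initial law\<close>

lemma infsum_cover_bound:
  fixes p :: "'a \<Rightarrow> real"
  assumes nonneg: "\<And>y. 0 \<le> p y" and summable: "\<And>A. p summable_on A" and I: "finite I"
    and cover: "\<And>y. y \<in> B \<Longrightarrow> p y \<noteq> 0 \<Longrightarrow> \<exists>i\<in>I. y \<in> Y i"
  shows "infsum p B \<le> (\<Sum>i\<in>I. infsum p (Y i))"
proof (rule infsum_le_finite_sums[OF summable])
  fix F assume F: "finite F" "F \<subseteq> B"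
  have "sum p F \<le> (\<Sum>y\<in>F. \<Sum>i\<in>I. if y \<in> Y i then p y else 0)"
  proof (rule sum_mono)
    fix y assume y: "y \<in> F"
    show "p y \<le> (\<Sum>i\<in>I. if y \<in> Y i then p y else 0)"
    proof (cases "p y = 0")
      case False
      then obtain i where i: "i \<in> I" "y \<in> Y i" using cover y F by blast
      have "p y = (if y \<in> Y i then p y else 0)" using i by simp
      also have "\<dots> \<le> (\<Sum>i\<in>I. if y \<in> Y i then p y else 0)"
        by (rule member_le_sum[OF i(1) _ I]) (use nonneg in auto)
      finally show ?thesis .
    qed (simp add: sum_nonneg)
  qed
  also have "\<dots> = (\<Sum>i\<in>I. \<Sum>y\<in>F. if y \<in> Y i then p y else 0)" by (rule sum.swap)
  also have "\<dots> \<le> (\<Sum>i\<in>I. infsum p (Y i))"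
  proof (rule sum_mono)
    fix i
    have "(\<Sum>y\<in>F. if y \<in> Y i then p y else 0) = sum p (F \<inter> Y i)"
      using F by (simp add: sum.If_cases Int_def)
    also have "\<dots> \<le> infsum p (Y i)"
      by (rule finite_sum_le_infsum[OF summable]) (use F nonneg in auto)
    finally show "(\<Sum>y\<in>F. if y \<in> Y i then p y else 0) \<le> infsum p (Y i)" .
  qed
  finally show "sum p F \<le> (\<Sum>i\<in>I. infsum p (Y i))" .
qed

lemma pmf_average_bound:
  fixes P :: "'a \<Rightarrow> real"
  assumes P: "\<And>x. x \<in> set_pmf \<nu> \<Longrightarrow> 0 \<le> P x" "\<And>x. x \<in> set_pmf \<nu> \<Longrightarrow> P x \<le> 1"
    and \<rho>: "0 \<le> \<rho>" "\<And>x. x \<in> set_pmf \<nu> \<Longrightarrow> x \<notin> B \<Longrightarrow> P x \<le> \<rho>"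
  shows "0 \<le> infsum (\<lambda>x. pmf \<nu> x * P x) (set_pmf \<nu>)"
    "infsum (\<lambda>x. pmf \<nu> x * P x) (set_pmf \<nu>) \<le> \<rho> + measure_pmf.prob \<nu> B"
proof -
  have nn: "0 \<le> pmf \<nu> x * P x" if "x \<in> set_pmf \<nu>" for x using P(1)[OF that] by simp
  then show "0 \<le> infsum (\<lambda>x. pmf \<nu> x * P x) (set_pmf \<nu>)" by (rule infsum_nonneg)
  have bound: "(\<Sum>x\<in>F. pmf \<nu> x * P x) \<le> \<rho> + measure_pmf.prob \<nu> B" if F: "finite F" "F \<subseteq> set_pmf \<nu>" for F
  proof -
    have "(\<Sum>x\<in>F. pmf \<nu> x * P x) \<le> (\<Sum>x\<in>F. \<rho> * pmf \<nu> x + (if x \<in> B then pmf \<nu> x else 0))"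
    proof (rule sum_mono)
      fix x assume "x \<in> F"
      then have x: "x \<in> set_pmf \<nu>" using F by auto
      show "pmf \<nu> x * P x \<le> \<rho> * pmf \<nu> x + (if x \<in> B then pmf \<nu> x else 0)"
      proof (cases "x \<in> B")
        case True
        have "pmf \<nu> x * P x \<le> pmf \<nu> x * 1" by (intro mult_left_mono P x) simp
        moreover have "0 \<le> \<rho> * pmf \<nu> x" using \<rho>(1) by simp
        ultimately show ?thesis using True by simp
      next
        case False
        then show ?thesis using mult_left_mono[OF \<rho>(2)[OF x False], of "pmf \<nu> x"] by (simp add: mult.commute)
      qed
    qed
    also have "\<dots> = \<rho> * sum (pmf \<nu>) F + sum (pmf \<nu>) (F \<inter> B)"
      using F by (simp add: sum.distrib sum_distrib_left sum.If_cases Int_def)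
    also have "\<dots> = \<rho> * measure_pmf.prob \<nu> F + measure_pmf.prob \<nu> (F \<inter> B)"
      using F by (simp add: measure_measure_pmf_finite)
    also have "\<dots> \<le> \<rho> * 1 + measure_pmf.prob \<nu> B"
      using \<rho>(1) by (intro add_mono mult_left_mono measure_pmf.finite_measure_mono) auto
    finally show ?thesis by simp
  qed
  have "(\<lambda>x. pmf \<nu> x * P x) summable_on set_pmf \<nu>"
    by (rule nonneg_bdd_above_summable_on) (use nn bound in \<open>auto intro!: bdd_aboveI\<close>)
  then show "infsum (\<lambda>x. pmf \<nu> x * P x) (set_pmf \<nu>) \<le> \<rho> + measure_pmf.prob \<nu> B"
    by (rule infsum_le_finite_sums) (use bound in auto)
qed

text \<open>By \<open>good_from_tests\<close> the bad configurations are covered by finitely many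
  test events, with test functions that do not change with \<open>N\<close>.\<close>

lemma initial_good:
  fixes \<nu> :: "nat \<Rightarrow> config pmf"
  assumes supp: "\<forall>N\<ge>1. set_pmf (\<nu> N) \<subseteq> Qset" and \<psi>0: "\<psi>0 \<in> XR"
    and conv: "\<forall>\<delta>>0. \<forall>f. C0pos f \<longrightarrow>
           ((\<lambda>N. measure_pmf.prob (\<nu> N)
              {q. \<bar>integral {0..} (\<lambda>u. f u * height_resc N q u)
                   - integral {0..} (\<lambda>u. f u * \<psi>0 u)\<bar> > \<delta>}) \<longlonglongrightarrow> 0)"
    and d: "0 < d"
  shows "(\<lambda>N. measure_pmf.prob (\<nu> N) {q \<in> Qset. \<not> good \<psi>0 N d q}) \<longlonglongrightarrow> 0"
proof -
  from good_from_tests[OF \<psi>0 d] obtain \<delta> M r where \<delta>: "0 < \<delta>" and r: "0 < r"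
    and tests: "\<forall>N. 1 \<le> N \<longrightarrow> 1 / real N \<le> d / 8 \<longrightarrow> (\<forall>q\<in>Qset.
    (\<forall>k\<in>{1..M}. \<bar>integral {0..} (\<lambda>u. bump (real k * r) r u * height_resc N q u)
        - integral {0..} (\<lambda>u. bump (real k * r) r u * \<psi>0 u)\<bar> \<le> \<delta>) \<longrightarrow> good \<psi>0 N d q)"
    by (elim exE conjE)
  define B where "B k N = {q. \<bar>integral {0..} (\<lambda>u. bump (real k * r) r u * height_resc N q u)
        - integral {0..} (\<lambda>u. bump (real k * r) r u * \<psi>0 u)\<bar> > \<delta>}" for k N
  have Bk: "(\<lambda>N. measure_pmf.prob (\<nu> N) (B k N)) \<longlonglongrightarrow> 0" if "k \<in> {1..M}" for k
  proof -
    have "C0pos (bump (real k * r) r)" using that r by (intro bump_props) auto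
    then show ?thesis using conv \<delta> unfolding B_def by blast
  qed
  have sum0: "(\<lambda>N. \<Sum>k\<in>{1..M}. measure_pmf.prob (\<nu> N) (B k N)) \<longlonglongrightarrow> 0"
    using tendsto_sum[of "{1..M}" "\<lambda>k N. measure_pmf.prob (\<nu> N) (B k N)" "\<lambda>_. 0" sequentially] Bk by simp
  have "\<forall>\<^sub>F N in sequentially. 1 / real N < d / 8"
    by (rule order_tendstoD(2)[OF lim_1_over_n]) (use d in simp)
  then have "\<forall>\<^sub>F N in sequentially. measure_pmf.prob (\<nu> N) {q \<in> Qset. \<not> good \<psi>0 N d q}
      \<le> (\<Sum>k\<in>{1..M}. measure_pmf.prob (\<nu> N) (B k N))"
    using eventually_ge_at_top[of 1]
  proof eventually_elim
    case (elim N)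
    have "{q \<in> Qset. \<not> good \<psi>0 N d q} \<subseteq> (\<Union>k\<in>{1..M}. B k N)"
    proof
      fix q assume "q \<in> {q \<in> Qset. \<not> good \<psi>0 N d q}"
      then have q: "q \<in> Qset" "\<not> good \<psi>0 N d q" by auto
      show "q \<in> (\<Union>k\<in>{1..M}. B k N)"
      proof (rule ccontr)
        assume n: "q \<notin> (\<Union>k\<in>{1..M}. B k N)"
        have "good \<psi>0 N d q"
          by (rule tests[rule_format, OF elim(2) less_imp_le[OF elim(1)] q(1)]) (use n in \<open>auto simp: B_def not_less\<close>)
        with q show False by simp
      qed
    qed
    then have "measure_pmf.prob (\<nu> N) {q \<in> Qset. \<not> good \<psi>0 N d q} \<le> measure_pmf.prob (\<nu> N) (\<Union>k\<in>{1..M}. B k N)"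
      by (intro measure_pmf.finite_measure_mono) auto
    also have "\<dots> \<le> (\<Sum>k\<in>{1..M}. measure_pmf.prob (\<nu> N) (B k N))"
      by (rule measure_pmf.finite_measure_subadditive_finite) auto
    finally show ?case .
  qed
  then show ?thesis
    by (intro tendsto_sandwich[OF _ _ tendsto_const sum0]) auto
qed

lemma hydrodynamic_limit:
  fixes \<nu> :: "nat \<Rightarrow> config pmf"
  assumes supp: "\<forall>N\<ge>1. set_pmf (\<nu> N) \<subseteq> Qset" and \<psi>0: "\<psi>0 \<in> XR"
    and conv: "\<forall>\<delta>>0. \<forall>f. C0pos f \<longrightarrow>
           ((\<lambda>N. measure_pmf.prob (\<nu> N)
              {q. \<bar>integral {0..} (\<lambda>u. f u * height_resc N q u)
                   - integral {0..} (\<lambda>u. f u * \<psi>0 u)\<bar> > \<delta>}) \<longlonglongrightarrow> 0)"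
    and t: "0 < t" and \<delta>: "0 < \<delta>" and f: "C0pos f"
  shows "(\<lambda>N. QN_prob N (\<nu> N) t
                  {q. \<bar>integral {0..} (\<lambda>u. f u * height_resc N q u)
                       - integral {0..} (\<lambda>u. f u * profile beta \<psi>0 t u)\<bar> > \<delta>}) \<longlonglongrightarrow> 0"
proof -
  let ?\<phi> = "profile beta \<psi>0 t"
  have \<phi>: "?\<phi> \<in> XR" by (rule profile_in_XR[OF beta_bounds(1) \<psi>0 t])
  from tests_from_grid[OF \<phi> f \<delta>] obtain c M r where c: "0 < c" and r: "0 < r"
    and grid: "\<forall>N. 1 \<le> N \<longrightarrow> 1 / real N \<le> c \<longrightarrow> (\<forall>q\<in>Qset.
    (\<forall>k\<in>{1..M}. \<bar>height_resc N q (real k * r) - ?\<phi> (real k * r)\<bar> \<le> c) \<longrightarrow>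
    \<bar>integral {0..} (\<lambda>u. f u * height_resc N q u) - integral {0..} (\<lambda>u. f u * ?\<phi> u)\<bar> \<le> \<delta>)"
    by (elim exE conjE)
  define B where "B N = {q. \<bar>integral {0..} (\<lambda>u. f u * height_resc N q u) - integral {0..} (\<lambda>u. f u * ?\<phi> u)\<bar> > \<delta>}" for N
  define Y where "Y k N = {y. c < \<bar>height_resc N y (real k * r) - ?\<phi> (real k * r)\<bar>}" for k N
  let ?r = "\<lambda>N q q'. (real N)\<^sup>2 * rateR (epsN N) q q'"
  have small: "\<forall>\<^sub>F N in sequentially. 0 \<le> QN_prob N (\<nu> N) t (B N) \<and> QN_prob N (\<nu> N) t (B N) < s" if s: "0 < s" for s
  proof -
    \<comment> \<open>All \<open>M\<close> grid points together use less than half of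
      \<open>s\<close>, and the probability of a bad start uses the other half. The
      \<open>+ 1\<close> keeps the quotient meaningful for an empty grid.\<close>
    define \<rho> where "\<rho> = s / (2 * (real M + 1))"
    have \<rho>: "0 < \<rho>" "real M * \<rho> < s / 2" using s by (auto simp: \<rho>_def field_simps)
    have "\<forall>k\<in>{1..M}. \<exists>d>0. \<forall>\<^sub>F N in sequentially. \<forall>q\<in>Qset. good \<psi>0 N d q \<longrightarrow> infsum (mc_trans (?r N) t q) (Y k N) \<le> \<rho>"
    proof
      fix k assume "k \<in> {1..M}"
      then have "0 < real k * r" using r by simp
      from point_estimate[OF \<psi>0 t this c \<rho>(1)]
      show "\<exists>d>0. \<forall>\<^sub>F N in sequentially. \<forall>q\<in>Qset. good \<psi>0 N d q \<longrightarrow> infsum (mc_trans (?r N) t q) (Y k N) \<le> \<rho>"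
        unfolding Y_def .
    qed
    from bchoice[OF this] obtain d where d_all: "\<forall>k\<in>{1..M}. 0 < d k \<and>
        (\<forall>\<^sub>F N in sequentially. \<forall>q\<in>Qset. good \<psi>0 N (d k) q \<longrightarrow> infsum (mc_trans (?r N) t q) (Y k N) \<le> \<rho>)"
      by (elim exE)
    have d: "0 < d k"
      "\<forall>\<^sub>F N in sequentially. \<forall>q\<in>Qset. good \<psi>0 N (d k) q \<longrightarrow> infsum (mc_trans (?r N) t q) (Y k N) \<le> \<rho>"
      if "k \<in> {1..M}" for k
      using bspec[OF d_all that] by (rule conjunct1, rule conjunct2)
    \<comment> \<open>One quality of the start that serves all grid points; the inserted 1 makes the
      minimum well defined when the grid is empty.\<close>
    define d0 where "d0 = Min (insert 1 (d ` {1..M}))"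
    have d0: "0 < d0" "\<And>k. k \<in> {1..M} \<Longrightarrow> d0 \<le> d k"
    proof -
      show "0 < d0" unfolding d0_def using d(1) by (subst Min_gr_iff) auto
      show "d0 \<le> d k" if "k \<in> {1..M}" for k unfolding d0_def using that by (intro Min_le) auto
    qed
    have ev_all: "\<forall>\<^sub>F N in sequentially. \<forall>k\<in>{1..M}. \<forall>q\<in>Qset. good \<psi>0 N (d k) q \<longrightarrow> infsum (mc_trans (?r N) t q) (Y k N) \<le> \<rho>"
      using d(2) by (intro eventually_ball_finite) auto
    have ev_c: "\<forall>\<^sub>F N in sequentially. 1 / real N < c"
      by (rule order_tendstoD(2)[OF lim_1_over_n c])
    have ev_g: "\<forall>\<^sub>F N in sequentially. measure_pmf.prob (\<nu> N) {q \<in> Qset. \<not> good \<psi>0 N d0 q} < s / 2"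
      by (rule order_tendstoD(2)[OF initial_good[OF supp \<psi>0 conv d0(1)]]) (use s in simp)
    show ?thesis
      using ev_all ev_c ev_g eventually_ge_at_top[of 1]
    proof eventually_elim
      case (elim N)
      note N = elim(4)
      have sup: "set_pmf (\<nu> N) \<subseteq> Qset" using supp N by simp
      interpret markov_rates "?r N" Qset
        by (rule markov_rates_rateR) (use epsN_props(1)[OF N] N in auto)
      have t0: "0 \<le> t" using t by simp
      define P where "P x = infsum (mc_trans (?r N) t x) (B N)" for x
      have bad: "P x \<le> real M * \<rho>" if x: "x \<in> Qset" and g: "good \<psi>0 N d0 x" for x
      proof -
        have "P x \<le> (\<Sum>k\<in>{1..M}. infsum (mc_trans (?r N) t x) (Y k N))"
          unfolding P_def
        proof (rule infsum_cover_bound)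
          show "0 \<le> mc_trans (?r N) t x y" for y by (rule mc_trans_nonneg[OF x t0])
          show "mc_trans (?r N) t x summable_on A" for A
            by (rule mc_trans_markov_inequality(1)[where G = "\<lambda>_ _. 1" and G' = "\<lambda>_ _. 0" and c = 1]) (use x t0 in auto)
          fix y assume y: "y \<in> B N" "mc_trans (?r N) t x y \<noteq> 0"
          have yQ: "y \<in> Qset" using mc_trans_outside[OF x] y(2) by blast
          show "\<exists>k\<in>{1..M}. y \<in> Y k N"
          proof (rule ccontr)
            assume "\<not> (\<exists>k\<in>{1..M}. y \<in> Y k N)"
            then have "\<bar>height_resc N y (real k * r) - ?\<phi> (real k * r)\<bar> \<le> c" if "k \<in> {1..M}" for k
              using that unfolding Y_def by (simp add: not_less)
            from grid[rule_format, OF N less_imp_le[OF elim(2)] yQ this] y(1) show False by (simp add: B_def)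
          qed
        qed simp
        also have "\<dots> \<le> (\<Sum>k\<in>{1..M}. \<rho>)"
        proof (rule sum_mono)
          fix k assume k: "k \<in> {1..M}"
          have "good \<psi>0 N (d k) x" using g d0(2)[OF k] unfolding good_def by (meson order_trans)
          then show "infsum (mc_trans (?r N) t x) (Y k N) \<le> \<rho>" using elim(1) k x by blast
        qed
        finally show ?thesis by simp
      qed
      have Q: "QN_prob N (\<nu> N) t (B N) = infsum (\<lambda>x. pmf (\<nu> N) x * P x) (set_pmf (\<nu> N))"
        by (simp add: QN_prob_def mc_prob_def P_def)
      have P01: "0 \<le> P x" "P x \<le> 1" if "x \<in> set_pmf (\<nu> N)" for x
        unfolding P_def using infsum_mc_trans_bounds[OF _ t0, of x] that sup by auto
      have M\<rho>: "0 \<le> real M * \<rho>" using \<rho>(1) by simp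
      have outside: "P x \<le> real M * \<rho>" if "x \<in> set_pmf (\<nu> N)" "x \<notin> {q \<in> Qset. \<not> good \<psi>0 N d0 q}" for x
        using bad[of x] that sup by auto
      show ?case
        using pmf_average_bound[where \<nu> = "\<nu> N" and P = P and B = "{q \<in> Qset. \<not> good \<psi>0 N d0 q}", OF P01 M\<rho> outside] elim(3) \<rho>(2) unfolding Q by linarith
    qed
  qed
  have "(\<lambda>N. QN_prob N (\<nu> N) t (B N)) \<longlonglongrightarrow> 0"
  proof (rule order_tendstoI)
    show "\<forall>\<^sub>F N in sequentially. a < QN_prob N (\<nu> N) t (B N)" if "a < 0" for a
      using small[of 1] by (rule eventually_mono) (use that in auto)
    show "\<forall>\<^sub>F N in sequentially. QN_prob N (\<nu> N) t (B N) < a" if "0 < a" for a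
      using small[OF that] by (rule eventually_mono) simp
  qed
  then show ?thesis by (simp add: B_def)
qed

theorem theorem2p2:
  fixes \<nu> :: "nat \<Rightarrow> config pmf" and \<psi>0 :: "real \<Rightarrow> real"
  assumes "\<forall>N\<ge>1. set_pmf (\<nu> N) \<subseteq> Qset"
    and "\<psi>0 \<in> XR"
    and "\<forall>\<delta>>0. \<forall>f. C0pos f \<longrightarrow>
           ((\<lambda>N. measure_pmf.prob (\<nu> N)
              {q. \<bar>integral {0..} (\<lambda>u. f u * height_resc N q u)
                   - integral {0..} (\<lambda>u. f u * \<psi>0 u)\<bar> > \<delta>}) \<longlonglongrightarrow> 0)"
  shows "\<exists>\<psi>. classical_sol (pi / sqrt 12) \<psi>0 \<psi>
          \<and> (\<forall>\<phi>. classical_sol (pi / sqrt 12) \<psi>0 \<phi> \<longrightarrow> (\<forall>t\<ge>0. \<forall>u\<ge>0. \<phi> t u = \<psi> t u))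
          \<and> (\<forall>t>0. \<forall>\<delta>>0. \<forall>f. C0pos f \<longrightarrow>
               ((\<lambda>N. QN_prob N (\<nu> N) t
                  {q. \<bar>integral {0..} (\<lambda>u. f u * height_resc N q u)
                       - integral {0..} (\<lambda>u. f u * \<psi> t u)\<bar> > \<delta>}) \<longlonglongrightarrow> 0))"
proof (intro exI[of _ "profile beta \<psi>0"] conjI allI impI)
  have b: "0 < pi / sqrt 12" using beta_bounds(1) by (simp only: beta_def)
  show sol: "classical_sol (pi / sqrt 12) \<psi>0 (profile beta \<psi>0)"
    using classical_sol_profile[OF beta_bounds(1) assms(2)] by (simp only: beta_def)
  show "\<phi> t u = profile beta \<psi>0 t u"
    if "classical_sol (pi / sqrt 12) \<psi>0 \<phi>" "0 \<le> t" "0 \<le> u" for \<phi> t u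
    by (rule antisym[OF classical_sol_le[OF less_imp_le[OF b] that(1) sol that(2,3)]
        classical_sol_le[OF less_imp_le[OF b] sol that]])
  show "(\<lambda>N. QN_prob N (\<nu> N) t
                  {q. \<bar>integral {0..} (\<lambda>u. f u * height_resc N q u)
                       - integral {0..} (\<lambda>u. f u * profile beta \<psi>0 t u)\<bar> > \<delta>}) \<longlonglongrightarrow> 0"
    if "0 < t" "0 < \<delta>" "C0pos f" for t \<delta> f
    by (rule hydrodynamic_limit[OF assms that])
qed

end
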